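(* Let $M_n$ be the area of the largest empty cap of the spherical ensemble $\mathcal{X}^{(n)}=\sum_{i=1}^n\delta_{P_i}$. For any $s>0$, \[\frac{n}{8\pi\sqrt{\log n}}M_n\overset{L^s}{\longrightarrow}1\quad\text{as } n\to+\infty,\] that is, $\mathbf{E}\left|\frac{n}{8\pi\sqrt{\log n}}M_n-1\right|^s\to 0$ as $n\to+\infty$.
   Context: Spherical ensemble. Let $\mathbb{S}^2=\{p\in\mathbb{R}^3:|p|=1\}$ and let $\nu$ be the surface area measure on $\mathbb{S}^2$ (total mass $4\pi$). Let $A_n,B_n$ be independent $n\times n$ random matrices with i.i.d. standard complex Gaussian entries, let $\lambda_1,\ldots,\lambda_n$ be the eigenvalues of $A_n^{-1}B_n$, let $g$ be the stereographic projection of $\mathbb{S}^2$ from the north pole onto the plane $\{(t_1,t_2,0)\}\cong\mathbb{C}$, and let $P_i=g^{-1}(\lambda_i)$. Equivalently, in uniform random order, $(P_1,\ldots,P_n)$ has joint density proportional to $\prod_{i<j}|p_i-p_j|^2$ with respect to $\nu^{\otimes n}$ on $(\mathbb{S}^2)^n$, where $|\cdot|$ is the Euclidean norm. The point process is $\mathcal{X}^{(n)}=\sum_{i=1}^n\delta_{P_i}$. Largest empty cap. A spherical cap is the intersection of $\mathbb{S}^2$ with a half-space. $M_n$ is the area of the largest spherical cap containing no point of $\{P_1,\ldots,P_n\}$ in its interior. Equivalently $M_n=\pi\tau^2$, where $\tau$ is the covering radius: the infimum of $t>0$ such that every point of $\mathbb{S}^2$ is within Euclidean distance $t$ of some $P_j$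 (the cap $\{p\in\mathbb{S}^2:|p-q|\le r\}$ has area $\pi r^2$). *)

theory Defs
  imports
    "HOL-Probability.Probability"
    "Jordan_Normal_Form.Gauss_Jordan_Elimination"
    "Jordan_Normal_Form.Char_Poly"
begin

no_notation Matrix.vec_index (infixl "$" 100)

(* The unit sphere of R^3 is the library set "sphere (0 :: real^3) 1". *)

(* Surface area on the unit sphere, normalised by polar coordinates dx = r^2 dr d\<nu>:
   \<nu>(E) = 3 * vol {x. 0 < |x| \<le> 1 \<and> x/|x| \<in> E}, so the total mass is 3 * (4/3) * pi = 4 * pi. *)
definition sphere_area :: "(real^3) measure" where
  "sphere_area = scale_measure 3
     (distr (restrict_space lborel (cball 0 1 - {0})) (restrict_space borel (sphere 0 1)) sgn)"

definition stereographic :: "real^3 \<Rightarrow> complex" where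
  "stereographic p = Complex (p $ 1 / (1 - p $ 3)) (p $ 2 / (1 - p $ 3))"

definition north_pole :: "real^3" where
  "north_pole = vector [0, 0, 1]"

definition inv_stereographic :: "complex \<Rightarrow> real^3" where
  "inv_stereographic = inv_into (sphere 0 1 - {north_pole}) stereographic"

(* E[Z] = 0, E[|Z|^2] = 1, with independent real and imaginary parts N(0, 1/2). *)
definition std_complex_gaussian :: "complex measure" where
  "std_complex_gaussian = density lborel (\<lambda>z. ennreal (exp (- (cmod z)\<^sup>2) / pi))"

(* The 2 * n^2 entries of A (index True) and of B (index False) are jointly independent, which
   says that A and B are independent and that each has independent entries. *)
definition independent_gaussian_matrices ::
    "'a measure \<Rightarrow> nat \<Rightarrow> ('a \<Rightarrow> complex mat) \<Rightarrow> ('a \<Rightarrow> complex mat) \<Rightarrow> bool" where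
  "independent_gaussian_matrices M n A B \<longleftrightarrow>
     prob_space M \<and>
     (\<forall>\<omega>\<in>space M. A \<omega> \<in> carrier_mat n n \<and> B \<omega> \<in> carrier_mat n n) \<and>
     prob_space.indep_vars M (\<lambda>_. borel)
       (\<lambda>(c, i, j) \<omega>. (if c then A \<omega> else B \<omega>) $$ (i, j)) (UNIV \<times> {..<n} \<times> {..<n}) \<and>
     (\<forall>i<n. \<forall>j<n.
        distr M borel (\<lambda>\<omega>. A \<omega> $$ (i, j)) = std_complex_gaussian \<and>
        distr M borel (\<lambda>\<omega>. B \<omega> $$ (i, j)) = std_complex_gaussian)"

(* Eigenvalues with algebraic multiplicity. *)
definition eigenvalues_mset :: "complex mat \<Rightarrow> complex multiset" where
  "eigenvalues_mset C = proots (char_poly C)"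

(* The point configuration, a sum of Dirac masses, is the multiset of its atoms.
   It is empty on the null event that A is singular. *)
definition spherical_ensemble :: "complex mat \<Rightarrow> complex mat \<Rightarrow> (real^3) multiset" where
  "spherical_ensemble A B =
     (case mat_inverse A of
        None \<Rightarrow> {#}
      | Some A' \<Rightarrow> image_mset inv_stereographic (eigenvalues_mset (A' * B)))"

definition spherical_cap :: "(real^3) set \<Rightarrow> bool" where
  "spherical_cap C \<longleftrightarrow> (\<exists>u c. u \<noteq> 0 \<and> C = sphere 0 1 \<inter> {p. inner u p \<ge> c})"

(* The interior is taken relative to the sphere. *)
definition largest_empty_cap_area :: "(real^3) multiset \<Rightarrow> real" where
  "largest_empty_cap_area X =
     Sup {measure sphere_area C |C. spherical_cap C \<and>
            top_of_set (sphere 0 1) interior_of C \<inter> set_mset X = {}}"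

end

theory Submission
  imports Defs "HOL-Complex_Analysis.Complex_Analysis"
begin

no_notation Matrix.vec_index (infixl "$" 100)
no_notation Matrix.scalar_prod (infix "\<bullet>" 70)
no_notation fps_nth (infixl "$" 75)

text \<open>The gap probability of a set of the sphere is an integral over all pairs \<open>(A, B)\<close> with
  \<open>det (B - z A) \<noteq> 0\<close> on an open set \<open>V\<close> of the plane. Deflating one eigenvalue of the pencil at a time turns
  it into a ratio of determinants of Gram matrices of monomials for the weight
  \<open>(1 + \<bar>z\<bar>\<^sup>2) powr - (n + 1)\<close> on the complement of \<open>V\<close>. For a disc
  around \<open>0\<close> the matrix is diagonal, and the gap probability is a product of binomial tails, which is
  \<open>exp (- (1 + o(1)) m\<^sup>2 / 4)\<close> for a cap of area \<open>4 \<pi> m / n\<close>; unitary changes of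
  the pencil rotate the sphere. Fischer's inequality makes emptiness of disjoint caps negatively correlated.
  A union bound over a net of caps bounds the largest empty cap from above, the second moment of the number
  of empty caps in a packing bounds it from below.\<close>

text \<open>The scale: of the order of n / m disjoint caps of area 4 pi m / n fit on the sphere,
  each empty with probability near exp(- m^2 / 4), so empty ones become rare at m = 2 sqrt(ln n),
  that is, at area 8 pi sqrt(ln n) / n. The joint density of the eigenvalues never appears.
  Splitting off an eigenvalue z leaves a smaller pencil with the extra weight |det (B - z A)|^2, so
  the induction has to run over integrals \<open>J n V zs\<close> that carry such factors at a whole
  list of points. The Gram determinants obey the same recursion up to constants that depend only on
  the size and on the number of points; these constants are not evaluated, they cancel against the
  case of empty V. Deflation is an identity between integrals, valid off null sets, hence the care
  with measurability and exceptional pencils. The passage from probability to L^s rests on a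
  polynomial tail: the rescaled area is eventually at most n, and it exceeds a level above b with
  probability at most n^(1 - b^2) for large n, so a large b beats n^s.\<close>

text \<open>A pencil holds the entries of \<open>B\<close> at the indices \<open>(False, i, j)\<close> and those of \<open>A\<close> at \<open>(True, i, j)\<close>.\<close>

type_synonym pencil = "bool \<times> nat \<times> nat \<Rightarrow> complex"

section \<open>Change of variables in the plane\<close>

text \<open>The change of variables theorem with a Jacobian determinant is stated for
  \<open>real^'n\<close>, so sets and maps of the complex plane are carried to \<open>real^2\<close>
  and back.\<close>

definition vec_of_complex :: "complex => real^2" where
 "vec_of_complex z = vector [Re z, Im z]"

definition complex_of_vec :: "real^2 => complex" where
 "complex_of_vec v = Complex (v$1) (v$2)"

lemma complex_of_vec_of_complex [simp]: "complex_of_vec (vec_of_complex z) = z"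
 by (simp add: complex_of_vec_def vec_of_complex_def vector_2)

lemma vec_of_complex_of_vec [simp]: "vec_of_complex (complex_of_vec v) = v"
 by (simp add: complex_of_vec_def vec_of_complex_def Finite_Cartesian_Product.vec_eq_iff forall_2 vector_2)

lemma linear_vec_of_complex: "linear vec_of_complex"
 by (rule linearI) (auto simp: vec_of_complex_def Finite_Cartesian_Product.vec_eq_iff forall_2 vector_2)

lemma linear_complex_of_vec: "linear complex_of_vec"
 by (rule linearI) (auto simp: complex_of_vec_def complex_eq_iff)

lemma bounded_linear_vec_of_complex: "bounded_linear vec_of_complex"
 using linear_vec_of_complex by (simp add: linear_linear)

lemma bounded_linear_complex_of_vec: "bounded_linear complex_of_vec"
 using linear_complex_of_vec by (simp add: linear_linear)

lemma measurable_vec_of_complex [measurable]: "vec_of_complex \<in> borel_measurable borel"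
 by (rule borel_measurable_continuous_onI)
  (rule linear_continuous_on[OF bounded_linear_vec_of_complex])

lemma measurable_complex_of_vec [measurable]: "complex_of_vec \<in> borel_measurable borel"
 by (rule borel_measurable_continuous_onI)
  (rule linear_continuous_on[OF bounded_linear_complex_of_vec])

lemma lborel_vec_of_complex: "lborel = distr lborel borel vec_of_complex"
proof (rule lborel_eqI)
 fix l u :: "real^2"
 assume le: "!!b. b \<in> Basis ==> l \<bullet> b <= u \<bullet> b"
 have le': "l$i <= u$i" for i
  using le[of "axis i 1"] by (simp add: axis_in_Basis_iff cart_eq_inner_axis)
 have eq: "vec_of_complex -` box l u = box (complex_of_vec l) (complex_of_vec u)"
 proof (rule Set.set_eqI)
  fix z
  show "z \<in> vec_of_complex -` box l u \<longleftrightarrow> z \<in> box (complex_of_vec l) (complex_of_vec u)"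
   unfolding vimage_eq mem_box_cart forall_2
   by (auto simp: mem_box Basis_complex_def complex_of_vec_def vec_of_complex_def vector_2)
 qed
 have "emeasure (distr lborel borel vec_of_complex) (box l u) =
   emeasure lborel (box (complex_of_vec l) (complex_of_vec u))"
  by (subst emeasure_distr) (auto simp: eq)
 also have "... = ennreal ((u$1 - l$1) * (u$2 - l$2))"
  using le' by (subst emeasure_lborel_box_eq)
   (auto simp: Basis_complex_def complex_of_vec_def)
 also have "(u$1 - l$1) * (u$2 - l$2) = (\<Prod>b\<in>Basis. (u - l) \<bullet> b)"
 proof -
  have "(\<Prod>b\<in>Basis. (u - l) \<bullet> b) = (\<Prod>i\<in>UNIV. (u - l) $ i)"
  proof -
   have B: "(Basis :: (real^2) set) = (%i. axis i 1) ` UNIV"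
    by (auto simp: Basis_vec_def)
   show ?thesis
    unfolding B by (subst prod.reindex) (auto simp: inj_on_def axis_eq_axis cart_eq_inner_axis)
  qed
  also have "... = (u$1 - l$1) * (u$2 - l$2)"
   by (simp add: UNIV_2)
  finally show ?thesis by simp
 qed
 finally show "emeasure (distr lborel borel vec_of_complex) (box l u) = ennreal (\<Prod>b\<in>Basis. (u - l) \<bullet> b)" .
qed simp

lemma image_vec_of_complex: "vec_of_complex ` S = complex_of_vec -` S"
 by (auto simp: image_iff) (metis vec_of_complex_of_vec)

lemma vec_image_borel: "S \<in> sets borel ==> vec_of_complex ` S \<in> sets borel"
 using measurable_sets[OF measurable_complex_of_vec, of S] by (simp add: image_vec_of_complex)

text \<open>Images of Borel sets under differentiable maps are only known to be Lebesgue sets, so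
  the transfer between the two planes has to respect the completed measure. A Lebesgue set is split
  into a Borel set and a part of a null set.\<close>

lemma vec_vimage_lebesgue:
 assumes "S \<in> sets lebesgue"
 shows "vec_of_complex -` S \<in> sets lebesgue"
  and "emeasure lebesgue (vec_of_complex -` S) = emeasure lebesgue S"
proof -
 have m: "vec_of_complex \<in> lborel \<rightarrow>\<^sub>M borel" by measurable
 from assms obtain A N N' where A: "S = A \<union> N" "N <= N'" "N' \<in> null_sets lborel" "A \<in> sets lborel"
  by (auto elim!: sets_completionE)
 have null: "vec_of_complex -` N' \<in> null_sets lborel"
  using A(3) by (auto simp: null_sets_def lborel_vec_of_complex emeasure_distr
    intro!: measurable_sets_borel[OF measurable_vec_of_complex])
 have eq: "vec_of_complex -` S = vec_of_complex -` A \<union> vec_of_complex -` N"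
  using A(1) by auto
 have nN: "vec_of_complex -` N \<in> null_sets lebesgue"
  using null A(2) by (metis null_sets_completionI null_sets_completion_subset vimage_mono)
 have nN2: "N \<in> null_sets lebesgue"
  using A by (metis null_sets_completionI null_sets_completion_subset)
 have A': "vec_of_complex -` A \<in> sets lborel"
  using A(4) measurable_sets_borel[OF measurable_vec_of_complex] by simp
 show "vec_of_complex -` S \<in> sets lebesgue"
  unfolding eq using nN A' by (auto simp: null_sets_def)
 have "emeasure lebesgue (vec_of_complex -` S) = emeasure lebesgue (vec_of_complex -` A)"
  unfolding eq using A' nN by (intro emeasure_Un_null_set) auto
 also have "... = emeasure lborel (vec_of_complex -` A)" using A' by simp
 also have "... = emeasure lborel A"
  using A(4) arg_cong[OF lborel_vec_of_complex, of "%M. emeasure M A"] by (simp add: emeasure_distr)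
 also have "... = emeasure lebesgue S"
  unfolding A(1) using A(4) nN2 by (subst emeasure_Un_null_set) auto
 finally show "emeasure lebesgue (vec_of_complex -` S) = emeasure lebesgue S" .
qed

lemma det_matrix_complex_mult:
 "Determinants.det (matrix (%v. vec_of_complex (c * complex_of_vec v))) = (cmod c)^2"
 using cmod_power2[of c]
 by (simp add: det_2 matrix_def vec_of_complex_def complex_of_vec_def axis_def vector_2
   power2_eq_square)

text \<open>Boundedness of E and of the derivative makes the Jacobian integrable, as the change of
  variables theorem demands. By the Cauchy-Riemann equations the real Jacobian determinant is the
  squared modulus of the derivative.\<close>

lemma emeasure_image_complex_aux:
 assumes E: "E \<in> sets borel" "bounded E"
  and der: "!!z. z \<in> E ==> (f has_field_derivative f' z) (at z)"
  and inj: "inj_on f E"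
  and f': "f' \<in> borel_measurable borel"
  and bd: "!!z. z \<in> E ==> cmod (f' z) <= b"
 shows "f ` E \<in> sets lebesgue"
  and "emeasure lebesgue (f ` E) = (\<integral>\<^sup>+z. ennreal ((cmod (f' z))^2) * indicator E z \<partial>lborel)"
proof -
 let ?g = "%v. vec_of_complex (f (complex_of_vec v))"
 let ?g' = "%v w. vec_of_complex (f' (complex_of_vec v) * complex_of_vec w)"
 let ?S = "vec_of_complex ` E"
 have S: "?S \<in> sets borel" using E(1) by (rule vec_image_borel)
 have der': "(?g has_derivative ?g' v) (at v within ?S)" if "v \<in> ?S" for v
 proof -
  have "complex_of_vec v \<in> E" using that by auto
  then have "(f has_derivative (%w. f' (complex_of_vec v) * w)) (at (complex_of_vec v))"
   using der by (simp add: has_field_derivative_def)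
  then have "((%v. f (complex_of_vec v)) has_derivative (%w. f' (complex_of_vec v) * complex_of_vec w)) (at v)"
   using has_derivative_compose[OF bounded_linear_imp_has_derivative[OF bounded_linear_complex_of_vec]]
   by blast
  then have "(?g has_derivative ?g' v) (at v)"
   using has_derivative_compose[OF _ bounded_linear_imp_has_derivative[OF bounded_linear_vec_of_complex]]
   by blast
  then show ?thesis by (rule has_derivative_at_withinI)
 qed
 have inj': "inj_on ?g ?S"
  using inj by (auto simp: inj_on_def) (metis complex_of_vec_of_complex)
 have fin: "emeasure lborel ?S < \<infinity>"
  using E(2) by (intro emeasure_bounded_finite bounded_linear_image bounded_linear_vec_of_complex)
 have dt: "\<bar>Determinants.det (matrix (?g' v))\<bar> = (cmod (f' (complex_of_vec v)))^2" for v
  by (simp add: det_matrix_complex_mult)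
 have meas: "(%v. (cmod (f' (complex_of_vec v)))\<^sup>2) \<in> borel_measurable borel"
  using f' by measurable
 have int: "set_integrable lborel ?S (%v. (cmod (f' (complex_of_vec v)))\<^sup>2)"
  unfolding set_integrable_def
 proof (rule Bochner_Integration.integrable_bound)
  show "integrable lborel (%v. b\<^sup>2 * indicator ?S v)"
   using fin S by (intro integrable_mult_right integrable_real_indicator) auto
  show "(%v. indicator ?S v *\<^sub>R (cmod (f' (complex_of_vec v)))\<^sup>2) \<in> borel_measurable lborel"
   using meas S by measurable
  show "AE v in lborel. norm (indicator ?S v *\<^sub>R (cmod (f' (complex_of_vec v)))\<^sup>2) <= norm (b^2 * indicator ?S v)"
  proof (intro AE_I2)
   fix v
   show "norm (indicator ?S v *\<^sub>R (cmod (f' (complex_of_vec v)))\<^sup>2) <= norm (b^2 * indicator ?S v)"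
   proof (cases "v \<in> ?S")
    case True
    then have "cmod (f' (complex_of_vec v)) <= b" using bd by auto
    then show ?thesis using True by (auto intro!: power_mono)
   qed auto
  qed
 qed
 have absint: "(%v. \<bar>Determinants.det (matrix (?g' v))\<bar>) integrable_on ?S"
  unfolding dt using set_borel_integral_eq_integral(1)[OF int] .
 have eqI: "integral ?S (%v. \<bar>Determinants.det (matrix (?g' v))\<bar>) = (LINT v:?S|lborel. (cmod (f' (complex_of_vec v)))\<^sup>2)"
  unfolding dt using set_borel_integral_eq_integral(2)[OF int] by simp
 have S': "?S \<in> sets lebesgue" using S by simp
 have lm: "?g ` ?S \<in> lmeasurable"
  using measurable_differentiable_image_eq[OF S' der' inj'] absint by blast
 have m: "measure lebesgue (?g ` ?S) = (LINT v:?S|lborel. (cmod (f' (complex_of_vec v)))\<^sup>2)"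
  using measure_differentiable_image_eq[OF S' der' inj' absint] eqI by simp
 have gS: "vec_of_complex -` (?g ` ?S) = f ` E"
  by (auto simp: image_iff) (metis complex_of_vec_of_complex)
 have gl: "?g ` ?S \<in> sets lebesgue" using lm by (auto simp: fmeasurable_def)
 show "f ` E \<in> sets lebesgue"
  using vec_vimage_lebesgue(1)[OF gl] gS by simp
 have "emeasure lebesgue (f ` E) = emeasure lebesgue (?g ` ?S)"
  using vec_vimage_lebesgue(2)[OF gl] gS by simp
 also have "... = ennreal (measure lebesgue (?g ` ?S))"
  using lm by (simp add: emeasure_eq_measure2)
 also have "... = (\<integral>\<^sup>+v. ennreal (indicator ?S v *\<^sub>R (cmod (f' (complex_of_vec v)))\<^sup>2) \<partial>lborel)"
  unfolding m set_lebesgue_integral_def using int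
  by (subst nn_integral_eq_integral) (auto simp: set_integrable_def)
 also have "... = (\<integral>\<^sup>+z. ennreal (indicator ?S (vec_of_complex z) *\<^sub>R (cmod (f' z))\<^sup>2) \<partial>lborel)"
  using meas S by (subst lborel_vec_of_complex, subst nn_integral_distr) auto
 also have "... = (\<integral>\<^sup>+z. ennreal ((cmod (f' z))^2) * indicator E z \<partial>lborel)"
 proof (intro nn_integral_cong)
  fix z
  have "vec_of_complex z \<in> ?S \<longleftrightarrow> z \<in> E"
   by (auto simp: image_iff) (metis complex_of_vec_of_complex)
  then show "ennreal (indicator ?S (vec_of_complex z) *\<^sub>R (cmod (f' z))\<^sup>2) = ennreal ((cmod (f' z))^2) * indicator E z"
   by (simp add: indicator_def)
 qed
 finally show "emeasure lebesgue (f ` E) = (\<integral>\<^sup>+z. ennreal ((cmod (f' z))^2) * indicator E z \<partial>lborel)" .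
qed

lemma emeasure_image_complex:
 assumes E: "E \<in> sets borel"
  and der: "!!z. z \<in> E ==> (f has_field_derivative f' z) (at z)"
  and inj: "inj_on f E"
  and f'[measurable]: "f' \<in> borel_measurable borel"
 shows "f ` E \<in> sets lebesgue"
  and "emeasure lebesgue (f ` E) = (\<integral>\<^sup>+z. ennreal ((cmod (f' z))^2) * indicator E z \<partial>lborel)"
proof -
 \<comment> \<open>Bounded pieces with bounded derivative that increase to E; monotone convergence
   then removes both bounds.\<close>
 define EN where "EN N = E \<inter> {z. cmod z <= real N & cmod (f' z) <= real N}" for N :: nat
 have EN: "EN N \<in> sets borel" for N unfolding EN_def using E by measurable
 have EN_sub: "EN N <= E" for N by (auto simp: EN_def)
 have bnd: "bounded (EN N)" for N
  by (rule boundedI[of _ "real N"]) (auto simp: EN_def)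
 have bd: "z \<in> EN N ==> cmod (f' z) <= real N" for z N by (auto simp: EN_def)
 have inc: "incseq EN" by (auto simp: incseq_def EN_def)
 have un: "(\<Union>N. EN N) = E"
 proof
  show "E <= (\<Union>N. EN N)"
  proof
   fix z assume z: "z \<in> E"
   obtain N where "max (cmod z) (cmod (f' z)) <= real N" using real_arch_simple by blast
   then show "z \<in> (\<Union>N. EN N)" using z by (auto simp: EN_def)
  qed
 qed (auto simp: EN_def)
 have aux: "f ` EN N \<in> sets lebesgue"
  "emeasure lebesgue (f ` EN N) = (\<integral>\<^sup>+z. ennreal ((cmod (f' z))^2) * indicator (EN N) z \<partial>lborel)" for N
  using emeasure_image_complex_aux[OF EN bnd _ inj_on_subset[OF inj EN_sub] f' bd] der EN_sub
  by (blast, metis (no_types, lifting) subsetD)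
 have img: "f ` E = (\<Union>N. f ` EN N)" using un by blast
 show "f ` E \<in> sets lebesgue" unfolding img using aux by blast
 have "emeasure lebesgue (f ` E) = (SUP N. emeasure lebesgue (f ` EN N))"
  unfolding img using aux inc
  by (intro SUP_emeasure_incseq[symmetric]) (auto simp: incseq_def image_mono)
 also have "... = (SUP N. \<integral>\<^sup>+z. ennreal ((cmod (f' z))^2) * indicator (EN N) z \<partial>lborel)"
  using aux by simp
 also have "... = (\<integral>\<^sup>+z. (SUP N. ennreal ((cmod (f' z))^2) * indicator (EN N) z) \<partial>lborel)"
 proof (rule nn_integral_monotone_convergence_SUP[symmetric])
  show "incseq (%N z. ennreal ((cmod (f' z))^2) * indicator (EN N) z)"
   using inc by (auto simp: incseq_def le_fun_def indicator_def split: if_splits)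
  show "(%z. ennreal ((cmod (f' z))^2) * indicator (EN N) z) \<in> borel_measurable lborel" for N
   using EN[of N] by measurable
 qed
 also have "... = (\<integral>\<^sup>+z. ennreal ((cmod (f' z))^2) * indicator E z \<partial>lborel)"
 proof (intro nn_integral_cong)
  fix z
  have "(SUP N. indicator (EN N) z) = (indicator E z :: ennreal)"
  proof (cases "z \<in> E")
   case True
   then obtain N where "z \<in> EN N" using un by blast
   then show ?thesis using True
    by (intro antisym SUP_least SUP_upper2[of N]) (auto simp: indicator_def)
  next
   case False
   then have "z ~: EN N" for N using un by blast
   then show ?thesis using False by (simp add: indicator_def)
  qed
  then show "(SUP N. ennreal ((cmod (f' z))^2) * indicator (EN N) z) = ennreal ((cmod (f' z))^2) * indicator E z"
   by (metis SUP_mult_left_ennreal)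
 qed
 finally show "emeasure lebesgue (f ` E) = (\<integral>\<^sup>+z. ennreal ((cmod (f' z))^2) * indicator E z \<partial>lborel)" .
qed

text \<open>Both sides are integrals of H against image measures on the Borel sets, and the
  preceding lemma, applied to parts of E, says that these measures coincide. The left side uses
  \<open>lebesgue\<close> because the image of E need not be Borel.\<close>

lemma nn_integral_image_complex:
 fixes H :: "complex => ennreal"
 assumes E[measurable]: "E \<in> sets borel"
  and der: "!!z. z \<in> E ==> (f has_field_derivative f' z) (at z)"
  and inj: "inj_on f E"
  and f[measurable]: "f \<in> borel_measurable borel"
  and f'[measurable]: "f' \<in> borel_measurable borel"
  and H[measurable]: "H \<in> borel_measurable borel"
 shows "(\<integral>\<^sup>+b. H b * indicator (f ` E) b \<partial>lebesgue) =
  (\<integral>\<^sup>+z. H (f z) * ennreal ((cmod (f' z))^2) * indicator E z \<partial>lborel)"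
proof -
 have fE: "f ` E \<in> sets lebesgue" by (rule emeasure_image_complex[OF E der inj f'])
 let ?D = "density lborel (%z. ennreal ((cmod (f' z))^2) * indicator E z)"
 \<comment> \<open>The identity as a map from \<open>lebesgue\<close> to \<open>borel\<close>
   forgets the completion, so that both measures have the same sets.\<close>
 let ?P = "distr (density lebesgue (indicator (f ` E))) borel (%b. b)"
 have idm: "(%b. b) \<in> lebesgue \<rightarrow>\<^sub>M (borel :: complex measure)"
  by (simp add: measurable_completion)
 have eq: "distr ?D borel f = ?P"
 proof (rule measure_eqI)
  fix A :: "complex set" assume "A \<in> sets (distr ?D borel f)"
  then have A[measurable]: "A \<in> sets borel" by simp
  have fA[measurable]: "f -` A \<in> sets borel" using measurable_sets_borel[OF f A] by simp
  have EA: "E \<inter> f -` A \<in> sets borel" by measurable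
  have "emeasure (distr ?D borel f) A = (\<integral>\<^sup>+z. ennreal ((cmod (f' z))^2) * indicator E z * indicator (f -` A) z \<partial>lborel)"
   by (subst emeasure_distr) (auto simp: emeasure_density)
  also have "... = (\<integral>\<^sup>+z. ennreal ((cmod (f' z))^2) * indicator (E \<inter> f -` A) z \<partial>lborel)"
   by (intro nn_integral_cong) (auto simp: indicator_def)
  also have "... = emeasure lebesgue (f ` (E \<inter> f -` A))"
   using emeasure_image_complex(2)[OF EA _ inj_on_subset[OF inj] f'] der by auto
  also have "f ` (E \<inter> f -` A) = f ` E \<inter> A" by auto
  also have "emeasure lebesgue (f ` E \<inter> A) = (\<integral>\<^sup>+b. indicator (f ` E) b * indicator A b \<partial>lebesgue)"
  proof -
   have "emeasure lebesgue (f ` E \<inter> A) = (\<integral>\<^sup>+b. indicator (f ` E \<inter> A) b \<partial>lebesgue)"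
    using fE A by (subst nn_integral_indicator) (auto intro!: sets.Int)
   then show ?thesis by (simp add: indicator_inter_arith)
  qed
  also have "... = emeasure ?P A"
   using fE idm by (subst emeasure_distr) (auto simp: emeasure_density)
  finally show "emeasure (distr ?D borel f) A = emeasure ?P A" .
 qed simp
 have Hl: "H \<in> borel_measurable lebesgue" by (simp add: measurable_completion)
 have "(\<integral>\<^sup>+z. H (f z) * ennreal ((cmod (f' z))^2) * indicator E z \<partial>lborel) = (\<integral>\<^sup>+z. H (f z) \<partial>?D)"
  by (subst nn_integral_density) (auto simp: mult_ac)
 also have "... = (\<integral>\<^sup>+b. H b \<partial>(distr ?D borel f))"
  by (subst nn_integral_distr) auto
 also have "... = (\<integral>\<^sup>+b. H b \<partial>(density lebesgue (indicator (f ` E))))"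
  unfolding eq using idm by (subst nn_integral_distr) auto
 also have "... = (\<integral>\<^sup>+b. H b * indicator (f ` E) b \<partial>lebesgue)"
  using fE Hl by (subst nn_integral_density) (auto simp: mult_ac)
 finally show ?thesis by simp
qed

lemma nn_integral_complex_mult:
 fixes H :: "complex => ennreal"
 assumes H[measurable]: "H \<in> borel_measurable borel" and "c ~= 0"
 shows "(\<integral>\<^sup>+b. H b \<partial>lborel) = ennreal ((cmod c)^2) * (\<integral>\<^sup>+z. H (c * z) \<partial>lborel)"
proof -
 have surj: "(%z. c * z) ` UNIV = UNIV"
  using \<open>c ~= 0\<close> by (auto simp: image_iff intro!: exI[of _ "_ / c"])
 have "(\<integral>\<^sup>+b. H b * indicator ((%z. c * z) ` UNIV) b \<partial>lebesgue) =
  (\<integral>\<^sup>+z. H (c * z) * ennreal ((cmod c)^2) * indicator UNIV z \<partial>lborel)"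
  by (rule nn_integral_image_complex)
   (auto intro!: derivative_eq_intros inj_onI simp: \<open>c ~= 0\<close>)
 then show ?thesis
  unfolding surj using nn_integral_completion[of lborel H]
  by (simp add: nn_integral_multc mult.commute)
qed

lemma nn_integral_complex_translate:
 fixes H :: "complex => ennreal"
 assumes [measurable]: "H \<in> borel_measurable borel"
 shows "(\<integral>\<^sup>+b. H (b + c) \<partial>lborel) = (\<integral>\<^sup>+b. H b \<partial>lborel)"
proof -
 have "(\<integral>\<^sup>+b. H b \<partial>lborel) = (\<integral>\<^sup>+b. H b \<partial>(distr lborel borel ((+) c)))"
  by (simp add: lborel_distr_plus)
 also have "... = (\<integral>\<^sup>+b. H (b + c) \<partial>lborel)"
  by (subst nn_integral_distr) (auto simp: add.commute)
 finally show ?thesis by simp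
qed

section \<open>Integration over finitely many coordinates\<close>

abbreviation (input) "csq z == (cmod z)\<^sup>2"
abbreviation (input) "esq z == ennreal ((cmod z)^2)"
abbreviation (input) "LPi K == Pi\<^sub>M K (%_. lborel)"
abbreviation env :: "('i => complex) measure" where
 "env == Pi\<^sub>M UNIV (%_. borel)"

abbreviation (input) "benv == borel_measurable env"

text \<open>Only the coordinates in K are integrated, the others are read from y. All integrands
  thus live on the one space \<open>env\<close>, and Fubini, translations and linear maps apply to a
  block of coordinates while the remaining ones act as parameters.\<close>

definition Intg :: "'i set => (('i => complex) => ennreal) => ('i => complex) => ennreal" where
 "Intg K F y = (\<integral>\<^sup>+x. F (override_on y x K) \<partial>LPi K)"

interpretation lborel_prod: product_sigma_finite "%_. lborel :: complex measure"
 by standard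

lemma space_env [simp]: "space env = UNIV"
 by (simp add: space_PiM)

lemma measurable_env_component [simp]: "(%y. y i) \<in> benv"
 by (rule measurable_component_singleton) simp

lemma measurable_env_component':
 "f \<in> M \<rightarrow>\<^sub>M env ==> (%x. f x i) \<in> borel_measurable M"
 by (rule measurable_compose[OF _ measurable_env_component])

lemma measurable_envI:
 assumes "!!i. (%x. f x i) \<in> borel_measurable M"
 shows "f \<in> M \<rightarrow>\<^sub>M env"
proof -
 have "(%x i. f x i) \<in> M \<rightarrow>\<^sub>M env"
  by (rule measurable_PiM_single') (use assms in auto)
 then show ?thesis by simp
qed

lemma measurable_override [measurable]:
 "(%p. override_on (fst p) (snd p) K) \<in> env \<Otimes>\<^sub>M LPi K \<rightarrow>\<^sub>M env"
proof (rule measurable_envI)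
 fix i
 show "(%p. override_on (fst p) (snd p) K i) \<in> borel_measurable (env \<Otimes>\<^sub>M LPi K)"
 proof (cases "i \<in> K")
  case True
  have "(%p. snd p i) \<in> borel_measurable (env \<Otimes>\<^sub>M Pi\<^sub>M K (%_. lborel :: complex measure))"
   using measurable_compose[OF measurable_snd measurable_component_singleton[OF True, of "%_. lborel"]]
   by simp
  then show ?thesis using True by simp
 qed (simp add: measurable_env_component')
qed

lemma measurable_override' [measurable (raw)]:
 assumes "f \<in> M \<rightarrow>\<^sub>M env" "g \<in> M \<rightarrow>\<^sub>M LPi K"
 shows "(%x. override_on (f x) (g x) K) \<in> M \<rightarrow>\<^sub>M env"
 using measurable_compose[OF measurable_Pair[OF assms] measurable_override] by simp

lemma measurable_env_upd [measurable (raw)]: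
 assumes f: "f \<in> M \<rightarrow>\<^sub>M env" and g: "g \<in> borel_measurable M"
 shows "(%x. (f x)(i := g x)) \<in> M \<rightarrow>\<^sub>M env"
proof (rule measurable_envI)
 fix j show "(%x. ((f x)(i := g x)) j) \<in> borel_measurable M"
  using measurable_env_component'[OF f, of j] g by (cases "j = i") auto
qed

lemma sigma_finite_PiM_lborel: "finite K ==> sigma_finite_measure (Pi\<^sub>M K (%_. lborel :: complex measure))"
 by (rule lborel_prod.sigma_finite)

lemma measurable_Int [measurable]:
 assumes "finite K" and [measurable]: "F \<in> benv"
 shows "Intg K F \<in> benv"
proof -
 interpret sigma_finite_measure "Pi\<^sub>M K (%_. lborel :: complex measure)"
  using assms(1) by (rule sigma_finite_PiM_lborel)
 show ?thesis unfolding Intg_def by measurable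
qed

lemma measurable_override_right [measurable]:
 "(%x. override_on y x K) \<in> LPi K \<rightarrow>\<^sub>M env"
 by (rule measurable_override') auto

lemma Intg_empty [simp]: "Intg {} F y = F y"
 unfolding Intg_def PiM_empty by (simp add: nn_integral_count_space_finite)

lemma Intg_insert:
 assumes "finite K" "i ~: K" and [measurable]: "F \<in> benv"
 shows "Intg (insert i K) F y = (\<integral>\<^sup>+z. Intg K F (y(i := z)) \<partial>lborel)"
proof -
 have 1: "override_on y (x(i := z)) (insert i K) = override_on (y(i := z)) x K" for x z
  using assms(2) by (auto simp: override_on_def fun_eq_iff)
 have 2: "(\<integral>\<^sup>+x. F (override_on y x (insert i K)) \<partial>LPi (insert i K)) =
   (\<integral>\<^sup>+z. (\<integral>\<^sup>+x. F (override_on y (x(i := z)) (insert i K)) \<partial>LPi K) \<partial>lborel)"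
  by (rule lborel_prod.product_nn_integral_insert_rev[OF assms(1,2)]) measurable
 show ?thesis unfolding Intg_def 2 1 ..
qed

lemma Intg_insert_inner:
 assumes "finite K" "i ~: K" and [measurable]: "F \<in> benv"
 shows "Intg (insert i K) F y = Intg K (%y. \<integral>\<^sup>+z. F (y(i := z)) \<partial>lborel) y"
proof -
 have 1: "override_on y (x(i := z)) (insert i K) = (override_on y x K)(i := z)" for x z
  using assms(2) by (auto simp: override_on_def fun_eq_iff)
 have 2: "(\<integral>\<^sup>+x. F (override_on y x (insert i K)) \<partial>LPi (insert i K)) =
   (\<integral>\<^sup>+x. (\<integral>\<^sup>+z. F (override_on y (x(i := z)) (insert i K)) \<partial>lborel) \<partial>LPi K)"
  by (rule lborel_prod.product_nn_integral_insert[OF assms(1,2)]) measurable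
 show ?thesis unfolding Intg_def 2 1 ..
qed

lemma Intg_singleton:
 assumes "F \<in> benv"
 shows "Intg {i} F y = (\<integral>\<^sup>+z. F (y(i := z)) \<partial>lborel)"
 using Intg_insert[of "{}" i F y] assms by simp

lemma Intg_Un:
 assumes "finite K" "finite L" "K \<inter> L = {}" and [measurable]: "F \<in> benv"
 shows "Intg (K \<union> L) F y = Intg K (Intg L F) y"
 using assms(1,3)
proof (induction K arbitrary: y rule: finite_induct)
 case (insert i K)
 have "Intg (insert i K \<union> L) F y = (\<integral>\<^sup>+z. Intg (K \<union> L) F (y(i := z)) \<partial>lborel)"
  using insert assms(2) by (simp add: Intg_insert)
 also have "... = (\<integral>\<^sup>+z. Intg K (Intg L F) (y(i := z)) \<partial>lborel)"
  using insert by (intro nn_integral_cong) auto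
 also have "... = Intg (insert i K) (Intg L F) y"
  using insert assms(2) by (subst Intg_insert) auto
 finally show ?case .
qed simp

lemma Intg_Un':
 assumes "finite K" "finite L" "K \<inter> L = {}" and "F \<in> benv"
 shows "Intg (K \<union> L) F y = Intg L (Intg K F) y"
 using Intg_Un[of L K F y] assms by (simp add: Un_commute Int_commute)

lemma Intg_cong:
 assumes "!!y'. (!!i. i ~: K ==> y' i = y i) ==> F y' = G y'"
 shows "Intg K F y = Intg K G y"
 unfolding Intg_def by (intro nn_integral_cong assms) simp

lemma Intg_mono:
 assumes "!!y'. (!!i. i ~: K ==> y' i = y i) ==> F y' <= G y'"
 shows "Intg K F y <= Intg K G y"
 unfolding Intg_def by (intro nn_integral_mono assms) simp

lemma Intg_cong_base:
 assumes "!!x. F (override_on y x K) = F (override_on y' x K)"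
 shows "Intg K F y = Intg K F y'"
 unfolding Intg_def using assms by simp

lemma Intg_cmult:
 assumes [measurable]: "F \<in> benv"
 shows "Intg K (%y. c * F y) y = c * Intg K F y"
 unfolding Intg_def by (subst nn_integral_cmult) auto

lemma Intg_cmult_dep:
 assumes [measurable]: "F \<in> benv"
  and "!!y'. (!!i. i ~: K ==> y' i = y i) ==> c y' = c y"
 shows "Intg K (%y. c y * F y) y = c y * Intg K F y"
proof -
 have "Intg K (%y. c y * F y) y = Intg K (%y'. c y * F y') y"
  by (intro Intg_cong arg_cong2[where f="(*)"] assms(2)) auto
 also have "... = c y * Intg K F y" by (rule Intg_cmult) fact
 finally show ?thesis .
qed

lemma Intg_add:
 assumes [measurable]: "F \<in> benv" "G \<in> benv"
 shows "Intg K (%y. F y + G y) y = Intg K F y + Intg K G y"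
 unfolding Intg_def by (subst nn_integral_add) auto

lemma Intg_zero [simp]: "Intg K (%_. 0) y = 0"
 by (simp add: Intg_def)

lemma Intg_cong_null:
 assumes [measurable]: "F \<in> benv" "G \<in> benv" "N \<in> sets env"
  and null: "Intg K (indicator N) y = 0"
  and eq: "!!y'. (!!i. i ~: K ==> y' i = y i) ==> y' ~: N ==> F y' = G y'"
 shows "Intg K F y = Intg K G y"
proof -
 have "AE x in LPi K. indicator N (override_on y x K) = (0::ennreal)"
  using null unfolding Intg_def by (subst (asm) nn_integral_0_iff_AE) auto
 then show ?thesis unfolding Intg_def
 proof (intro nn_integral_cong_AE, elim eventually_mono)
  fix x assume "indicator N (override_on y x K) = (0::ennreal)"
  then have "override_on y x K ~: N" by (simp add: indicator_def split: if_splits)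
  then show "F (override_on y x K) = G (override_on y x K)"
   by (intro eq) auto
 qed
qed

text \<open>The shift may depend on the coordinates that are held fixed, so that shears are covered
  as well as constant translations.\<close>

lemma Intg_translate:
 assumes "finite K" and [measurable]: "F \<in> benv"
  and c: "!!y' i. (!!i. i ~: K ==> y' i = y i) ==> c y' i = c y i"
 shows "Intg K (%y. F (%i. if i \<in> K then y i + c y i else y i)) y = Intg K F y"
proof -
 have *: "Intg K (%y. F (%i. if i \<in> K then y i + d i else y i)) y = Intg K F y" for d y
  using assms(1)
 proof (induction K arbitrary: y rule: finite_induct)
  case (insert i K)
  have m: "(%y. F (%j. if j \<in> K then y j + d j else y j)) \<in> benv"
   by (intro measurable_compose[OF measurable_envI assms(2)]) auto
  have m2: "(%y. F (%j. if j \<in> insert i K then y j + d j else y j)) \<in> benv"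
   by (intro measurable_compose[OF measurable_envI assms(2)]) auto
  have "Intg (insert i K) (%y. F (%j. if j \<in> insert i K then y j + d j else y j)) y =
   Intg K (%y. \<integral>\<^sup>+z. F (%j. if j \<in> insert i K then (y(i := z)) j + d j else (y(i := z)) j) \<partial>lborel) y"
   using insert m2 by (subst Intg_insert_inner) auto
  also have "... = Intg K (%y. \<integral>\<^sup>+z. F (%j. if j \<in> K then (y(i := z + d i)) j + d j else (y(i := z + d i)) j) \<partial>lborel) y"
   using insert by (intro Intg_cong nn_integral_cong arg_cong[of _ _ F]) (auto simp: fun_eq_iff)
  also have "... = Intg K (%y. \<integral>\<^sup>+z. F (%j. if j \<in> K then (y(i := z)) j + d j else (y(i := z)) j) \<partial>lborel) y"
  proof (intro Intg_cong)
   fix y' :: "'a => complex"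
   show "(\<integral>\<^sup>+z. F (%j. if j \<in> K then (y'(i := z + d i)) j + d j else (y'(i := z + d i)) j) \<partial>lborel) =
    (\<integral>\<^sup>+z. F (%j. if j \<in> K then (y'(i := z)) j + d j else (y'(i := z)) j) \<partial>lborel)"
    by (rule nn_integral_complex_translate)
     (intro measurable_compose[OF _ m], rule measurable_env_upd, auto)
  qed
  also have "... = Intg (insert i K) (%y. F (%j. if j \<in> K then y j + d j else y j)) y"
   using insert m by (subst Intg_insert_inner) auto
  also have "... = (\<integral>\<^sup>+z. Intg K F (y(i := z)) \<partial>lborel)"
   by (subst Intg_insert[OF insert(1,2) m]) (simp only: insert.IH)
  also have "... = Intg (insert i K) F y"
   using insert by (subst Intg_insert) auto
  finally show ?case .
 qed simp
 have "Intg K (%y. F (%i. if i \<in> K then y i + c y i else y i)) y =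
  Intg K (%y'. F (%i. if i \<in> K then y' i + c y i else y' i)) y"
 proof (rule Intg_cong)
  fix y' :: "'a => complex" assume "!!i. i ~: K ==> y' i = y i"
  then have "c y' i = c y i" for i by (rule c)
  then show "F (%i. if i \<in> K then y' i + c y' i else y' i) = F (%i. if i \<in> K then y' i + c y i else y' i)"
   by (simp only:)
 qed
 with * show ?thesis by simp
qed

lemma Intg_scale:
 assumes "finite K" and [measurable]: "F \<in> benv" and "c ~= 0"
 shows "Intg K F y = esq c ^ card K * Intg K (%y. F (%i. if i \<in> K then c * y i else y i)) y"
 using assms(1)
proof (induction K arbitrary: y rule: finite_induct)
 case (insert i K)
 have m: "(%y. F (%j. if j \<in> K then c * y j else y j)) \<in> benv" for K
  by (intro measurable_compose[OF measurable_envI assms(2)]) auto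
 have m3: "(%z. Intg K (%y. F (%j. if j \<in> K then c * y j else y j)) (y(i := z))) \<in> borel_measurable borel"
  using insert m by (intro measurable_compose[OF _ measurable_Int]) auto
 have "Intg (insert i K) F y = (\<integral>\<^sup>+z. Intg K F (y(i := z)) \<partial>lborel)"
  using insert by (subst Intg_insert) auto
 also have "... = (\<integral>\<^sup>+z. esq c ^ card K * Intg K (%y. F (%j. if j \<in> K then c * y j else y j)) (y(i := z)) \<partial>lborel)"
  by (subst insert.IH) (rule refl)
 also have "... = esq c ^ card K * (\<integral>\<^sup>+z. Intg K (%y. F (%j. if j \<in> K then c * y j else y j)) (y(i := z)) \<partial>lborel)"
  using m3 by (subst nn_integral_cmult) auto
 also have "(\<integral>\<^sup>+z. Intg K (%y. F (%j. if j \<in> K then c * y j else y j)) (y(i := z)) \<partial>lborel) =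
  Intg (insert i K) (%y. F (%j. if j \<in> K then c * y j else y j)) y"
  using insert m by (subst Intg_insert) auto
 also have "... = Intg K (%y. \<integral>\<^sup>+z. F (%j. if j \<in> K then c * (y(i := z)) j else (y(i := z)) j) \<partial>lborel) y"
  using insert m by (subst Intg_insert_inner) auto
 also have "... = Intg K (%y. esq c * (\<integral>\<^sup>+z. F (%j. if j \<in> insert i K then c * (y(i := z)) j else (y(i := z)) j) \<partial>lborel)) y"
 proof (intro Intg_cong)
  fix y' :: "'a => complex"
  have "(\<integral>\<^sup>+z. F (%j. if j \<in> K then c * (y'(i := z)) j else (y'(i := z)) j) \<partial>lborel) =
   esq c * (\<integral>\<^sup>+z. F (%j. if j \<in> K then c * (y'(i := c * z)) j else (y'(i := c * z)) j) \<partial>lborel)"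
   by (rule nn_integral_complex_mult[OF _ assms(3)]) (intro measurable_compose[OF _ m], rule measurable_env_upd, auto)
  also have "(\<integral>\<^sup>+z. F (%j. if j \<in> K then c * (y'(i := c * z)) j else (y'(i := c * z)) j) \<partial>lborel) =
   (\<integral>\<^sup>+z. F (%j. if j \<in> insert i K then c * (y'(i := z)) j else (y'(i := z)) j) \<partial>lborel)"
   using insert by (intro nn_integral_cong arg_cong[of _ _ F]) (auto simp: fun_eq_iff)
  finally show "(\<integral>\<^sup>+z. F (%j. if j \<in> K then c * (y'(i := z)) j else (y'(i := z)) j) \<partial>lborel) =
   esq c * (\<integral>\<^sup>+z. F (%j. if j \<in> insert i K then c * (y'(i := z)) j else (y'(i := z)) j) \<partial>lborel)" .
 qed
 also have "... = esq c * Intg K (%y. \<integral>\<^sup>+z. F (%j. if j \<in> insert i K then c * (y(i := z)) j else (y(i := z)) j) \<partial>lborel) y"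
  by (rule Intg_cmult) (intro lborel.borel_measurable_nn_integral, unfold case_prod_beta,
    intro measurable_compose[OF measurable_envI assms(2)], auto)
 also have "Intg K (%y. \<integral>\<^sup>+z. F (%j. if j \<in> insert i K then c * (y(i := z)) j else (y(i := z)) j) \<partial>lborel) y =
  Intg (insert i K) (%y. F (%j. if j \<in> insert i K then c * y j else y j)) y"
  using insert m[of "insert i K"] by (subst Intg_insert_inner) auto
 finally show ?case using insert by (simp add: mult_ac)
qed simp

section \<open>Linear substitutions\<close>

text \<open>Gauss-Jordan elimination as an induction principle: an invertible matrix is a product of
  row additions and row scalings. Row swaps are avoided by adding a lower row to the pivot row when
  the pivot vanishes.\<close>

lemma invertible_mat_induct:
 fixes P :: "'a :: field mat => bool"
 assumes one: "P (1\<^sub>m m)"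
  and add: "!!a k l. k < m ==> l < m ==> k ~= l ==> P (addrow_mat m a k l)"
  and mul: "!!a k. k < m ==> a ~= 0 ==> P (multrow_mat m k a)"
  and prd: "!!A B. A \<in> carrier_mat m m ==> B \<in> carrier_mat m m ==> P A ==> P B ==> P (A * B)"
  and M: "M \<in> carrier_mat m m" "det M ~= 0"
 shows "P M"
proof -
 \<comment> \<open>The invariant: M is invertible and its first j columns are those of the
   identity.\<close>
 define U where "U j M \<longleftrightarrow> M \<in> carrier_mat m m & det M ~= 0 &
  (\<forall>l<j. \<forall>i<m. M $$ (i, l) = (if i = l then 1 else 0))" for j and M :: "'a mat"
 have red_add: "P M" if "P (addrow a k l M)" "M \<in> carrier_mat m m" "k < m" "l < m" "k ~= l" for a k l M
 proof -
  have "M = addrow_mat m (-a) k l * addrow a k l M"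
   using that addrow_mat_inv[of k m l "-a"]
   by (subst addrow_mat[of M m m], auto simp flip: assoc_mult_mat[of _ m m _ m _ m])
  then show ?thesis using that add[of k l "-a"] prd[of "addrow_mat m (-a) k l" "addrow a k l M"] by simp
 qed
 have red_mul: "P M" if "P (multrow k a M)" "M \<in> carrier_mat m m" "k < m" "a ~= 0" for a k M
 proof -
  have "M = multrow_mat m k (inverse a) * multrow k a M"
   using that multrow_mat_inv[of k m "inverse a"]
   by (subst multrow_mat[of M m m], auto simp flip: assoc_mult_mat[of _ m m _ m _ m])
  then show ?thesis using that mul[of k "inverse a"] prd[of "multrow_mat m k (inverse a)" "multrow k a M"] by simp
 qed
 have main: "P M" if "U j M" "j + d = m" for j d M
  using that
 proof (induction d arbitrary: j M)
  case 0
  then have "M = 1\<^sub>m m" by (intro eq_matI) (auto simp: U_def)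
  then show ?case using one by simp
 next
  case (Suc d)
  then have j: "j < m" by simp
  have clear: "P M" if "U j M" "M $$ (j, j) = 1" "card {i. i < m & i ~= j & M $$ (i, j) ~= 0} = r" for M r
   using that
  proof (induction r arbitrary: M)
   case 0
   then have "\<forall>i<m. i ~= j --> M $$ (i, j) = 0" by auto
   then have "U (Suc j) M" using 0(1,2) by (auto simp: U_def less_Suc_eq)
   then show ?case using Suc.IH[of "Suc j" M] Suc.prems(2) by simp
  next
   case (Suc r)
   have MC: "M \<in> carrier_mat m m" using Suc.prems by (auto simp: U_def)
   let ?R = "%M. {i. i < m & i ~= j & M $$ (i, j) ~= 0}"
   obtain i where i: "i \<in> ?R M" using Suc.prems(3) by (metis card.empty ex_in_conv nat.distinct(1))
   let ?N = "addrow (- M $$ (i, j)) i j M"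
   have "?R ?N = ?R M - {i}" using i j MC Suc.prems(2) by (auto split: if_splits)
   then have "card (?R ?N) = r" using i Suc.prems(3) by simp
   moreover have "?N $$ (j, j) = 1" using i j MC Suc.prems(2) by auto
   moreover have "U j ?N"
    unfolding U_def
   proof (intro conjI allI impI)
    show "?N \<in> carrier_mat m m" using MC by simp
    show "det ?N ~= 0" using i j MC Suc.prems(1) by (subst det_addrow[of _ m]) (auto simp: U_def)
    fix l i' assume "l < j" "i' < m"
    then show "?N $$ (i', l) = (if i' = l then 1 else 0)"
     using i j MC Suc.prems(1) by (auto simp: U_def)
   qed
   ultimately have "P ?N" using Suc.IH[of ?N] by simp
   then show ?case using red_add[of "- M $$ (i, j)" i j M] i j MC by auto
  qed
  have pivot: "P M" if U: "U j M" and nz: "M $$ (j, j) ~= 0" for M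
  proof -
   have MC: "M \<in> carrier_mat m m" using U by (auto simp: U_def)
   let ?N = "multrow j (inverse (M $$ (j, j))) M"
   have "U j ?N"
    unfolding U_def
   proof (intro conjI allI impI)
    show "?N \<in> carrier_mat m m" using MC by simp
    show "det ?N ~= 0" using j MC U nz by (subst det_multrow[of _ m]) (auto simp: U_def)
    fix l i' assume "l < j" "i' < m"
    then show "?N $$ (i', l) = (if i' = l then 1 else 0)"
     using j MC U by (auto simp: U_def)
   qed
   moreover have "?N $$ (j, j) = 1" using j MC nz by auto
   ultimately have "P ?N" using clear by blast
   then show ?thesis using red_mul[of j _ M] j MC nz by auto
  qed
  have MC: "M \<in> carrier_mat m m" using Suc.prems by (auto simp: U_def)
  have "\<exists>i. j <= i & i < m & M $$ (i, j) ~= 0"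
  proof (rule ccontr)
   assume "~ ?thesis"
   then have z: "M $$ (i, j) = 0" if "j <= i" "i < m" for i using that by auto
   \<comment> \<open>If column j had no entry from row j downwards, it would be a combination of the
     unit columns before it, and this v would be in the kernel.\<close>
   define v where "v = Matrix.vec m (%i. if i = j then 1 else if i < j then - M $$ (i, j) else 0)"
   have "M *\<^sub>v v = 0\<^sub>v m"
   proof (rule eq_vecI)
    fix i assume "i < dim_vec (0\<^sub>v m :: 'a Matrix.vec)"
    then have i: "i < m" by simp
    have "vec_index (M *\<^sub>v v) i = (\<Sum>l<m. M $$ (i, l) * vec_index v l)"
     using MC i by (simp add: scalar_prod_def v_def atLeast0LessThan)
    also have "... = (\<Sum>l<m. (if l = j then M $$ (i, j) else 0) + (if l = i & i < j then - M $$ (i, j) else 0))"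
     using Suc.prems(1) i by (intro sum.cong) (auto simp: v_def U_def)
    also have "... = 0"
     using i j z[of i] by (cases "i < j") (auto simp: sum.distrib)
    finally show "vec_index (M *\<^sub>v v) i = vec_index (0\<^sub>v m) i" using i by simp
   qed (use MC in simp)
   moreover have "v \<in> carrier_vec m" "v ~= 0\<^sub>v m"
    using j by (auto simp: v_def vec_eq_iff)
   ultimately have "det M = 0" using det_0_iff_vec_prod_zero_field[OF MC] by blast
   then show False using Suc.prems by (auto simp: U_def)
  qed
  then obtain i where i: "j <= i" "i < m" "M $$ (i, j) ~= 0" by blast
  show ?case
  proof (cases "M $$ (j, j) = 0")
   case False then show ?thesis using pivot Suc.prems by blast
  next
   case True
   with i have ij: "j < i" by (metis le_neq_implies_less)
   let ?N = "addrow 1 j i M"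
   have "U j ?N"
    unfolding U_def
   proof (intro conjI allI impI)
    show "?N \<in> carrier_mat m m" using MC by simp
    show "det ?N ~= 0" using i ij j MC Suc.prems(1) by (subst det_addrow[of _ m]) (auto simp: U_def)
    fix l i' assume "l < j" "i' < m"
    then show "?N $$ (i', l) = (if i' = l then 1 else 0)"
     using i ij j MC Suc.prems(1) by (auto simp: U_def)
   qed
   moreover have "?N $$ (j, j) ~= 0" using i j MC True by auto
   ultimately have "P ?N" using pivot by blast
   then show ?thesis using red_add[of 1 j i M] i ij j MC by auto
  qed
 qed
 show ?thesis using main[of 0 M m] M by (simp add: U_def)
qed

text \<open>The set \<open>K\<close> of coordinates is a union of lines of length \<open>m\<close>: \<open>r \<iota>\<close> is the position of \<open>\<iota>\<close>
 in its line, and \<open>e \<iota> j\<close> is the \<open>j\<close>-th coordinate of that line.\<close>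

locale lines =
 fixes K :: "'i set" and r :: "'i => nat" and e :: "'i => nat => 'i" and m p :: nat
 assumes fin: "finite K"
  and r: "!!i. i \<in> K ==> r i < m"
  and e: "!!i j. i \<in> K ==> j < m ==> e i j \<in> K"
  and re: "!!i j. i \<in> K ==> j < m ==> r (e i j) = j"
  and ee: "!!i j k. i \<in> K ==> j < m ==> k < m ==> e (e i j) k = e i k"
  and er: "!!i. i \<in> K ==> e i (r i) = i"
  and card_row: "!!j. j < m ==> card {i\<in>K. r i = j} = p"

begin

definition lin :: "complex mat => ('i => complex) => 'i => complex" where
 "lin M y = (%i. if i \<in> K then (\<Sum>j<m. M $$ (r i, j) * y (e i j)) else y i)"

lemma measurable_lin [measurable]: "lin M \<in> env \<rightarrow>\<^sub>M env"
proof (rule measurable_envI)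
 fix i
 show "(%y. lin M y i) \<in> benv"
  by (cases "i \<in> K") (simp_all add: lin_def)
qed

lemma lin_mult:
 assumes A: "A \<in> carrier_mat m m" and B: "B \<in> carrier_mat m m"
 shows "lin (A * B) y = lin A (lin B y)"
proof
 fix i
 show "lin (A * B) y i = lin A (lin B y) i"
 proof (cases "i \<in> K")
  case True
  have "lin (A * B) y i = (\<Sum>j<m. (\<Sum>k<m. A $$ (r i, k) * B $$ (k, j)) * y (e i j))"
   using A B True r by (simp add: lin_def scalar_prod_def atLeast0LessThan)
  also have "... = (\<Sum>j<m. \<Sum>k<m. A $$ (r i, k) * (B $$ (k, j) * y (e i j)))"
   by (simp add: sum_distrib_right mult.assoc)
  also have "... = (\<Sum>k<m. \<Sum>j<m. A $$ (r i, k) * (B $$ (k, j) * y (e i j)))"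
   by (rule sum.swap)
  also have "... = lin A (lin B y) i"
   using True by (simp add: lin_def e re ee sum_distrib_left)
  finally show ?thesis .
 qed (simp add: lin_def)
qed

lemma Intg_split_row:
 assumes "j < m" and "F \<in> benv"
 shows "Intg K F y = Intg (K - {i\<in>K. r i = j}) (Intg {i\<in>K. r i = j} F) y"
proof -
 have "K = (K - {i\<in>K. r i = j}) \<union> {i\<in>K. r i = j}" by auto
 then show ?thesis using fin assms(2)
  by (subst Intg_Un[symmetric]) auto
qed

text \<open>The matrix acts on each of the p lines separately, hence the power p of the Jacobian.
  For a row addition the substitution is a translation by coordinates of another row, for a row
  scaling it is a dilation of one row.\<close>

theorem Intg_lin:
 assumes M: "M \<in> carrier_mat m m" "det M ~= 0" and F: "F \<in> benv"
 shows "Intg K F y = esq (det M) ^ p * Intg K (%y. F (lin M y)) y"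
proof -
 define Q where "Q M \<longleftrightarrow> (\<forall>F\<in>benv. \<forall>y.
  Intg K F y = esq (det M) ^ p * Intg K (%y. F (lin M y)) y)" for M
 have meas: "(%y. F (lin M y)) \<in> benv" if "F \<in> benv" for F :: "_ => ennreal" and M
  using that by measurable
 have "Q M"
 proof (rule invertible_mat_induct[OF _ _ _ _ M])
  have "lin (1\<^sub>m m) y = y" for y
  proof
   fix i
   show "lin (1\<^sub>m m) y i = y i"
   proof (cases "i \<in> K")
    case True
    then have "lin (1\<^sub>m m) y i = (\<Sum>j<m. (if j = r i then y (e i j) else 0))"
     unfolding lin_def if_P[OF True] by (intro sum.cong) (use True r in auto)
    then show ?thesis using True r er by simp
   qed (simp add: lin_def)
  qed
  then show "Q (1\<^sub>m m)" by (simp add: Q_def)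
 next
  fix A B assume AB: "A \<in> carrier_mat m m" "B \<in> carrier_mat m m" "Q A" "Q B"
  show "Q (A * B)"
   unfolding Q_def
  proof (intro ballI allI)
   fix F :: "('i => complex) => ennreal" and y assume F: "F \<in> benv"
   have "Intg K F y = esq (det A) ^ p * Intg K (%y. F (lin A y)) y"
    using AB(3) F unfolding Q_def by blast
   also have "Intg K (%y. F (lin A y)) y = esq (det B) ^ p * Intg K (%y. F (lin A (lin B y))) y"
    using AB(4) meas[OF F, of A] unfolding Q_def by blast
   also have "(%y. F (lin A (lin B y))) = (%y. F (lin (A * B) y))"
    using AB by (simp add: lin_mult)
   finally show "Intg K F y = esq (det (A * B)) ^ p * Intg K (%y. F (lin (A * B) y)) y"
    using AB by (simp add: det_mult[of _ m] norm_mult power_mult_distrib ennreal_mult mult_ac)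
  qed
 next
  fix a :: complex and k l assume kl: "k < m" "l < m" "k ~= l"
  let ?K = "{i\<in>K. r i = k}"
  have lin: "lin (addrow_mat m a k l) y = (%i. if i \<in> ?K then y i + a * y (e i l) else y i)" for y
  proof
   fix i
   show "lin (addrow_mat m a k l) y i = (if i \<in> ?K then y i + a * y (e i l) else y i)"
   proof (cases "i \<in> K")
    case True
    have "lin (addrow_mat m a k l) y i = (\<Sum>j<m. (if j = r i then y (e i j) else 0) + (if r i = k & j = l then a * y (e i l) else 0))"
     using True r kl by (auto simp: lin_def intro!: sum.cong)
    then show ?thesis using True r er kl by (cases "r i = k") (auto simp: sum.distrib)
   qed (simp add: lin_def)
  qed
  show "Q (addrow_mat m a k l)"
   unfolding Q_def
  proof (intro ballI allI)
   fix F :: "('i => complex) => ennreal" and y assume F: "F \<in> benv"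
   have "Intg K (%y. F (lin (addrow_mat m a k l) y)) y = Intg (K - ?K) (Intg ?K (%y. F (%i. if i \<in> ?K then y i + a * y (e i l) else y i))) y"
    unfolding lin[symmetric] by (rule Intg_split_row[OF kl(1) meas[OF F]])
   also have "... = Intg (K - ?K) (Intg ?K F) y"
   proof (rule Intg_cong)
    fix y
    have "Intg ?K (%y. F (%i. if i \<in> ?K then y i + (if i \<in> ?K then a * y (e i l) else 0) else y i)) y = Intg ?K F y"
    proof (rule Intg_translate)
     fix y' :: "'i => complex" and i assume y': "!!i. i ~: ?K ==> y' i = y i"
     show "(if i \<in> ?K then a * y' (e i l) else 0) = (if i \<in> ?K then a * y (e i l) else 0)"
      using y'[of "e i l"] re[of i l] kl by auto
    qed (use fin F in auto)
    moreover have "(%i. if i \<in> ?K then y i + (if i \<in> ?K then a * y (e i l) else 0) else y i) =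
     (%i. if i \<in> ?K then y i + a * y (e i l) else y i)" for y
     by auto
    ultimately show "Intg ?K (%y. F (%i. if i \<in> ?K then y i + a * y (e i l) else y i)) y = Intg ?K F y"
     by (simp only:)
   qed
   also have "... = Intg K F y" by (rule Intg_split_row[OF kl(1) F, symmetric])
   finally show "Intg K F y = esq (det (addrow_mat m a k l)) ^ p * Intg K (%y. F (lin (addrow_mat m a k l) y)) y"
    using kl by (simp add: det_addrow_mat)
  qed
 next
  fix a :: complex and k assume k: "k < m" "a ~= 0"
  let ?K = "{i\<in>K. r i = k}"
  have lin: "lin (multrow_mat m k a) y = (%i. if i \<in> ?K then a * y i else y i)" for y
  proof
   fix i
   show "lin (multrow_mat m k a) y i = (if i \<in> ?K then a * y i else y i)"
   proof (cases "i \<in> K")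
    case True
    have "lin (multrow_mat m k a) y i = (\<Sum>j<m. (if j = r i then (if r i = k then a else 1) * y (e i j) else 0))"
     unfolding lin_def if_P[OF True] by (intro sum.cong) (use True r k in auto)
    then show ?thesis using True r er k by auto
   qed (simp add: lin_def)
  qed
  show "Q (multrow_mat m k a)"
   unfolding Q_def
  proof (intro ballI allI)
   fix F :: "('i => complex) => ennreal" and y assume F: "F \<in> benv"
   let ?G = "%y. F (%i. if i \<in> ?K then a * y i else y i)"
   have G: "?G \<in> benv" using meas[OF F, of "multrow_mat m k a"] by (simp add: lin)
   have "Intg K F y = Intg (K - ?K) (Intg ?K F) y" by (rule Intg_split_row[OF k(1) F])
   also have "... = Intg (K - ?K) (%y. esq a ^ p * Intg ?K ?G y) y"
   proof (intro Intg_cong)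
    fix y
    show "Intg ?K F y = esq a ^ p * Intg ?K ?G y"
     using Intg_scale[of ?K F a y] fin F k card_row by simp
   qed
   also have "... = esq a ^ p * Intg (K - ?K) (Intg ?K ?G) y"
    using fin G by (intro Intg_cmult measurable_Int) auto
   also have "Intg (K - ?K) (Intg ?K ?G) y = Intg K ?G y"
    by (rule Intg_split_row[OF k(1) G, symmetric])
   finally show "Intg K F y = esq (det (multrow_mat m k a)) ^ p * Intg K (%y. F (lin (multrow_mat m k a) y)) y"
    using k by (simp add: det_multrow_mat lin)
  qed
 qed
 then show ?thesis using F unfolding Q_def by blast
qed

end

section \<open>Area formula for rational functions\<close>

lemma card_roots_simple:
 fixes q :: "complex poly"
 assumes "!!z. poly q z = 0 ==> poly (pderiv q) z ~= 0" and "q ~= 0"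
 shows "card {z. poly q z = 0} = degree q"
proof -
 have "rsquarefree q" using assms(1) by (auto simp: rsquarefree_roots)
 then show ?thesis using rsquarefree_card_degree[OF assms(2)] by simp
qed

text \<open>Off finitely many values b the equation R/m = b has exactly n solutions, all simple,
  because b m - R has degree n and a double root would make b a critical value. The derivative of
  R/m is W/m^2, so the area formula counts every b exactly n times.\<close>

lemma area_rational:
 fixes m R :: "complex poly" and H :: "complex => ennreal"
 assumes cop: "!!z. ~ (poly m z = 0 & poly R z = 0)"
  and deg: "degree R = n" "degree m < n" and m0: "m ~= 0"
  and H[measurable]: "H \<in> borel_measurable borel"
 defines "W == pderiv R * m - R * pderiv m"
 shows "(\<integral>\<^sup>+z. H (poly R z / poly m z) * esq (poly W z / (poly m z)^2) *
   indicator {z. poly m z ~= 0} z \<partial>lborel) = of_nat n * (\<integral>\<^sup>+b. H b \<partial>lborel)"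
proof -
 define \<phi> where "\<phi> z = poly R z / poly m z" for z
 define \<phi>' where "\<phi>' z = poly W z / (poly m z)^2" for z
 define S where "S = {z. poly m z ~= 0 & poly W z ~= 0}"
 have R0: "R ~= 0" using deg by auto
 \<comment> \<open>The coefficient of W in degree n - 1 + deg m is (n - deg m) times the product of
   the two leading coefficients.\<close>
 have W0: "W ~= 0"
 proof
  assume "W = 0"
  then have eq: "pderiv R * m = R * pderiv m" by (simp add: W_def)
  have "coeff (pderiv R * m) (n - 1 + degree m) = coeff (pderiv R) (n - 1) * lead_coeff m"
   using deg degree_pderiv[of R] coeff_mult_degree_sum[of "pderiv R" m] by simp
  also have "coeff (pderiv R) (n - 1) = of_nat n * lead_coeff R"
   using deg by (cases n) (simp_all add: coeff_pderiv)
  finally have 1: "coeff (pderiv R * m) (n - 1 + degree m) = of_nat n * lead_coeff R * lead_coeff m" .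
  have 2: "coeff (R * pderiv m) (n - 1 + degree m) = of_nat (degree m) * lead_coeff R * lead_coeff m"
  proof (cases "degree m")
   case 0
   then have "pderiv m = 0" by (simp add: pderiv_eq_0_iff)
   then show ?thesis using 0 by simp
  next
   case (Suc d)
   have "n - 1 + degree m = degree R + d"
    using Suc deg by simp
   moreover have "coeff (R * pderiv m) (degree R + d) = lead_coeff R * coeff (pderiv m) d"
    using coeff_mult_degree_sum[of R "pderiv m"] Suc by (simp add: degree_pderiv)
   ultimately have "coeff (R * pderiv m) (n - 1 + degree m) = lead_coeff R * coeff (pderiv m) d"
    by (simp only:)
   then show ?thesis using Suc by (simp add: coeff_pderiv)
  qed
  have "of_nat n * (lead_coeff R * lead_coeff m) = of_nat (degree m) * (lead_coeff R * lead_coeff m)"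
   using 1 2 eq by (simp only: mult.assoc)
  moreover have "lead_coeff R * lead_coeff m ~= 0" using m0 R0 by simp
  ultimately have "(of_nat n :: complex) = of_nat (degree m)" by (metis mult_right_cancel)
  moreover have "(of_nat n :: complex) ~= of_nat (degree m)" using deg(2) by simp
  ultimately show False by blast
 qed
 have finW: "finite {z. poly W z = 0}" and finm: "finite {z. poly m z = 0}"
  using W0 m0 poly_roots_finite by auto
 have openS: "open S"
 proof -
  have "S = - ({z. poly m z = 0} \<union> {z. poly W z = 0})" by (auto simp: S_def)
  then show ?thesis using finW finm by (metis finite_UnI finite_imp_closed open_Compl)
 qed
 have der: "(\<phi> has_field_derivative \<phi>' z) (at z)" if "poly m z ~= 0" for z
  unfolding \<phi>_def \<phi>'_def W_def using that
  by (auto intro!: derivative_eq_intros simp: power2_eq_square)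
 have hol: "\<phi> holomorphic_on S"
  unfolding holomorphic_on_def field_differentiable_def
  by (intro ballI exI, rule has_field_derivative_at_within[OF der]) (simp add: S_def)
 have "\<exists>r>0. inj_on \<phi> (ball z r)" if z: "z \<in> S" for z
 proof -
  have "deriv \<phi> z = \<phi>' z" using der z by (auto simp: S_def intro!: DERIV_imp_deriv)
  also have "... ~= 0" using z by (auto simp: S_def \<phi>'_def)
  finally show ?thesis
   using has_complex_derivative_locally_injective[OF hol z openS] by metis
 qed
 then obtain r where r: "!!z. z \<in> S ==> r z > 0" "!!z. z \<in> S ==> inj_on \<phi> (ball z (r z))" by metis
 obtain \<F> where \<F>: "\<F> <= (%z. ball z (r z)) ` S" "countable \<F>" "\<Union>\<F> = (\<Union>z\<in>S. ball z (r z))"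
  using Lindelof[of "(%z. ball z (r z)) ` S"] by (metis (no_types, lifting) image_iff open_ball)
 define U where "U i = (if \<F> = {} then {} else from_nat_into \<F> i)" for i
 have U_ball: "U i = {} \<or> (\<exists>z\<in>S. U i = ball z (r z))" for i
  unfolding U_def using \<F>(1) from_nat_into[of \<F> i] by (metis (mono_tags, lifting) imageE subsetD)
 have U_open: "open (U i)" for i
  using U_ball[of i] by auto
 have U_inj: "inj_on \<phi> (U i)" for i
  using U_ball[of i] r by auto
 have U_cover: "S <= (\<Union>i. U i)"
 proof
  fix z assume "z \<in> S"
  then have "z \<in> \<Union>\<F>" using r(1) \<F>(3) by force
  then obtain B where "B \<in> \<F>" "z \<in> B" by blast
  then show "z \<in> (\<Union>i. U i)"
   using \<F>(2) from_nat_into_surj[of \<F> B] by (auto simp: U_def split: if_splits)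
 qed
 \<comment> \<open>Countably many disjoint Borel pieces on which the map is injective, cut out of a
   countable cover by balls of local injectivity.\<close>
 define E where "E i = disjointed U i \<inter> S" for i
 have E_borel [measurable]: "E i \<in> sets borel" for i
  unfolding E_def disjointed_def using U_open openS by (auto intro!: sets.Int sets.Diff)
 have E_disj: "disjoint_family E"
  using disjoint_family_disjointed[of U] by (auto simp: E_def disjoint_family_on_def)
 have E_un: "(\<Union>i. E i) = S"
  using U_cover UN_disjointed_eq[of U] by (auto simp: E_def)
 have E_inj: "inj_on \<phi> (E i)" for i
  unfolding E_def by (rule inj_on_subset[OF U_inj[of i]]) (use disjointed_subset[of U i] in blast)
 have [measurable]: "(%z. poly p z) \<in> borel_measurable borel" for p :: "complex poly"
  by (intro borel_measurable_continuous_onI continuous_intros)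
 have [measurable]: "\<phi> \<in> borel_measurable borel" "\<phi>' \<in> borel_measurable borel"
  unfolding \<phi>_def \<phi>'_def by measurable
 have piece: "(\<integral>\<^sup>+z. H (\<phi> z) * esq (\<phi>' z) * indicator (E i) z \<partial>lborel) =
  (\<integral>\<^sup>+b. H b * indicator (\<phi> ` E i) b \<partial>lebesgue)" for i
  by (rule nn_integral_image_complex[OF E_borel _ E_inj, symmetric]) (auto simp: E_def S_def intro: der)
 have imE: "\<phi> ` E i \<in> sets lebesgue" for i
  by (rule emeasure_image_complex(1)[OF E_borel _ E_inj, of _ \<phi>']) (auto simp: E_def S_def intro: der)
 \<comment> \<open>The exceptional values: images of the zeros of W. There are finitely many, so
   they carry no area.\<close>
 define B where "B = \<phi> ` {z. poly W z = 0}"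
 have finB: "finite B" unfolding B_def using finW by simp
 have count: "(\<Sum>i. indicator (\<phi> ` E i) b) = (of_nat n :: ennreal)" if "b ~: B" for b
 proof -
  define q where "q = Polynomial.smult b m - R"
  have dq: "degree q = n"
  proof -
   have "degree (Polynomial.smult b m) < degree R" using deg degree_smult_le[of b m] by simp
   then show ?thesis unfolding q_def using deg
    by (metis add.commute degree_add_eq_right degree_minus uminus_add_conv_diff diff_conv_add_uminus)
  qed
  then have q0: "q ~= 0" using deg by auto
  have Z: "{z. poly q z = 0} = {z \<in> S. \<phi> z = b}"
  proof safe
   fix z assume z: "poly q z = 0"
   then have e: "b * poly m z = poly R z" by (simp add: q_def)
   then have mz: "poly m z ~= 0" using cop[of z] by auto
   then show "\<phi> z = b" using e by (simp add: \<phi>_def field_simps)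
   then show "z \<in> S" using that mz by (auto simp: S_def B_def)
  next
   fix z assume "z \<in> S" "b = \<phi> z"
   then show "poly q z = 0" by (simp add: q_def \<phi>_def S_def)
  qed
  have "card {z. poly q z = 0} = degree q"
  proof (rule card_roots_simple[OF _ q0])
   fix z assume z: "poly q z = 0"
   then have zS: "z \<in> S" and e: "b * poly m z = poly R z" using Z by (auto simp: q_def)
   show "poly (pderiv q) z ~= 0"
   proof
    assume "poly (pderiv q) z = 0"
    then have "b * poly (pderiv m) z = poly (pderiv R) z" by (simp add: q_def pderiv_diff pderiv_smult)
    then have "poly W z = 0" using e by (simp add: W_def) (metis mult.assoc mult.commute)
    then show False using zS by (simp add: S_def)
   qed
  qed
  then have card: "card {z \<in> S. \<phi> z = b} = n" using Z dq by simp
  then have fin: "finite {z \<in> S. \<phi> z = b}" using deg by (metis card.infinite not_less_zero)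
  define idx where "idx z = (THE i. z \<in> E i)" for z
  have idx: "idx z = i" if "z \<in> E i" for z i
   unfolding idx_def using that E_disj by (intro the_equality) (auto simp: disjoint_family_on_def)
  have inj: "inj_on idx {z \<in> S. \<phi> z = b}"
  proof (rule inj_onI)
   fix x y assume xy: "x \<in> {z \<in> S. \<phi> z = b}" "y \<in> {z \<in> S. \<phi> z = b}" "idx x = idx y"
   obtain i j where ij: "x \<in> E i" "y \<in> E j" using xy E_un by blast
   then have "i = j" using idx xy by metis
   then show "x = y" using ij xy E_inj[of i] by (auto simp: inj_on_def)
  qed
  have img: "b \<in> \<phi> ` E i \<longleftrightarrow> i \<in> idx ` {z \<in> S. \<phi> z = b}" for i
  proof
   assume "b \<in> \<phi> ` E i"
   then obtain z where "z \<in> E i" "\<phi> z = b" by blast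
   then show "i \<in> idx ` {z \<in> S. \<phi> z = b}" using idx E_un by (intro image_eqI[of _ _ z]) auto
  next
   assume "i \<in> idx ` {z \<in> S. \<phi> z = b}"
   then obtain z where z: "z \<in> S" "\<phi> z = b" "i = idx z" by blast
   then obtain j where "z \<in> E j" using E_un by blast
   then show "b \<in> \<phi> ` E i" using z idx by auto
  qed
  have "(\<Sum>i. indicator (\<phi> ` E i) b) = (\<Sum>i\<in>idx ` {z \<in> S. \<phi> z = b}. indicator (\<phi> ` E i) b :: ennreal)"
   using fin img by (intro suminf_finite) (auto simp: indicator_def)
  also have "... = (\<Sum>i\<in>idx ` {z \<in> S. \<phi> z = b}. 1)"
   using img by (intro sum.cong) (auto simp: indicator_def)
  also have "... = of_nat n"
   using card inj by (simp add: card_image)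
  finally show ?thesis .
 qed
 have Hl: "H \<in> borel_measurable lebesgue" by (simp add: measurable_completion)
 have nullW: "AE z in lborel. z ~: {z. poly W z = 0}"
  using finite_imp_null_set_lborel[OF finW] by (rule AE_not_in)
 have nullB: "AE z in lebesgue. z ~: B"
  using null_sets_completionI[OF finite_imp_null_set_lborel[OF finB]] by (rule AE_not_in)
 have "(\<integral>\<^sup>+z. H (\<phi> z) * esq (\<phi>' z) * indicator {z. poly m z ~= 0} z \<partial>lborel) =
  (\<integral>\<^sup>+z. (\<Sum>i. H (\<phi> z) * esq (\<phi>' z) * indicator (E i) z) \<partial>lborel)"
 proof (intro nn_integral_cong_AE, use nullW in eventually_elim)
  fix z assume "z ~: {z. poly W z = 0}"
  then have "indicator {z. poly m z ~= 0} z = (indicator S z :: ennreal)" by (auto simp: S_def indicator_def)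
  also have "... = (\<Sum>i. indicator (E i) z)"
   using suminf_indicator[OF E_disj, of z] E_un by simp
  finally show "H (\<phi> z) * esq (\<phi>' z) * indicator {z. poly m z ~= 0} z =
   (\<Sum>i. H (\<phi> z) * esq (\<phi>' z) * indicator (E i) z)"
   by simp
 qed
 also have "... = (\<Sum>i. \<integral>\<^sup>+z. H (\<phi> z) * esq (\<phi>' z) * indicator (E i) z \<partial>lborel)"
  by (rule nn_integral_suminf) measurable
 also have "... = (\<Sum>i. \<integral>\<^sup>+b. H b * indicator (\<phi> ` E i) b \<partial>lebesgue)"
  by (simp only: piece)
 also have "... = (\<integral>\<^sup>+b. (\<Sum>i. H b * indicator (\<phi> ` E i) b) \<partial>lebesgue)"
  using Hl imE by (intro nn_integral_suminf[symmetric]) auto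
 also have "... = (\<integral>\<^sup>+b. of_nat n * H b \<partial>lebesgue)"
 proof (intro nn_integral_cong_AE, use nullB in eventually_elim)
  fix b assume "b ~: B"
  then show "(\<Sum>i. H b * indicator (\<phi> ` E i) b) = of_nat n * H b"
   using count by (simp add: mult.commute)
 qed
 also have "... = (\<integral>\<^sup>+b. of_nat n * H b \<partial>lborel)"
  by (rule nn_integral_completion)
 also have "... = of_nat n * (\<integral>\<^sup>+b. H b \<partial>lborel)"
  by (rule nn_integral_cmult) simp
 finally show ?thesis by (simp only: \<phi>_def \<phi>'_def)
qed

section \<open>Matrix pencils\<close>

definition pencil_poly :: "nat => pencil => complex poly" where
 "pencil_poly n y = det (mat n n (%(i, j). [:y (False, i, j), - y (True, i, j):]))"

definition pdet :: "nat => pencil => complex => complex" where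
 "pdet n y z = det (mat n n (%(i, j). y (False, i, j) - z * y (True, i, j)))"

definition adet :: "nat => pencil => complex" where
 "adet n y = det (mat n n (%(i, j). y (True, i, j)))"

lemma poly_pencil_poly: "poly (pencil_poly n y) z = pdet n y z"
proof -
 have hom: "comm_ring_hom (%p :: complex poly. poly p z)" by standard auto
 have "poly (pencil_poly n y) z = det (map_mat (%p. poly p z) (mat n n (%(i, j). [:y (False, i, j), - y (True, i, j):])))"
  unfolding pencil_poly_def by (rule comm_ring_hom.hom_det[OF hom, symmetric])
 also have "map_mat (%p. poly p z) (mat n n (%(i, j). [:y (False, i, j), - y (True, i, j):])) =
  mat n n (%(i, j). y (False, i, j) - z * y (True, i, j))"
  by (intro eq_matI) auto
 finally show ?thesis by (simp add: pdet_def)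
qed

lemma permutes_less: "p permutes {0..<n} ==> i < n ==> p i < (n::nat)"
 using permutes_in_image[of p "{0..<n}" i] by simp

lemma prod_linear_poly:
 fixes a b :: "'b => 'a :: idom"
 assumes "finite S"
 shows "degree (\<Prod>i\<in>S. [:a i, b i:]) <= card S & coeff (\<Prod>i\<in>S. [:a i, b i:]) (card S) = (\<Prod>i\<in>S. b i)"
 using assms
proof (induction S rule: finite_induct)
 case (insert x S)
 let ?p = "\<Prod>i\<in>S. [:a i, b i:]"
 have "degree ([:a x, b x:] * ?p) <= 1 + card S"
  using degree_mult_le[of "[:a x, b x:]" ?p] insert.IH degree_pCons_le[of "a x" "[:b x:]"]
  by (simp add: add.commute)
 moreover have "coeff ([:a x, b x:] * ?p) (Suc (card S)) = b x * coeff ?p (card S)"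
  using insert.IH by (simp add: mult_pCons_left coeff_eq_0 le_imp_less_Suc)
 ultimately show ?case using insert by simp
qed simp

lemma pencil_poly_degree:
 shows "degree (pencil_poly n y) <= n" and "coeff (pencil_poly n y) n = (-1) ^ n * adet n y"
proof -
 have e: "pencil_poly n y = (\<Sum>p\<in>{p. p permutes {0..<n}}. of_int (sign p) * (\<Prod>i\<in>{0..<n}. [:y (False, i, p i), - y (True, i, p i):]))"
  unfolding pencil_poly_def
  by (subst det_def'[of _ n]) (auto intro!: sum.cong prod.cong simp: permutes_less)
 have 1: "degree (\<Prod>i\<in>{0..<n}. [:y (False, i, p i), - y (True, i, p i):]) <= n" for p
  using prod_linear_poly[of "{0..<n}" "%i. y (False, i, p i)" "%i. - y (True, i, p i)"] by simp
 have 2: "coeff (\<Prod>i\<in>{0..<n}. [:y (False, i, p i), - y (True, i, p i):]) n = (-1) ^ n * (\<Prod>i\<in>{0..<n}. y (True, i, p i))" for p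
  using prod_linear_poly[of "{0..<n}" "%i. y (False, i, p i)" "%i. - y (True, i, p i)"] by (simp add: prod_uminus)
 show "degree (pencil_poly n y) <= n"
  unfolding e
 proof (intro degree_sum_le)
  fix p
  have "degree (of_int (sign p) * (\<Prod>i\<in>{0..<n}. [:y (False, i, p i), - y (True, i, p i):])) <=
   degree (of_int (sign p) :: complex poly) + degree (\<Prod>i\<in>{0..<n}. [:y (False, i, p i), - y (True, i, p i):])"
   by (rule degree_mult_le)
  then show "degree (of_int (sign p) * (\<Prod>i\<in>{0..<n}. [:y (False, i, p i), - y (True, i, p i):])) <= n"
   using 1[of p] by simp
 qed (simp add: finite_permutations)
 have "coeff (pencil_poly n y) n = (\<Sum>p\<in>{p. p permutes {0..<n}}. of_int (sign p) * ((-1) ^ n * (\<Prod>i\<in>{0..<n}. y (True, i, p i))))"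
  unfolding e by (simp add: coeff_sum of_int_poly 2)
 also have "... = (-1) ^ n * adet n y"
  unfolding adet_def
  by (subst det_def'[of _ n]) (auto simp: sum_distrib_left permutes_less mult_ac intro!: sum.cong prod.cong)
 finally show "coeff (pencil_poly n y) n = (-1) ^ n * adet n y" .
qed

lemma degree_pencil_poly: "adet n y ~= 0 ==> degree (pencil_poly n y) = n"
 using pencil_poly_degree[of n y] by (intro antisym le_degree) auto

lemma pdet_0 [simp]: "pdet 0 y z = 1"
 by (simp add: pdet_def)

lemma pdet_cong:
 assumes "!!c i j. i < n ==> j < n ==> y (c, i, j) = y' (c, i, j)"
 shows "pdet n y z = pdet n y' z" "adet n y = adet n y'" "pencil_poly n y = pencil_poly n y'"
 unfolding pdet_def adet_def pencil_poly_def
 using assms by (auto intro!: arg_cong[where f=det] eq_matI)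

lemma continuous_pdet: "continuous_on S (%z. pdet n y z)"
 unfolding poly_pencil_poly[symmetric] by (intro continuous_intros)

text \<open>Laplace expansion along the last row: none of its cofactors involves the corner entry,
  so the determinant is affine in that entry with the leading minor as slope.\<close>

lemma det_corner:
 fixes M :: "'a :: comm_ring_1 mat"
 assumes M: "M \<in> carrier_mat (Suc N) (Suc N)"
 shows "det M = M $$ (N, N) * det (mat N N (%(i, j). M $$ (i, j))) +
  det (mat (Suc N) (Suc N) (%(i, j). if i = N & j = N then 0 else M $$ (i, j)))"
proof -
 let ?M = "mat (Suc N) (Suc N) (%(i, j). if i = N & j = N then 0 else M $$ (i, j))"
 have cof: "cofactor ?M N j = cofactor M N j" if "j < Suc N" for j
  unfolding cofactor_def using that M
  by (intro arg_cong2[where f="(*)"] refl arg_cong[where f=det] eq_matI) (auto simp: mat_delete_def)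
 have cN: "cofactor M N N = det (mat N N (%(i, j). M $$ (i, j)))"
  unfolding cofactor_def using M
  by (simp flip: power_add mult_2) (intro arg_cong[where f=det] eq_matI, auto simp: mat_delete_def)
 have "det M = (\<Sum>j<Suc N. M $$ (N, j) * cofactor M N j)"
  by (rule laplace_expansion_row[OF M]) simp
 also have "... = M $$ (N, N) * cofactor M N N + (\<Sum>j<N. M $$ (N, j) * cofactor M N j)" by simp
 also have "(\<Sum>j<N. M $$ (N, j) * cofactor M N j) = (\<Sum>j<Suc N. ?M $$ (N, j) * cofactor ?M N j)"
  using cof by simp
 also have "... = det ?M"
  by (rule laplace_expansion_row[symmetric]) simp_all
 finally show ?thesis by (simp add: cN)
qed

lemma affine_corner:
 fixes A :: "'a :: comm_ring"
 shows "A = (t - c) * P + Y ==> B = (0 - c) * P + Y ==> A = t * P + B"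
 by (simp only: left_diff_distrib) simp

lemma pdet_corner:
 "pdet (Suc N) (y((False, N, N) := t)) z = t * pdet N y z + pdet (Suc N) (y((False, N, N) := 0)) z"
proof -
 define M where "M t = mat (Suc N) (Suc N) (%(i, j). (y((False, N, N) := t)) (False, i, j) - z * (y((False, N, N) := t)) (True, i, j))" for t
 have MC: "M t \<in> carrier_mat (Suc N) (Suc N)" for t by (simp add: M_def)
 have 1: "det (mat N N (%(i, j). M t $$ (i, j))) = pdet N y z" for t
  unfolding pdet_def M_def by (intro arg_cong[where f=det] eq_matI) auto
 have 2: "mat (Suc N) (Suc N) (%(i, j). if i = N & j = N then 0 else M t $$ (i, j)) =
  mat (Suc N) (Suc N) (%(i, j). if i = N & j = N then 0 else M 0 $$ (i, j))"
  unfolding M_def by (intro eq_matI) auto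
 have 3: "M t $$ (N, N) = t - z * y (True, N, N)" for t by (simp add: M_def)
 have "det (M t) = t * pdet N y z + det (M 0)"
  by (rule affine_corner[OF det_corner[OF MC[of t], unfolded 1 2 3] det_corner[OF MC[of 0], unfolded 1 2 3]])
 then show ?thesis unfolding pdet_def M_def .
qed

lemma adet_corner:
 "adet (Suc N) (y((True, N, N) := t)) = t * adet N y + adet (Suc N) (y((True, N, N) := 0))"
proof -
 define M where "M t = mat (Suc N) (Suc N) (%(i, j). (y((True, N, N) := t)) (True, i, j))" for t
 have MC: "M t \<in> carrier_mat (Suc N) (Suc N)" for t by (simp add: M_def)
 have 1: "det (mat N N (%(i, j). M t $$ (i, j))) = adet N y" for t
  unfolding adet_def M_def by (intro arg_cong[where f=det] eq_matI) auto
 have 2: "mat (Suc N) (Suc N) (%(i, j). if i = N & j = N then 0 else M t $$ (i, j)) =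
  mat (Suc N) (Suc N) (%(i, j). if i = N & j = N then 0 else M 0 $$ (i, j))"
  unfolding M_def by (intro eq_matI) auto
 have 3: "M t $$ (N, N) = t" for t by (simp add: M_def)
 have "det (M t) = t * adet N y + det (M 0)"
  using det_corner[OF MC[of t]] det_corner[OF MC[of 0]] unfolding 1 2 3 by simp
 then show ?thesis unfolding adet_def M_def .
qed

lemma borel_measurable_det [measurable (raw)]:
 fixes m :: "'x => nat => nat => complex"
 assumes "!!i j. (%x. m x i j) \<in> borel_measurable M"
 shows "(%x. det (mat n n (%(i, j). m x i j))) \<in> borel_measurable M"
proof -
 have "det (mat n n (%(i, j). m x i j)) =
  (\<Sum>p\<in>{p. p permutes {0..<n}}. of_int (sign p) * (\<Prod>i\<in>{0..<n}. m x i (p i)))" for x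
  by (subst det_def'[of _ n]) (auto intro!: sum.cong prod.cong simp: permutes_less)
 then show ?thesis using assms by simp
qed

lemma borel_measurable_pdet [measurable (raw)]:
 assumes f: "f \<in> M \<rightarrow>\<^sub>M env" and g: "g \<in> borel_measurable M"
 shows "(%x. pdet n (f x) (g x)) \<in> borel_measurable M"
 unfolding pdet_def
 using measurable_env_component'[OF f] g
 by (intro borel_measurable_det borel_measurable_diff borel_measurable_times)

lemma borel_measurable_adet [measurable (raw)]:
 assumes f: "f \<in> M \<rightarrow>\<^sub>M env"
 shows "(%x. adet n (f x)) \<in> borel_measurable M"
 unfolding adet_def
 using measurable_env_component'[OF f] by (intro borel_measurable_det)

section \<open>Measurability of holes and of exceptional pencils\<close>

text \<open>The quantifier over K is uncountable. A continuous nonnegative function on a compact set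
  attains its infimum, so a zero exists exactly if the values on a countable dense subset come
  arbitrarily close to 0. Open sets follow as countable unions of compact ones.\<close>

lemma pred_exists_zero_compact:
 fixes g :: "'x => complex => real"
 assumes K: "compact K"
  and cont: "!!x. continuous_on K (g x)" and nonneg: "!!x z. 0 <= g x z"
  and meas: "!!z. (%x. g x z) \<in> borel_measurable M"
 shows "Measurable.pred M (%x. \<exists>z\<in>K. g x z = 0)"
proof -
 obtain T where T: "countable T" "T <= K" "K <= closure T" using separable by blast
 have "(\<exists>z\<in>K. g x z = 0) \<longleftrightarrow> (\<forall>k::nat. \<exists>q\<in>T. g x q < inverse (real (Suc k)))" for x
 proof
  assume "\<exists>z\<in>K. g x z = 0"
  then obtain z where z: "z \<in> K" "g x z = 0" by blast
  show "\<forall>k::nat. \<exists>q\<in>T. g x q < inverse (real (Suc k))"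
  proof
   fix k :: nat
   obtain d where d: "d > 0" "!!z'. z' \<in> K ==> dist z' z < d ==> dist (g x z') (g x z) < inverse (real (Suc k))"
    using cont[of x] z(1) unfolding continuous_on_iff by (metis inverse_positive_iff_positive of_nat_0_less_iff zero_less_Suc)
   obtain q where "q \<in> T" "dist q z < d" using z(1) T(3) d(1) closure_approachable by blast
   then show "\<exists>q\<in>T. g x q < inverse (real (Suc k))"
    using d(2)[of q] T(2) z(2) by (intro bexI[of _ q]) (auto simp: dist_real_def)
  qed
 next
  assume h: "\<forall>k::nat. \<exists>q\<in>T. g x q < inverse (real (Suc k))"
  then have "K ~= {}" using T(2) by blast
  then obtain z where z: "z \<in> K" "!!z'. z' \<in> K ==> g x z <= g x z'"
   using continuous_attains_inf[OF K _ cont] by blast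
  have "g x z < inverse (real (Suc k))" for k
   using h z(2) T(2) by (metis subsetD order_le_less_trans)
  then have "g x z <= 0" using reals_Archimedean not_le by (metis less_asym)
  then show "\<exists>z\<in>K. g x z = 0" using z(1) nonneg by (metis order_antisym)
 qed
 moreover have "Measurable.pred M (%x. \<forall>k::nat. \<exists>q\<in>T. g x q < inverse (real (Suc k)))"
  using T(1) meas by measurable
 ultimately show ?thesis by simp
qed

lemma pred_exists_zero_open:
 fixes g :: "'x => complex => real"
 assumes V: "open V"
  and cont: "!!x. continuous_on V (g x)" and nonneg: "!!x z. 0 <= g x z"
  and meas: "!!z. (%x. g x z) \<in> borel_measurable M"
 shows "Measurable.pred M (%x. \<exists>z\<in>V. g x z = 0)"
proof -
 obtain C where C: "!!n. compact (C n)" "!!n. C n <= V" "(\<Union>n::nat. C n) = V"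
  using open_Union_compact_subsets[OF V] by metis
 have "(\<exists>z\<in>V. g x z = 0) \<longleftrightarrow> (\<exists>n. \<exists>z\<in>C n. g x z = 0)" for x using C(3) by blast
 moreover have "Measurable.pred M (%x. \<exists>n. \<exists>z\<in>C n. g x z = 0)"
 proof (rule pred_intros_countable)
  fix n
  show "Measurable.pred M (%x. \<exists>z\<in>C n. g x z = 0)"
   using C cont continuous_on_subset nonneg meas by (intro pred_exists_zero_compact) blast+
 qed
 ultimately show ?thesis by simp
qed

definition hole :: "nat => complex set => pencil => bool" where
 "hole n V y \<longleftrightarrow> (\<forall>z\<in>V. pdet n y z ~= 0)"

lemma pred_hole:
 assumes "open V" shows "Measurable.pred env (hole n V)"
proof -
 have "Measurable.pred env (%y. \<exists>z\<in>V. cmod (pdet n y z) = 0)"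
  by (intro pred_exists_zero_open assms continuous_intros continuous_pdet) auto
 then have "Measurable.pred env (%y. ~ (\<exists>z\<in>V. cmod (pdet n y z) = 0))" by measurable
 then show ?thesis by (simp add: hole_def cong: measurable_cong)
qed

text \<open>A null set outside of which \<open>B - z A\<close> has the full number of eigenvalues, none of them shared with
  the leading block.\<close>

fun bad :: "nat => pencil => bool" where
 "bad 0 y \<longleftrightarrow> False"
| "bad (Suc N) y \<longleftrightarrow> bad N y \<or> adet (Suc N) y = 0 \<or> (\<exists>z. pdet (Suc N) y z = 0 & pdet N y z = 0)"

lemma pred_bad: "Measurable.pred env (bad n)"
proof (induction n)
 case (Suc N)
 have "Measurable.pred env (%y. \<exists>z\<in>UNIV. cmod (pdet (Suc N) y z) + cmod (pdet N y z) = 0)"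
  by (intro pred_exists_zero_open continuous_intros continuous_pdet) auto
 moreover have "cmod a + cmod b = 0 \<longleftrightarrow> a = 0 & b = 0" for a b
  by (simp add: add_nonneg_eq_0_iff)
 ultimately have "Measurable.pred env (%y. \<exists>z. pdet (Suc N) y z = 0 & pdet N y z = 0)" by simp
 then show ?case using Suc by simp
qed simp

lemma bad_adet: "~ bad n y ==> adet n y ~= 0"
 by (cases n) (auto simp: adet_def)

lemma bad_cong:
 assumes "!!c i j. i < n ==> j < n ==> y (c, i, j) = y' (c, i, j)"
 shows "bad n y = bad n y'"
 using assms
proof (induction n)
 case (Suc n)
 have "pdet (Suc n) y z = pdet (Suc n) y' z" "adet (Suc n) y = adet (Suc n) y'" "pdet n y z = pdet n y' z" for z
  using Suc.prems by (auto intro!: pdet_cong)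
 then show ?case using Suc by simp
qed simp

section \<open>Exceptional pencils form a null set\<close>

lemma nn_integral_finite_support:
 fixes f :: "complex => ennreal"
 assumes "finite A" and "!!z. z ~: A ==> f z = 0"
 shows "(\<integral>\<^sup>+z. f z \<partial>lborel) = 0"
proof -
 have "AE z in lborel. z ~: A"
  using finite_imp_null_set_lborel[OF assms(1)] by (rule AE_not_in)
 then have "AE z in lborel. f z = 0" by eventually_elim (rule assms(2))
 then have "(\<integral>\<^sup>+z. f z \<partial>lborel) = integral\<^sup>N lborel (%z::complex. 0)" by (rule nn_integral_cong_AE)
 then show ?thesis by simp
qed

abbreviation (input) ix :: "nat => (bool \<times> nat \<times> nat) set" where
 "ix n == UNIV \<times> {..<n} \<times> {..<n}"

text \<open>At a zero z of the minor of size N + 1 the corner entry of the next minor has slope 0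
  and cannot move its value. The two entries next to the corner can: the coefficient of s is affine
  in t, and the slope of that affine function is, up to sign, the minor of size N.\<close>

lemma pdet_two_entries:
 fixes y :: "pencil"
 assumes z: "pdet (Suc N) y z = 0" and nz: "pdet N y z ~= 0"
 obtains \<beta> \<gamma> where "!!s t. pdet (Suc (Suc N)) (y((False, Suc N, N) := s, (False, N, Suc N) := t)) z =
  s * (\<gamma> - t * pdet N y z) + pdet (Suc (Suc N)) (y((False, Suc N, N) := 0, (False, N, Suc N) := t)) z"
proof -
 define Y where "Y s t = y((False, Suc N, N) := s, (False, N, Suc N) := t)" for s t
 define M where "M s t = mat (Suc (Suc N)) (Suc (Suc N)) (%(i, j). Y s t (False, i, j) - z * Y s t (True, i, j))" for s t
 have MC: "M s t \<in> carrier_mat (Suc (Suc N)) (Suc (Suc N))" for s t by (simp add: M_def)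
 define Q where "Q t = mat (Suc N) (Suc N) (%(i, j). if j < N then y (False, i, j) - z * y (True, i, j)
  else (if i = N then t else y (False, i, Suc N)) - z * y (True, i, Suc N))" for t
 have cof: "cofactor (M s t) (Suc N) j = cofactor (M 0 t) (Suc N) j" if "j < Suc (Suc N)" for j s t
  unfolding cofactor_def using that
  by (intro arg_cong2[where f="(*)"] refl arg_cong[where f=det] eq_matI) (auto simp: mat_delete_def M_def Y_def)
 have cQ: "cofactor (M s t) (Suc N) N = - det (Q t)" for s t
 proof -
  have "mat_delete (M s t) (Suc N) N = Q t"
   by (intro eq_matI) (auto simp: mat_delete_def M_def Y_def Q_def less_Suc_eq)
  then show ?thesis by (simp add: cofactor_def)
 qed
 have detM: "det (M s t) = s * (- det (Q t)) + det (M 0 t)" for s t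
 proof -
  have "det (M s t) = (\<Sum>j<Suc (Suc N). M s t $$ (Suc N, j) * cofactor (M s t) (Suc N) j)"
   by (rule laplace_expansion_row[OF MC]) simp
  also have "... = (\<Sum>j<Suc (Suc N). M s t $$ (Suc N, j) * cofactor (M 0 t) (Suc N) j)"
   by (intro sum.cong refl arg_cong2[where f="(*)"] cof) simp
  also have "... = (\<Sum>j<Suc (Suc N). (if j = N then s * cofactor (M 0 t) (Suc N) j else 0) + M 0 t $$ (Suc N, j) * cofactor (M 0 t) (Suc N) j)"
   by (intro sum.cong) (auto simp: M_def Y_def algebra_simps)
  also have "... = s * cofactor (M 0 t) (Suc N) N + (\<Sum>j<Suc (Suc N). M 0 t $$ (Suc N, j) * cofactor (M 0 t) (Suc N) j)"
   unfolding sum.distrib by (subst sum.delta) auto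
  also have "(\<Sum>j<Suc (Suc N). M 0 t $$ (Suc N, j) * cofactor (M 0 t) (Suc N) j) = det (M 0 t)"
   by (rule laplace_expansion_row[OF MC, symmetric]) simp
  finally show ?thesis unfolding cQ .
 qed
 have detQ: "det (Q t) = t * pdet N y z + det (Q 0)" for t
 proof -
  have 1: "det (mat N N (%(i, j). Q t $$ (i, j))) = pdet N y z" for t
   unfolding pdet_def Q_def by (intro arg_cong[where f=det] eq_matI) auto
  have 2: "mat (Suc N) (Suc N) (%(i, j). if i = N & j = N then 0 else Q t $$ (i, j)) =
   mat (Suc N) (Suc N) (%(i, j). if i = N & j = N then 0 else Q 0 $$ (i, j))"
   by (intro eq_matI) (auto simp: Q_def)
  have 3: "Q t $$ (N, N) = t - z * y (True, N, Suc N)" for t by (simp add: Q_def)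
  have QC: "Q t \<in> carrier_mat (Suc N) (Suc N)" for t by (simp add: Q_def)
  show ?thesis
   by (rule affine_corner[OF det_corner[OF QC[of t], unfolded 1 2 3] det_corner[OF QC[of 0], unfolded 1 2 3]])
 qed
 have "pdet (Suc (Suc N)) (Y s t) z = s * (- det (Q 0) - t * pdet N y z) + pdet (Suc (Suc N)) (Y 0 t) z" for s t
  using detM[of s t] detQ[of t] by (simp add: pdet_def M_def algebra_simps)
 then show thesis using that unfolding Y_def by blast
qed

lemma affine_nonzero: "a ~= 0 ==> t ~= - b / a ==> t * a + b ~= (0 :: 'a :: field)"
proof
 assume a: "a ~= 0" "t ~= - b / a" "t * a + b = 0"
 then have "t * a = - b" by (simp add: eq_neg_iff_add_eq_0)
 then have "t = - b / a" using a(1) by (metis nonzero_eq_divide_eq)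
 with a(2) show False ..
qed

lemma sets_adet [measurable]: "{y. adet n y = 0} \<in> sets env"
proof -
 have "(%y. adet n y) \<in> benv" by (rule borel_measurable_adet) simp
 from measurable_sets[OF this, of "{0}"] show ?thesis by (simp add: vimage_def)
qed

lemma Intg_adet_zero:
 assumes "adet N y ~= 0"
 shows "Intg {(True, N, N)} (indicator {y. adet (Suc N) y = 0}) y = 0"
proof -
 have "Intg {(True, N, N)} (indicator {y. adet (Suc N) y = 0}) y =
  (\<integral>\<^sup>+t. indicator {y. adet (Suc N) y = 0} (y((True, N, N) := t)) \<partial>lborel)"
  by (rule Intg_singleton) measurable
 also have "... = 0"
 proof (rule nn_integral_finite_support)
  fix t assume "t ~: {- adet (Suc N) (y((True, N, N) := 0)) / adet N y}"
  then have "t * adet N y + adet (Suc N) (y((True, N, N) := 0)) ~= 0"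
   using affine_nonzero[OF assms, of t] by simp
  then show "indicator {y. adet (Suc N) y = 0} (y((True, N, N) := t)) = (0::ennreal)"
   using adet_corner[of N y t] by (simp add: indicator_def)
 qed simp
 finally show ?thesis .
qed

text \<open>Off the exceptional set the minor of size N + 1 has finitely many zeros. For all but
  finitely many t the coefficient of s is nonzero at each of them, and then all but finitely many s
  avoid a common zero.\<close>

lemma Intg_common_zero:
 assumes nb: "~ bad (Suc N) y"
 defines "C == {y. \<exists>z. pdet (Suc (Suc N)) y z = 0 & pdet (Suc N) y z = 0}"
 assumes C: "C \<in> sets env"
 shows "Intg {(False, N, Suc N), (False, Suc N, N)} (indicator C) y = 0"
proof -
 let ?s = "(False, Suc N, N)" and ?t = "(False, N, Suc N)"
 have nz: "pdet N y z ~= 0" if "pdet (Suc N) y z = 0" for z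
  using nb that by auto
 define Z where "Z = {z. pdet (Suc N) y z = 0}"
 have "pencil_poly (Suc N) y ~= 0"
  using bad_adet[OF nb] degree_pencil_poly[of "Suc N" y] by auto
 then have finZ: "finite Z"
  using poly_roots_finite[of "pencil_poly (Suc N) y"] by (simp add: Z_def poly_pencil_poly)
 have "\<forall>z\<in>Z. \<exists>\<gamma>. \<forall>s t. pdet (Suc (Suc N)) (y(?s := s, ?t := t)) z =
  s * (\<gamma> - t * pdet N y z) + pdet (Suc (Suc N)) (y(?s := 0, ?t := t)) z"
 proof
  fix z assume "z \<in> Z"
  then have "pdet (Suc N) y z = 0" by (simp add: Z_def)
  from pdet_two_entries[OF this nz[OF this]]
  show "\<exists>\<gamma>. \<forall>s t. pdet (Suc (Suc N)) (y(?s := s, ?t := t)) z =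
   s * (\<gamma> - t * pdet N y z) + pdet (Suc (Suc N)) (y(?s := 0, ?t := t)) z" by metis
 qed
 from bchoice[OF this] obtain \<gamma> where \<gamma>: "\<forall>z\<in>Z. \<forall>s t. pdet (Suc (Suc N)) (y(?s := s, ?t := t)) z =
  s * (\<gamma> z - t * pdet N y z) + pdet (Suc (Suc N)) (y(?s := 0, ?t := t)) z" by blast
 have inner: "(\<integral>\<^sup>+s. indicator C (y(?t := t, ?s := s)) \<partial>lborel) = (0::ennreal)"
  if t: "t ~: (%z. \<gamma> z / pdet N y z) ` Z" for t
 proof (rule nn_integral_finite_support)
  show "finite ((%z. - pdet (Suc (Suc N)) (y(?s := 0, ?t := t)) z / (\<gamma> z - t * pdet N y z)) ` Z)"
   using finZ by simp
  fix s assume s: "s ~: (%z. - pdet (Suc (Suc N)) (y(?s := 0, ?t := t)) z / (\<gamma> z - t * pdet N y z)) ` Z"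
  have "y(?t := t, ?s := s) ~: C"
  proof
   assume "y(?t := t, ?s := s) \<in> C"
   then obtain z where z: "pdet (Suc (Suc N)) (y(?s := s, ?t := t)) z = 0" "pdet (Suc N) (y(?s := s, ?t := t)) z = 0"
    unfolding C_def by (auto simp: fun_upd_twist)
   have "pdet (Suc N) (y(?s := s, ?t := t)) z = pdet (Suc N) y z"
    by (rule pdet_cong) auto
   then have zZ: "z \<in> Z" using z by (simp add: Z_def)
   then have "pdet N y z ~= 0" using nz by (simp add: Z_def)
   moreover have "t ~= \<gamma> z / pdet N y z" using t zZ by blast
   ultimately have "\<gamma> z - t * pdet N y z ~= 0" by (auto simp: field_simps)
   moreover have "s ~= - pdet (Suc (Suc N)) (y(?s := 0, ?t := t)) z / (\<gamma> z - t * pdet N y z)" using s zZ by blast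
   ultimately show False using z(1) \<gamma>[rule_format, OF zZ, of s t]
    affine_nonzero[of "\<gamma> z - t * pdet N y z" s "pdet (Suc (Suc N)) (y(?s := 0, ?t := t)) z"] by auto
  qed
  then show "indicator C (y(?t := t, ?s := s)) = (0::ennreal)" by simp
 qed
 have "Intg {?t, ?s} (indicator C) y = (\<integral>\<^sup>+t. Intg {?s} (indicator C) (y(?t := t)) \<partial>lborel)"
  using C by (intro Intg_insert) auto
 also have "... = (\<integral>\<^sup>+t. (\<integral>\<^sup>+s. indicator C (y(?t := t, ?s := s)) \<partial>lborel) \<partial>lborel)"
  using C by (simp add: Intg_singleton)
 also have "... = 0"
  by (rule nn_integral_finite_support[of "(%z. \<gamma> z / pdet N y z) ` Z"]) (use finZ inner in auto)
 finally show ?thesis .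
qed

text \<open>Each clause of \<open>bad\<close> is null already after integrating the entries that
  make it generic: the corner of A for the vanishing of det A, two entries of B next to the corner
  for a shared eigenvalue.\<close>

theorem Intg_bad: "Intg (ix n) (indicator {y. bad n y}) y = 0"
proof (induction n arbitrary: y)
 case (Suc N)
 have m1: "{y. bad N y} \<in> sets env" using pred_bad[of N] by (simp add: pred_def)
 let ?A = "{y::pencil. adet (Suc N) y = 0}"
 have m2: "?A \<in> sets env" by (rule sets_adet)
 let ?C = "{y. \<exists>z. pdet (Suc N) y z = 0 & pdet N y z = 0}"
 have m3: "?C \<in> sets env"
 proof -
  have "Measurable.pred env (%y. \<exists>z\<in>UNIV. cmod (pdet (Suc N) y z) + cmod (pdet N y z) = 0)"
   by (intro pred_exists_zero_open continuous_intros continuous_pdet) auto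
  moreover have "cmod a + cmod b = 0 \<longleftrightarrow> a = 0 & b = 0" for a b
   by (simp add: add_nonneg_eq_0_iff)
  ultimately show ?thesis by (simp add: pred_def)
 qed
 have z1: "Intg (ix (Suc N)) (indicator {y. bad N y}) y = 0"
 proof -
  have "ix (Suc N) = (ix (Suc N) - ix N) \<union> ix N" by auto
  then have "Intg (ix (Suc N)) (indicator {y. bad N y}) y = Intg (ix (Suc N) - ix N) (Intg (ix N) (indicator {y. bad N y})) y"
   using m1 by (subst Intg_Un[symmetric]) auto
  also have "... = Intg (ix (Suc N) - ix N) (%_. 0) y" using Suc by (intro Intg_cong)
  finally show ?thesis by simp
 qed
 have z2: "Intg (ix (Suc N)) (indicator (?A - {y. bad N y})) y = 0"
 proof -
  let ?e = "{(True, N, N)}"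
  have "ix (Suc N) = (ix (Suc N) - ?e) \<union> ?e" by auto
  then have "Intg (ix (Suc N)) (indicator (?A - {y. bad N y})) y = Intg (ix (Suc N) - ?e) (Intg ?e (indicator (?A - {y. bad N y}))) y"
   using m1 m2 by (subst Intg_Un[symmetric]) auto
  also have "... = Intg (ix (Suc N) - ?e) (%_. 0) y"
  proof (rule Intg_cong)
   fix y' :: "pencil"
   have "Intg ?e (indicator (?A - {y. bad N y})) y' = 0"
   proof (cases "bad N y'")
    case True
    have "Intg ?e (indicator (?A - {y. bad N y})) y' = Intg ?e (%_. 0) y'"
    proof (rule Intg_cong)
     fix y'' :: "pencil" assume "!!i. i ~: ?e ==> y'' i = y' i"
     then have "bad N y'' = bad N y'" by (intro bad_cong) auto
     then show "indicator (?A - {y. bad N y}) y'' = (0::ennreal)" using True by (simp add: indicator_def)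
    qed
    then show ?thesis by simp
   next
    case False
    have "Intg ?e (indicator (?A - {y. bad N y})) y' <= Intg ?e (indicator ?A) y'"
     by (intro Intg_mono) (auto simp: indicator_def)
    then show ?thesis using Intg_adet_zero[OF bad_adet[OF False]] by simp
   qed
   then show "Intg ?e (indicator (?A - {y. bad N y})) y' = 0" .
  qed
  finally show ?thesis by simp
 qed
 have z3: "Intg (ix (Suc N)) (indicator (?C - {y. bad N y})) y = 0"
 proof (cases N)
  case 0
  then have "indicator (?C - {y. bad N y}) = (%_. 0 :: ennreal)"
   by (auto simp: fun_eq_iff indicator_def)
  then show ?thesis by (simp only: Intg_zero)
 next
  case (Suc N')
  let ?e = "{(False, N', Suc N'), (False, Suc N', N')}"
  have "ix (Suc N) = (ix (Suc N) - ?e) \<union> ?e" using Suc by auto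
  then have "Intg (ix (Suc N)) (indicator (?C - {y. bad N y})) y = Intg (ix (Suc N) - ?e) (Intg ?e (indicator (?C - {y. bad N y}))) y"
   using m1 m3 by (subst Intg_Un[symmetric]) auto
  also have "... = Intg (ix (Suc N) - ?e) (%_. 0) y"
  proof (rule Intg_cong)
   fix y' :: "pencil"
   have "Intg ?e (indicator (?C - {y. bad N y})) y' = 0"
   proof (cases "bad N y'")
    case True
    have "Intg ?e (indicator (?C - {y. bad N y})) y' = Intg ?e (%_. 0) y'"
    proof (rule Intg_cong)
     fix y'' :: "pencil" assume "!!i. i ~: ?e ==> y'' i = y' i"
     then have "bad N y'' = bad N y'" using Suc by (intro bad_cong) auto
     then show "indicator (?C - {y. bad N y}) y'' = (0::ennreal)" using True by (simp add: indicator_def)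
    qed
    then show ?thesis by simp
   next
    case False
    have "Intg ?e (indicator (?C - {y. bad N y})) y' <= Intg ?e (indicator ?C) y'"
     by (intro Intg_mono) (auto simp: indicator_def)
    then show ?thesis using Intg_common_zero[of N' y'] False m3 Suc by simp
   qed
   then show "Intg ?e (indicator (?C - {y. bad N y})) y' = 0" .
  qed
  finally show ?thesis by simp
 qed
 have "Intg (ix (Suc N)) (indicator {y. bad (Suc N) y}) y <=
  Intg (ix (Suc N)) (%y. indicator {y. bad N y} y + (indicator (?A - {y. bad N y}) y + indicator (?C - {y. bad N y}) y)) y"
  by (intro Intg_mono) (auto simp: indicator_def)
 also have "... = 0"
  using m1 m2 m3 z1 z2 z3 by (simp add: Intg_add)
 finally show ?case by simp
qed simp

section \<open>Deflation of an eigenvalue\<close>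

lemma Intg_split:
 assumes "finite I" "K <= I" "F \<in> benv"
 shows "Intg I F y = Intg (I - K) (Intg K F) y" and "Intg I F y = Intg K (Intg (I - K) F) y"
proof -
 have K: "finite K" using assms finite_subset by blast
 have I: "(I - K) \<union> K = I" using assms(2) by blast
 show "Intg I F y = Intg (I - K) (Intg K F) y"
  using Intg_Un[of "I - K" K F y] assms K unfolding I by auto
 show "Intg I F y = Intg K (Intg (I - K) F) y"
  using Intg_Un'[of "I - K" K F y] assms K unfolding I by auto
qed

text \<open>The derivative is a limit of difference quotients of \<open>pdet\<close>, which is
  jointly measurable in the pencil and the point.\<close>

lemma borel_measurable_pderiv_pencil:
 assumes f: "f \<in> M \<rightarrow>\<^sub>M env" and g: "g \<in> borel_measurable M"
 shows "(%x. poly (pderiv (pencil_poly n (f x))) (g x)) \<in> borel_measurable M"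
proof (rule borel_measurable_LIMSEQ_metric)
 fix k :: nat
 have gk: "(%x. g x + of_real (inverse (real (Suc k)))) \<in> borel_measurable M"
  using g by (intro borel_measurable_add) auto
 show "(%x. (pdet n (f x) (g x + of_real (inverse (real (Suc k)))) - pdet n (f x) (g x)) / of_real (inverse (real (Suc k)))) \<in> borel_measurable M"
  by (intro borel_measurable_divide borel_measurable_diff borel_measurable_pdet f g gk borel_measurable_const)
next
 fix x
 let ?p = "pencil_poly n (f x)"
 have "((%h. (poly ?p (g x + h) - poly ?p (g x)) / h) \<longlongrightarrow> poly (pderiv ?p) (g x)) (at 0)"
  using poly_DERIV[of ?p "g x"] by (simp add: DERIV_def)
 moreover have "filterlim (%k. complex_of_real (inverse (real (Suc k)))) (at 0) sequentially"
  unfolding filterlim_at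
 proof
  show "\<forall>\<^sub>F k in sequentially. complex_of_real (inverse (real (Suc k))) \<in> UNIV & complex_of_real (inverse (real (Suc k))) ~= 0"
   by (intro always_eventually allI) (simp del: of_nat_Suc)
  show "(%k. complex_of_real (inverse (real (Suc k)))) \<longlonglongrightarrow> 0"
   using tendsto_of_real[OF LIMSEQ_inverse_real_of_nat, where 'a=complex] by simp
 qed
 ultimately show "(%k. (pdet n (f x) (g x + of_real (inverse (real (Suc k)))) - pdet n (f x) (g x)) / of_real (inverse (real (Suc k)))) \<longlonglongrightarrow> poly (pderiv ?p) (g x)"
  unfolding poly_pencil_poly[symmetric] by (rule filterlim_compose)
qed

text \<open>The last column of B - w A is replaced by the last column of A. This is what remains of
  the determinant of the deflated pencil once its linear factor is divided out.\<close>

definition edet :: "nat => pencil => complex => complex" where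
 "edet N y w = det (mat (Suc N) (Suc N) (%(i, j). if j < N then y (False, i, j) - w * y (True, i, j) else y (True, i, N)))"

text \<open>The eigenvalue \<open>y (False, N, N)\<close> has the eigenvector \<open>(v, 1)\<close>, where \<open>v\<close> is the remaining part of
  the last column of \<open>B\<close>.\<close>

definition deflate :: "nat => pencil => pencil" where
 "deflate N y = (%(c, i, j). if j = N & i <= N
  then (if c then y (True, i, N) else y (False, N, N) * y (True, i, N)) - (\<Sum>l<N. y (c, i, l) * y (False, l, N))
  else y (c, i, j))"

lemma measurable_deflate [measurable]: "deflate N \<in> env \<rightarrow>\<^sub>M env"
proof (rule measurable_envI)
 fix i :: "bool \<times> nat \<times> nat"
 obtain c k j where i: "i = (c, k, j)" by (cases i) auto
 show "(%y. deflate N y i) \<in> benv"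
  unfolding i deflate_def
  by (cases "j = N & k <= N"; cases c) (auto intro!: borel_measurable_diff borel_measurable_sum borel_measurable_times)
qed

lemma borel_measurable_edet [measurable (raw)]:
 assumes f: "f \<in> M \<rightarrow>\<^sub>M env" and g: "g \<in> borel_measurable M"
 shows "(%x. edet n (f x) (g x)) \<in> borel_measurable M"
proof -
 have "(%x. if j < n then f x (False, i, j) - g x * f x (True, i, j) else f x (True, i, n)) \<in> borel_measurable M" for i j
  using measurable_env_component'[OF f] g
  by (cases "j < n") (simp_all add: borel_measurable_diff borel_measurable_times)
 then show ?thesis unfolding edet_def by (rule borel_measurable_det)
qed

text \<open>The deflated matrix is E T, where T is the identity with last column (- v, z - w). Since
  T is triangular, its determinant is z - w.\<close>

lemma pdet_deflate: "pdet (Suc N) (deflate N y) w = (y (False, N, N) - w) * edet N y w"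
proof -
 let ?z = "y (False, N, N)"
 define E where "E = mat (Suc N) (Suc N) (%(i, j). if j < N then y (False, i, j) - w * y (True, i, j) else y (True, i, N))"
 define T where "T = mat (Suc N) (Suc N) (%(i, j). if j < N then (if i = j then 1 else 0) else if i = N then ?z - w else - y (False, i, N))"
 have EC: "E \<in> carrier_mat (Suc N) (Suc N)" and TC: "T \<in> carrier_mat (Suc N) (Suc N)"
  by (simp_all add: E_def T_def)
 have "mat (Suc N) (Suc N) (%(i, j). deflate N y (False, i, j) - w * deflate N y (True, i, j)) = E * T" (is "?M = _")
 proof (rule eq_matI)
  fix i j assume "i < dim_row (E * T)" "j < dim_col (E * T)"
  then have ij: "i < Suc N" "j < Suc N" by (simp_all add: E_def T_def)
  have "(E * T) $$ (i, j) = (\<Sum>l<Suc N. E $$ (i, l) * T $$ (l, j))"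
   using ij by (simp add: E_def T_def scalar_prod_def atLeast0LessThan)
  also have "... = ?M $$ (i, j)"
  proof (cases "j < N")
   case True
   then have "(\<Sum>l<Suc N. E $$ (i, l) * T $$ (l, j)) = (\<Sum>l<Suc N. if l = j then E $$ (i, j) else 0)"
    using ij by (intro sum.cong) (auto simp: T_def)
   also have "... = E $$ (i, j)" using ij by simp
   finally show ?thesis using True ij by (simp add: E_def deflate_def)
  next
   case False
   then have j: "j = N" using ij by simp
   have "(\<Sum>l<Suc N. E $$ (i, l) * T $$ (l, j)) =
    (\<Sum>l<N. (y (False, i, l) - w * y (True, i, l)) * (- y (False, l, N))) + y (True, i, N) * (?z - w)"
    using ij j by (simp add: E_def T_def)
   also have "(\<Sum>l<N. (y (False, i, l) - w * y (True, i, l)) * (- y (False, l, N))) =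
    w * (\<Sum>l<N. y (True, i, l) * y (False, l, N)) - (\<Sum>l<N. y (False, i, l) * y (False, l, N))"
    by (simp add: algebra_simps sum_distrib_left sum_subtractf)
   finally show ?thesis using ij j by (simp add: deflate_def algebra_simps)
  qed
  finally show "?M $$ (i, j) = (E * T) $$ (i, j)" by simp
 qed (simp_all add: E_def T_def)
 then have "pdet (Suc N) (deflate N y) w = det E * det T"
  unfolding pdet_def using det_mult[OF EC TC] by simp
 also have "det T = ?z - w"
 proof -
  have "upper_triangular T" by (auto simp: upper_triangular_def T_def)
  then have "det T = prod_list (diag_mat T)" using det_upper_triangular TC by blast
  also have "... = (\<Prod>i\<in>{0..<Suc N}. T $$ (i, i))" using TC by (simp add: prod_list_diag_prod)
  also have "... = ?z - w" by (simp add: T_def)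
  finally show ?thesis .
 qed
 finally show ?thesis by (simp add: edet_def E_def mult.commute)
qed

text \<open>The corner of B enters only the largest minor, and there with slope
  \<open>pdet N y z\<close>, which vanishes at the points where a common zero is sought.\<close>

lemma bad_upd_corner: "bad (Suc N) (y((False, N, N) := t)) = bad (Suc N) y"
proof -
 have "bad N (y((False, N, N) := t)) = bad N y" by (rule bad_cong) auto
 moreover have "adet (Suc N) (y((False, N, N) := t)) = adet (Suc N) y" by (simp add: adet_def)
 moreover have "pdet N (y((False, N, N) := t)) z = pdet N y z" for z by (rule pdet_cong) auto
 moreover have "pdet (Suc N) (y((False, N, N) := t)) z = pdet (Suc N) y z" if "pdet N y z = 0" for z
  using pdet_corner[of N y t z] pdet_corner[of N y "y (False, N, N)" z] that by simp
 ultimately show ?thesis by (auto; metis)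
qed

context
 fixes N :: nat

begin

abbreviation "bN == (False, N, N)"

text \<open>\<open>cphi y z\<close> is the corner entry that makes \<open>z\<close> an eigenvalue, \<open>cdphi y z\<close> its derivative.\<close>

definition cphi :: "pencil => complex => complex" where
 "cphi y z = - pdet (Suc N) (y(bN := 0)) z / pdet N y z"

definition cdphi :: "pencil => complex => complex" where
 "cdphi y z = (- poly (pderiv (pencil_poly (Suc N) (y(bN := 0)))) z * pdet N y z
  + pdet (Suc N) (y(bN := 0)) z * poly (pderiv (pencil_poly N y)) z) / (pdet N y z)^2"

lemma cphi_upd [simp]: "cphi (y(bN := t)) z = cphi y z" "cdphi (y(bN := t)) z = cdphi y z"
proof -
 have "pdet N (y(bN := t)) z = pdet N y z" "pencil_poly N (y(bN := t)) = pencil_poly N y"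
  by (auto intro!: pdet_cong)
 then show "cphi (y(bN := t)) z = cphi y z" "cdphi (y(bN := t)) z = cdphi y z"
  by (simp_all add: cphi_def cdphi_def)
qed

lemma measurable_cphi:
 assumes f: "f \<in> M \<rightarrow>\<^sub>M env" and g: "g \<in> borel_measurable M"
 shows "(%x. cphi (f x) (g x)) \<in> borel_measurable M" "(%x. cdphi (f x) (g x)) \<in> borel_measurable M"
proof -
 have f0: "(%x. (f x)(bN := 0)) \<in> M \<rightarrow>\<^sub>M env" using f by (intro measurable_env_upd) auto
 show "(%x. cphi (f x) (g x)) \<in> borel_measurable M"
  unfolding cphi_def
  by (intro borel_measurable_divide borel_measurable_uminus borel_measurable_pdet f f0 g)
 show "(%x. cdphi (f x) (g x)) \<in> borel_measurable M"
  unfolding cdphi_def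
  by (intro borel_measurable_divide borel_measurable_uminus borel_measurable_pdet f f0 g borel_measurable_add
    borel_measurable_times borel_measurable_power borel_measurable_pderiv_pencil)
qed

lemma sets_pdet_zero: "{y. pdet N y (y bN) = 0} \<in> sets env"
proof -
 have "(%y. pdet N y (y bN)) \<in> benv" by (rule borel_measurable_pdet) auto
 from measurable_sets[OF this, of "{0}"] show ?thesis by (simp add: vimage_def)
qed

text \<open>The integrand after the substitution: the corner coordinate now stores an eigenvalue,
  \<open>cphi\<close> recovers the matrix entry from it, and the squared modulus of
  \<open>cdphi\<close> is the Jacobian.\<close>

definition corner_roots :: "(pencil => ennreal) => pencil => ennreal" where
 "corner_roots F y = F (y(bN := cphi y (y bN))) * esq (cdphi y (y bN)) * indicator {y. pdet N y (y bN) ~= 0} y"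

lemma sets_pdet_nonzero: "{y. pdet N y (y bN) ~= 0} \<in> sets env"
proof -
 have "{y. pdet N y (y bN) ~= 0} = UNIV - {y. pdet N y (y bN) = 0}" by auto
 then show ?thesis using sets.compl_sets[OF sets_pdet_zero] by simp
qed

lemma measurable_corner_roots [measurable]:
 assumes F: "F \<in> benv"
 shows "corner_roots F \<in> benv"
proof -
 have i: "(%y. y) \<in> env \<rightarrow>\<^sub>M env" "(%y. y bN) \<in> benv" by simp_all
 have "(%y. F (y(bN := cphi y (y bN)))) \<in> benv"
  by (rule measurable_compose[OF measurable_env_upd[OF i(1) measurable_cphi(1)[OF i]] F])
 moreover have "(%y. esq (cdphi y (y bN))) \<in> benv"
  using measurable_cphi(2)[OF i] by measurable
 moreover have "indicator {y. pdet N y (y bN) ~= 0} \<in> benv"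
  using sets_pdet_nonzero by (rule borel_measurable_indicator)
 ultimately show ?thesis unfolding corner_roots_def by (intro borel_measurable_times_ennreal)
qed

text \<open>A pencil has \<open>N + 1\<close> eigenvalues, so trading the corner entry for an eigenvalue is an
  \<open>(N + 1)\<close>-to-one change of variables.\<close>

lemma Intg_corner:
 assumes nb: "~ bad (Suc N) y" and F: "F \<in> benv"
 shows "of_nat (Suc N) * Intg {bN} F y = Intg {bN} (corner_roots F) y"
proof -
 define m where "m = pencil_poly N y"
 define R where "R = - pencil_poly (Suc N) (y(bN := 0))"
 have pm: "poly m z = pdet N y z" and pR: "poly R z = - pdet (Suc N) (y(bN := 0)) z" for z
  by (simp_all add: m_def R_def poly_pencil_poly)
 have ad: "adet N y ~= 0" using nb bad_adet[of N y] by simp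
 have ad': "adet (Suc N) (y(bN := 0)) ~= 0" using nb by (simp add: adet_def)
 have pN: "pdet N (y(bN := t)) z = pdet N y z" for t z by (rule pdet_cong) auto
 have "(\<integral>\<^sup>+z. F (y(bN := poly R z / poly m z)) *
   esq (poly (pderiv R * m - R * pderiv m) z / (poly m z)^2) * indicator {z. poly m z ~= 0} z \<partial>lborel) =
  of_nat (Suc N) * (\<integral>\<^sup>+t. F (y(bN := t)) \<partial>lborel)"
 proof (rule area_rational)
  fix z show "~ (poly m z = 0 & poly R z = 0)"
  proof
   assume h: "poly m z = 0 & poly R z = 0"
   then have "pdet (Suc N) y z = 0"
    using pdet_corner[of N y "y bN" z] by (simp add: pm pR)
   then show False using nb h by (simp add: pm)
  qed
 next
  show "degree R = Suc N" using degree_pencil_poly[OF ad'] by (simp add: R_def)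
  show "degree m < Suc N" using pencil_poly_degree(1)[of N y] by (simp add: m_def)
  show "m ~= 0" using pencil_poly_degree(2)[of N y] ad by (auto simp: m_def)
  show "(%t. F (y(bN := t))) \<in> borel_measurable borel"
   by (rule measurable_compose[OF measurable_env_upd F]) auto
 qed
 moreover have "poly (pderiv R * m - R * pderiv m) z / (poly m z)^2 = cdphi y z" for z
  by (simp add: cdphi_def pm pR R_def pderiv_minus poly_pencil_poly m_def)
 moreover have "poly R z / poly m z = cphi y z" for z by (simp add: cphi_def pm pR)
 ultimately have "of_nat (Suc N) * (\<integral>\<^sup>+t. F (y(bN := t)) \<partial>lborel) =
  (\<integral>\<^sup>+z. corner_roots F (y(bN := z)) \<partial>lborel)"
  by (simp add: corner_roots_def pm pN indicator_def)
 then show ?thesis using F measurable_corner_roots[OF F] by (simp add: Intg_singleton)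
qed

lemma Intg_corner_ix:
 assumes F: "F \<in> benv"
 shows "of_nat (Suc N) * Intg (ix (Suc N)) F y = Intg (ix (Suc N)) (corner_roots F) y"
proof -
 let ?I = "ix (Suc N)"
 define Bd where "Bd = {y. bad (Suc N) y}"
 have Bd: "Bd \<in> sets env" using pred_bad[of "Suc N"] by (simp add: Bd_def pred_def)
 have null: "Intg ?I (indicator Bd) y = 0" for y unfolding Bd_def by (rule Intg_bad)
 have mg: "(%y. indicator (- Bd) y * G y) \<in> benv" if "G \<in> benv" for G :: "_ => ennreal"
 proof -
  have "- Bd \<in> sets env" using Bd sets.compl_sets[OF Bd] by (simp add: Compl_eq_Diff_UNIV)
  then show ?thesis using that by measurable
 qed
 have good: "Intg ?I G y = Intg ?I (%y. indicator (- Bd) y * G y) y" if "G \<in> benv" for G y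
  by (rule Intg_cong_null[OF that mg[OF that] Bd null]) simp
 have "of_nat (Suc N) * Intg ?I F y = Intg ?I (%y. of_nat (Suc N) * (indicator (- Bd) y * F y)) y"
  unfolding good[OF F] by (rule Intg_cmult[symmetric, OF mg[OF F]])
 also have "... = Intg (?I - {bN}) (Intg {bN} (%y. of_nat (Suc N) * (indicator (- Bd) y * F y))) y"
  by (rule Intg_split) (use mg[OF F] in auto)
 also have "... = Intg (?I - {bN}) (Intg {bN} (%y. indicator (- Bd) y * corner_roots F y)) y"
 proof (rule Intg_cong)
  fix y :: "pencil"
  \<comment> \<open>Being exceptional does not depend on the corner entry, so the indicator can be
    moved through the integral over that entry.\<close>
  have dep: "indicator (- Bd) y' = (indicator (- Bd) y :: ennreal)" if "!!i. i ~: {bN} ==> y' i = y i" for y'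
  proof -
   have "y' = y(bN := y' bN)" using that by auto
   then have "bad (Suc N) y' = bad (Suc N) y" using bad_upd_corner by metis
   then show ?thesis by (simp add: Bd_def indicator_def)
  qed
  have "Intg {bN} (%y. of_nat (Suc N) * (indicator (- Bd) y * F y)) y =
   of_nat (Suc N) * (indicator (- Bd) y * Intg {bN} F y)"
  proof -
   have "Intg {bN} (%y. indicator (- Bd) y * F y) y = indicator (- Bd) y * Intg {bN} F y"
    by (rule Intg_cmult_dep[where c="indicator (- Bd)", OF F dep])
   then show ?thesis unfolding Intg_cmult[OF mg[OF F]] by (rule arg_cong)
  qed
  also have "... = indicator (- Bd) y * Intg {bN} (corner_roots F) y"
  proof (cases "y \<in> Bd")
   case False
   then show ?thesis using Intg_corner[OF _ F, of y] by (simp add: Bd_def)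
  qed simp
  also have "... = Intg {bN} (%y. indicator (- Bd) y * corner_roots F y) y"
   by (rule Intg_cmult_dep[where c="indicator (- Bd)" and y=y and K="{bN}", OF measurable_corner_roots[OF F] dep, symmetric])
  finally show "Intg {bN} (%y. of_nat (Suc N) * (indicator (- Bd) y * F y)) y = Intg {bN} (%y. indicator (- Bd) y * corner_roots F y) y" .
 qed
 also have "... = Intg ?I (%y. indicator (- Bd) y * corner_roots F y) y"
  by (rule Intg_split(1)[symmetric]) (use mg[OF measurable_corner_roots[OF F]] in auto)
 also have "... = Intg ?I (corner_roots F) y" by (rule good[OF measurable_corner_roots[OF F], symmetric])
 finally show ?thesis .
qed

text \<open>Solves the first N rows of (B - z A)(v, 1) = 0 for the last column of B: that column
  becomes z a - (B0 - z A0) v, where a is the last column of A, A0 and B0 are the leading blocks, z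
  is read from the corner and v from the old column.\<close>

definition shiftB :: "pencil => pencil" where
 "shiftB y = (%(c, i, j). if ~ c & j = N & i < N
  then y bN * y (True, i, N) - (\<Sum>l<N. (y (False, i, l) - y bN * y (True, i, l)) * y (False, l, N))
  else y (c, i, j))"

text \<open>A shear of the last column of A, of Jacobian 1, which cancels the sums that
  \<open>deflate\<close> subtracts there. After it, \<open>deflate\<close> agrees with
  \<open>shiftB\<close> off the corner.\<close>

definition kappa :: "pencil => pencil" where
 "kappa y = (%(c, i, j). if c & j = N & i <= N
  then y (True, i, N) + (\<Sum>l<N. y (True, i, l) * y (False, l, N)) else y (c, i, j))"

lemma measurable_shiftB [measurable]: "shiftB \<in> env \<rightarrow>\<^sub>M env"
proof (rule measurable_envI)
 fix i :: "bool \<times> nat \<times> nat"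
 obtain c k j where i: "i = (c, k, j)" by (cases i) auto
 show "(%y. shiftB y i) \<in> benv"
  unfolding i shiftB_def
  by (cases "~ c & j = N & k < N") (auto intro!: borel_measurable_diff borel_measurable_sum borel_measurable_times)
qed

lemma measurable_kappa [measurable]: "kappa \<in> env \<rightarrow>\<^sub>M env"
proof (rule measurable_envI)
 fix i :: "bool \<times> nat \<times> nat"
 obtain c k j where i: "i = (c, k, j)" by (cases i) auto
 show "(%y. kappa y i) \<in> benv"
  unfolding i kappa_def
  by (cases "c & j = N & k <= N") (auto intro!: borel_measurable_add borel_measurable_sum borel_measurable_times)
qed

abbreviation "Kv == {False} \<times> {..<N} \<times> {N}"

lemma lines_Kv: "lines Kv (%(c, i, j). i) (%(c, i, j) k. (c, k, j)) N 1"
proof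
 fix j assume "j < N"
 then have "{i \<in> Kv. (case i of (c, i, j) => i) = j} = {(False, j, N)}" by auto
 then show "card {i \<in> Kv. (case i of (c, i, j) => i) = j} = 1" by simp
qed auto

text \<open>The substitution is a translation by z a combined with the linear map - (B0 - z A0),
  whose Jacobian is the squared modulus of \<open>pdet N y z\<close>. The indicator keeps this map
  invertible.\<close>

lemma Intg_shiftB:
 assumes G: "G \<in> benv"
 defines "ind == indicator {y. pdet N y (y bN) ~= 0} :: _ => ennreal"
 shows "Intg (ix (Suc N)) (%y. ind y * G y) y =
  Intg (ix (Suc N)) (%y. ind y * (esq (pdet N y (y bN)) * G (shiftB y))) y"
proof -
 have ind: "ind \<in> benv"
  unfolding ind_def using sets_pdet_nonzero by (rule borel_measurable_indicator)
 have GB: "(%y. G (shiftB y)) \<in> benv" using G by measurable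
 have pd: "(%y. esq (pdet N y (y bN))) \<in> benv"
 proof -
  have "(%y. pdet N y (y bN)) \<in> benv" by (rule borel_measurable_pdet) auto
  then show ?thesis by measurable
 qed
 have m1: "(%y. ind y * G y) \<in> benv" using ind G by (rule borel_measurable_times_ennreal)
 have m2: "(%y. ind y * (esq (pdet N y (y bN)) * G (shiftB y))) \<in> benv"
  by (intro borel_measurable_times_ennreal ind pd GB)
 have sub: "Kv <= ix (Suc N)" by auto
 have fin: "finite (ix (Suc N))" by simp
 have "Intg Kv (%y. ind y * G y) y = Intg Kv (%y. ind y * (esq (pdet N y (y bN)) * G (shiftB y))) y" for y
 proof -
  have agree: "pdet N y' w = pdet N y w" "y' bN = y bN" "ind y' = ind y"
   if "!!i. i ~: Kv ==> y' i = y i" for y' w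
  proof -
   show 1: "pdet N y' w = pdet N y w" for w using that by (intro pdet_cong) auto
   show 2: "y' bN = y bN" using that by auto
   show "ind y' = ind y" using 1 2 by (simp add: ind_def indicator_def)
  qed
  show ?thesis
  proof (cases "pdet N y (y bN) = 0")
   case True
   then have z: "ind y' = 0" if "!!i. i ~: Kv ==> y' i = y i" for y'
    using agree(3)[OF that] by (simp add: ind_def)
   have "Intg Kv (%y. ind y * G y) y = Intg Kv (%_. 0) y"
    by (rule Intg_cong) (simp add: z)
   moreover have "Intg Kv (%y. ind y * (esq (pdet N y (y bN)) * G (shiftB y))) y = Intg Kv (%_. 0) y"
    by (rule Intg_cong) (simp add: z)
   ultimately show ?thesis by simp
  next
   case False
   define X where "X = mat N N (%(i, j). y (False, i, j) - y bN * y (True, i, j))"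
   define M where "M = (-1) \<cdot>\<^sub>m X"
   have MC: "M \<in> carrier_mat N N" by (simp add: M_def X_def)
   have "det M = (-1) ^ N * pdet N y (y bN)" by (simp add: M_def X_def pdet_def)
   then have dM: "cmod (det M) = cmod (pdet N y (y bN))" "det M ~= 0" using False
    by (simp_all add: norm_mult norm_power)
   define c :: "pencil => pencil"
    where "c y' = (%(c, i, j). y' bN * y' (True, i, N))" for y'
   define G' where "G' y' = G (%i. if i \<in> Kv then y' i + c y' i else y' i)" for y'
   have G': "G' \<in> benv"
    unfolding G'_def
   proof (intro measurable_compose[OF measurable_envI G])
    fix i :: "bool \<times> nat \<times> nat"
    show "(%y'. if i \<in> Kv then y' i + c y' i else y' i) \<in> benv"
     by (cases "i \<in> Kv") (auto simp: c_def intro!: borel_measurable_add borel_measurable_times)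
   qed
   have "Intg Kv G y = Intg Kv G' y"
    unfolding G'_def
   proof (rule Intg_translate[symmetric])
    fix y' :: "pencil" and i :: "bool \<times> nat \<times> nat"
    assume "!!i. i ~: Kv ==> y' i = y i"
    then show "c y' i = c y i" by (auto simp: c_def split: prod.splits)
   qed (use G in auto)
   also have "... = esq (det M) ^ 1 * Intg Kv (%y'. G' (lines.lin Kv (%(c, i, j). i) (%(c, i, j) k. (c, k, j)) N M y')) y"
    by (rule lines.Intg_lin[OF lines_Kv MC dM(2) G'])
   also have "Intg Kv (%y'. G' (lines.lin Kv (%(c, i, j). i) (%(c, i, j) k. (c, k, j)) N M y')) y = Intg Kv (%y'. G (shiftB y')) y"
   proof (rule Intg_cong)
    fix y' :: "pencil"
    assume a: "!!i. i ~: Kv ==> y' i = y i"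
    have X': "M $$ (i, j) = - (y' (False, i, j) - y' bN * y' (True, i, j))" if "i < N" "j < N" for i j
     using that a by (simp add: M_def X_def)
    show "G' (lines.lin Kv (%(c, i, j). i) (%(c, i, j) k. (c, k, j)) N M y') = G (shiftB y')"
     unfolding G'_def
    proof (intro arg_cong[where f=G] ext)
     fix \<iota> :: "bool \<times> nat \<times> nat"
     obtain b i j where \<iota>: "\<iota> = (b, i, j)" by (cases \<iota>) auto
     show "(if \<iota> \<in> Kv then lines.lin Kv (%(c, i, j). i) (%(c, i, j) k. (c, k, j)) N M y' \<iota> +
       c (lines.lin Kv (%(c, i, j). i) (%(c, i, j) k. (c, k, j)) N M y') \<iota>
      else lines.lin Kv (%(c, i, j). i) (%(c, i, j) k. (c, k, j)) N M y' \<iota>) = shiftB y' \<iota>"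
     proof (cases "\<iota> \<in> Kv")
      case True
      then have 1: "b = False" "j = N" "i < N" using \<iota> by auto
      have "lines.lin Kv (%(c, i, j). i) (%(c, i, j) k. (c, k, j)) N M y' \<iota> = - (\<Sum>l<N. (y' (False, i, l) - y' bN * y' (True, i, l)) * y' (False, l, N))"
      proof -
       have "lines.lin Kv (%(c, i, j). i) (%(c, i, j) k. (c, k, j)) N M y' \<iota> = (\<Sum>l<N. M $$ (i, l) * y' (False, l, N))"
        using 1 \<iota> by (simp add: lines.lin_def[OF lines_Kv])
       also have "... = (\<Sum>l<N. - ((y' (False, i, l) - y' bN * y' (True, i, l)) * y' (False, l, N)))"
        by (intro sum.cong refl, subst X'[OF 1(3)]) (simp_all only: lessThan_iff mult_minus_left)
       finally show ?thesis by (simp only: sum_negf)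
      qed
      moreover have "c (lines.lin Kv (%(c, i, j). i) (%(c, i, j) k. (c, k, j)) N M y') \<iota> = y' bN * y' (True, i, N)"
       using 1 \<iota> by (simp add: c_def lines.lin_def[OF lines_Kv])
      ultimately show ?thesis using 1 \<iota> by (simp add: shiftB_def)
     next
      case False
      then have "lines.lin Kv (%(c, i, j). i) (%(c, i, j) k. (c, k, j)) N M y' \<iota> = y' \<iota>"
       by (simp add: lines.lin_def[OF lines_Kv])
      then show ?thesis using False \<iota> by (auto simp: shiftB_def)
     qed
    qed
   qed
   finally have main: "Intg Kv G y = esq (pdet N y (y bN)) * Intg Kv (%y'. G (shiftB y')) y"
    using dM(1) by simp
   have "Intg Kv (%y. ind y * G y) y = ind y * Intg Kv G y"
    by (rule Intg_cmult_dep[where c=ind, OF G agree(3)])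
   also have "... = (ind y * esq (pdet N y (y bN))) * Intg Kv (%y'. G (shiftB y')) y"
    unfolding main by (rule mult.assoc[symmetric])
   also have "... = Intg Kv (%y. (ind y * esq (pdet N y (y bN))) * G (shiftB y)) y"
   proof (rule Intg_cmult_dep[where c="%y. ind y * esq (pdet N y (y bN))", symmetric, OF GB])
    fix y' :: "pencil"
    assume "!!i. i ~: Kv ==> y' i = y i"
    from agree[OF this] show "ind y' * esq (pdet N y' (y' bN)) = ind y * esq (pdet N y (y bN))"
     by simp
   qed
   finally show ?thesis by (simp add: mult.assoc)
  qed
 qed
 then have "Intg Kv (%y. ind y * G y) = Intg Kv (%y. ind y * (esq (pdet N y (y bN)) * G (shiftB y)))"
  by (rule ext)
 then show ?thesis
  unfolding Intg_split(1)[OF fin sub m1] Intg_split(1)[OF fin sub m2] by (rule arg_cong)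
qed

lemma continuous_edet: "continuous_on UNIV (%w. edet N y w)"
proof -
 have e: "edet N y w = (\<Sum>p\<in>{p. p permutes {0..<Suc N}}. of_int (sign p) *
  (\<Prod>i\<in>{0..<Suc N}. if p i < N then y (False, i, p i) - w * y (True, i, p i) else y (True, i, N)))" for w
  unfolding edet_def by (subst det_def'[of _ "Suc N"]) (auto intro!: sum.cong prod.cong simp: permutes_less)
 have "continuous_on UNIV (%w. if a then b - w * c else (d :: complex))" for a b c d
  by (cases a) (auto intro!: continuous_intros)
 then show ?thesis unfolding e by (intro continuous_on_sum continuous_on_mult continuous_on_prod continuous_on_const)
qed

lemma deflate_kappa: "deflate N (kappa y) = (shiftB y)(bN := deflate N (kappa y) bN)"
proof
 fix \<iota> :: "bool \<times> nat \<times> nat"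
 obtain c i j where \<iota>: "\<iota> = (c, i, j)" by (cases \<iota>) auto
 show "deflate N (kappa y) \<iota> = ((shiftB y)(bN := deflate N (kappa y) bN)) \<iota>"
 proof (cases "\<iota> = bN")
  case False
  have s: "(\<Sum>l<N. kappa y (c, i, l) * kappa y (False, l, N)) = (\<Sum>l<N. y (c, i, l) * y (False, l, N))"
   by (intro sum.cong) (auto simp: kappa_def)
  show ?thesis
  proof (cases "j = N & i <= N")
   case True
   show ?thesis
   proof (cases c)
    case True
    then show ?thesis using s \<open>j = N & i <= N\<close> \<iota> by (simp add: deflate_def shiftB_def kappa_def)
   next
    case c: False
    then have "i < N" using False True \<iota> by auto
    have "deflate N (kappa y) \<iota> = y bN * (y (True, i, N) + (\<Sum>l<N. y (True, i, l) * y (False, l, N))) - (\<Sum>l<N. y (False, i, l) * y (False, l, N))"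
     using s c True \<iota> by (simp add: deflate_def kappa_def)
    also have "... = shiftB y \<iota>"
     using c True \<iota> \<open>i < N\<close> by (simp add: shiftB_def algebra_simps sum_subtractf sum_distrib_left)
    finally show ?thesis using False by simp
   qed
  next
   case o: False
   then show ?thesis using False \<iota> by (auto simp: deflate_def shiftB_def kappa_def)
  qed
 qed simp
qed

text \<open>Since the minor of size N is nonzero at z, only one corner entry makes z an eigenvalue,
  and the deflated pencil has it. Its characteristic polynomial is (z - w) times
  \<open>edet\<close>, so its derivative at z is minus \<open>edet\<close>; on the other hand that
  derivative is - \<open>cdphi\<close> times the minor.\<close>

lemma corner_shiftB:
 assumes nz: "pdet N y (y bN) ~= 0"
 shows "cphi (shiftB y) (y bN) = deflate N (kappa y) bN"
  and "cmod (cdphi (shiftB y) (y bN)) * cmod (pdet N y (y bN)) = cmod (edet N (kappa y) (y bN))"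
proof -
 define z where "z = y bN"
 define y1 where "y1 = shiftB y"
 define t where "t = deflate N (kappa y) bN"
 have d: "deflate N (kappa y) = y1(bN := t)" using deflate_kappa unfolding y1_def t_def .
 have kz: "kappa y bN = z" by (simp add: kappa_def z_def)
 have m: "pdet N y1 w = pdet N y w" for w by (rule pdet_cong) (auto simp: y1_def shiftB_def)
 have m': "pencil_poly N y1 = pencil_poly N y" by (rule pdet_cong) (auto simp: y1_def shiftB_def)
 have nz': "pdet N y z ~= 0" using nz by (simp add: z_def)
 have P: "pdet (Suc N) (y1(bN := t)) w = (z - w) * edet N (kappa y) w" for w
  using pdet_deflate[of N "kappa y" w] unfolding d kz .
 have corner: "pdet (Suc N) (y1(bN := t)) w = t * pdet N y w + pdet (Suc N) (y1(bN := 0)) w" for w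
  using pdet_corner[of N y1 t w] unfolding m .
 have "t * pdet N y z + pdet (Suc N) (y1(bN := 0)) z = 0"
  using P[of z] corner[of z] by simp
 then have t: "t * pdet N y z = - pdet (Suc N) (y1(bN := 0)) z" by (simp add: eq_neg_iff_add_eq_0)
 then have tphi: "t = cphi y1 z" unfolding cphi_def m using nz' by (metis nonzero_eq_divide_eq)
 then show "cphi (shiftB y) (y bN) = deflate N (kappa y) bN" by (simp add: y1_def z_def t_def)
 let ?p = "pencil_poly (Suc N) (y1(bN := t))" and ?q = "pencil_poly (Suc N) (y1(bN := 0))" and ?m = "pencil_poly N y"
 have pp: "?p = Polynomial.smult t ?m + ?q"
 proof (rule poly_ext)
  fix w show "poly ?p w = poly (Polynomial.smult t ?m + ?q) w"
   using corner[of w] by (simp add: poly_pencil_poly)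
 qed
 have d1: "poly (pderiv ?p) z = t * poly (pderiv ?m) z + poly (pderiv ?q) z"
  unfolding pp by (simp add: pderiv_add pderiv_smult)
 have "((%h. (poly ?p (z + h) - poly ?p z) / h) \<longlongrightarrow> poly (pderiv ?p) z) (at 0)"
  using poly_DERIV[of ?p z] by (simp add: DERIV_def)
 moreover have "((%h. (poly ?p (z + h) - poly ?p z) / h) \<longlongrightarrow> - edet N (kappa y) z) (at 0)"
 proof -
  have "isCont (%w. edet N (kappa y) w) z"
   using continuous_edet[of "kappa y"] by (simp add: continuous_on_eq_continuous_at)
  then have "((%h. edet N (kappa y) (z + h)) \<longlongrightarrow> edet N (kappa y) z) (at 0)"
   using isCont_iff by blast
  then have "((%h. - edet N (kappa y) (z + h)) \<longlongrightarrow> - edet N (kappa y) z) (at 0)" by (rule tendsto_minus)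
  then show ?thesis
  proof (rule Lim_transform_eventually)
   show "\<forall>\<^sub>F h in at 0. - edet N (kappa y) (z + h) = (poly ?p (z + h) - poly ?p z) / h"
    unfolding poly_pencil_poly P by (auto simp: eventually_at_filter)
  qed
 qed
 ultimately have d2: "poly (pderiv ?p) z = - edet N (kappa y) z"
  using tendsto_unique[OF trivial_limit_at] by blast
 have "cdphi y1 z * pdet N y z = - poly (pderiv ?p) z"
 proof -
  have R: "pdet (Suc N) (y1(bN := 0)) z = - (t * pdet N y z)" using t by simp
  show ?thesis unfolding d1 cdphi_def m m' R using nz' by (simp add: field_simps power2_eq_square)
 qed
 then have "cmod (cdphi y1 z * pdet N y z) = cmod (edet N (kappa y) z)" unfolding d2 by simp
 then show "cmod (cdphi (shiftB y) (y bN)) * cmod (pdet N y (y bN)) = cmod (edet N (kappa y) (y bN))"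
  by (simp add: norm_mult y1_def z_def)
qed

lemma Intg_kappa:
 assumes H: "H \<in> benv"
 shows "Intg (ix (Suc N)) (%y. H (kappa y)) y = Intg (ix (Suc N)) H y"
proof -
 let ?K = "{True} \<times> {..N} \<times> {N}"
 have sub: "?K <= ix (Suc N)" by auto
 have fin: "finite (ix (Suc N))" by simp
 have m: "(%y. H (kappa y)) \<in> benv" using H by measurable
 define c :: "pencil => pencil"
  where "c y = (%(c, i, j). \<Sum>l<N. y (True, i, l) * y (False, l, N))" for y
 have k: "kappa y = (%i. if i \<in> ?K then y i + c y i else y i)" for y
  by (auto simp: kappa_def c_def fun_eq_iff)
 have "Intg ?K (%y. H (kappa y)) y = Intg ?K H y" for y
  unfolding k
 proof (rule Intg_translate)
  fix y' :: "pencil" and i :: "bool \<times> nat \<times> nat"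
  assume a: "!!i. i ~: ?K ==> y' i = y i"
  obtain b k j where i: "i = (b, k, j)" by (cases i) auto
  show "c y' i = c y i" unfolding c_def i prod.case
   by (intro sum.cong arg_cong2[where f="(*)"] a) auto
 qed (use H in auto)
 then have "Intg ?K (%y. H (kappa y)) = Intg ?K H" by (rule ext)
 then show ?thesis
  unfolding Intg_split(1)[OF fin sub m] Intg_split(1)[OF fin sub H] by (rule arg_cong)
qed

text \<open>Three substitutions in a row: corner entry to eigenvalue, last column of B to
  eigenvector, shear of the last column of A. Their Jacobians multiply to the squared modulus of
  \<open>edet\<close>.\<close>

theorem pencil_deflation:
 assumes F: "F \<in> benv"
 shows "of_nat (Suc N) * Intg (ix (Suc N)) F y =
  Intg (ix (Suc N)) (%y. F (deflate N y) * esq (edet N y (y bN))) y"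
proof -
 let ?I = "ix (Suc N)"
 let ?ind = "indicator {y. pdet N y (y bN) ~= 0} :: _ => ennreal"
 define G where "G y = F (y(bN := cphi y (y bN))) * esq (cdphi y (y bN))" for y
 have i: "(%y. y) \<in> env \<rightarrow>\<^sub>M env" "(%y. y bN) \<in> benv" by simp_all
 have G: "G \<in> benv"
 proof -
  have "(%y. F (y(bN := cphi y (y bN)))) \<in> benv"
   by (rule measurable_compose[OF measurable_env_upd[OF i(1) measurable_cphi(1)[OF i]] F])
  moreover have "(%y. esq (cdphi y (y bN))) \<in> benv"
   using measurable_cphi(2)[OF i] by measurable
  ultimately show ?thesis unfolding G_def by (intro borel_measurable_times_ennreal)
 qed
 define H where "H y = F (deflate N y) * esq (edet N y (y bN))" for y
 have H: "H \<in> benv"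
 proof -
  have "(%y. F (deflate N y)) \<in> benv" using F by measurable
  moreover have "(%y. esq (edet N y (y bN))) \<in> benv"
   using borel_measurable_edet[OF i] by measurable
  ultimately show ?thesis unfolding H_def by (intro borel_measurable_times_ennreal)
 qed
 have ind: "?ind \<in> benv" using sets_pdet_nonzero by (rule borel_measurable_indicator)
 have iH: "(%y. ?ind y * H y) \<in> benv" by (intro borel_measurable_times_ennreal ind H)
 have "of_nat (Suc N) * Intg ?I F y = Intg ?I (corner_roots F) y" by (rule Intg_corner_ix[OF F])
 also have "corner_roots F = (%y. ?ind y * G y)" by (simp add: corner_roots_def G_def fun_eq_iff mult_ac)
 also have "Intg ?I (%y. ?ind y * G y) y =
  Intg ?I (%y. ?ind y * (esq (pdet N y (y bN)) * G (shiftB y))) y"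
  by (rule Intg_shiftB[OF G])
 also have "... = Intg ?I (%y. ?ind (kappa y) * H (kappa y)) y"
 proof (rule Intg_cong)
  fix y :: "pencil"
  have kb: "kappa y bN = y bN" "shiftB y bN = y bN" by (simp_all add: kappa_def shiftB_def)
  have "pdet N (kappa y) w = pdet N y w" for w by (rule pdet_cong) (auto simp: kappa_def)
  then have i: "?ind (kappa y) = ?ind y" using kb by (simp add: indicator_def)
  show "?ind y * (esq (pdet N y (y bN)) * G (shiftB y)) = ?ind (kappa y) * H (kappa y)"
  proof (cases "pdet N y (y bN) = 0")
   case False
   note s = corner_shiftB[OF False]
   have "csq (edet N (kappa y) (y bN)) = csq (pdet N y (y bN)) * csq (cdphi (shiftB y) (y bN))"
    by (simp flip: s(2) add: power_mult_distrib mult_ac)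
   then show ?thesis unfolding i
    using deflate_kappa[of y] s(1)
    by (simp add: G_def H_def kb ennreal_mult mult_ac)
  qed (simp add: i)
 qed
 also have "... = Intg ?I (%y. ?ind y * H y) y" by (rule Intg_kappa[OF iH])
 also have "... = Intg ?I H y"
 proof -
  \<comment> \<open>For a pencil that is not exceptional the minor of size N is a nonzero
    polynomial, so only finitely many corner values lie in Z.\<close>
  define Z where "Z = {y. pdet N y (y bN) = 0}"
  have Z: "Z \<in> sets env" unfolding Z_def by (rule sets_pdet_zero)
  have Bd: "{y. bad (Suc N) y} \<in> sets env" using pred_bad[of "Suc N"] by (simp add: pred_def)
  have ZB: "Z - {y. bad (Suc N) y} \<in> sets env" using Z Bd by (rule sets.Diff)
  have "Intg ?I (indicator (Z - {y. bad (Suc N) y})) y = Intg (?I - {bN}) (Intg {bN} (indicator (Z - {y. bad (Suc N) y}))) y"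
   by (rule Intg_split) (use ZB in auto)
  also have "... = Intg (?I - {bN}) (%_. 0) y"
  proof (rule Intg_cong)
   fix y :: "pencil"
   have "Intg {bN} (indicator (Z - {y. bad (Suc N) y})) y = (\<integral>\<^sup>+t. indicator (Z - {y. bad (Suc N) y}) (y(bN := t)) \<partial>lborel)"
    by (rule Intg_singleton) (use ZB in auto)
   also have "... = 0"
   proof (cases "bad (Suc N) y")
    case True
    then show ?thesis by (simp add: bad_upd_corner del: bad.simps)
   next
    case False
    then have "adet N y ~= 0" using bad_adet[of N y] by simp
    then have "pencil_poly N y ~= 0" using pencil_poly_degree(2)[of N y] by auto
    then have fin: "finite {t. pdet N y t = 0}"
     using poly_roots_finite[of "pencil_poly N y"] by (simp add: poly_pencil_poly)
    have "pdet N (y(bN := t)) w = pdet N y w" for t w by (rule pdet_cong) auto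
    then show ?thesis
     by (intro nn_integral_finite_support[OF fin]) (simp add: Z_def indicator_def)
   qed
   finally show "Intg {bN} (indicator (Z - {y. bad (Suc N) y})) y = 0" .
  qed
  finally have n1: "Intg ?I (indicator (Z - {y. bad (Suc N) y})) y = 0" by simp
  have "Intg ?I (indicator Z) y <= Intg ?I (%y. indicator (Z - {y. bad (Suc N) y}) y + indicator {y. bad (Suc N) y} y) y"
   by (intro Intg_mono) (auto simp: indicator_def)
  also have "... = 0"
   using n1 Intg_bad[of "Suc N" y] ZB Bd by (simp add: Intg_add del: bad.simps)
  finally have null: "Intg ?I (indicator Z) y = 0" by simp
  show ?thesis by (rule Intg_cong_null[OF iH H Z null]) (simp add: Z_def)
 qed
 finally show ?thesis unfolding H_def .
qed

end

section \<open>Gaussian integrals and isometries\<close>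

text \<open>The disc with squared radius a has area pi a, so the squared modulus carries plane
  measure to pi times the length on the half-line. Equality on the half-lines {..a} determines the
  measure.\<close>

lemma nn_integral_radial:
 fixes g :: "real => ennreal"
 assumes [measurable]: "g \<in> borel_measurable borel"
 shows "(\<integral>\<^sup>+z. g (csq z) \<partial>lborel) = ennreal pi * (\<integral>\<^sup>+x. g x * indicator {0..} x \<partial>lborel)"
proof -
 let ?M = "distr lborel borel (%z::complex. csq z)"
 let ?N = "density lborel (%x::real. ennreal pi * indicator {0..} x)"
 have val: "emeasure ?M {..a} = ennreal (pi * max a 0)" "emeasure ?N {..a} = ennreal (pi * max a 0)" for a :: real
 proof -
  have "emeasure ?M {..a} = emeasure lborel {z::complex. csq z <= a}"
   by (subst emeasure_distr) (auto intro!: arg_cong[where f="emeasure lborel"])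
  also have "... = ennreal (pi * max a 0)"
  proof (cases "a < 0")
   case True
   then have "{z::complex. csq z <= a} = {}"
    by (auto simp: not_le intro: order_less_le_trans)
   then show ?thesis using True by simp
  next
   case False
   then have "{z::complex. csq z <= a} = cball 0 (sqrt a)"
    by (auto simp: real_le_rsqrt intro: real_sqrt_le_iff power2_le_imp_le)
     (metis norm_ge_zero power_mono real_sqrt_pow2 not_less)
   then show ?thesis using False by (simp add: emeasure_cball unit_ball_vol_numeral)
  qed
  finally show "emeasure ?M {..a} = ennreal (pi * max a 0)" .
  have "emeasure ?N {..a} = (\<integral>\<^sup>+x. ennreal pi * indicator {0..a} x \<partial>lborel)"
   by (subst emeasure_density) (auto intro!: nn_integral_cong simp: indicator_def)
  also have "... = ennreal pi * emeasure lborel {0..a}"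
   by (subst nn_integral_cmult) auto
  also have "... = ennreal (pi * max a 0)"
   by (auto simp: max_def ennreal_mult emeasure_lborel_Icc_eq)
  finally show "emeasure ?N {..a} = ennreal (pi * max a 0)" .
 qed
 have eq: "?M = ?N"
 proof (rule measure_eqI_generator_eq[where E="range (%a::real. {..a})" and \<Omega>=UNIV and A="%i. {..real i}"])
  show "Int_stable (range (%a::real. {..a}))" by (auto simp: Int_stable_def)
  show "sets ?M = sigma_sets UNIV (range (%a::real. {..a}))"
   by (simp add: borel_eq_atMost sets_measure_of)
  show "sets ?N = sigma_sets UNIV (range (%a::real. {..a}))"
   by (simp add: borel_eq_atMost sets_measure_of)
  show "(\<Union>i. {..real i}) = UNIV" using real_arch_simple by auto
  show "emeasure ?M X = emeasure ?N X" if "X \<in> range (%a::real. {..a})" for X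
   using that val by auto
  show "emeasure ?M {..real i} ~= \<infinity>" for i by (simp only: val) simp
 qed auto
 have "(\<integral>\<^sup>+z. g (csq z) \<partial>lborel) = (\<integral>\<^sup>+x. g x \<partial>?M)"
  by (subst nn_integral_distr) auto
 also have "... = (\<integral>\<^sup>+x. ennreal pi * (g x * indicator {0..} x) \<partial>lborel)"
  unfolding eq by (subst nn_integral_density) (auto simp: mult_ac)
 also have "... = ennreal pi * (\<integral>\<^sup>+x. g x * indicator {0..} x \<partial>lborel)"
  by (rule nn_integral_cmult) auto
 finally show ?thesis .
qed

lemma nn_integral_gauss_complex: "(\<integral>\<^sup>+z. ennreal (exp (- csq z)) \<partial>lborel) = ennreal pi"
proof -
 have "(\<integral>\<^sup>+x. ennreal (exp (- x)) * indicator {0..} x \<partial>lborel) = ennreal (0 - (- exp (- 0)))"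
 proof (rule nn_integral_FTC_atLeast)
  show "((%x::real. - exp (- x)) has_real_derivative exp (- x)) (at x)" for x
   by (auto intro!: derivative_eq_intros)
  show "((%x::real. - exp (- x)) \<longlongrightarrow> 0) at_top" by real_asymp
 qed auto
 then show ?thesis
  using nn_integral_radial[of "%x. ennreal (exp (- x))"] by simp
qed

definition sq :: "'i set => ('i => complex) => real" where
 "sq K y = (\<Sum>i\<in>K. csq (y i))"

lemma borel_measurable_sq [measurable]: "sq K \<in> benv"
 unfolding sq_def using measurable_env_component
 by (intro borel_measurable_sum borel_measurable_power borel_measurable_norm) auto

lemma Intg_gauss:
 assumes "finite K"
 shows "Intg K (%y. ennreal (exp (- sq K y))) y = ennreal pi ^ card K"
 using assms
proof (induction K arbitrary: y rule: finite_induct)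
 case (insert i K)
 have m: "(%y::'a => complex. ennreal (exp (- sq L y))) \<in> benv" for L by measurable
 have "Intg (insert i K) (%y. ennreal (exp (- sq (insert i K) y))) y =
  Intg K (%y. \<integral>\<^sup>+z. ennreal (exp (- sq (insert i K) (y(i := z)))) \<partial>lborel) y"
  by (rule Intg_insert_inner[OF insert(1,2) m])
 also have "... = Intg K (%y. ennreal pi * ennreal (exp (- sq K y))) y"
 proof (rule Intg_cong)
  fix y :: "'a => complex"
  have "sq (insert i K) (y(i := z)) = csq z + sq K y" for z
   unfolding sq_def using insert by (subst sum.insert) (auto intro!: sum.cong)
  then have "(\<integral>\<^sup>+z. ennreal (exp (- sq (insert i K) (y(i := z)))) \<partial>lborel) =
   (\<integral>\<^sup>+z. ennreal (exp (- csq z)) * ennreal (exp (- sq K y)) \<partial>lborel)"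
   by (simp only: minus_add_distrib exp_add ennreal_mult[OF exp_ge_zero exp_ge_zero])
  also have "... = ennreal pi * ennreal (exp (- sq K y))"
   by (subst nn_integral_multc) (auto simp: nn_integral_gauss_complex)
  finally show "(\<integral>\<^sup>+z. ennreal (exp (- sq (insert i K) (y(i := z)))) \<partial>lborel) = ennreal pi * ennreal (exp (- sq K y))" .
 qed
 also have "... = ennreal pi * Intg K (%y. ennreal (exp (- sq K y))) y"
  by (rule Intg_cmult[OF m])
 also have "... = ennreal pi ^ card (insert i K)"
  using insert by simp
 finally show ?case .
qed (simp add: sq_def)

lemma pi_power_ennreal: "ennreal pi ^ k ~= 0" "ennreal pi ^ k ~= \<infinity>"
 by (simp_all add: ennreal_power)

text \<open>The squared norm of (I - c w w^H) x. With one choice of c this gives a reflection, with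
  another the inverse square root of a rank-one perturbation of I.\<close>

lemma rank_one_norm:
 fixes x w :: "nat => complex" and c :: real and m :: nat
 defines "t == \<Sum>j<m. cnj (w j) * x j"
 shows "(\<Sum>i<m. csq (x i - of_real c * w i * t)) =
  (\<Sum>i<m. csq (x i)) - 2 * c * csq t + c^2 * csq t * (\<Sum>i<m. csq (w i))"
proof -
 have 1: "csq (p - q) = csq p + csq q - 2 * Re (q * cnj p)" for p q :: complex
 proof -
  have "(a - b)^2 + (c - d)^2 = a^2 + c^2 + (b^2 + d^2) - 2 * (b * a - d * - c)" for a b c d :: real
   by (simp add: power2_eq_square algebra_simps)
  then show ?thesis unfolding cmod_power2 minus_complex.sel times_complex.sel cnj.sel by blast
 qed
 have "(\<Sum>i<m. csq (x i - of_real c * w i * t)) =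
  (\<Sum>i<m. csq (x i) + c^2 * csq t * csq (w i) - 2 * c * Re (t * (w i * cnj (x i))))"
  unfolding 1 by (intro sum.cong refl) (simp add: norm_mult power_mult_distrib algebra_simps)
 also have "... = (\<Sum>i<m. csq (x i)) + c^2 * csq t * (\<Sum>i<m. csq (w i))
  - 2 * c * Re (t * (\<Sum>i<m. w i * cnj (x i)))"
  by (simp only: sum.distrib sum_subtractf sum_distrib_left Re_sum)
 also have "(\<Sum>i<m. w i * cnj (x i)) = cnj t" by (simp add: t_def)
 also have "Re (t * cnj t) = csq t" by (simp add: complex_norm_square[symmetric] flip: of_real_power)
 finally show ?thesis by simp
qed

definition mv :: "nat => complex mat => (nat => complex) => nat => complex" where
 "mv m M x i = (\<Sum>j<m. M $$ (i, j) * x j)"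

lemma mv_rank_one:
 assumes "i < m"
 shows "mv m (mat m m (%(i, j). (if i = j then 1 else 0) - of_real c * w i * cnj (w j))) x i =
  x i - of_real c * w i * (\<Sum>j<m. cnj (w j) * x j)"
proof -
 have "mv m (mat m m (%(i, j). (if i = j then 1 else 0) - of_real c * w i * cnj (w j))) x i =
  (\<Sum>j<m. (if j = i then x j else 0) - of_real c * w i * (cnj (w j) * x j))"
  unfolding mv_def using assms by (intro sum.cong) (auto simp: algebra_simps)
 then show ?thesis using assms by (simp add: sum_subtractf sum_distrib_left)
qed

lemma det_nonzero_inj:
 assumes M: "M \<in> carrier_mat m m"
  and inj: "!!x. (!!i. i < m ==> mv m M x i = 0) ==> (!!i. i < m ==> x i = 0)"
 shows "det M ~= 0"
proof
 assume "det M = 0"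
 then obtain v where v: "v \<in> carrier_vec m" "v ~= 0\<^sub>v m" "M *\<^sub>v v = 0\<^sub>v m"
  using det_0_iff_vec_prod_zero_field[OF M] by blast
 have "mv m M (vec_index v) i = 0" if "i < m" for i
 proof -
  have "mv m M (vec_index v) i = vec_index (M *\<^sub>v v) i"
   using M v(1) that by (simp add: mv_def scalar_prod_def atLeast0LessThan)
  then show ?thesis using v(3) that by simp
 qed
 then have "vec_index v i = 0" if "i < m" for i using inj that by blast
 then have "v = 0\<^sub>v m" using v(1) by (intro eq_vecI) auto
 with v(2) show False ..
qed

lemma lines_nat: "lines {..<m} (%i. i) (%i k. k) m 1"
proof
 fix j assume "j < m"
 then have "{i \<in> {..<m}. i = j} = {j}" by auto
 then show "card {i \<in> {..<m}. i = j} = 1" by simp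
qed auto

abbreviation (input) "isom m M x == (\<Sum>i<m. (cmod (mv m M x i))\<^sup>2) = (\<Sum>i<m. (cmod (x i))\<^sup>2)"

abbreviation (input) whit :: "nat => complex mat => pencil => (nat => complex) => bool" where
 "whit N M y x == (\<Sum>i<N. (cmod (mv N M x i))\<^sup>2) + (cmod (\<Sum>i<N. mv N M x i * y (False, i, N)))^2 = (\<Sum>i<N. (cmod (x i))\<^sup>2)"

text \<open>The Gaussian integral is positive and finite and does not change under the isometry, so
  the Jacobian has to be 1.\<close>

lemma isometric_det:
 assumes M: "M \<in> carrier_mat m m"
  and iso: "!!x. isom m M x"
 shows "cmod (det M) = 1"
proof -
 have nz: "det M ~= 0"
 proof (rule det_nonzero_inj[OF M])
  fix x i assume h: "!!i. i < m ==> mv m M x i = 0" "i < m"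
  then have "(\<Sum>i<m. csq (x i)) = 0" using iso[of x] by simp
  then show "x i = 0" using h(2) by (simp add: sum_nonneg_eq_0_iff)
 qed
 have eq: "sq {..<m} (lines.lin {..<m} (%i. i) (%i k. k) m M y) = sq {..<m} y" for y
 proof -
  have "sq {..<m} (lines.lin {..<m} (%i. i) (%i k. k) m M y) = (\<Sum>i<m. csq (mv m M y i))"
   unfolding sq_def by (intro sum.cong) (auto simp: lines.lin_def[OF lines_nat] mv_def)
  then show ?thesis using iso[of y] by (simp add: sq_def)
 qed
 have "Intg {..<m} (%y. ennreal (exp (- sq {..<m} y))) (%_. 0) =
  esq (det M) ^ 1 * Intg {..<m} (%y. ennreal (exp (- sq {..<m} (lines.lin {..<m} (%i. i) (%i k. k) m M y)))) (%_. 0)"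
  by (rule lines.Intg_lin[OF lines_nat M nz]) measurable
 then have "ennreal pi ^ m = esq (det M) * ennreal pi ^ m"
  unfolding eq using Intg_gauss[of "{..<m}"] by simp
 then have "ennreal (pi ^ m) = ennreal (csq (det M) * pi ^ m)"
  by (simp add: ennreal_power ennreal_mult)
 then have "csq (det M) = 1" by simp
 then show ?thesis by (simp add: power2_eq_1_iff) (metis norm_ge_zero not_one_le_zero neg_0_le_iff_le order_trans zero_le_one)
qed

text \<open>A Householder reflection times a phase. The phase e makes the last entry of \<alpha> / e
  real and nonnegative, so that the reflection in w = \<alpha> / e - a e_N carries a e_N to \<alpha>
  / e. The squared norm of w is W = 2 a (a - b), which gives c = 2 / W.\<close>

lemma exists_unitary:
 fixes \<alpha> :: "nat => complex" and N :: nat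
 defines "a == sqrt (\<Sum>i<Suc N. csq (\<alpha> i))"
 obtains M where "M \<in> carrier_mat (Suc N) (Suc N)"
  "!!x. isom (Suc N) M x"
  "!!i. i < Suc N ==> M $$ (i, N) * of_real a = \<alpha> i"
proof -
 have a2: "a^2 = (\<Sum>i<Suc N. csq (\<alpha> i))" by (simp add: a_def sum_nonneg)
 define e where "e = (if \<alpha> N = 0 then 1 else \<alpha> N / of_real (cmod (\<alpha> N)))"
 have e1: "cmod e = 1" by (simp add: e_def norm_divide)
 then have e0: "e ~= 0" by auto
 define b where "b = cmod (\<alpha> N)"
 have eb: "e * of_real b = \<alpha> N" by (simp add: e_def b_def)
 define w where "w i = \<alpha> i / e - (if i = N then of_real a else 0)" for i
 define W where "W = (\<Sum>i<Suc N. csq (w i))"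
 have wN: "w N = of_real (b - a)" using eb e0 by (simp add: w_def field_simps)
 have cw: "cmod (w i) = cmod (\<alpha> i)" if "i < N" for i using that e1 by (simp add: w_def norm_divide)
 have "W = (\<Sum>i<N. csq (\<alpha> i)) + (b - a)^2"
  by (simp add: W_def cw wN flip: of_real_diff)
 also have "(\<Sum>i<N. csq (\<alpha> i)) = a^2 - b\<^sup>2" using a2 by (simp add: b_def)
 finally have W: "W = 2 * a * (a - b)" by (simp add: power2_eq_square algebra_simps)
 define c where "c = (if W = 0 then 0 else 2 / W)"
 define H where "H = mat (Suc N) (Suc N) (%(i, j). (if i = j then 1 else 0) - of_real c * w i * cnj (w j))"
 have cW: "c^2 * W = 2 * c" by (simp add: c_def power2_eq_square)
 define M where "M = e \<cdot>\<^sub>m H"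
 have mvM: "mv (Suc N) M x i = e * mv (Suc N) H x i" if "i < Suc N" for x i
  unfolding mv_def sum_distrib_left using that
  by (intro sum.cong) (auto simp: M_def H_def)
 show thesis
 proof
  show "M \<in> carrier_mat (Suc N) (Suc N)" by (simp add: M_def H_def)
  show "isom (Suc N) M x" for x
  proof -
   let ?t = "\<Sum>j<Suc N. cnj (w j) * x j"
   have "(\<Sum>i<Suc N. csq (mv (Suc N) M x i)) = (\<Sum>i<Suc N. csq (x i - of_real c * w i * ?t))"
   proof (rule sum.cong)
    fix i assume "i \<in> {..<Suc N}"
    then have i: "i < Suc N" by simp
    show "csq (mv (Suc N) M x i) = csq (x i - of_real c * w i * ?t)"
     unfolding mvM[OF i] H_def mv_rank_one[OF i] norm_mult e1 by simp
   qed simp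
   also have "... = (\<Sum>i<Suc N. csq (x i)) - 2 * c * csq ?t + c^2 * csq ?t * W"
    unfolding W_def by (rule rank_one_norm)
   also have "c^2 * csq ?t * W = 2 * c * csq ?t"
    using cW by (metis mult.assoc mult.commute)
   finally show ?thesis by simp
  qed
  fix i assume i: "i < Suc N"
  have "M $$ (i, N) * of_real a = e * ((if i = N then of_real a else 0) - of_real c * w i * of_real (b - a) * of_real a)"
   using i by (simp add: M_def H_def wN algebra_simps)
  also have "of_real c * w i * of_real (b - a) * of_real a = - (of_real (c * (a * (a - b))) * w i)"
   by (simp add: algebra_simps)
  also have "c * (a * (a - b)) = (if W = 0 then 0 else 1)"
   using W by (simp add: c_def)
  also have "of_real (if W = 0 then 0 else 1) * w i = w i"
  proof (cases "W = 0")
   case True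
   then have "w i = 0" using i by (auto simp: W_def sum_nonneg_eq_0_iff simp del: sum.lessThan_Suc)
   then show ?thesis by simp
  qed simp
  also have "e * ((if i = N then of_real a else 0) - - w i) = \<alpha> i"
   using e0 by (simp add: w_def)
  finally show "M $$ (i, N) * of_real a = \<alpha> i" .
 qed
qed

text \<open>M is the inverse square root of I + w w^H with w the conjugate of v. Along w the
  eigenvalue of that matrix is 1 + s, so M multiplies w by q = 1 / sqrt (1 + s) and fixes the
  orthogonal complement, which is the choice c = (1 - q) / s.\<close>

lemma exists_whitening:
 fixes v :: "nat => complex"
 obtains M where "M \<in> carrier_mat m m" "det M ~= 0"
  "!!x. (\<Sum>i<m. csq (mv m M x i)) + csq (\<Sum>i<m. mv m M x i * v i) = (\<Sum>i<m. csq (x i))"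
proof -
 define s where "s = (\<Sum>i<m. csq (v i))"
 have s0: "s >= 0" by (simp add: s_def sum_nonneg)
 define q where "q = 1 / sqrt (1 + s)"
 have q2: "q^2 * (1 + s) = 1" using s0 by (simp add: q_def power_divide)
 define c where "c = (if s = 0 then 0 else (1 - q) / s)"
 define w where "w i = cnj (v i)" for i
 define M where "M = mat m m (%(i, j). (if i = j then 1 else 0) - of_real c * w i * cnj (w j))"
 have MC: "M \<in> carrier_mat m m" by (simp add: M_def)
 have iso: "(\<Sum>i<m. csq (mv m M x i)) + csq (\<Sum>i<m. mv m M x i * v i) = (\<Sum>i<m. csq (x i))" for x
 proof -
  let ?t = "\<Sum>j<m. cnj (w j) * x j"
  have mv: "mv m M x i = x i - of_real c * w i * ?t" if "i < m" for i
   unfolding M_def by (rule mv_rank_one[OF that])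
  have ws: "(\<Sum>i<m. csq (w i)) = s" by (simp add: w_def s_def)
  have 1: "(\<Sum>i<m. csq (mv m M x i)) = (\<Sum>i<m. csq (x i)) - 2 * c * csq ?t + c^2 * csq ?t * s"
   using rank_one_norm[of x c w m] mv ws by simp
  have "(\<Sum>i<m. mv m M x i * v i) = (\<Sum>i<m. x i * v i - of_real c * ?t * (w i * v i))"
   by (intro sum.cong refl) (simp add: mv algebra_simps)
  also have "... = (\<Sum>i<m. x i * v i) - of_real c * ?t * (\<Sum>i<m. w i * v i)"
   unfolding sum_subtractf by (simp only: sum_distrib_left)
  also have "(\<Sum>i<m. x i * v i) = ?t" by (simp add: w_def mult.commute)
  also have "(\<Sum>i<m. w i * v i) = of_real s"
   by (simp add: w_def s_def complex_norm_square mult.commute flip: of_real_power)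
  finally have 2: "(\<Sum>i<m. mv m M x i * v i) = of_real (1 - c * s) * ?t" by (simp add: algebra_simps)
  have "(\<Sum>i<m. csq (mv m M x i)) + csq (\<Sum>i<m. mv m M x i * v i) =
   (\<Sum>i<m. csq (x i)) + csq ?t * (- 2 * c + c^2 * s + (1 - c * s)^2)"
   unfolding 1 2 norm_mult norm_of_real power_mult_distrib by (simp add: algebra_simps)
  also have "csq ?t * (- 2 * c + c^2 * s + (1 - c * s)^2) = 0"
  proof (cases "s = 0")
   case True
   then have "v i = 0" if "i < m" for i using that by (auto simp: s_def sum_nonneg_eq_0_iff)
   then have "?t = 0" by (simp add: w_def)
   then show ?thesis by simp
  next
   case False
   then have cs: "c * s = 1 - q" by (simp add: c_def)
   have "s * (- 2 * c + c^2 * s + (1 - c * s)^2) = - 2 * (c * s) + (c * s)^2 + s * (1 - c * s)^2"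
    by (simp add: power2_eq_square algebra_simps)
   also have "... = q^2 * (1 + s) - 1" unfolding cs by (simp add: power2_eq_square algebra_simps)
   also have "... = 0" using q2 by simp
   finally show ?thesis using False by simp
  qed
  finally show ?thesis by simp
 qed
 have "det M ~= 0"
 proof (rule det_nonzero_inj[OF MC])
  fix x i assume h: "!!i. i < m ==> mv m M x i = 0" "i < m"
  then have "(\<Sum>i<m. csq (x i)) = 0" using iso[of x] by simp
  then show "x i = 0" using h(2) by (simp add: sum_nonneg_eq_0_iff)
 qed
 with MC iso that show thesis by blast
qed

lemma Intg_cmult_cong:
 assumes "F \<in> benv"
  and "!!y'. (!!i. i ~: K ==> y' i = y i) ==> H y' = c * F y'"
 shows "Intg K H y = c * Intg K F y"
proof -
 have "Intg K H y = Intg K (%y'. c * F y') y" by (rule Intg_cong) (rule assms(2))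
 also have "... = c * Intg K F y" by (rule Intg_cmult[OF assms(1)])
 finally show ?thesis .
qed

section \<open>The recursion for Gaussian integrals with a hole\<close>

text \<open>The list \<open>zs\<close> collects the eigenvalues that were split off from a larger
  pencil; each of them leaves one factor |det (B - w A)|^2 behind.\<close>

definition FJ :: "nat => complex set => complex list => pencil => ennreal" where
 "FJ n V zs y = ennreal (exp (- sq (ix n) y)) * indicator {y. hole n V y} y *
  (\<Prod>w\<leftarrow>zs. esq (pdet n y w))"

definition J :: "nat => complex set => complex list => ennreal" where
 "J n V zs = Intg (ix n) (FJ n V zs) (%_. 0)"

lemma sets_hole: "open V ==> {y. hole n V y} \<in> sets env"
 using pred_hole[of V n] by (simp add: pred_def)

lemma borel_measurable_pdet_prod:
 fixes zs :: "complex list"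
 assumes f: "f \<in> M \<rightarrow>\<^sub>M env"
 shows "(%y. \<Prod>w\<leftarrow>zs. esq (pdet n (f y) w)) \<in> borel_measurable M"
proof (induction zs)
 case (Cons w zs)
 have "(%y. pdet n (f y) w) \<in> borel_measurable M" using f by (intro borel_measurable_pdet) auto
 then have "(%y. esq (pdet n (f y) w)) \<in> borel_measurable M" by measurable
 then show ?case using Cons by simp
qed simp

lemma measurable_FJ: "open V ==> FJ n V zs \<in> benv"
 unfolding FJ_def using borel_measurable_pdet_prod[of "%y. y" env] sets_hole borel_measurable_sq
 by (intro borel_measurable_times_ennreal borel_measurable_indicator) auto

lemma sq_ix: "finite I ==> finite L ==> sq (UNIV \<times> I \<times> L) y = (\<Sum>c\<in>UNIV. \<Sum>i\<in>I. \<Sum>j\<in>L. csq (y (c::bool, i, j)))"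
 unfolding sq_def by (simp add: sum.cartesian_product)

lemma hole_cong:
 assumes "!!c i j. i < n ==> j < n ==> y (c, i, j) = y' (c, i, j)"
 shows "hole n V y = hole n V y'"
proof -
 have "pdet n y z = pdet n y' z" for z using assms by (rule pdet_cong)
 then show ?thesis by (simp add: hole_def)
qed

lemma FJ_cong:
 assumes a: "!!c i j. i < n ==> j < n ==> y (c, i, j) = y' (c, i, j)"
 shows "FJ n V zs y = FJ n V zs y'"
proof -
 have "sq (ix n) y = sq (ix n) y'" unfolding sq_def by (intro sum.cong) (auto simp: a)
 moreover have "pdet n y w = pdet n y' w" for w using a by (rule pdet_cong)
 moreover have "hole n V y = hole n V y'" using a by (rule hole_cong)
 ultimately show ?thesis by (simp add: FJ_def indicator_def)
qed

lemma Intg_FJ_base: "Intg (ix n) (FJ n V zs) y = J n V zs"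
 unfolding J_def by (rule Intg_cong_base, rule FJ_cong) simp

definition lmul :: "nat => complex mat => pencil => pencil" where
 "lmul n U y = (%(c, i, j). mv n U (%k. y (c, k, j)) i)"

lemma mv_diff: "mv n U (%k. a k - b k) i = mv n U a i - mv n U b i"
 by (simp add: mv_def algebra_simps sum_subtractf)

lemma mv_scale: "mv n U (%k. c * a k) i = c * mv n U a i"
 by (simp add: mv_def sum_distrib_left algebra_simps)

lemma mv_sum: "mv n U (%k. \<Sum>l\<in>L. f l k) i = (\<Sum>l\<in>L. mv n U (f l) i)"
 unfolding mv_def by (subst sum.swap) (simp add: sum_distrib_left)

lemma mv_cong: "(!!k. k < n ==> a k = b k) ==> mv n U a i = mv n U b i"
 unfolding mv_def by (intro sum.cong) auto

lemma det_mv: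
 assumes U: "U \<in> carrier_mat n n"
 shows "det (mat n n (%(i, j). mv n U (%k. m k j) i)) = det U * det (mat n n (%(i, j). m i j))"
proof -
 have "mat n n (%(i, j). mv n U (%k. m k j) i) = U * mat n n (%(i, j). m i j)"
  using U by (intro eq_matI) (auto simp: mv_def scalar_prod_def atLeast0LessThan)
 then show ?thesis using det_mult[OF U, of "mat n n (%(i, j). m i j)"] by simp
qed

lemma det_mv_right:
 assumes U: "U \<in> carrier_mat n n"
 shows "det (mat n n (%(i, j). mv n U (%k. m i k) j)) = det (mat n n (%(i, j). m i j)) * det U"
proof -
 have "mat n n (%(i, j). mv n U (%k. m i k) j) = mat n n (%(i, j). m i j) * transpose_mat U"
  using U by (intro eq_matI) (auto simp: mv_def scalar_prod_def atLeast0LessThan mult.commute)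
 then show ?thesis using U det_mult[of "mat n n (%(i, j). m i j)" n "transpose_mat U"] by (simp add: det_transpose)
qed

lemma pdet_lmul:
 assumes U: "U \<in> carrier_mat n n"
 shows "pdet n (lmul n U y) w = det U * pdet n y w"
proof -
 have "mat n n (%(i, j). lmul n U y (False, i, j) - w * lmul n U y (True, i, j)) =
  mat n n (%(i, j). mv n U (%k. y (False, k, j) - w * y (True, k, j)) i)"
  by (intro eq_matI) (auto simp: lmul_def mv_diff mv_scale)
 then show ?thesis
  using det_mv[OF U, of "%i j. y (False, i, j) - w * y (True, i, j)"] by (simp add: pdet_def)
qed

lemma FJ_lmul:
 assumes U: "U \<in> carrier_mat n n"
  and iso: "!!x. isom n U x"
 shows "FJ n V zs (lmul n U y) = FJ n V zs y"
proof -
 have d: "cmod (det U) = 1" by (rule isometric_det[OF U iso])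
 then have d0: "det U ~= 0" by auto
 have "sq (ix n) (lmul n U y) = (\<Sum>c\<in>UNIV. \<Sum>j<n. \<Sum>i<n. csq (mv n U (%k. y (c, k, j)) i))"
  unfolding sq_ix[OF finite_lessThan finite_lessThan] lmul_def prod.case
  by (rule sum.cong[OF refl], rule sum.swap)
 also have "... = (\<Sum>c\<in>UNIV. \<Sum>j<n. \<Sum>i<n. csq (y (c, i, j)))" by (simp only: iso)
 also have "... = sq (ix n) y"
  unfolding sq_ix[OF finite_lessThan finite_lessThan] by (rule sum.cong[OF refl], rule sum.swap)
 finally have "sq (ix n) (lmul n U y) = sq (ix n) y" .
 moreover have "hole n V (lmul n U y) = hole n V y" using d0 by (simp add: hole_def pdet_lmul[OF U])
 ultimately show ?thesis by (simp add: FJ_def pdet_lmul[OF U] norm_mult d indicator_def)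
qed

text \<open>For multiplication from the left the lines are the columns of both matrices; in
  \<open>lines_right\<close> they are rows.\<close>

lemma lines_left: "lines (UNIV \<times> {..<m} \<times> {..<q}) (%(c::bool, i, j). i) (%(c, i, j) k. (c, k, j)) m (2 * q)"
proof
 fix k assume "k < m"
 then have "{i \<in> UNIV \<times> {..<m} \<times> {..<q}. (case i of (c::bool, i, j) => i) = k} = UNIV \<times> {k} \<times> {..<q}" by auto
 then show "card {i \<in> UNIV \<times> {..<m} \<times> {..<q}. (case i of (c::bool, i, j) => i) = k} = 2 * q"
  by (simp add: card_cartesian_product)
qed auto

lemma lines_right:
 assumes "finite C" "finite L"
 shows "lines (C \<times> L \<times> {..<m}) (%(c::bool, i::nat, j). j) (%(c, i, j) k. (c, i, k)) m (card C * card L)"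
proof
 fix k assume "k < m"
 then have "{i \<in> C \<times> L \<times> {..<m}. (case i of (c::bool, i::nat, j) => j) = k} = C \<times> L \<times> {k}" by auto
 then show "card {i \<in> C \<times> L \<times> {..<m}. (case i of (c::bool, i::nat, j) => j) = k} = card C * card L"
  by (simp add: card_cartesian_product)
qed (use assms in auto)

context
 fixes N :: nat

begin

definition alf :: "pencil => real" where
 "alf y = sqrt (\<Sum>i<Suc N. csq (y (True, i, N)))"

text \<open>The last column of A replaced by its norm in the last place, which is what a unitary
  multiplication from the left achieves.\<close>

definition flat :: "pencil => pencil" where
 "flat y = (%(c, i, j). if c & j = N & i <= N then (if i = N then of_real (alf y) else 0) else y (c, i, j))"

lemma borel_measurable_alf [measurable]: "alf \<in> benv"
 unfolding alf_def using measurable_env_component by measurable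

lemma measurable_flat [measurable]: "flat \<in> env \<rightarrow>\<^sub>M env"
proof (rule measurable_envI)
 fix i :: "bool \<times> nat \<times> nat"
 obtain c k j where i: "i = (c, k, j)" by (cases i) auto
 show "(%y. flat y i) \<in> benv"
  unfolding i flat_def by (cases "c & j = N & k <= N"; cases "k = N") auto
qed

lemma edet_flat: "edet N (flat y) w = of_real (alf y) * pdet N y w"
proof -
 let ?M = "mat (Suc N) (Suc N) (%(i, j). if j < N then flat y (False, i, j) - w * flat y (True, i, j) else flat y (True, i, N))"
 have 1: "?M $$ (N, N) = of_real (alf y)" by (simp add: flat_def)
 have 2: "det (mat N N (%(i, j). ?M $$ (i, j))) = pdet N y w"
  unfolding pdet_def by (intro arg_cong[where f=det] eq_matI) (auto simp: flat_def)
 have 3: "det (mat (Suc N) (Suc N) (%(i, j). if i = N & j = N then 0 else ?M $$ (i, j))) = 0" (is "det ?Z = 0")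
 proof -
  have "det ?Z = (\<Sum>i<Suc N. ?Z $$ (i, N) * cofactor ?Z i N)"
   by (rule laplace_expansion_column) auto
  also have "... = 0" by (intro sum.neutral) (auto simp: flat_def)
  finally show ?thesis .
 qed
 have "edet N (flat y) w = det ?M" by (simp add: edet_def)
 also have "... = ?M $$ (N, N) * det (mat N N (%(i, j). ?M $$ (i, j))) +
  det (mat (Suc N) (Suc N) (%(i, j). if i = N & j = N then 0 else ?M $$ (i, j)))"
  by (rule det_corner) simp
 finally show ?thesis unfolding 1 2 3 by simp
qed

text \<open>Blocks of the deflated pencil that are integrated separately: the first N columns of
  both matrices (\<open>Kd\<close>), the last rows of these columns (\<open>Kl\<close>) and the last
  column of A (\<open>Ka\<close>). The eigenvector part is \<open>Kv N\<close>, the eigenvalue sits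
  at \<open>bN N\<close>.\<close>

abbreviation "Kd == UNIV \<times> {..<Suc N} \<times> {..<N}"

abbreviation "Kl == UNIV \<times> {N} \<times> {..<N}"

abbreviation "Ka == {True} \<times> {..<Suc N} \<times> {N}"

definition XX :: "complex set => complex list => pencil => ennreal" where
 "XX V zs y = FJ (Suc N) V zs (deflate N y) * esq (edet N y (y (bN N)))"

lemma measurable_XX: "open V ==> XX V zs \<in> benv"
proof -
 assume V: "open V"
 have "(%y. FJ (Suc N) V zs (deflate N y)) \<in> benv"
  using measurable_FJ[OF V] by measurable
 moreover have "(%y. esq (edet N y (y (bN N)))) \<in> benv"
 proof -
  have "(%y. edet N y (y (bN N))) \<in> benv" by (rule borel_measurable_edet) auto
  then show ?thesis by measurable
 qed
 ultimately show ?thesis unfolding XX_def by (rule borel_measurable_times_ennreal)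
qed

text \<open>Multiplying the matrix columns by a unitary U while keeping v and the eigenvalue
  commutes with \<open>deflate\<close>, because the columns that it produces are combinations of
  columns. The Gaussian weight and the moduli of all determinants are unchanged.\<close>

lemma XX_left_mult:
 assumes U: "U \<in> carrier_mat (Suc N) (Suc N)"
  and iso: "!!x. isom (Suc N) U x"
  and 1: "!!c i j. i < Suc N ==> j < N ==> y1 (c, i, j) = mv (Suc N) U (%k. y0 (c, k, j)) i"
  and 2: "!!i. i < Suc N ==> y1 (True, i, N) = mv (Suc N) U (%k. y0 (True, k, N)) i"
  and 3: "!!l. l <= N ==> y1 (False, l, N) = y0 (False, l, N)"
 shows "XX V zs y1 = XX V zs y0"
proof -
 have d: "cmod (det U) = 1" by (rule isometric_det[OF U iso])
 have "mat (Suc N) (Suc N) (%(i, j). if j < N then y1 (False, i, j) - w * y1 (True, i, j) else y1 (True, i, N)) =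
  mat (Suc N) (Suc N) (%(i, j). mv (Suc N) U (%k. if j < N then y0 (False, k, j) - w * y0 (True, k, j) else y0 (True, k, N)) i)" for w
  by (intro eq_matI) (auto simp: 1 2 mv_diff mv_scale)
 then have e: "edet N y1 w = det U * edet N y0 w" for w
  using det_mv[OF U, of "%k j. if j < N then y0 (False, k, j) - w * y0 (True, k, j) else y0 (True, k, N)"]
  by (simp add: edet_def)
 have "FJ (Suc N) V zs (deflate N y1) = FJ (Suc N) V zs (lmul (Suc N) U (deflate N y0))"
 proof (rule FJ_cong)
  fix c :: bool and i j :: nat assume ij: "i < Suc N" "j < Suc N"
  show "deflate N y1 (c, i, j) = lmul (Suc N) U (deflate N y0) (c, i, j)"
  proof (cases "j = N")
   case False
   then have "j < N" using ij by simp
   then show ?thesis using 1[OF ij(1)] by (simp add: deflate_def lmul_def)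
  next
   case True
   have s: "(\<Sum>l<N. y1 (c, i, l) * y1 (False, l, N)) = mv (Suc N) U (%k. \<Sum>l<N. y0 (c, k, l) * y0 (False, l, N)) i"
    unfolding mv_sum
   proof (rule sum.cong)
    fix l assume "l \<in> {..<N}"
    then show "y1 (c, i, l) * y1 (False, l, N) = mv (Suc N) U (%k. y0 (c, k, l) * y0 (False, l, N)) i"
     using 1[OF ij(1), of l c] 3[of l] mv_scale[of "Suc N" U "y0 (False, l, N)" "%k. y0 (c, k, l)" i]
     by (simp add: mult.commute)
   qed simp
   have t: "(if c then y1 (True, i, N) else y1 (False, N, N) * y1 (True, i, N)) =
    mv (Suc N) U (%k. if c then y0 (True, k, N) else y0 (False, N, N) * y0 (True, k, N)) i"
    using 2[OF ij(1)] 3[of N] by (cases c) (simp_all add: mv_scale)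
   have "deflate N y1 (c, i, j) = (if c then y1 (True, i, N) else y1 (False, N, N) * y1 (True, i, N)) - (\<Sum>l<N. y1 (c, i, l) * y1 (False, l, N))"
    using True ij by (simp add: deflate_def)
   also have "... = mv (Suc N) U (%k. (if c then y0 (True, k, N) else y0 (False, N, N) * y0 (True, k, N)) - (\<Sum>l<N. y0 (c, k, l) * y0 (False, l, N))) i"
    unfolding s t by (rule mv_diff[symmetric])
   also have "... = lmul (Suc N) U (deflate N y0) (c, i, j)"
    unfolding lmul_def prod.case using True by (intro mv_cong) (auto simp: deflate_def)
   finally show ?thesis .
  qed
 qed
 also have "... = FJ (Suc N) V zs (deflate N y0)" by (rule FJ_lmul[OF U iso])
 finally show ?thesis using 3[of N] by (simp add: XX_def e norm_mult d)
qed

text \<open>U is chosen from the last column of A, which is a parameter while \<open>Kd\<close> is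
  integrated. Substituting U in \<open>Kd\<close> and pulling it out of the integrand leaves that
  column flat.\<close>

lemma Intg_XX_flat:
 assumes V: "open V"
 shows "Intg Kd (XX V zs) y = Intg Kd (%y. XX V zs (flat y)) y"
proof -
 obtain U where U: "U \<in> carrier_mat (Suc N) (Suc N)"
  and iso: "!!x. isom (Suc N) U x"
  and al: "!!i. i < Suc N ==> U $$ (i, N) * of_real (alf y) = y (True, i, N)"
  using exists_unitary[of N "%i. y (True, i, N)"] unfolding alf_def by metis
 have d: "cmod (det U) = 1" by (rule isometric_det[OF U iso])
 then have d0: "det U ~= 0" by auto
 note L = lines_left[of "Suc N" N]
 have "Intg Kd (XX V zs) y = esq (det U) ^ (2 * N) *
  Intg Kd (%y. XX V zs (lines.lin Kd (%(c, i, j). i) (%(c, i, j) k. (c, k, j)) (Suc N) U y)) y"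
  by (rule lines.Intg_lin[OF L U d0 measurable_XX[OF V]])
 also have "... = Intg Kd (%y. XX V zs (lines.lin Kd (%(c, i, j). i) (%(c, i, j) k. (c, k, j)) (Suc N) U y)) y"
  using d by simp
 also have "... = Intg Kd (%y. XX V zs (flat y)) y"
 proof (rule Intg_cong)
  fix y' :: "pencil"
  assume "!!i. i ~: Kd ==> y' i = y i"
  then have a: "y' (c, i, j) = y (c, i, j)" if "~ (i < Suc N & j < N)" for c i j using that by auto
  have alf: "alf y' = alf y" unfolding alf_def by (simp add: a)
  let ?y1 = "lines.lin Kd (%(c, i, j). i) (%(c, i, j) k. (c, k, j)) (Suc N) U y'"
  have off: "?y1 (c, i, j) = y' (c, i, j)" if "~ (i < Suc N & j < N)" for c i j
   using that by (auto simp: lines.lin_def[OF L])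
  show "XX V zs ?y1 = XX V zs (flat y')"
  proof (rule XX_left_mult[OF U iso])
   fix c i j assume "i < Suc N" "j < N"
   then show "?y1 (c, i, j) = mv (Suc N) U (%k. flat y' (c, k, j)) i"
    unfolding lines.lin_def[OF L] mv_def by (simp add: flat_def)
  next
   fix i assume i: "i < Suc N"
   have "mv (Suc N) U (%k. flat y' (True, k, N)) i = U $$ (i, N) * of_real (alf y)"
    unfolding mv_def by (simp add: flat_def alf)
   then show "?y1 (True, i, N) = mv (Suc N) U (%k. flat y' (True, k, N)) i"
    using al[OF i] off[of i N True] a[of i N True] by simp
  next
   fix l assume "l <= N"
   then show "?y1 (False, l, N) = flat y' (False, l, N)"
    using off[of l N False] by (simp add: flat_def)
  qed
 qed
 finally show ?thesis .
qed

definition vdot :: "bool => nat => pencil => complex" where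
 "vdot c i y = (\<Sum>l<N. y (c, i, l) * y (False, l, N))"

definition rsq :: "bool => nat => pencil => real" where
 "rsq c i y = (\<Sum>l<N. csq (y (c, i, l)))"

definition vsq :: "pencil => real" where
 "vsq y = (\<Sum>l<N. csq (y (False, l, N)))"

definition shf :: "bool => pencil => complex" where
 "shf c y = (if c then of_real (alf y) else y (bN N) * of_real (alf y))"

text \<open>The Gaussian exponent of the deflated flat pencil, split into the rows i < N
  (\<open>Qup\<close>) and row N (\<open>Qlast\<close>). \<open>Qcen\<close> is what
  \<open>Qlast\<close> becomes when its square is completed.\<close>

definition Qup :: "pencil => real" where
 "Qup y = (\<Sum>c\<in>UNIV. \<Sum>i<N. rsq c i y + csq (vdot c i y))"

definition Qlast :: "pencil => real" where
 "Qlast y = (\<Sum>c\<in>UNIV. rsq c N y + csq (shf c y - vdot c N y))"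

definition Qcen :: "pencil => real" where
 "Qcen y = (\<Sum>c\<in>UNIV. rsq c N y + csq (vdot c N y))"

lemma borel_measurable_parts [measurable]:
 "vdot c i \<in> benv" "rsq c i \<in> benv" "vsq \<in> benv"
 "shf c \<in> benv"
proof -
 show "vdot c i \<in> benv" unfolding vdot_def
  by (intro borel_measurable_sum borel_measurable_times) auto
 have n: "(%y :: pencil. csq (y i)) \<in> benv" for i
  by (intro borel_measurable_power borel_measurable_norm) simp
 show "rsq c i \<in> benv" "vsq \<in> benv" unfolding rsq_def vsq_def
  by (intro borel_measurable_sum n)+
 show "shf c \<in> benv" unfolding shf_def
  using borel_measurable_alf measurable_env_component[of "bN N"] by (cases c) simp_all
qed

lemma borel_measurable_Q [measurable]:
 "Qup \<in> benv" "Qlast \<in> benv" "Qcen \<in> benv"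
 unfolding Qup_def Qlast_def Qcen_def by measurable

definition YY :: "complex set => complex list => pencil => ennreal" where
 "YY V zs y = ennreal (exp (- Qup y)) * indicator {y. hole N V y} y * (\<Prod>w\<leftarrow>zs. esq (pdet N y w))"

definition ZZ :: "complex set => complex list => complex => ennreal" where
 "ZZ V zs z = indicator (- V) z * (\<Prod>w\<leftarrow>zs. esq (z - w))"

lemma sq_deflate_flat: "sq (ix (Suc N)) (deflate N (flat y)) = Qup y + Qlast y"
proof -
 let ?d = "deflate N (flat y)"
 have vd: "(\<Sum>l<N. flat y (c, i, l) * flat y (False, l, N)) = vdot c i y" for c i
  unfolding vdot_def by (intro sum.cong) (auto simp: flat_def)
 have up: "(\<Sum>j<Suc N. csq (?d (c, i, j))) = rsq c i y + csq (vdot c i y)" if "i < N" for c i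
 proof -
  have "?d (c, i, N) = - vdot c i y" using that vd[of c i] by (simp add: deflate_def flat_def)
  moreover have "(\<Sum>j<N. csq (?d (c, i, j))) = rsq c i y"
   unfolding rsq_def by (intro sum.cong) (auto simp: deflate_def flat_def)
  ultimately show ?thesis by simp
 qed
 have last: "(\<Sum>j<Suc N. csq (?d (c, N, j))) = rsq c N y + csq (shf c y - vdot c N y)" for c
 proof -
  have "?d (c, N, N) = shf c y - vdot c N y" using vd[of c N] by (simp add: deflate_def flat_def shf_def)
  moreover have "(\<Sum>j<N. csq (?d (c, N, j))) = rsq c N y"
   unfolding rsq_def by (intro sum.cong) (auto simp: deflate_def flat_def)
  ultimately show ?thesis by simp
 qed
 have "sq (ix (Suc N)) ?d = (\<Sum>c\<in>UNIV. (\<Sum>i<N. \<Sum>j<Suc N. csq (?d (c, i, j))) + (\<Sum>j<Suc N. csq (?d (c, N, j))))"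
  unfolding sq_ix[OF finite_lessThan finite_lessThan] sum.lessThan_Suc[of _ N] ..
 also have "... = (\<Sum>c\<in>UNIV. (\<Sum>i<N. rsq c i y + csq (vdot c i y)) + (rsq c N y + csq (shf c y - vdot c N y)))"
  unfolding last using up by simp
 finally show ?thesis unfolding Qup_def Qlast_def by (simp only: sum.distrib)
qed

text \<open>After flattening, the determinant at w is (z - w) times \<open>alf y\<close> times the
  minor of size N, so eigenvalue, last column and minor separate. Each point of \<open>zs\<close>
  contributes one factor \<open>(alf y)\<^sup>2\<close>, the Jacobian one more together with a new
  factor at z.\<close>

lemma XX_flat:
 "XX V zs (flat y) = ZZ V zs (y (bN N)) * ennreal (((alf y)^2) ^ (length zs + 1)) * ennreal (exp (- Qlast y)) * YY V (y (bN N) # zs) y"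
proof (cases "alf y = 0")
 case True
 then show ?thesis by (simp add: XX_def edet_flat)
next
 case False
 define z where "z = y (bN N)"
 have fz: "flat y (bN N) = z" by (simp add: flat_def z_def)
 have pd: "pdet (Suc N) (deflate N (flat y)) w = (z - w) * (of_real (alf y) * pdet N y w)" for w
  unfolding pdet_deflate fz edet_flat ..
 have hole: "hole (Suc N) V (deflate N (flat y)) \<longleftrightarrow> z ~: V & hole N V y"
  unfolding hole_def pd using False by auto
 have prod: "(\<Prod>w\<leftarrow>zs. esq ((z - w) * (of_real (alf y) * pdet N y w))) =
  (\<Prod>w\<leftarrow>zs. esq (z - w)) * ennreal (((alf y)^2) ^ length zs) * (\<Prod>w\<leftarrow>zs. esq (pdet N y w))"
  by (induction zs) (simp_all add: norm_mult power_mult_distrib ennreal_mult mult_ac)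
 have "XX V zs (flat y) = ennreal (exp (- (Qup y + Qlast y))) * indicator {y. hole (Suc N) V y} (deflate N (flat y)) *
  (\<Prod>w\<leftarrow>zs. esq ((z - w) * (of_real (alf y) * pdet N y w))) * esq (of_real (alf y) * pdet N y z)"
  unfolding XX_def FJ_def sq_deflate_flat pd fz edet_flat ..
 also have "indicator {y. hole (Suc N) V y} (deflate N (flat y)) = indicator (- V) z * (indicator {y. hole N V y} y :: ennreal)"
  using hole by (simp add: indicator_def)
 also have "ennreal (exp (- (Qup y + Qlast y))) = ennreal (exp (- Qup y)) * ennreal (exp (- Qlast y))"
  by (simp only: minus_add_distrib exp_add ennreal_mult[OF exp_ge_zero exp_ge_zero])
 also have "esq (of_real (alf y) * pdet N y z) = ennreal ((alf y)^2) * esq (pdet N y z)"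
  by (simp add: norm_mult power_mult_distrib ennreal_mult)
 finally show ?thesis
  unfolding prod ZZ_def YY_def z_def[symmetric] by (simp add: ennreal_mult mult_ac)
qed

definition kap :: "pencil => ennreal" where
 "kap y = Intg ({True} \<times> {N} \<times> {..<N}) (%y. ennreal (exp (- (rsq True N y + csq (vdot True N y))))) y"

definition kcen :: "pencil => ennreal" where
 "kcen y = Intg Kl (%y. ennreal (exp (- Qcen y))) y"

lemma rsq_lin:
 fixes M v
 assumes iso: "!!x. whit N M y x"
  and 1: "!!j. j < N ==> y1 (c, i, j) = mv N M (%l. y' (c, i, l)) j"
  and 2: "!!l. l < N ==> y1 (False, l, N) = y (False, l, N)"
 shows "rsq c i y1 + csq (vdot c i y1) = rsq c i y'"
 using iso[of "%l. y' (c, i, l)"] by (simp add: rsq_def vdot_def 1 2)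

lemma kap_eq:
 assumes M: "M \<in> carrier_mat N N" "det M ~= 0"
  and iso: "!!x. whit N M y x"
 shows "kap y = esq (det M) * ennreal pi ^ N"
proof -
 let ?K = "{True} \<times> {N} \<times> {..<N}"
 have L: "lines ?K (%(c, i, j). j) (%(c, i, j) k. (c, i, k)) N 1"
  using lines_right[of "{True}" "{N}" N] by simp
 let ?lin = "lines.lin ?K (%(c, i, j). j) (%(c, i, j) k. (c, i, k)) N M"
 have "kap y = esq (det M) ^ 1 * Intg ?K (%y. ennreal (exp (- (rsq True N (?lin y) + csq (vdot True N (?lin y)))))) y"
  unfolding kap_def by (rule lines.Intg_lin[OF L M]) measurable
 also have "Intg ?K (%y. ennreal (exp (- (rsq True N (?lin y) + csq (vdot True N (?lin y)))))) y =
  Intg ?K (%y. ennreal (exp (- sq ?K y))) y"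
 proof (rule Intg_cong)
  fix y' :: "pencil"
  assume a: "!!i. i ~: ?K ==> y' i = y i"
  have "rsq True N (?lin y') + csq (vdot True N (?lin y')) = rsq True N y'"
  proof (rule rsq_lin[OF iso])
   show "?lin y' (True, N, j) = mv N M (%l. y' (True, N, l)) j" if "j < N" for j
    using that by (simp add: lines.lin_def[OF L] mv_def)
   show "?lin y' (False, l, N) = y (False, l, N)" if "l < N" for l
    using a by (simp add: lines.lin_def[OF L])
  qed
  also have "rsq True N y' = sq ?K y'"
   unfolding sq_def rsq_def by (rule sum.reindex_bij_witness[where i="%(c, i, j). j" and j="%j. (True, N, j)"]) auto
  finally show "ennreal (exp (- (rsq True N (?lin y') + csq (vdot True N (?lin y'))))) = ennreal (exp (- sq ?K y'))" by simp
 qed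
 also have "... = ennreal pi ^ N" using Intg_gauss[of ?K y] by (simp add: card_cartesian_product)
 finally show ?thesis by simp
qed

text \<open>The squared modulus of the determinant of any whitening matrix for v. Defining it by a
  Gaussian integral makes it visibly measurable in the pencil and independent of the chosen
  matrix.\<close>

definition del :: "pencil => ennreal" where
 "del y = kap y / ennreal pi ^ N"

lemma del_eq:
 assumes "M \<in> carrier_mat N N" "det M ~= 0"
  and "!!x. whit N M y x"
 shows "del y = esq (det M)"
 unfolding del_def kap_eq[OF assms] using pi_power_ennreal[of N] by (intro mult_divide_eq_ennreal) auto

lemma ex_whitening:
 "\<exists>M. M \<in> carrier_mat N N & det M ~= 0 &
  (\<forall>x. whit N M y x)"
 by (rule exists_whitening[of N "%i. y (False, i, N)"]) (intro exI conjI allI)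

lemma del_cong: "(!!l. l < N ==> y' (False, l, N) = y (False, l, N)) ==> del y' = del y"
proof -
 assume a: "!!l. l < N ==> y' (False, l, N) = y (False, l, N)"
 obtain M where M: "M \<in> carrier_mat N N" "det M ~= 0"
  "!!x. whit N M y x"
  using ex_whitening[of y] by blast
 have "(\<Sum>i<N. csq (mv N M x i)) + csq (\<Sum>i<N. mv N M x i * y' (False, i, N)) = (\<Sum>i<N. csq (x i))" for x
  using M(3)[of x] a by simp
 from del_eq[OF M(1,2) this] del_eq[OF M] show ?thesis by simp
qed

lemma measurable_kap: "kap \<in> benv" "kcen \<in> benv" "del \<in> benv"
proof -
 have "Intg ({True} \<times> {N} \<times> {..<N}) (%y. ennreal (exp (- (rsq True N y + csq (vdot True N y))))) \<in> benv"
  by (rule measurable_Int) auto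
 moreover have "kap = Intg ({True} \<times> {N} \<times> {..<N}) (%y. ennreal (exp (- (rsq True N y + csq (vdot True N y)))))"
  by (simp add: kap_def fun_eq_iff)
 ultimately show k: "kap \<in> benv" by simp
 have "Intg Kl (%y. ennreal (exp (- Qcen y))) \<in> benv"
  by (rule measurable_Int) auto
 moreover have "kcen = Intg Kl (%y. ennreal (exp (- Qcen y)))"
  by (simp add: kcen_def fun_eq_iff)
 ultimately show "kcen \<in> benv" by simp
 show "del \<in> benv" unfolding del_def using k by measurable
qed

lemma kcen_cong: "(!!l. l < N ==> y' (False, l, N) = y (False, l, N)) ==> kcen y' = kcen y"
 unfolding kcen_def
proof (rule Intg_cong_base)
 fix x assume a: "!!l. l < N ==> y' (False, l, N) = y (False, l, N)"
 have "Qcen (override_on y' x Kl) = Qcen (override_on y x Kl)"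
  unfolding Qcen_def rsq_def vdot_def using a by (simp add: override_on_def)
 then show "ennreal (exp (- Qcen (override_on y' x Kl))) = ennreal (exp (- Qcen (override_on y x Kl)))" by simp
qed

lemma sets_hole': "open V ==> indicator {y. hole N V y} \<in> (benv :: (_ => ennreal) set)"
 using sets_hole by (rule borel_measurable_indicator)

lemma measurable_YY: "open V ==> YY V zs \<in> benv"
 unfolding YY_def using sets_hole' borel_measurable_pdet_prod[of "%y. y" env N zs]
 by (intro borel_measurable_times_ennreal) auto

text \<open>Multiplication from the right by a whitening matrix turns the exponent
  \<open>Qup\<close> into the standard one. Each of the 2 N rows contributes one factor
  \<open>del y\<close>, and so does every determinant in the product.\<close>

lemma Intg_YY:
 assumes V: "open V"
 shows "Intg (ix N) (YY V zs) y = del y ^ (2 * N + length zs) * J N V zs"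
proof -
 obtain M where M: "M \<in> carrier_mat N N" "det M ~= 0"
  and iso: "!!x. whit N M y x"
  using ex_whitening[of y] by blast
 define D where "D = esq (det M)"
 have D: "del y = D" unfolding D_def by (rule del_eq[OF M iso])
 have L: "lines (ix N) (%(c, i, j). j) (%(c, i, j) k. (c, i, k)) N (2 * N)"
  using lines_right[of UNIV "{..<N}" N] by simp
 let ?lin = "lines.lin (ix N) (%(c, i, j). j) (%(c, i, j) k. (c, i, k)) N M"
 have "Intg (ix N) (YY V zs) y = D ^ (2 * N) * Intg (ix N) (%y. YY V zs (?lin y)) y"
  unfolding D_def by (rule lines.Intg_lin[OF L M measurable_YY[OF V]])
 also have "Intg (ix N) (%y. YY V zs (?lin y)) y = D ^ length zs * Intg (ix N) (FJ N V zs) y"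
 proof (rule Intg_cmult_cong[OF measurable_FJ[OF V]])
  fix y' :: "pencil"
  assume a: "!!i. i ~: ix N ==> y' i = y i"
  have lin: "?lin y' (c, i, j) = mv N M (%l. y' (c, i, l)) j" if "i < N" "j < N" for c i j
   using that by (simp add: lines.lin_def[OF L] mv_def)
  have "rsq c i (?lin y') + csq (vdot c i (?lin y')) = rsq c i y'" if "i < N" for c i
  proof (rule rsq_lin[OF iso])
   show "?lin y' (c, i, j) = mv N M (%l. y' (c, i, l)) j" if "j < N" for j
    using that \<open>i < N\<close> by (rule lin[rotated])
   show "?lin y' (False, l, N) = y (False, l, N)" for l
    using a by (simp add: lines.lin_def[OF L])
  qed
  then have Q: "Qup (?lin y') = sq (ix N) y'"
   unfolding Qup_def sq_ix[OF finite_lessThan finite_lessThan] by (simp add: rsq_def)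
  have pd: "pdet N (?lin y') w = pdet N y' w * det M" for w
  proof -
   have "mat N N (%(i, j). ?lin y' (False, i, j) - w * ?lin y' (True, i, j)) =
    mat N N (%(i, j). mv N M (%l. y' (False, i, l) - w * y' (True, i, l)) j)"
    by (intro eq_matI) (auto simp: lin mv_diff mv_scale)
   then show ?thesis using det_mv_right[OF M(1), of "%i l. y' (False, i, l) - w * y' (True, i, l)"] by (simp add: pdet_def)
  qed
  have h: "hole N V (?lin y') = hole N V y'" unfolding hole_def pd using M(2) by simp
  have p: "(\<Prod>w\<leftarrow>zs. esq (pdet N y' w * det M)) = D ^ length zs * (\<Prod>w\<leftarrow>zs. esq (pdet N y' w))"
   by (induction zs) (simp_all add: norm_mult power_mult_distrib ennreal_mult mult_ac D_def)
  show "YY V zs (?lin y') = D ^ length zs * FJ N V zs y'"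
   unfolding YY_def FJ_def Q pd p using h by (simp add: indicator_def mult_ac)
 qed
 finally show ?thesis unfolding Intg_FJ_base D by (simp add: power_add mult_ac)
qed

text \<open>Completing the square: |r|^2 + |a - r v|^2 is minimal at r = a cnj v / (1 + |v|^2), with
  minimum |a|^2 / (1 + |v|^2). The rows of A and of B have a = \<open>alf y\<close> and a = z
  \<open>alf y\<close>, whence the factor 1 + |z|^2.\<close>

lemma Qlast_translate:
 defines "T == %y. %i. if i \<in> Kl then y i + (case i of (c, i, l) => shf c y * cnj (y (False, l, N)) / of_real (1 + vsq y)) else y i"
 shows "Qlast (T y) = Qcen y + (alf y)^2 * (1 + csq (y (bN N))) / (1 + vsq y)"
proof -
 define s where "s = vsq y"
 have s0: "s >= 0" by (simp add: s_def vsq_def sum_nonneg)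
 then have s1: "1 + s ~= 0" by simp
 have sc: "complex_of_real (1 + s) ~= 0" using s1 by (simp only: of_real_eq_0_iff not_False_eq_True)
 have key: "rsq c N (T y) + csq (A - vdot c N (T y)) = rsq c N y + csq (vdot c N y) + csq A / (1 + s)"
  if A: "A = shf c y" for c A
 proof -
  define t where "t = vdot c N y"
  define B where "B = A / of_real (1 + s)"
  have Ty: "T y (c, N, l) = y (c, N, l) + B * cnj (y (False, l, N))" if "l < N" for l
   using that by (simp add: T_def A B_def s_def)
  have Tv: "T y (False, l, N) = y (False, l, N)" if "l < N" for l using that by (simp add: T_def)
  have sv: "(\<Sum>l<N. y (False, l, N) * cnj (y (False, l, N))) = of_real s"
   by (simp add: s_def vsq_def complex_norm_square flip: of_real_power)
  have "vdot c N (T y) = (\<Sum>l<N. y (c, N, l) * y (False, l, N) + B * (y (False, l, N) * cnj (y (False, l, N))))"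
   unfolding vdot_def by (intro sum.cong) (auto simp: Ty Tv algebra_simps)
  also have "... = t + B * of_real s" unfolding sum.distrib sum_distrib_left[symmetric] sv by (simp add: t_def vdot_def)
  finally have vd: "vdot c N (T y) = t + B * of_real s" .
  have nrm: "csq (p + q) = csq p + csq q + 2 * Re (p * cnj q)" for p q :: complex
  proof -
   have "(a + b)^2 + (c + d)^2 = a^2 + c^2 + (b^2 + d^2) + 2 * (a * b - c * - d)" for a b c d :: real
    by (simp add: power2_eq_square algebra_simps)
   then show ?thesis unfolding cmod_power2 plus_complex.sel times_complex.sel cnj.sel by blast
  qed
  have "rsq c N (T y) = (\<Sum>l<N. csq (y (c, N, l)) + csq B * csq (y (False, l, N)) + 2 * Re (cnj B * (y (c, N, l) * y (False, l, N))))"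
   unfolding rsq_def by (intro sum.cong) (auto simp: Ty nrm norm_mult power_mult_distrib mult_ac)
  also have "... = rsq c N y + csq B * s + 2 * Re (cnj B * t)"
   unfolding sum.distrib sum_distrib_left[symmetric] Re_sum[symmetric] by (simp add: rsq_def s_def vsq_def t_def vdot_def)
  finally have r: "rsq c N (T y) = rsq c N y + csq B * s + 2 * Re (cnj B * t)" .
  have AB: "A = B * of_real (1 + s)" unfolding B_def using sc by simp
  have Bt: "A - vdot c N (T y) = B + (- t)" unfolding vd AB by (simp add: algebra_simps)
  have 2: "csq (A - vdot c N (T y)) = csq B + csq t - 2 * Re (cnj B * t)"
   unfolding Bt nrm by simp
  have "csq A = csq B * (1 + s)^2"
   unfolding AB using s0 by (simp only: norm_mult norm_of_real power_mult_distrib power2_abs)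
  then have "csq A / (1 + s) = csq B * (1 + s)" using s1 by (simp add: power2_eq_square)
  then show ?thesis unfolding r 2 t_def[symmetric] by (simp add: algebra_simps)
 qed
 have alf: "alf (T y) = alf y" unfolding alf_def by (simp add: T_def)
 have "T y (bN N) = y (bN N)" by (simp add: T_def)
 then have shf: "shf c (T y) = shf c y" for c by (simp only: shf_def alf)
 have "Qlast (T y) = (\<Sum>c\<in>UNIV. rsq c N y + csq (vdot c N y) + csq (shf c y) / (1 + s))"
  unfolding Qlast_def shf by (intro sum.cong refl key)
 also have "... = Qcen y + (\<Sum>c\<in>UNIV. csq (shf c y) / (1 + s))"
  unfolding Qcen_def by (simp only: sum.distrib)
 also have "(\<Sum>c\<in>UNIV. csq (shf c y) / (1 + s)) = (alf y)^2 * (1 + csq (y (bN N))) / (1 + s)"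
  by (simp add: UNIV_bool shf_def norm_mult power_mult_distrib add_divide_distrib distrib_left mult.commute)
 finally show ?thesis by (simp add: s_def)
qed

lemma Intg_Qlast:
 "Intg Kl (%y. ennreal (exp (- Qlast y))) y =
  ennreal (exp (- ((alf y)^2 * (1 + csq (y (bN N))) / (1 + vsq y)))) * kcen y"
proof -
 define c :: "pencil => pencil"
  where "c y = (%(c, i, l). if i = N & l < N then shf c y * cnj (y (False, l, N)) / of_real (1 + vsq y) else 0)" for y
 have agree: "alf y' = alf y" "vsq y' = vsq y" "shf b y' = shf b y" "y' (bN N) = y (bN N)"
  if "!!i. i ~: Kl ==> y' i = y i" for y' b
  using that by (auto simp: alf_def vsq_def shf_def)
 have "Intg Kl (%y. ennreal (exp (- Qlast y))) y =
  Intg Kl (%y. ennreal (exp (- Qlast (%i. if i \<in> Kl then y i + c y i else y i)))) y"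
 proof (rule Intg_translate[symmetric, where F="%y. ennreal (exp (- Qlast y))"])
  fix y' :: "pencil" and i :: "bool \<times> nat \<times> nat"
  assume a: "!!i. i ~: Kl ==> y' i = y i"
  show "c y' i = c y i"
   using agree(2)[OF a] agree(3)[OF a] a by (auto simp: c_def split: prod.splits)
 qed auto
 also have "... = ennreal (exp (- ((alf y)^2 * (1 + csq (y (bN N))) / (1 + vsq y)))) * Intg Kl (%y. ennreal (exp (- Qcen y))) y"
 proof (rule Intg_cmult_cong)
  fix y' :: "pencil"
  assume a: "!!i. i ~: Kl ==> y' i = y i"
  have "(%i. if i \<in> Kl then y' i + c y' i else y' i) =
   (%i. if i \<in> Kl then y' i + (case i of (c, i, l) => shf c y' * cnj (y' (False, l, N)) / of_real (1 + vsq y')) else y' i)"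
   by (auto simp: fun_eq_iff c_def)
  then have "Qlast (%i. if i \<in> Kl then y' i + c y' i else y' i) =
   Qcen y' + (alf y')^2 * (1 + csq (y' (bN N))) / (1 + vsq y')"
   using Qlast_translate[of y'] by (simp only:)
  also have "... = Qcen y' + (alf y)^2 * (1 + csq (y (bN N))) / (1 + vsq y)"
   using agree(1)[OF a] agree(2)[OF a] agree(4)[OF a] by simp
  finally show "ennreal (exp (- Qlast (%i. if i \<in> Kl then y' i + c y' i else y' i))) =
   ennreal (exp (- ((alf y)^2 * (1 + csq (y (bN N))) / (1 + vsq y)))) * ennreal (exp (- Qcen y'))"
   by (simp only: minus_add_distrib exp_add ennreal_mult[OF exp_ge_zero exp_ge_zero] mult.commute)
 qed measurable
 finally show ?thesis by (simp add: kcen_def)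
qed

text \<open>The point z is stored in a coordinate outside \<open>ix N\<close>, so that measurability
  of J in z becomes an instance of measurability of partial integrals.\<close>

lemma J_as_Intg:
 "J N V (y (bN N) # zs) = Intg (ix N) (%y'. FJ N V (y' (bN N) # zs) y') y"
proof -
 have "Intg (ix N) (%y'. FJ N V (y' (bN N) # zs) y') y = Intg (ix N) (FJ N V (y (bN N) # zs)) y"
  by (rule Intg_cong) simp
 then show ?thesis by (simp add: Intg_FJ_base)
qed

lemma measurable_J_env:
 assumes V: "open V"
 shows "(%y. J N V (y (bN N) # zs)) \<in> benv"
proof -
 have "(%y. pdet N y (y (bN N))) \<in> benv" by (rule borel_measurable_pdet) auto
 then have p: "(%y. esq (pdet N y (y (bN N)))) \<in> benv" by measurable
 have "(%y. FJ N V zs y * esq (pdet N y (y (bN N)))) \<in> benv"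
  by (rule borel_measurable_times_ennreal[OF measurable_FJ[OF V] p])
 then have m: "(%y'. FJ N V (y' (bN N) # zs) y') \<in> benv"
  by (simp add: FJ_def mult_ac)
 have "Intg (ix N) (%y'. FJ N V (y' (bN N) # zs) y') \<in> benv"
  by (rule measurable_Int[OF _ m]) simp
 moreover have "(%y. J N V (y (bN N) # zs)) = Intg (ix N) (%y'. FJ N V (y' (bN N) # zs) y')"
  by (rule ext) (rule J_as_Intg)
 ultimately show ?thesis by simp
qed

lemma measurable_J:
 assumes V: "open V"
 shows "(%z. J N V (z # zs)) \<in> borel_measurable borel"
proof -
 have u: "(%z. (%_::bool \<times> nat \<times> nat. 0::complex)(bN N := z)) \<in> borel \<rightarrow>\<^sub>M env"
  by (rule measurable_env_upd) auto
 show ?thesis using measurable_compose[OF u measurable_J_env[OF V, of zs]] by simp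
qed

lemma measurable_ZZ: "open V ==> ZZ V zs \<in> borel_measurable borel"
proof -
 assume V: "open V"
 have "(%z. \<Prod>w\<leftarrow>zs. esq (z - w)) \<in> borel_measurable borel"
  by (induction zs) auto
 moreover have "- V \<in> sets borel" using V by auto
 ultimately show ?thesis unfolding ZZ_def by measurable
qed

definition rho :: "pencil => real" where
 "rho y = (1 + csq (y (bN N))) / (1 + vsq y)"

lemma vsq_nonneg: "0 <= vsq y" by (simp add: vsq_def sum_nonneg)

lemma rho_pos: "0 < rho y"
 unfolding rho_def using vsq_nonneg[of y] by (intro divide_pos_pos add_pos_nonneg) auto

lemma Intg_XX:
 assumes V: "open V"
 shows "Intg Kd (XX V zs) y = ZZ V zs (y (bN N)) * ennreal (((alf y)^2) ^ (length zs + 1)) *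
  (del y ^ (2 * N + (length zs + 1)) * J N V (y (bN N) # zs)) *
  (ennreal (exp (- ((alf y)^2 * rho y))) * kcen y)"
proof -
 let ?P = "%y. ZZ V zs (y (bN N)) * ennreal (((alf y)^2) ^ (length zs + 1))"
 let ?E = "%y. ennreal (exp (- Qlast y))"
 let ?D = "%y. del y ^ (2 * N + (length zs + 1)) * J N V (y (bN N) # zs)"
 have mX: "(%y. XX V zs (flat y)) \<in> benv"
  using measurable_XX[OF V] by measurable
 have inner: "Intg (ix N) (%y. XX V zs (flat y)) y = (?P y * ?D y) * ?E y" for y
 proof -
  have "Intg (ix N) (%y. XX V zs (flat y)) y = (?P y * ?E y) * Intg (ix N) (YY V (y (bN N) # zs)) y"
  proof (rule Intg_cmult_cong[OF measurable_YY[OF V]])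
   fix y' :: "pencil"
   assume "!!i. i ~: ix N ==> y' i = y i"
   then have a: "y' (c, i, j) = y (c, i, j)" if "~ (i < N & j < N)" for c i j using that by auto
   have 1: "y' (bN N) = y (bN N)" by (rule a) simp
   have 2: "alf y' = alf y" unfolding alf_def by (simp add: a)
   have 3: "rsq c N y' = rsq c N y" "vdot c N y' = vdot c N y" for c
    unfolding rsq_def vdot_def by (simp_all add: a)
   have 4: "Qlast y' = Qlast y" unfolding Qlast_def shf_def 1 2 3 ..
   show "XX V zs (flat y') = (?P y * ?E y) * YY V (y (bN N) # zs) y'"
    unfolding XX_flat 1 2 4 by (simp only: mult_ac)
  qed
  also have "Intg (ix N) (YY V (y (bN N) # zs)) y = ?D y"
   using Intg_YY[OF V, of "y (bN N) # zs" y] by simp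
  finally show ?thesis by (simp only: mult_ac)
 qed
 have "Intg Kd (XX V zs) y = Intg Kd (%y. XX V zs (flat y)) y" by (rule Intg_XX_flat[OF V])
 also have "... = Intg Kl (Intg (ix N) (%y. XX V zs (flat y))) y"
 proof -
  have K: "Kd = Kl \<union> ix N" by auto
  show ?thesis unfolding K by (rule Intg_Un[OF _ _ _ mX]) auto
 qed
 also have "Intg (ix N) (%y. XX V zs (flat y)) = (%y. (?P y * ?D y) * ?E y)"
  by (rule ext) (rule inner)
 also have "Intg Kl (%y. (?P y * ?D y) * ?E y) y = (?P y * ?D y) * Intg Kl ?E y"
 proof (rule Intg_cmult_cong)
  fix y' :: "pencil"
  assume "!!i. i ~: Kl ==> y' i = y i"
  then have a: "y' (c, i, j) = y (c, i, j)" if "~ (i = N & j < N)" for c i j using that by auto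
  have 1: "y' (bN N) = y (bN N)" by (rule a) simp
  have 2: "alf y' = alf y" unfolding alf_def by (simp add: a)
  have 3: "del y' = del y" by (rule del_cong) (simp add: a)
  show "(?P y' * ?D y') * ?E y' = (?P y * ?D y) * ?E y'" unfolding 1 2 3 ..
 qed measurable
 also have "Intg Kl ?E y = ennreal (exp (- ((alf y)^2 * rho y))) * kcen y"
  unfolding Intg_Qlast rho_def by simp
 finally show ?thesis .
qed

definition G0 :: "nat => ennreal" where
 "G0 k = Intg Ka (%y. ennreal (((alf y)^2) ^ (k + 1) * exp (- (alf y)\<^sup>2))) (%_. 0)"

text \<open>Dilation by 1 / sqrt r: the N + 1 complex coordinates give r^(-(N + 1)), the k + 1
  powers of the squared norm give r^(-(k + 1)).\<close>

lemma Intg_alf: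
 assumes r: "0 < r"
 shows "Intg Ka (%y. ennreal (((alf y)^2) ^ (k + 1) * exp (- ((alf y)^2 * r)))) y = ennreal (inverse (r ^ (N + k + 2))) * G0 k"
proof -
 let ?F = "%y. ennreal (((alf y)^2) ^ (k + 1) * exp (- ((alf y)^2 * r)))"
 let ?G = "%y. ennreal (((alf y)^2) ^ (k + 1) * exp (- (alf y)\<^sup>2))"
 define c where "c = complex_of_real (1 / sqrt r)"
 have c0: "c ~= 0" using r by (simp add: c_def)
 have c2: "csq c = inverse r" unfolding c_def norm_of_real power2_abs power_divide using r by (simp add: field_simps)
 have card: "card Ka = N + 1" by (simp add: card_cartesian_product)
 have mG: "?G \<in> benv" by measurable
 have "Intg Ka ?F y = esq c ^ card Ka * Intg Ka (%y. ?F (%i. if i \<in> Ka then c * y i else y i)) y"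
  by (rule Intg_scale[OF _ _ c0]) auto
 also have "Intg Ka (%y. ?F (%i. if i \<in> Ka then c * y i else y i)) y = ennreal (inverse r ^ (k + 1)) * Intg Ka ?G y"
 proof (rule Intg_cmult_cong[OF mG])
  fix y' :: "pencil"
  let ?y = "%i. if i \<in> Ka then c * y' i else y' i"
  have "(alf ?y)^2 = (\<Sum>i<Suc N. csq (c * y' (True, i, N)))"
   unfolding alf_def by (simp add: sum_nonneg)
  also have "... = inverse r * (\<Sum>i<Suc N. csq (y' (True, i, N)))"
   unfolding norm_mult power_mult_distrib c2 sum_distrib_left ..
  also have "... = inverse r * (alf y')^2"
   unfolding alf_def by (subst real_sqrt_pow2) (rule sum_nonneg, simp, rule refl)
  finally have e: "(alf ?y)^2 = inverse r * (alf y')^2" .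
  show "?F ?y = ennreal (inverse r ^ (k + 1)) * ?G y'"
   unfolding e using r by (subst ennreal_mult[symmetric]) (auto simp: power_mult_distrib mult_ac)
 qed
 also have "Intg Ka ?G y = G0 k"
  unfolding G0_def by (rule Intg_cong_base) (simp add: alf_def)
 finally have "Intg Ka ?F y = ennreal (inverse r) ^ (N + 1) * (ennreal (inverse r ^ (k + 1)) * G0 k)"
  unfolding c2 card .
 also have "... = ennreal (inverse r ^ (N + 1) * inverse r ^ (k + 1)) * G0 k"
  using r by (simp add: ennreal_mult ennreal_power mult.assoc)
 also have "inverse r ^ (N + 1) * inverse r ^ (k + 1) = inverse (r ^ (N + k + 2))"
  by (simp add: power_inverse[symmetric] flip: power_add)
 finally show ?thesis .
qed

definition CC :: "nat => ennreal" where
 "CC k = Intg (Kv N) (%y. del y ^ (2 * N + (k + 1)) * kcen y * ennreal ((1 + vsq y) ^ (N + k + 2))) (%_. 0) * G0 k"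

text \<open>Since the powers of 1 + |z|^2 and 1 + |v|^2 separate, everything except the integral
  over z is collected in \<open>CC\<close>, which depends on N and on the length of
  \<open>zs\<close> but not on V. For an empty list the exponent is N + 2, the n + 1 of the
  spherical weight with n = N + 1.\<close>

theorem J_recursion:
 assumes V: "open V"
 shows "of_nat (Suc N) * J (Suc N) V zs = CC (length zs) *
  (\<integral>\<^sup>+z. ZZ V zs z * ennreal (inverse ((1 + csq z) ^ (N + length zs + 2))) * J N V (z # zs) \<partial>lborel)"
proof -
 define k where "k = length zs"
 let ?B = "%y. del y ^ (2 * N + (k + 1)) * kcen y * ennreal ((1 + vsq y) ^ (N + k + 2))"
 let ?Z = "%z. ZZ V zs z * ennreal (inverse ((1 + csq z) ^ (N + k + 2))) * J N V (z # zs)"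
 have mB: "?B \<in> benv" using measurable_kap by measurable
 have mZ: "?Z \<in> borel_measurable borel"
  using measurable_ZZ[OF V, of zs] measurable_J[OF V, of zs] by measurable
 have mX: "XX V zs \<in> benv" by (rule measurable_XX[OF V])
 have A: "Intg Ka (Intg Kd (XX V zs)) y = ?Z (y (bN N)) * (?B y * G0 k)" for y
 proof -
  let ?F = "%y'. ennreal (((alf y')^2) ^ (k + 1) * exp (- ((alf y')^2 * rho y)))"
  have "Intg Ka (Intg Kd (XX V zs)) y = (ZZ V zs (y (bN N)) * (del y ^ (2 * N + (k + 1)) * J N V (y (bN N) # zs)) * kcen y) * Intg Ka ?F y"
  proof (rule Intg_cmult_cong)
   fix y' :: "pencil"
   assume "!!i. i ~: Ka ==> y' i = y i"
   then have a: "y' (False, i, j) = y (False, i, j)" for i j by auto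
   have 1: "y' (bN N) = y (bN N)" by (rule a)
   have 2: "rho y' = rho y" unfolding rho_def vsq_def by (simp add: a)
   have 3: "del y' = del y" by (rule del_cong) (simp add: a)
   have 4: "kcen y' = kcen y" by (rule kcen_cong) (simp add: a)
   have 5: "?F y' = ennreal (((alf y')^2) ^ (k + 1)) * ennreal (exp (- ((alf y')^2 * rho y)))"
    by (rule ennreal_mult) auto
   show "Intg Kd (XX V zs) y' = (ZZ V zs (y (bN N)) * (del y ^ (2 * N + (k + 1)) * J N V (y (bN N) # zs)) * kcen y) * ?F y'"
    unfolding Intg_XX[OF V] k_def[symmetric] 5 unfolding 1 2 3 4 by (simp only: mult_ac)
  qed measurable
  also have "Intg Ka ?F y = ennreal (inverse (rho y ^ (N + k + 2))) * G0 k"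
   by (rule Intg_alf[OF rho_pos])
  also have "ennreal (inverse (rho y ^ (N + k + 2))) =
   ennreal (inverse ((1 + csq (y (bN N))) ^ (N + k + 2))) * ennreal ((1 + vsq y) ^ (N + k + 2))"
   unfolding rho_def power_divide inverse_divide using vsq_nonneg[of y]
   by (subst ennreal_mult[symmetric]) (auto simp: divide_inverse mult.commute)
  finally show ?thesis by (simp only: mult_ac)
 qed
 have B: "Intg (Kv N) (Intg Ka (Intg Kd (XX V zs))) y = ?Z (y (bN N)) * CC k" for y
 proof -
  have "Intg (Kv N) (Intg Ka (Intg Kd (XX V zs))) y = (?Z (y (bN N)) * G0 k) * Intg (Kv N) ?B y"
  proof (rule Intg_cmult_cong[OF mB])
   fix y' :: "pencil"
   assume "!!i. i ~: Kv N ==> y' i = y i"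
   then have "y' (bN N) = y (bN N)" by auto
   then show "Intg Ka (Intg Kd (XX V zs)) y' = (?Z (y (bN N)) * G0 k) * ?B y'"
    unfolding A by (simp only: mult_ac)
  qed
  also have "Intg (Kv N) ?B y = Intg (Kv N) ?B (%_. 0)"
  proof (rule Intg_cong_base)
   fix x
   have "del (override_on y x (Kv N)) = del (override_on (%_. 0) x (Kv N))"
    by (rule del_cong) (simp add: override_on_def)
   moreover have "kcen (override_on y x (Kv N)) = kcen (override_on (%_. 0) x (Kv N))"
    by (rule kcen_cong) (simp add: override_on_def)
   moreover have "vsq (override_on y x (Kv N)) = vsq (override_on (%_. 0) x (Kv N))"
    by (simp add: vsq_def override_on_def)
   ultimately show "?B (override_on y x (Kv N)) = ?B (override_on (%_. 0) x (Kv N))" by (simp only:)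
  qed
  finally show ?thesis unfolding CC_def by (simp only: mult_ac)
 qed
 have mXd: "Intg Kd (XX V zs) \<in> benv" by (rule measurable_Int[OF _ mX]) simp
 have split: "ix (Suc N) = {bN N} \<union> (Kv N \<union> (Ka \<union> Kd))"
  by (auto simp: less_Suc_eq)
 have e1: "Intg (Ka \<union> Kd) (XX V zs) = Intg Ka (Intg Kd (XX V zs))"
  by (rule ext, rule Intg_Un[OF _ _ _ mX]) auto
 have e2: "Intg (Kv N \<union> (Ka \<union> Kd)) (XX V zs) = Intg (Kv N) (Intg (Ka \<union> Kd) (XX V zs))"
  by (rule ext, rule Intg_Un[OF _ _ _ mX]) auto
 have "of_nat (Suc N) * J (Suc N) V zs = Intg (ix (Suc N)) (XX V zs) (%_. 0)"
  unfolding J_def XX_def by (rule pencil_deflation[OF measurable_FJ[OF V]])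
 also have "... = Intg {bN N} (Intg (Kv N \<union> (Ka \<union> Kd)) (XX V zs)) (%_. 0)"
  unfolding split by (rule Intg_Un[OF _ _ _ mX]) auto
 also have "Intg (Kv N \<union> (Ka \<union> Kd)) (XX V zs) = (%y. ?Z (y (bN N)) * CC k)"
  unfolding e2 e1 by (rule ext) (rule B)
 also have "Intg {bN N} (%y. ?Z (y (bN N)) * CC k) (%_. 0) = (\<integral>\<^sup>+z. ?Z z * CC k \<partial>lborel)"
 proof (subst Intg_singleton)
  show "(%y. ?Z (y (bN N)) * CC k) \<in> benv"
   using measurable_compose[OF measurable_env_component[of "bN N"] mZ] by measurable
 qed simp
 also have "... = (\<integral>\<^sup>+z. ?Z z \<partial>lborel) * CC k" by (rule nn_integral_multc) (use mZ in simp)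
 finally show ?thesis by (simp add: k_def mult.commute)
qed

end

section \<open>Gram determinants\<close>

text \<open>Laplace expansion along the border row, then along the border column of the minors that
  remain.\<close>

lemma det_bordered:
 fixes G :: "'a :: comm_ring_1 mat" and a b :: "nat => 'a"
 assumes G: "G \<in> carrier_mat n n"
 shows "det (mat (Suc n) (Suc n) (%(i, j). if i = 0 then (if j = 0 then c else - b (j - 1))
   else if j = 0 then a (i - 1) else G $$ (i - 1, j - 1))) =
  c * det G + (\<Sum>j<n. \<Sum>i<n. a i * b j * cofactor G i j)" (is "det ?B = _")
proof -
 have BC: "?B \<in> carrier_mat (Suc n) (Suc n)" by simp
 have "det ?B = (\<Sum>j<Suc n. ?B $$ (0, j) * cofactor ?B 0 j)"
  by (rule laplace_expansion_row[OF BC]) simp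
 also have "... = ?B $$ (0, 0) * cofactor ?B 0 0 + (\<Sum>j<n. ?B $$ (0, Suc j) * cofactor ?B 0 (Suc j))"
  by (rule sum.lessThan_Suc_shift)
 also have "cofactor ?B 0 0 = det G"
  unfolding cofactor_def using G
  by simp (intro arg_cong[where f=det] eq_matI, auto simp: mat_delete_def)
 also have "(\<Sum>j<n. ?B $$ (0, Suc j) * cofactor ?B 0 (Suc j)) = (\<Sum>j<n. \<Sum>i<n. a i * b j * cofactor G i j)"
 proof (rule sum.cong[OF refl])
  fix j assume "j \<in> {..<n}"
  then have j: "j < n" by simp
  then obtain n' where n': "n = Suc n'" by (cases n) auto
  let ?M = "mat_delete ?B 0 (Suc j)"
  have MC: "?M \<in> carrier_mat n n" using mat_delete_carrier[OF BC] by simp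
  have "det ?M = (\<Sum>i<n. ?M $$ (i, 0) * cofactor ?M i 0)"
   by (rule laplace_expansion_column[OF MC]) (simp add: n')
  also have "... = (\<Sum>i<n. a i * ((-1) ^ i * det (mat_delete G i j)))"
  proof (rule sum.cong[OF refl])
   fix i assume "i \<in> {..<n}"
   then have i: "i < n" by simp
   have 1: "?M $$ (i, 0) = a i" using i n' by (simp add: mat_delete_def)
   have "mat_delete ?M i 0 = mat_delete G i j"
    using i j n' G by (intro eq_matI) (auto simp: mat_delete_def)
   then show "?M $$ (i, 0) * cofactor ?M i 0 = a i * ((-1) ^ i * det (mat_delete G i j))"
    unfolding 1 by (simp add: cofactor_def)
  qed
  finally have dM: "det ?M = (\<Sum>i<n. a i * ((-1) ^ i * det (mat_delete G i j)))" .
  have "?B $$ (0, Suc j) * cofactor ?B 0 (Suc j) = - b j * ((-1) ^ Suc j * det ?M)"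
   using j by (simp add: cofactor_def)
  also have "... = (\<Sum>i<n. a i * b j * cofactor G i j)"
   unfolding dM sum_distrib_left by (intro sum.cong refl) (simp add: cofactor_def power_add mult_ac)
  finally show "?B $$ (0, Suc j) * cofactor ?B 0 (Suc j) = (\<Sum>i<n. a i * b j * cofactor G i j)" .
 qed
 finally show ?thesis by simp
qed

text \<open>The matrix determinant lemma with cofactors in place of an inverse, hence also for
  singular G. A unimodular column operation clears the border row of a bordered matrix and produces
  the update in its block.\<close>

lemma det_rank_one_update:
 fixes G :: "'a :: idom mat" and a b :: "nat => 'a"
 assumes G: "G \<in> carrier_mat n n"
 shows "det (mat n n (%(i, j). G $$ (i, j) + a i * b j)) = det G + (\<Sum>j<n. \<Sum>i<n. a i * b j * cofactor G i j)"
proof -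
 let ?B = "mat (Suc n) (Suc n) (%(i, j). if i = 0 then (if j = 0 then 1 else - b (j - 1))
   else if j = 0 then a (i - 1) else G $$ (i - 1, j - 1))"
 let ?C = "mat (Suc n) (Suc n) (%(i, j). if i = j then 1 else if i = 0 then b (j - 1) else 0)"
 let ?D = "mat (Suc n) (Suc n) (%(i, j). if i = 0 then (if j = 0 then 1 else - 0)
   else if j = 0 then a (i - 1) else mat n n (%(i, j). G $$ (i, j) + a i * b j) $$ (i - 1, j - 1))"
 have "?B * ?C = ?D"
 proof (rule eq_matI)
  fix i j assume "i < dim_row ?D" "j < dim_col ?D"
  then have ij: "i < Suc n" "j < Suc n" by auto
  have "(?B * ?C) $$ (i, j) = (\<Sum>l<Suc n. ?B $$ (i, l) * ?C $$ (l, j))"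
   using ij by (simp add: scalar_prod_def atLeast0LessThan)
  also have "... = ?B $$ (i, 0) * ?C $$ (0, j) + (\<Sum>l<n. ?B $$ (i, Suc l) * ?C $$ (Suc l, j))"
   by (rule sum.lessThan_Suc_shift)
  also have "... = ?D $$ (i, j)"
  proof (cases j)
   case 0
   then have "(\<Sum>l<n. ?B $$ (i, Suc l) * ?C $$ (Suc l, j)) = 0" using ij by (intro sum.neutral) auto
   then show ?thesis using 0 ij by auto
  next
   case (Suc j')
   have "(\<Sum>l<n. ?B $$ (i, Suc l) * ?C $$ (Suc l, j)) = (\<Sum>l<n. if l = j' then ?B $$ (i, j) else 0)"
    using ij Suc by (intro sum.cong) auto
   also have "... = ?B $$ (i, j)" using Suc ij by simp
   finally show ?thesis using Suc ij by (cases i) auto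
  qed
  finally show "(?B * ?C) $$ (i, j) = ?D $$ (i, j)" .
 qed auto
 then have "det ?B * det ?C = det ?D"
  using det_mult[of ?B "Suc n" ?C] by simp
 moreover have "det ?C = 1"
 proof -
  have "upper_triangular ?C" by (auto simp: upper_triangular_def)
  then have "det ?C = prod_list (diag_mat ?C)" by (rule det_upper_triangular[where n="Suc n"]) simp
  also have "... = (\<Prod>i\<in>{0..<Suc n}. ?C $$ (i, i))" by (simp add: prod_list_diag_prod)
  also have "... = 1" by (intro prod.neutral) auto
  finally show ?thesis .
 qed
 moreover have "det ?D = det (mat n n (%(i, j). G $$ (i, j) + a i * b j))"
  using det_bordered[of "mat n n (%(i, j). G $$ (i, j) + a i * b j)" n 1 "%_. 0" a] by simp
 moreover have "det ?B = det G + (\<Sum>j<n. \<Sum>i<n. a i * b j * cofactor G i j)"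
  using det_bordered[OF G, of 1 b a] by simp
 ultimately show ?thesis by simp
qed

section \<open>Gram matrices of monomials\<close>

definition ent :: "(complex => real) => nat => nat => complex" where
 "ent h i j = (\<integral>z. of_real (h z) * (z ^ i * cnj z ^ j) \<partial>lborel)"

definition gram :: "nat => (complex => real) => complex mat" where
 "gram n h = mat n n (%(i, j). ent h i j)"

text \<open>Makes the entries with indices up to N integrable, since |z|^(i + j) is at most (1 +
  |z|^2)^N for i and j at most N.\<close>

definition adm :: "nat => (complex => real) => bool" where
 "adm N h \<longleftrightarrow> h \<in> borel_measurable borel & (\<forall>z. 0 <= h z) & integrable lborel (%z. h z * (1 + csq z) ^ N)"

lemma cmod_power_le:
 assumes "k <= 2 * N"
 shows "cmod z ^ k <= (1 + csq z) ^ N"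
proof -
 let ?s = "sqrt (1 + csq z)"
 have "cmod z <= ?s" by (rule real_le_rsqrt) simp
 then have "cmod z ^ k <= ?s ^ k" by (intro power_mono) auto
 also have "... <= ?s ^ (2 * N)" by (rule power_increasing[OF assms]) simp
 also have "... = (1 + csq z) ^ N" by (simp add: power_mult)
 finally show ?thesis .
qed

lemma integrable_ent:
 assumes h: "adm N h" and ij: "i <= N" "j <= N"
 shows "integrable lborel (%z. of_real (h z) * (z ^ i * cnj z ^ j))"
proof (rule Bochner_Integration.integrable_bound)
 show "integrable lborel (%z. h z * (1 + csq z) ^ N)" using h by (simp add: adm_def)
 have [measurable]: "h \<in> borel_measurable borel" using h by (simp add: adm_def)
 have [measurable]: "cnj \<in> borel_measurable borel"
  by (intro borel_measurable_continuous_onI continuous_intros)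
 show "(%z. of_real (h z) * (z ^ i * cnj z ^ j)) \<in> borel_measurable lborel" by measurable
 show "AE z in lborel. norm (of_real (h z) * (z ^ i * cnj z ^ j)) <= norm (h z * (1 + csq z) ^ N)"
 proof (intro AE_I2)
  fix z
  have "norm (of_real (h z) * (z ^ i * cnj z ^ j)) = \<bar>h z\<bar> * cmod z ^ (i + j)"
   by (simp add: norm_mult norm_power power_add)
  also have "... <= \<bar>h z\<bar> * (1 + csq z) ^ N"
   using ij by (intro mult_left_mono cmod_power_le) auto
  finally show "norm (of_real (h z) * (z ^ i * cnj z ^ j)) <= norm (h z * (1 + csq z) ^ N)"
   by (simp add: abs_mult)
 qed
qed

lemma cmod_diff_sq_le: "csq (x - z) <= 2 * (1 + csq z) * (1 + csq x)"
proof -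
 have "csq (x - z) <= (cmod x + cmod z)\<^sup>2" by (intro power_mono norm_triangle_ineq4) auto
 also have "... <= 2 * csq x + 2 * csq z"
  using sum_squares_bound[of "cmod x" "cmod z"] by (simp add: power2_sum)
 also have "... <= 2 * (1 + csq z) * (1 + csq x)"
  by (simp add: algebra_simps)
 finally show ?thesis .
qed

lemma adm_shift:
 assumes h: "adm (Suc N) h"
 shows "adm N (%x. h x * csq (x - z))"
 unfolding adm_def
proof (intro conjI allI)
 have [measurable]: "h \<in> borel_measurable borel" using h by (simp add: adm_def)
 have h0: "0 <= h x" for x using h by (simp add: adm_def)
 show "(%x. h x * csq (x - z)) \<in> borel_measurable borel" by measurable
 show "0 <= h x * csq (x - z)" for x using h0 by simp
 show "integrable lborel (%x. h x * csq (x - z) * (1 + csq x) ^ N)"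
 proof (rule Bochner_Integration.integrable_bound)
  show "integrable lborel (%x. 2 * (1 + csq z) * (h x * (1 + csq x) ^ Suc N))"
   using h by (intro integrable_mult_right) (simp add: adm_def)
  show "AE x in lborel. norm (h x * csq (x - z) * (1 + csq x) ^ N) <=
   norm (2 * (1 + csq z) * (h x * (1 + csq x) ^ Suc N))"
  proof (intro AE_I2)
   fix x
   have p: "0 <= (1 + csq x) ^ N" by (intro zero_le_power add_nonneg_nonneg) auto
   have "h x * csq (x - z) * (1 + csq x) ^ N <= h x * (2 * (1 + csq z) * (1 + csq x)) * (1 + csq x) ^ N"
    using h0 p by (intro mult_right_mono mult_left_mono cmod_diff_sq_le) auto
   also have "... = 2 * (1 + csq z) * (h x * (1 + csq x) ^ Suc N)" by (simp add: mult_ac)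
   finally show "norm (h x * csq (x - z) * (1 + csq x) ^ N) <=
    norm (2 * (1 + csq z) * (h x * (1 + csq x) ^ Suc N))"
    using h0[of x] p by (simp add: abs_mult)
  qed
 qed measurable
qed

lemma ent_shift:
 assumes h: "adm N h" and ij: "i < N" "j < N"
 shows "ent (%x. h x * csq (x - z)) i j =
  ent h (Suc i) (Suc j) - z * ent h i (Suc j) - cnj z * ent h (Suc i) j + z * cnj z * ent h i j"
proof -
 have int: "integrable lborel (%z. of_real (h z) * (z ^ i' * cnj z ^ j'))" if "i' <= N" "j' <= N" for i' j'
  by (rule integrable_ent[OF h that])
 have e: "complex_of_real (h x * csq (x - z)) * (x ^ i * cnj x ^ j) =
  of_real (h x) * (x ^ Suc i * cnj x ^ Suc j) - z * (of_real (h x) * (x ^ i * cnj x ^ Suc j))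
   - cnj z * (of_real (h x) * (x ^ Suc i * cnj x ^ j)) + z * cnj z * (of_real (h x) * (x ^ i * cnj x ^ j))" for x
  by (simp only: of_real_mult complex_norm_square complex_cnj_diff power_Suc) (simp add: algebra_simps)
 have i1: "integrable lborel (%x. of_real (h x) * (x ^ Suc i * cnj x ^ Suc j))"
  and i2: "integrable lborel (%x. z * (of_real (h x) * (x ^ i * cnj x ^ Suc j)))"
  and i3: "integrable lborel (%x. cnj z * (of_real (h x) * (x ^ Suc i * cnj x ^ j)))"
  and i4: "integrable lborel (%x. z * cnj z * (of_real (h x) * (x ^ i * cnj x ^ j)))"
  using ij by (intro int integrable_mult_right; simp)+
 show ?thesis
  unfolding ent_def e
  by (simp only: Bochner_Integration.integral_add[OF Bochner_Integration.integrable_diff[OF Bochner_Integration.integrable_diff[OF i1 i2] i3] i4]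
    Bochner_Integration.integral_diff[OF Bochner_Integration.integrable_diff[OF i1 i2] i3]
    Bochner_Integration.integral_diff[OF i1 i2] integral_mult_right_zero)
qed

text \<open>Both sides are the increment of the determinant when the rank-one matrix of the vector
  (z^i) is added to the larger Gram matrix. In the basis 1, x - z, (x - z) x, ... that vector
  becomes the first unit vector and the complementary minor is the Gram matrix for h |x - z|^2; P
  and Q perform this change of basis.\<close>

lemma det_gram_shift:
 assumes h: "adm N h"
 shows "det (gram N (%x. h x * csq (x - z))) =
  (\<Sum>j<Suc N. \<Sum>i<Suc N. z ^ i * cnj z ^ j * cofactor (gram (Suc N) h) i j)"
proof -
 let ?n = "Suc N"
 define G where "G = gram ?n h"
 have GC: "G \<in> carrier_mat ?n ?n" by (simp add: G_def gram_def)
 define P where "P = mat ?n ?n (%(i, j). if i = j then 1 else if i = Suc j then - z else 0)"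
 define Q where "Q = mat ?n ?n (%(i, j). if i = j then 1 else if j = Suc i then - cnj z else 0)"
 have PC: "P \<in> carrier_mat ?n ?n" "Q \<in> carrier_mat ?n ?n" by (simp_all add: P_def Q_def)
 have detQ: "det Q = 1"
 proof -
  have "upper_triangular Q" by (auto simp: upper_triangular_def Q_def)
  then have "det Q = prod_list (diag_mat Q)" using PC(2) by (rule det_upper_triangular)
  also have "... = (\<Prod>i\<in>{0..<?n}. Q $$ (i, i))" using PC by (simp add: prod_list_diag_prod)
  also have "... = 1" by (intro prod.neutral) (auto simp: Q_def)
  finally show ?thesis .
 qed
 have detP: "det P = 1"
 proof -
  have "det P = prod_list (diag_mat P)" by (rule det_lower_triangular[OF _ PC(1)]) (auto simp: P_def)
  also have "... = (\<Prod>i\<in>{0..<?n}. P $$ (i, i))" using PC by (simp add: prod_list_diag_prod)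
  also have "... = 1" by (intro prod.neutral) (auto simp: P_def)
  finally show ?thesis .
 qed
 have mulP: "(P * M) $$ (i, j) = M $$ (i, j) - (if i = 0 then 0 else z * M $$ (i - 1, j))"
  if M: "M \<in> carrier_mat ?n ?n" and ij: "i < ?n" "j < ?n" for M i j
 proof -
  have "(P * M) $$ (i, j) = (\<Sum>l<?n. P $$ (i, l) * M $$ (l, j))"
   using ij M PC by (simp add: scalar_prod_def atLeast0LessThan)
  also have "... = (\<Sum>l<?n. (if l = i then M $$ (i, j) else 0) + (if i ~= 0 & l = i - 1 then - z * M $$ (i - 1, j) else 0))"
   using ij by (intro sum.cong) (auto simp: P_def)
  also have "... = M $$ (i, j) - (if i = 0 then 0 else z * M $$ (i - 1, j))"
   using ij unfolding sum.distrib by (cases "i = 0") auto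
  finally show ?thesis .
 qed
 have mulQ: "(M * Q) $$ (i, j) = M $$ (i, j) - (if j = 0 then 0 else cnj z * M $$ (i, j - 1))"
  if M: "M \<in> carrier_mat ?n ?n" and ij: "i < ?n" "j < ?n" for M i j
 proof -
  have "(M * Q) $$ (i, j) = (\<Sum>l<?n. M $$ (i, l) * Q $$ (l, j))"
   using ij M PC by (simp add: scalar_prod_def atLeast0LessThan)
  also have "... = (\<Sum>l<?n. (if l = j then M $$ (i, j) else 0) + (if j ~= 0 & l = j - 1 then - cnj z * M $$ (i, j - 1) else 0))"
   using ij by (intro sum.cong) (auto simp: Q_def)
  also have "... = M $$ (i, j) - (if j = 0 then 0 else cnj z * M $$ (i, j - 1))"
   using ij unfolding sum.distrib by (cases "j = 0") auto
  finally show ?thesis .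
 qed
 have mulPQ: "(P * M * Q) $$ (i, j) = M $$ (i, j) - (if i = 0 then 0 else z * M $$ (i - 1, j))
   - (if j = 0 then 0 else cnj z * (M $$ (i, j - 1) - (if i = 0 then 0 else z * M $$ (i - 1, j - 1))))"
  if M: "M \<in> carrier_mat ?n ?n" and ij: "i < ?n" "j < ?n" for M i j
  using mulQ[of "P * M" i j] mulP[OF M] M PC ij by simp
 have detPQ: "det (P * M * Q) = det M" if "M \<in> carrier_mat ?n ?n" for M
  using that PC by (simp add: det_mult[of _ ?n] detP detQ)
 define G1 where "G1 = mat ?n ?n (%(i, j). G $$ (i, j) + z ^ i * cnj z ^ j)"
 have G1C: "G1 \<in> carrier_mat ?n ?n" by (simp add: G1_def)
 define G' where "G' = P * G * Q"
 have G'C: "G' \<in> carrier_mat ?n ?n" using PC GC by (simp add: G'_def)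
 have upd: "P * G1 * Q = mat ?n ?n (%(i, j). G' $$ (i, j) + (if i = 0 then 1 else 0) * (if j = 0 then 1 else 0))"
 proof (rule eq_matI)
  fix i j assume "i < dim_row (mat ?n ?n (%(i, j). G' $$ (i, j) + (if i = 0 then 1 else 0) * (if j = 0 then 1 else 0)))"
   "j < dim_col (mat ?n ?n (%(i, j). G' $$ (i, j) + (if i = 0 then 1 else 0) * (if j = 0 then 1 else 0)))"
  then have ij: "i < ?n" "j < ?n" by auto
  have g: "(P * G1 * Q) $$ (i, j) = G' $$ (i, j) + ((z ^ i * cnj z ^ j) - (if i = 0 then 0 else z * (z ^ (i - 1) * cnj z ^ j))
   - (if j = 0 then 0 else cnj z * ((z ^ i * cnj z ^ (j - 1)) - (if i = 0 then 0 else z * (z ^ (i - 1) * cnj z ^ (j - 1))))))"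
   unfolding G'_def mulPQ[OF G1C ij] mulPQ[OF GC ij] using ij by (simp add: G1_def algebra_simps)
  show "(P * G1 * Q) $$ (i, j) = mat ?n ?n (%(i, j). G' $$ (i, j) + (if i = 0 then 1 else 0) * (if j = 0 then 1 else 0)) $$ (i, j)"
   unfolding g using ij by (cases i; cases j) auto
 qed (use PC G1C in auto)
 have "det (P * G1 * Q) = det G' + (\<Sum>j<?n. \<Sum>i<?n. (if i = 0 then 1 else 0) * (if j = 0 then 1 else 0) * cofactor G' i j)"
  unfolding upd by (rule det_rank_one_update[OF G'C])
 also have "(\<Sum>j<?n. \<Sum>i<?n. (if i = 0 then 1 else 0) * (if j = 0 then 1 else 0) * cofactor G' i j) = cofactor G' 0 0"
  by (simp add: sum.lessThan_Suc_shift del: sum.lessThan_Suc)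
 finally have 1: "det G1 = det G + cofactor G' 0 0"
  using detPQ[OF G1C] detPQ[OF GC] by (simp add: G'_def)
 have 2: "det G1 = det G + (\<Sum>j<?n. \<Sum>i<?n. z ^ i * cnj z ^ j * cofactor G i j)"
  unfolding G1_def by (rule det_rank_one_update[OF GC])
 have "cofactor G' 0 0 = det (mat_delete G' 0 0)" by (simp add: cofactor_def)
 also have "mat_delete G' 0 0 = gram N (%x. h x * csq (x - z))"
 proof (rule eq_matI)
  fix i j assume "i < dim_row (gram N (%x. h x * csq (x - z)))" "j < dim_col (gram N (%x. h x * csq (x - z)))"
  then have ij: "i < N" "j < N" by (auto simp: gram_def)
  have "mat_delete G' 0 0 $$ (i, j) = G' $$ (Suc i, Suc j)" using G'C ij by (simp add: mat_delete_def)
  also have "... = G $$ (Suc i, Suc j) - z * G $$ (i, Suc j) - cnj z * (G $$ (Suc i, j) - z * G $$ (i, j))"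
   unfolding G'_def using mulPQ[OF GC, of "Suc i" "Suc j"] ij by simp
  also have "... = gram N (%x. h x * csq (x - z)) $$ (i, j)"
   using ij ent_shift[OF h ij, of z] by (simp add: G_def gram_def algebra_simps)
  finally show "mat_delete G' 0 0 $$ (i, j) = gram N (%x. h x * csq (x - z)) $$ (i, j)" .
 qed (use G'C in \<open>auto simp: gram_def\<close>)
 finally show ?thesis using 1 2 by (simp add: G_def)
qed

text \<open>Integrating the preceding identity turns the double sum of cofactors into N + 1 column
  expansions of the same determinant. This is the counterpart of \<open>J_recursion\<close>.\<close>

lemma gram_recursion:
 assumes h: "adm N h"
 shows "integrable lborel (%z. of_real (h z) * det (gram N (%x. h x * csq (x - z))))"
  and "(\<integral>z. of_real (h z) * det (gram N (%x. h x * csq (x - z))) \<partial>lborel) = of_nat (Suc N) * det (gram (Suc N) h)"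
proof -
 let ?n = "Suc N" and ?c = "cofactor (gram (Suc N) h)"
 have GC: "gram ?n h \<in> carrier_mat ?n ?n" by (simp add: gram_def)
 have e: "of_real (h z) * det (gram N (%x. h x * csq (x - z))) =
  (\<Sum>j<?n. \<Sum>i<?n. ?c i j * (of_real (h z) * (z ^ i * cnj z ^ j)))" for z
  unfolding det_gram_shift[OF h] sum_distrib_left by (intro sum.cong refl) (simp add: mult_ac)
 have int: "integrable lborel (%z. ?c i j * (of_real (h z) * (z ^ i * cnj z ^ j)))" if "i < ?n" "j < ?n" for i j
  using that by (intro integrable_mult_right integrable_ent[OF h]) auto
 show "integrable lborel (%z. of_real (h z) * det (gram N (%x. h x * csq (x - z))))"
  unfolding e by (intro Bochner_Integration.integrable_sum int) auto
 have "(\<integral>z. of_real (h z) * det (gram N (%x. h x * csq (x - z))) \<partial>lborel) = (\<Sum>j<?n. \<Sum>i<?n. ?c i j * ent h i j)"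
  unfolding e ent_def
  by (subst Bochner_Integration.integral_sum, (intro Bochner_Integration.integrable_sum int; simp),
    intro sum.cong refl, subst Bochner_Integration.integral_sum, (intro int; simp), simp)
 also have "... = (\<Sum>j<?n. det (gram ?n h))"
 proof (rule sum.cong[OF refl])
  fix j assume "j \<in> {..<?n}"
  then have j: "j < ?n" by simp
  show "(\<Sum>i<?n. ?c i j * ent h i j) = det (gram ?n h)"
   unfolding laplace_expansion_column[OF GC j] using j
   by (intro sum.cong refl) (simp add: gram_def mult.commute)
 qed
 finally show "(\<integral>z. of_real (h z) * det (gram N (%x. h x * csq (x - z))) \<partial>lborel) = of_nat (Suc N) * det (gram (Suc N) h)"
  by simp
qed

text \<open>Induction along the recursion: the determinant is a positive multiple of an integral of
  smaller nonnegative determinants.\<close>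

lemma det_gram_real_nonneg:
 assumes "n = 0 \<or> adm (n - 1) h"
 shows "det (gram n h) \<in> \<real> & 0 <= Re (det (gram n h))"
 using assms
proof (induction n arbitrary: h)
 case 0
 then show ?case by (simp add: gram_def)
next
 case (Suc N)
 then have h: "adm N h" by simp
 let ?d = "%z. det (gram N (%x. h x * csq (x - z)))"
 have d: "?d z \<in> \<real> & 0 <= Re (?d z)" for z
 proof (rule Suc.IH)
  show "N = 0 \<or> adm (N - 1) (%x. h x * csq (x - z))"
   using adm_shift[of "N - 1" h z] h by (cases N) auto
 qed
 have e: "of_real (h z) * ?d z = of_real (h z * Re (?d z))" for z
  using d[of z] by (simp add: complex_is_Real_iff complex_eq_iff)
 have "of_nat (Suc N) * det (gram (Suc N) h) = of_real (\<integral>z. h z * Re (?d z) \<partial>lborel)"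
  using gram_recursion(2)[OF h, symmetric] unfolding e integral_complex_of_real .
 then have "det (gram (Suc N) h) = of_real (\<integral>z. h z * Re (?d z) \<partial>lborel) / of_nat (Suc N)"
  by (metis nonzero_mult_div_cancel_left of_nat_neq_0)
 then have r: "det (gram (Suc N) h) = of_real ((\<integral>z. h z * Re (?d z) \<partial>lborel) / real (Suc N))"
  by (simp only: of_real_divide of_real_of_nat_eq)
 have "0 <= (\<integral>z. h z * Re (?d z) \<partial>lborel)"
  using d h by (intro integral_nonneg_AE AE_I2 mult_nonneg_nonneg) (auto simp: adm_def)
 then show ?case unfolding r by simp
qed

lemma gram_recursion_nn:
 assumes h: "adm N h"
 shows "(\<integral>\<^sup>+z. ennreal (h z) * ennreal (Re (det (gram N (%x. h x * csq (x - z))))) \<partial>lborel) =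
  of_nat (Suc N) * ennreal (Re (det (gram (Suc N) h)))"
proof -
 let ?d = "%z. det (gram N (%x. h x * csq (x - z)))"
 have d: "?d z \<in> \<real> & 0 <= Re (?d z)" for z
 proof (rule det_gram_real_nonneg)
  show "N = 0 \<or> adm (N - 1) (%x. h x * csq (x - z))"
   using adm_shift[of "N - 1" h z] h by (cases N) auto
 qed
 have e: "of_real (h z) * ?d z = of_real (h z * Re (?d z))" for z
  using d[of z] by (simp add: complex_is_Real_iff complex_eq_iff)
 have h0: "0 <= h z" for z using h by (simp add: adm_def)
 have int: "integrable lborel (%z. h z * Re (?d z))"
  using integrable_Re[OF gram_recursion(1)[OF h]] by (simp add: e)
 have "(\<integral>\<^sup>+z. ennreal (h z) * ennreal (Re (?d z)) \<partial>lborel) = (\<integral>\<^sup>+z. ennreal (h z * Re (?d z)) \<partial>lborel)"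
  using h0 d by (simp add: ennreal_mult)
 also have "... = ennreal (\<integral>z. h z * Re (?d z) \<partial>lborel)"
  using int h0 d by (intro nn_integral_eq_integral) auto
 also have "(\<integral>z. h z * Re (?d z) \<partial>lborel) = Re (of_nat (Suc N) * det (gram (Suc N) h))"
  unfolding gram_recursion(2)[OF h, symmetric] e integral_complex_of_real Re_complex_of_real ..
 also have "ennreal ... = of_nat (Suc N) * ennreal (Re (det (gram (Suc N) h)))"
  by (simp add: ennreal_mult' flip: ennreal_of_nat_eq_real_of_nat)
 finally show ?thesis .
qed

definition wgt :: "complex set => complex list => nat => complex => real" where
 "wgt V zs m z = indicator (- V) z * (\<Prod>w\<leftarrow>zs. csq (z - w)) * inverse ((1 + csq z) ^ m)"

abbreviation (input) "wg n V == wgt V [] (n + 1)"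
abbreviation (input) "grm n V == gram n (wgt V [] (n + 1))"

lemma integrable_inverse_sq: "integrable lborel (%z::complex. inverse ((1 + csq z) ^ 2))"
proof (rule integrableI_bounded)
 have "(\<integral>\<^sup>+z. ennreal (inverse ((1 + csq z) ^ 2)) \<partial>lborel) =
  ennreal pi * (\<integral>\<^sup>+x. ennreal (inverse ((1 + x)^2)) * indicator {0..} x \<partial>lborel)"
  by (rule nn_integral_radial[of "%x. ennreal (inverse ((1 + x)^2))"]) measurable
 also have "(\<integral>\<^sup>+x. ennreal (inverse ((1 + x)^2)) * indicator {0..} x \<partial>lborel) = ennreal (0 - (- inverse (1 + 0)))"
 proof (rule nn_integral_FTC_atLeast)
  show "((%x::real. - inverse (1 + x)) has_real_derivative inverse ((1 + x)^2)) (at x)" if "0 <= x" for x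
   using that by (auto intro!: derivative_eq_intros simp: power2_eq_square)
  show "((%x::real. - inverse (1 + x)) \<longlongrightarrow> 0) at_top" by real_asymp
 qed auto
 finally show "(\<integral>\<^sup>+z. ennreal (norm (inverse ((1 + csq z) ^ 2))) \<partial>lborel) < \<infinity>"
  by (simp add: ennreal_mult_less_top)
qed measurable

lemma wgt_nonneg: "0 <= wgt V zs m z"
 unfolding wgt_def by (intro mult_nonneg_nonneg prod_list_nonneg) auto

lemma measurable_wgt: "open V ==> wgt V zs m \<in> borel_measurable borel"
proof -
 assume V: "open V"
 then have [measurable]: "- V \<in> sets borel" by auto
 have [measurable]: "(%z. \<Prod>w\<leftarrow>zs. csq (z - w)) \<in> borel_measurable borel"
  by (induction zs) auto
 show ?thesis unfolding wgt_def by measurable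
qed

lemma adm_wgt:
 assumes V: "open V"
 shows "adm N (wgt V zs (N + length zs + 2))"
 unfolding adm_def
proof (intro conjI allI)
 show "wgt V zs (N + length zs + 2) \<in> borel_measurable borel" by (rule measurable_wgt[OF V])
 show "0 <= wgt V zs (N + length zs + 2) z" for z by (rule wgt_nonneg)
 define C where "C = (\<Prod>w\<leftarrow>zs. 2 * (1 + csq w))"
 have C0: "0 <= C" unfolding C_def by (intro prod_list_nonneg) (auto intro!: mult_nonneg_nonneg add_nonneg_nonneg)
 have p: "(\<Prod>w\<leftarrow>zs. csq (z - w)) <= C * (1 + csq z) ^ length zs & 0 <= (\<Prod>w\<leftarrow>zs. csq (z - w))" for z
  unfolding C_def
 proof (induction zs)
  case (Cons w zs)
  have "csq (z - w) * (\<Prod>w\<leftarrow>zs. csq (z - w)) <=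
   (2 * (1 + csq w) * (1 + csq z)) * ((\<Prod>w\<leftarrow>zs. 2 * (1 + csq w)) * (1 + csq z) ^ length zs)"
   using Cons by (intro mult_mono cmod_diff_sq_le) auto
  then show ?case using Cons by (simp add: mult_ac)
 qed simp
 show "integrable lborel (%z. wgt V zs (N + length zs + 2) z * (1 + csq z) ^ N)"
 proof (rule Bochner_Integration.integrable_bound)
  show "integrable lborel (%z. C * inverse ((1 + csq z) ^ 2))"
   by (intro integrable_mult_right integrable_inverse_sq)
  show "(%z. wgt V zs (N + length zs + 2) z * (1 + csq z) ^ N) \<in> borel_measurable lborel"
   using measurable_wgt[OF V] by measurable
  show "AE z in lborel. norm (wgt V zs (N + length zs + 2) z * (1 + csq z) ^ N) <= norm (C * inverse ((1 + csq z) ^ 2))"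
  proof (intro AE_I2)
   fix z
   define s where "s = 1 + csq z"
   have s: "s > 0" by (simp add: s_def add_pos_nonneg)
   have "wgt V zs (N + length zs + 2) z * s ^ N <= (C * s ^ length zs) * inverse (s ^ (N + length zs + 2)) * s ^ N"
    unfolding wgt_def s_def[symmetric] using p[of z] s
    by (intro mult_right_mono) (auto simp: indicator_def s_def[symmetric])
   also have "... = C * inverse (s ^ 2)" using s by (simp add: power_add field_simps power2_eq_square)
   finally have "wgt V zs (N + length zs + 2) z * s ^ N <= C * inverse (s ^ 2)" .
   then show "norm (wgt V zs (N + length zs + 2) z * (1 + csq z) ^ N) <= norm (C * inverse ((1 + csq z) ^ 2))"
    using wgt_nonneg[of V zs "N + length zs + 2" z] s C0 unfolding s_def[symmetric] by (simp add: abs_mult)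
  qed
 qed
qed

lemma wgt_Cons: "wgt V (z # zs) m = (%x. wgt V zs m x * csq (x - z))"
 by (simp add: wgt_def fun_eq_iff mult_ac)

text \<open>Both sides satisfy the same recursion in n. One step turns a list of length k into one
  of length k + 1 for the smaller size, and n + k stays fixed, so the exponent of the weight does
  not change. C depends on n and k only.\<close>

theorem J_gram:
 "\<exists>C. \<forall>V zs. open V --> length zs = k --> J n V zs = C * ennreal (Re (det (gram n (wgt V zs (n + k + 1)))))"
proof (induction n arbitrary: k)
 case 0
 have "J 0 V zs = 1" if "open V" for V zs
 proof -
  have "FJ 0 V zs (%_. 0) = 1" by (induction zs) (auto simp: FJ_def sq_def hole_def)
  then show ?thesis by (simp add: J_def)
 qed
 then show ?case by (intro exI[of _ 1]) (simp add: gram_def)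
next
 case (Suc N)
 obtain C where C: "!!V zs. open V ==> length zs = Suc k ==>
   J N V zs = C * ennreal (Re (det (gram N (wgt V zs (N + Suc k + 1)))))"
  using Suc.IH[of "Suc k"] by blast
 have "J (Suc N) V zs = CC N k * C * ennreal (Re (det (gram (Suc N) (wgt V zs (Suc N + k + 1)))))"
  if V: "open V" and k: "length zs = k" for V zs
 proof -
  let ?h = "wgt V zs (N + k + 2)"
  have h: "adm N ?h" using adm_wgt[OF V, of N zs] k by simp
  have z: "ZZ V zs z * ennreal (inverse ((1 + csq z) ^ (N + k + 2))) * J N V (z # zs) =
   C * (ennreal (?h z) * ennreal (Re (det (gram N (%x. ?h x * csq (x - z))))))" for z
  proof -
   have nn: "0 <= (\<Prod>w\<leftarrow>zs. csq (z - w))" for zs by (induction zs) auto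
   have p: "(\<Prod>w\<leftarrow>zs. esq (z - w)) = ennreal (\<Prod>w\<leftarrow>zs. csq (z - w))"
    using nn by (induction zs) (simp_all add: ennreal_mult)
   have "ZZ V zs z * ennreal (inverse ((1 + csq z) ^ (N + k + 2))) = ennreal (?h z)"
    unfolding ZZ_def p wgt_def
    using nn by (cases "z \<in> V") (auto simp: ennreal_mult)
   moreover have "J N V (z # zs) = C * ennreal (Re (det (gram N (%x. ?h x * csq (x - z)))))"
    using C[OF V, of "z # zs"] k by (simp add: wgt_Cons)
   ultimately show ?thesis by (simp add: mult_ac)
  qed
  have "(%z. det (gram N (%x. ?h x * csq (x - z)))) \<in> borel_measurable borel"
  proof -
   have [measurable]: "cnj \<in> borel_measurable borel"
    by (intro borel_measurable_continuous_onI continuous_intros)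
   show ?thesis unfolding det_gram_shift[OF h] by measurable
  qed
  then have m: "(%z. ennreal (?h z) * ennreal (Re (det (gram N (%x. ?h x * csq (x - z)))))) \<in> borel_measurable lborel"
   using measurable_wgt[OF V, of zs "N + k + 2"] by measurable
  have "of_nat (Suc N) * J (Suc N) V zs = CC N k * (C * (of_nat (Suc N) * ennreal (Re (det (gram (Suc N) ?h)))))"
   unfolding J_recursion[OF V] k z nn_integral_cmult[OF m] gram_recursion_nn[OF h] ..
  also have "... = of_nat (Suc N) * (CC N k * C * ennreal (Re (det (gram (Suc N) ?h))))" by (simp add: mult_ac)
  finally have "J (Suc N) V zs = CC N k * C * ennreal (Re (det (gram (Suc N) ?h)))"
   by (subst (asm) ennreal_mult_cancel_left) auto
  then show ?thesis by simp
 qed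
 then show ?case by blast
qed

lemma J_empty: "J n {} [] = ennreal pi ^ (2 * n * n)"
proof -
 have "FJ n {} [] = (%y. ennreal (exp (- sq (ix n) y)))"
  by (simp add: FJ_def hole_def fun_eq_iff)
 then show ?thesis unfolding J_def using Intg_gauss[of "ix n" "%_. 0"]
  by (simp add: card_cartesian_product mult.assoc)
qed

definition hp :: "nat => complex set => real" where
 "hp n V = Re (det (grm n V)) / Re (det (grm n {}))"

text \<open>For an empty hole J is the full Gaussian integral, a power of pi. Dividing by this case
  eliminates the constant C and shows that the determinant for the full plane is not zero.\<close>

theorem J_hp:
 assumes V: "open V" and n: "n >= 1"
 shows "J n V [] = ennreal (hp n V) * ennreal pi ^ (2 * n * n)" and "0 < Re (det (grm n {}))"
proof -
 obtain C where C: "!!V. open V ==> J n V [] = C * ennreal (Re (det (grm n V)))"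
  using J_gram[of 0 n] by auto
 let ?d = "%V. Re (det (grm n V))"
 have adm: "n = 0 \<or> adm (n - 1) (wg n V)" if "open V" for V
  using adm_wgt[OF that, of "n - 1" "[]"] n by (cases n) auto
 have d0: "0 <= ?d V" if "open V" for V using det_gram_real_nonneg[OF adm[OF that]] by simp
 have e: "C * ennreal (?d {}) = ennreal pi ^ (2 * n * n)" using C[of "{}"] J_empty[of n] by simp
 then have "ennreal (?d {}) ~= 0" using pi_power_ennreal(1)[of "2 * n * n"] by auto
 then show pos: "0 < ?d {}" using d0[of "{}"] by (simp add: order_less_le)
 have "ennreal (?d V) = ennreal (hp n V) * ennreal (?d {})"
  using pos d0[OF V] by (simp add: hp_def flip: ennreal_mult)
 then have "J n V [] = ennreal (hp n V) * (C * ennreal (?d {}))" using C[OF V] by (simp add: mult_ac)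
 then show "J n V [] = ennreal (hp n V) * ennreal pi ^ (2 * n * n)" unfolding e .
qed

section \<open>Positive definite matrices\<close>

definition pd :: "nat => complex mat => bool" where
 "pd n G \<longleftrightarrow> G \<in> carrier_mat n n & (\<forall>i<n. \<forall>j<n. G $$ (i, j) = cnj (G $$ (j, i))) &
  (\<forall>x. (\<exists>i<n. x i ~= 0) --> 0 < Re (\<Sum>i<n. \<Sum>j<n. cnj (x i) * G $$ (i, j) * x j))"

definition skip :: "nat => nat => nat" where
 "skip k i = (if i < k then i else Suc i)"

lemma sum_skip:
 fixes f :: "nat => 'a :: comm_monoid_add"
 assumes "k < Suc n"
 shows "(\<Sum>i<Suc n. f i) = f k + (\<Sum>i<n. f (skip k i))"
proof -
 have "(\<Sum>i<Suc n. f i) = f k + (\<Sum>i\<in>{..<Suc n} - {k}. f i)"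
  using assms by (subst sum.remove[of _ k]) auto
 also have "(\<Sum>i\<in>{..<Suc n} - {k}. f i) = (\<Sum>i<n. f (skip k i))"
  by (rule sum.reindex_bij_witness[where i="skip k" and j="%i. if i < k then i else i - 1"])
   (use assms in \<open>auto simp: skip_def\<close>)
 finally show ?thesis .
qed

lemma mat_delete_skip:
 assumes "G \<in> carrier_mat (Suc n) (Suc n)" "i < n" "j < n"
 shows "mat_delete G k k $$ (i, j) = G $$ (skip k i, skip k j)"
 using assms by (simp add: mat_delete_def skip_def)

lemma det_sub_diag:
 fixes G :: "complex mat"
 assumes G: "G \<in> carrier_mat n n" and k: "k < n"
 shows "det (mat n n (%(i, j). G $$ (i, j) - (if i = k & j = k then t else 0))) = det G - t * cofactor G k k"
proof -
 let ?a = "%i. if i = k then - t else 0" and ?b = "%j. if j = k then 1 else (0::complex)"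
 have "mat n n (%(i, j). G $$ (i, j) - (if i = k & j = k then t else 0)) = mat n n (%(i, j). G $$ (i, j) + ?a i * ?b j)"
  by (intro eq_matI) auto
 then have "det (mat n n (%(i, j). G $$ (i, j) - (if i = k & j = k then t else 0))) =
  det G + (\<Sum>j<n. \<Sum>i<n. ?a i * ?b j * cofactor G i j)"
  using det_rank_one_update[OF G, of ?a ?b] by simp
 also have "(\<Sum>j<n. \<Sum>i<n. ?a i * ?b j * cofactor G i j) = (\<Sum>j<n. if j = k then - t * cofactor G k k else 0)"
 proof (rule sum.cong[OF refl])
  fix j
  have "(\<Sum>i<n. ?a i * ?b j * cofactor G i j) = (\<Sum>i<n. if i = k then - t * ?b j * cofactor G k j else 0)"
   by (intro sum.cong) auto
  then show "(\<Sum>i<n. ?a i * ?b j * cofactor G i j) = (if j = k then - t * cofactor G k k else 0)"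
   using k by simp
 qed
 also have "... = - t * cofactor G k k" using k by simp
 finally show ?thesis by simp
qed

lemma pd_delete:
 assumes G: "pd (Suc n) G" and k: "k < Suc n"
 shows "pd n (mat_delete G k k)"
proof -
 have GC: "G \<in> carrier_mat (Suc n) (Suc n)" using G by (simp add: pd_def)
 have sk: "skip k i < Suc n" if "i < n" for i using that by (simp add: skip_def)
 show ?thesis
  unfolding pd_def
 proof (intro conjI allI impI)
  show "mat_delete G k k \<in> carrier_mat n n" using mat_delete_carrier[OF GC] by simp
  show "mat_delete G k k $$ (i, j) = cnj (mat_delete G k k $$ (j, i))" if "i < n" "j < n" for i j
   using G sk that unfolding mat_delete_skip[OF GC that] mat_delete_skip[OF GC that(2,1)] pd_def by blast
  fix x :: "nat => complex" assume "\<exists>i<n. x i ~= 0"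
  then obtain i0 where i0: "i0 < n" "x i0 ~= 0" by blast
  define X where "X i = (if i = k then 0 else if i < k then x i else x (i - 1))" for i
  have Xs: "X (skip k i) = x i" for i by (simp add: X_def skip_def)
  have Xk: "X k = 0" by (simp add: X_def)
  have "\<exists>i<Suc n. X i ~= 0" using i0 sk[of i0] Xs[of i0] by (intro exI[of _ "skip k i0"]) simp
  then have "0 < Re (\<Sum>i<Suc n. \<Sum>j<Suc n. cnj (X i) * G $$ (i, j) * X j)"
   using G unfolding pd_def by blast
  also have "(\<Sum>i<Suc n. \<Sum>j<Suc n. cnj (X i) * G $$ (i, j) * X j) =
   (\<Sum>i<n. \<Sum>j<n. cnj (x i) * G $$ (skip k i, skip k j) * x j)"
   unfolding sum_skip[OF k] by (simp add: Xk Xs)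
  also have "... = (\<Sum>i<n. \<Sum>j<n. cnj (x i) * mat_delete G k k $$ (i, j) * x j)"
   by (intro sum.cong refl) (simp add: mat_delete_skip[OF GC])
  finally show "0 < Re (\<Sum>i<n. \<Sum>j<n. cnj (x i) * mat_delete G k k $$ (i, j) * x j)" .
 qed
qed

lemma cofactor_delete: "cofactor G k k = det (mat_delete G k k)"
 by (simp add: cofactor_def)

text \<open>Let t be det G divided by the minor. Then G - t E_kk is singular, and a kernel vector x
  has a nonzero k-th entry since the minor is nonsingular. The form at x is t |x_k|^2, so t > 0; at
  x - x_k e_k it is (G_kk - t) |x_k|^2, so t is at most G_kk. Positivity and Fischer's inequality
  come out together.\<close>

lemma pd_det_aux:
 assumes G: "pd (Suc n) G" and k: "k < Suc n"
  and c: "det (mat_delete G k k) \<in> \<real>" "0 < Re (det (mat_delete G k k))"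
 shows "det G \<in> \<real>" "0 < Re (det G)" "Re (det G) <= Re (G $$ (k, k)) * Re (cofactor G k k)"
proof -
 let ?n = "Suc n"
 have GC: "G \<in> carrier_mat ?n ?n" using G by (simp add: pd_def)
 have herm: "G $$ (i, j) = cnj (G $$ (j, i))" if "i < ?n" "j < ?n" for i j using G that unfolding pd_def by blast
 define c where "c = Re (det (mat_delete G k k))"
 have cc: "det (mat_delete G k k) = of_real c" using c(1) by (simp add: c_def)
 have c0: "0 < c" using c(2) by (simp add: c_def)
 define t where "t = det G / of_real c"
 have Dt: "det G = t * of_real c" using c0 by (simp add: t_def)
 let ?M = "mat ?n ?n (%(i, j). G $$ (i, j) - (if i = k & j = k then t else 0))"
 have "det ?M = 0" unfolding det_sub_diag[OF GC k] cofactor_delete cc using Dt by simp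
 then obtain v where v: "v \<in> carrier_vec ?n" "v ~= 0\<^sub>v ?n" "?M *\<^sub>v v = 0\<^sub>v ?n"
  using det_0_iff_vec_prod_zero_field[of ?M ?n] by auto
 define x where "x i = vec_index v i" for i
 have Gv: "(\<Sum>j<?n. G $$ (i, j) * x j) = (if i = k then t * x k else 0)" if i: "i < ?n" for i
 proof -
  have "0 = vec_index (?M *\<^sub>v v) i" using v(3) i by simp
  also have "... = (\<Sum>j<?n. ?M $$ (i, j) * x j)"
   using i v(1) by (simp add: scalar_prod_def atLeast0LessThan x_def)
  also have "... = (\<Sum>j<?n. G $$ (i, j) * x j - (if j = k then (if i = k then t * x k else 0) else 0))"
   using i by (intro sum.cong) (auto simp: algebra_simps)
  also have "... = (\<Sum>j<?n. G $$ (i, j) * x j) - (if i = k then t * x k else 0)"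
   using k unfolding sum_subtractf by simp
  finally show ?thesis by simp
 qed
 have ex: "\<exists>i<?n. x i ~= 0"
 proof (rule ccontr)
  assume "~ ?thesis"
  then have "v = 0\<^sub>v ?n" using v(1) by (intro eq_vecI) (auto simp: x_def)
  with v(2) show False ..
 qed
 have xk: "x k ~= 0"
 proof
  assume xk: "x k = 0"
  define w where "w = Matrix.vec n (%i. x (skip k i))"
  have "mat_delete G k k *\<^sub>v w = 0\<^sub>v n"
  proof (rule eq_vecI)
   fix i assume "i < dim_vec (0\<^sub>v n :: complex Matrix.vec)"
   then have i: "i < n" by simp
   then have si: "skip k i < ?n" "skip k i ~= k" by (auto simp: skip_def)
   have "vec_index (mat_delete G k k *\<^sub>v w) i = (\<Sum>j<n. mat_delete G k k $$ (i, j) * x (skip k j))"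
    using i carrier_matD[OF GC]
    by (auto simp: scalar_prod_def atLeast0LessThan w_def intro!: sum.cong)
   also have "... = (\<Sum>j<n. G $$ (skip k i, skip k j) * x (skip k j))"
    by (intro sum.cong refl) (use i in \<open>simp only: mat_delete_skip[OF GC i] lessThan_iff\<close>)
   also have "... = (\<Sum>j<?n. G $$ (skip k i, j) * x j)" unfolding sum_skip[OF k] using xk by simp
   also have "... = 0" using Gv[OF si(1)] si(2) by simp
   finally show "vec_index (mat_delete G k k *\<^sub>v w) i = vec_index (0\<^sub>v n) i" using i by simp
  qed (use carrier_matD[OF GC] in simp)
  moreover have "w \<in> carrier_vec n" by (simp add: w_def)
  moreover have "w ~= 0\<^sub>v n"
  proof
   assume w0: "w = 0\<^sub>v n"
   obtain i where i: "i < ?n" "x i ~= 0" using ex by blast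
   then have "i ~= k" using xk by auto
   then have "\<exists>i'<n. i = skip k i'" using i(1) k
    by (intro exI[of _ "if i < k then i else i - 1"]) (auto simp: skip_def)
   then obtain i' where i': "i' < n" "i = skip k i'" by blast
   have "x (skip k i') = vec_index w i'" using i' by (simp add: w_def)
   then show False using w0 i i' by simp
  qed
  ultimately have "det (mat_delete G k k) = 0"
   using det_0_iff_vec_prod_zero_field[of "mat_delete G k k" n] mat_delete_carrier[OF GC, of k k] by auto
  with cc c0 show False by simp
 qed
 have form: "(\<Sum>i<?n. \<Sum>j<?n. cnj (y i) * G $$ (i, j) * x j) = t * x k * cnj (y k)" for y
 proof -
  have "(\<Sum>i<?n. \<Sum>j<?n. cnj (y i) * G $$ (i, j) * x j) = (\<Sum>i<?n. cnj (y i) * (\<Sum>j<?n. G $$ (i, j) * x j))"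
   unfolding sum_distrib_left by (simp only: mult.assoc)
  also have "... = (\<Sum>i<?n. if i = k then t * x k * cnj (y k) else 0)"
  proof (rule sum.cong[OF refl])
   fix i assume "i \<in> {..<?n}"
   then have i: "i < ?n" by simp
   show "cnj (y i) * (\<Sum>j<?n. G $$ (i, j) * x j) = (if i = k then t * x k * cnj (y k) else 0)"
    unfolding Gv[OF i] by simp
  qed
  also have "... = t * x k * cnj (y k)" using k by simp
  finally show ?thesis .
 qed
 have q: "(\<Sum>i<?n. \<Sum>j<?n. cnj (x i) * G $$ (i, j) * x j) = t * of_real (csq (x k))"
  unfolding form complex_norm_square by (simp only: mult.assoc)
 have real: "(\<Sum>i<?n. \<Sum>j<?n. cnj (x i) * G $$ (i, j) * x j) \<in> \<real>" (is "?S \<in> _")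
 proof -
  have "cnj ?S = (\<Sum>i<?n. \<Sum>j<?n. x i * cnj (G $$ (i, j)) * cnj (x j))" by (simp add: cnj_sum)
  also have "... = (\<Sum>i<?n. \<Sum>j<?n. x i * G $$ (j, i) * cnj (x j))"
   by (intro sum.cong refl) (metis herm lessThan_iff)
  also have "... = (\<Sum>j<?n. \<Sum>i<?n. x i * G $$ (j, i) * cnj (x j))" by (rule sum.swap)
  also have "... = ?S" by (intro sum.cong refl) (simp add: mult_ac)
  finally show ?thesis by (simp add: Reals_cnj_iff)
 qed
 have pos: "0 < Re ?S" using G ex unfolding pd_def by blast
 have n0: "csq (x k) > 0" using xk by simp
 have tR: "t \<in> \<real>"
 proof -
  have tt: "t = ?S / of_real (csq (x k))" unfolding q using n0 by simp
  show ?thesis by (subst tt) (rule Reals_divide[OF real Reals_of_real])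
 qed
 then obtain \<tau> where \<tau>: "t = of_real \<tau>" by (rule Reals_cases)
 have \<tau>0: "0 < \<tau>" using pos n0 unfolding q \<tau> by (simp add: zero_less_mult_iff)
 show "det G \<in> \<real>" unfolding Dt \<tau> by simp
 have ReD: "Re (det G) = \<tau> * c" unfolding Dt \<tau> by simp
 show "0 < Re (det G)" unfolding ReD using \<tau>0 c0 by simp
 have Gkk: "G $$ (k, k) \<in> \<real>" using herm[OF k k, symmetric] by (simp add: Reals_cnj_iff)
 have "\<tau> <= Re (G $$ (k, k))"
 proof -
  define y where "y i = (if i = k then x k else 0)" for i
  define u where "u i = x i - y i" for i
  have nonneg: "0 <= Re (\<Sum>i<?n. \<Sum>j<?n. cnj (u i) * G $$ (i, j) * u j)"
  proof (cases "\<exists>i<?n. u i ~= 0")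
   case True
   then show ?thesis using G unfolding pd_def by (meson less_imp_le)
  next
   case False
   then show ?thesis by simp
  qed
  have a: "(\<Sum>i<?n. \<Sum>j<?n. cnj (u i) * G $$ (i, j) * u j) =
   (\<Sum>i<?n. \<Sum>j<?n. cnj (u i) * G $$ (i, j) * x j) - (\<Sum>i<?n. \<Sum>j<?n. cnj (u i) * G $$ (i, j) * y j)"
   unfolding sum_subtractf[symmetric] by (intro sum.cong refl) (simp add: u_def algebra_simps)
  have b: "(\<Sum>i<?n. \<Sum>j<?n. cnj (u i) * G $$ (i, j) * x j) = 0"
   unfolding form by (simp add: u_def y_def)
  have "(\<Sum>i<?n. \<Sum>j<?n. cnj (u i) * G $$ (i, j) * y j) = (\<Sum>i<?n. cnj (u i) * G $$ (i, k) * x k)"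
  proof (rule sum.cong[OF refl])
   fix i
   have "(\<Sum>j<?n. cnj (u i) * G $$ (i, j) * y j) = (\<Sum>j<?n. if j = k then cnj (u i) * G $$ (i, k) * x k else 0)"
    by (intro sum.cong) (auto simp: y_def)
   then show "(\<Sum>j<?n. cnj (u i) * G $$ (i, j) * y j) = cnj (u i) * G $$ (i, k) * x k" using k by simp
  qed
  also have "... = cnj (\<Sum>i<?n. G $$ (k, i) * u i) * x k"
   unfolding cnj_sum sum_distrib_right
  proof (rule sum.cong[OF refl])
   fix i assume "i \<in> {..<?n}"
   then have "G $$ (i, k) = cnj (G $$ (k, i))" using k by (intro herm) auto
   then show "cnj (u i) * G $$ (i, k) * x k = cnj (G $$ (k, i) * u i) * x k" by (simp only: complex_cnj_mult mult_ac)
  qed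
  also have "(\<Sum>i<?n. G $$ (k, i) * u i) = (\<Sum>i<?n. G $$ (k, i) * x i) - (\<Sum>i<?n. if i = k then G $$ (k, k) * x k else 0)"
   unfolding sum_subtractf[symmetric] by (intro sum.cong refl) (auto simp: u_def y_def algebra_simps)
  also have "... = (t - G $$ (k, k)) * x k" using Gv[OF k] k by (simp add: algebra_simps)
  finally have cc: "(\<Sum>i<?n. \<Sum>j<?n. cnj (u i) * G $$ (i, j) * y j) = cnj (t - G $$ (k, k)) * of_real (csq (x k))"
   unfolding complex_norm_square by (simp only: complex_cnj_mult mult_ac)
  have "Re (\<Sum>i<?n. \<Sum>j<?n. cnj (u i) * G $$ (i, j) * u j) = (Re (G $$ (k, k)) - \<tau>) * csq (x k)"
   unfolding a b cc \<tau> using Gkk by (simp add: algebra_simps)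
  then show ?thesis using nonneg n0 by (simp add: zero_le_mult_iff)
 qed
 then show "Re (det G) <= Re (G $$ (k, k)) * Re (cofactor G k k)"
  unfolding ReD cofactor_delete c_def[symmetric] using c0 by simp
qed

lemma pd_det_pos: "pd n G ==> det G \<in> \<real> & 0 < Re (det G)"
proof (induction n arbitrary: G)
 case 0
 then show ?case by (simp add: pd_def)
next
 case (Suc n)
 have "det (mat_delete G 0 0) \<in> \<real> & 0 < Re (det (mat_delete G 0 0))"
  by (rule Suc.IH[OF pd_delete[OF Suc.prems]]) simp
 then show ?case using pd_det_aux(1,2)[OF Suc.prems zero_less_Suc] by blast
qed

lemma pd_fischer:
 assumes G: "pd n G" and k: "k < n"
 shows "Re (det G) <= Re (G $$ (k, k)) * Re (cofactor G k k)" "cofactor G k k \<in> \<real>" "0 < Re (cofactor G k k)"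
proof -
 obtain n' where n: "n = Suc n'" using k by (cases n) auto
 have G': "pd (Suc n') G" and k': "k < Suc n'" using G k by (simp_all only: n)
 have d: "det (mat_delete G k k) \<in> \<real> & 0 < Re (det (mat_delete G k k))"
  by (rule pd_det_pos[OF pd_delete[OF G' k']])
 show "Re (det G) <= Re (G $$ (k, k)) * Re (cofactor G k k)"
  using d by (intro pd_det_aux(3)[OF G' k']) auto
 show "cofactor G k k \<in> \<real>" "0 < Re (cofactor G k k)" using d by (simp_all add: cofactor_delete)
qed

lemma pd_add_diag:
 assumes G: "pd n G" and f: "!!i. i < n ==> 0 <= f i"
 shows "pd n (mat n n (%(i, j). G $$ (i, j) + (if i = j then of_real (f i) else 0)))"
 unfolding pd_def
proof (intro conjI allI impI)
 fix i j assume ij: "i < n" "j < n"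
 have "G $$ (i, j) = cnj (G $$ (j, i))" using G ij unfolding pd_def by blast
 then show "mat n n (%(i, j). G $$ (i, j) + (if i = j then of_real (f i) else 0)) $$ (i, j) =
  cnj (mat n n (%(i, j). G $$ (i, j) + (if i = j then of_real (f i) else 0)) $$ (j, i))"
  using ij by auto
next
 fix x :: "nat => complex" assume "\<exists>i<n. x i ~= 0"
 then have p: "0 < Re (\<Sum>i<n. \<Sum>j<n. cnj (x i) * G $$ (i, j) * x j)" using G unfolding pd_def by blast
 have sq: "of_real (f i * csq (x i)) = of_real (f i) * (x i * cnj (x i))" for i
  by (simp only: of_real_mult complex_norm_square)
 have tm: "cnj (x i) * mat n n (%(i, j). G $$ (i, j) + (if i = j then of_real (f i) else 0)) $$ (i, j) * x j =
   cnj (x i) * G $$ (i, j) * x j + (if j = i then of_real (f i * csq (x i)) else 0)" if "i < n" "j < n" for i j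
  using that unfolding sq by (cases "j = i") (simp_all add: distrib_left distrib_right mult_ac)
 have "(\<Sum>i<n. \<Sum>j<n. cnj (x i) * mat n n (%(i, j). G $$ (i, j) + (if i = j then of_real (f i) else 0)) $$ (i, j) * x j) =
  (\<Sum>i<n. (\<Sum>j<n. cnj (x i) * G $$ (i, j) * x j) + (\<Sum>j<n. if j = i then of_real (f i * csq (x i)) else 0))"
  unfolding sum.distrib[symmetric] by (intro sum.cong refl tm) auto
 also have "... = (\<Sum>i<n. (\<Sum>j<n. cnj (x i) * G $$ (i, j) * x j) + of_real (f i * csq (x i)))"
  by (intro sum.cong refl) (simp only: sum.delta finite_lessThan if_True lessThan_iff cong: if_cong)
 also have "... = (\<Sum>i<n. \<Sum>j<n. cnj (x i) * G $$ (i, j) * x j) + of_real (\<Sum>i<n. f i * csq (x i))"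
  unfolding sum.distrib of_real_sum ..
 finally have e: "(\<Sum>i<n. \<Sum>j<n. cnj (x i) * mat n n (%(i, j). G $$ (i, j) + (if i = j then of_real (f i) else 0)) $$ (i, j) * x j) =
  (\<Sum>i<n. \<Sum>j<n. cnj (x i) * G $$ (i, j) * x j) + of_real (\<Sum>i<n. f i * csq (x i))" .
 have "0 <= (\<Sum>i<n. f i * csq (x i))" using f by (intro sum_nonneg mult_nonneg_nonneg) auto
 then show "0 < Re (\<Sum>i<n. \<Sum>j<n. cnj (x i) * mat n n (%(i, j). G $$ (i, j) + (if i = j then of_real (f i) else 0)) $$ (i, j) * x j)"
  unfolding e using p by simp
qed simp

text \<open>The diagonal is lowered one entry at a time. By Fischer's inequality the cofactor is at
  least the determinant over h i, so lowering by e i costs at least the factor 1 - e i / h i. All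
  intermediate matrices are positive definite, being the final one plus a nonnegative
  diagonal.\<close>

lemma pd_sub_diag_det:
 fixes e h :: "nat => real"
 assumes fin: "pd n (mat n n (%(i, j). G $$ (i, j) - (if i = j then of_real (e i) else 0)))"
  and G: "G \<in> carrier_mat n n"
  and e: "!!i. i < n ==> 0 <= e i & e i <= h i & 0 < h i" and Gh: "!!i. i < n ==> Re (G $$ (i, i)) <= h i"
 shows "Re (det (mat n n (%(i, j). G $$ (i, j) - (if i = j then of_real (e i) else 0)))) <= (\<Prod>i<n. (h i - e i) / h i) * Re (det G)"
proof -
 define Gm where "Gm m = mat n n (%(i, j). G $$ (i, j) - (if i = j & i < m then of_real (e i) else 0))" for m
 have GmC: "Gm m \<in> carrier_mat n n" for m by (simp add: Gm_def)
 have pdm: "pd n (Gm m)" for m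
 proof -
  have "Gm m = mat n n (%(i, j). mat n n (%(i, j). G $$ (i, j) - (if i = j then of_real (e i) else 0)) $$ (i, j) +
   (if i = j then of_real (if i < m then 0 else e i) else 0))"
   unfolding Gm_def by (intro eq_matI) auto
  then show ?thesis using pd_add_diag[OF fin, of "%i. if i < m then 0 else e i"] e by simp
 qed
 have main: "Re (det (Gm m)) <= (\<Prod>i<m. (h i - e i) / h i) * Re (det G)" if "m <= n" for m
  using that
 proof (induction m)
  case 0
  have "Gm 0 = G" using G by (intro eq_matI) (auto simp: Gm_def)
  then show ?case by simp
 next
  case (Suc m)
  then have m: "m < n" by simp
  let ?c = "cofactor (Gm m) m m"
  have "Gm (Suc m) = mat n n (%(i, j). Gm m $$ (i, j) - (if i = m & j = m then of_real (e m) else 0))"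
   unfolding Gm_def by (intro eq_matI) (auto simp: less_Suc_eq)
  then have d: "det (Gm (Suc m)) = det (Gm m) - of_real (e m) * ?c"
   using det_sub_diag[OF GmC m] by simp
  have "Gm m $$ (m, m) = G $$ (m, m)" using m by (simp add: Gm_def)
  then have "Re (det (Gm m)) <= Re (G $$ (m, m)) * Re ?c" using pd_fischer(1)[OF pdm m, of m] by simp
  also have "... <= h m * Re ?c" using Gh[OF m] pd_fischer(3)[OF pdm m, of m] by (intro mult_right_mono) auto
  finally have le: "Re (det (Gm m)) / h m <= Re ?c" using e[OF m] by (simp add: divide_le_eq mult.commute)
  have "Re (det (Gm (Suc m))) = Re (det (Gm m)) - e m * Re ?c" unfolding d by simp
  also have "... <= Re (det (Gm m)) - e m * (Re (det (Gm m)) / h m)"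
   using le e[OF m] by (intro diff_left_mono mult_left_mono) auto
  also have "... = (h m - e m) / h m * Re (det (Gm m))" using e[OF m] by (simp add: field_simps)
  also have "... <= (h m - e m) / h m * ((\<Prod>i<m. (h i - e i) / h i) * Re (det G))"
   using Suc e[OF m] by (intro mult_left_mono divide_nonneg_pos) auto
  finally show ?case by (simp add: mult_ac)
 qed
 have GE: "Gm n = mat n n (%(i, j). G $$ (i, j) - (if i = j then of_real (e i) else 0))"
  unfolding Gm_def by (intro eq_matI) auto
 show ?thesis using main[OF order_refl] unfolding GE .
qed

section \<open>Gap probabilities of discs\<close>

lemma distr_complex_mult:
 assumes "cmod c = 1"
 shows "distr lborel borel (%z. c * z) = lborel"
proof (rule measure_eqI)
 fix A :: "complex set" assume "A \<in> sets (distr lborel borel (%z. c * z))"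
 then have A[measurable]: "A \<in> sets borel" by simp
 have c: "c ~= 0" using assms by auto
 have "emeasure lborel A = (\<integral>\<^sup>+z. indicator A z \<partial>lborel)" by simp
 also have "... = esq c * (\<integral>\<^sup>+z. indicator A (c * z) \<partial>lborel)"
  by (rule nn_integral_complex_mult[OF _ c]) measurable
 also have "... = (\<integral>\<^sup>+z. indicator A z \<partial>(distr lborel borel (%z. c * z)))"
  using assms by (subst nn_integral_distr) auto
 also have "... = emeasure (distr lborel borel (%z. c * z)) A" by simp
 finally show "emeasure (distr lborel borel (%z. c * z)) A = emeasure lborel A" by simp
qed simp

text \<open>Rotating by the angle pi / (i - j) multiplies the integrand by -1 and leaves the
  integral unchanged.\<close>

lemma ent_radial_off_diag:
 assumes h: "h \<in> borel_measurable borel" and rad: "!!z. h z = H (cmod z)" and ij: "i ~= j"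
 shows "ent h i j = 0"
proof -
 define \<theta> where "\<theta> = pi / of_int (int i - int j)"
 define c where "c = cis \<theta>"
 have c1: "cmod c = 1" by (simp add: c_def)
 have [measurable]: "h \<in> borel_measurable borel" by fact
 have [measurable]: "cnj \<in> borel_measurable borel"
  by (intro borel_measurable_continuous_onI continuous_intros)
 have "ent h i j = (\<integral>z. of_real (h z) * (z ^ i * cnj z ^ j) \<partial>(distr lborel borel (%z. c * z)))"
  unfolding ent_def distr_complex_mult[OF c1] ..
 also have "... = (\<integral>z. of_real (h (c * z)) * ((c * z) ^ i * cnj (c * z) ^ j) \<partial>lborel)"
  by (rule integral_distr) measurable
 also have "... = (\<integral>z. (c ^ i * cnj c ^ j) * (of_real (h z) * (z ^ i * cnj z ^ j)) \<partial>lborel)"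
  by (intro Bochner_Integration.integral_cong refl) (simp add: rad norm_mult c1 power_mult_distrib mult_ac)
 also have "... = (c ^ i * cnj c ^ j) * ent h i j" unfolding ent_def by (rule integral_mult_right_zero)
 finally have e: "ent h i j = (c ^ i * cnj c ^ j) * ent h i j" .
 have "c ^ i * cnj c ^ j = cis (real i * \<theta> + real j * (- \<theta>))"
  unfolding c_def cis_cnj Complex.DeMoivre cis_mult ..
 also have "cis (real i * \<theta> + real j * (- \<theta>)) = cis (\<theta> * of_int (int i - int j))" by (simp add: algebra_simps)
 also have "... = -1" using ij by (simp add: \<theta>_def)
 finally show ?thesis using e by simp
qed

text \<open>In the variable x = |z|^2 this is an incomplete beta integral, whose antiderivative is a
  partial binomial sum divided by (1 + x)^n.\<close>

lemma radial_integral: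
 assumes k: "k < n" and r: "0 <= r"
 shows "(\<integral>\<^sup>+z. ennreal (indicator {z. r <= csq z} z * inverse ((1 + csq z) ^ (n + 1)) * (cmod z) ^ (2 * k)) \<partial>lborel) =
  ennreal (pi / (real (Suc k) * real (n choose Suc k)) * ((\<Sum>j\<le>k. real (n choose j) * r ^ j) / (1 + r) ^ n))"
proof -
 define K where "K = real (Suc k) * real (n choose Suc k)"
 have K: "K > 0" using k by (simp add: K_def)
 define S where "S m x = (\<Sum>j\<le>m. real (n choose j) * x ^ j)" for m and x :: real
 have S': "(S m has_real_derivative (\<Sum>j\<le>m. real (n choose j) * (real j * x ^ (j - 1)))) (at x)" for m x
 proof -
  have "((%x. \<Sum>j\<le>m. real (n choose j) * x ^ j) has_real_derivative (\<Sum>j\<le>m. real (n choose j) * (real j * x ^ (j - 1)))) (at x)"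
   by (rule DERIV_sum) (auto intro!: derivative_eq_intros)
  then show ?thesis by (simp only: S_def[abs_def])
 qed
 \<comment> \<open>The numerator of the derivative telescopes: only the top term of the partial sum
   survives.\<close>
 have tele: "(1 + x) * (\<Sum>j\<le>m. real (n choose j) * (real j * x ^ (j - 1))) - real n * S m x = - (real (Suc m) * real (n choose Suc m) * x ^ m)"
  if "m < n" for m x
  using that
 proof (induction m)
  case 0
  then show ?case by (simp add: S_def)
 next
  case (Suc m)
  have b: "real (Suc (Suc m)) * real (n choose Suc (Suc m)) = (real n - real (Suc m)) * real (n choose Suc m)"
  proof -
   have "Suc (Suc m) * (n choose Suc (Suc m)) = (n - Suc m) * (n choose Suc m)"
    using binomial_absorb_comp[of n "Suc m"] binomial_absorption[of "Suc m" n]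
    by (metis Suc.prems Suc_diff_Suc binomial_absorb_comp times_binomial_minus1_eq diff_Suc_1 binomial_absorption)
   then show ?thesis using Suc.prems by (metis of_nat_mult of_nat_diff less_imp_le)
  qed
  have "(1 + x) * (\<Sum>j\<le>Suc m. real (n choose j) * (real j * x ^ (j - 1))) - real n * S (Suc m) x =
   - (real (Suc m) * real (n choose Suc m) * x ^ m) + ((1 + x) * (real (n choose Suc m) * (real (Suc m) * x ^ m)) - real n * (real (n choose Suc m) * x ^ Suc m))"
   using Suc by (simp add: S_def algebra_simps)
  also have "... = - ((real n - real (Suc m)) * real (n choose Suc m) * x ^ Suc m)"
   by (simp add: algebra_simps)
  finally show ?case unfolding b .
 qed
 define F where "F x = - (S k x / (1 + x) ^ n) / K" for x
 have FTC: "(\<integral>\<^sup>+x. ennreal (x ^ k / (1 + x) ^ (n + 1)) * indicator {r..} x \<partial>lborel) = ennreal (0 - F r)"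
 proof (rule nn_integral_FTC_atLeast)
  fix x assume x: "r <= x"
  then have x1: "1 + x > 0" using r by simp
  have "(F has_real_derivative - (((\<Sum>j\<le>k. real (n choose j) * (real j * x ^ (j - 1))) * (1 + x) ^ n - S k x * (real n * (1 + x) ^ (n - 1))) / ((1 + x) ^ n * (1 + x) ^ n)) / K) (at x)"
  proof -
   have "((%x. (1 + x) ^ n) has_real_derivative (real n * (1 + x) ^ (n - 1))) (at x)"
    by (auto intro!: derivative_eq_intros)
   from DERIV_quotient[OF S'[of k x] this] x1
   have "((%x. S k x / (1 + x) ^ n) has_real_derivative ((\<Sum>j\<le>k. real (n choose j) * (real j * x ^ (j - 1))) * (1 + x) ^ n - (real n * (1 + x) ^ (n - 1)) * S k x) / (((1 + x) ^ n) ^ Suc (Suc 0))) (at x)"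
    by simp
   from DERIV_cdivide[OF DERIV_minus[OF this], of K] show ?thesis
    unfolding F_def[abs_def] by (simp only: power_Suc power_0 mult_1_right mult.commute[of "S k x"])
  qed
  also have "(\<Sum>j\<le>k. real (n choose j) * (real j * x ^ (j - 1))) * (1 + x) ^ n - S k x * (real n * (1 + x) ^ (n - 1)) =
   (1 + x) ^ (n - 1) * ((1 + x) * (\<Sum>j\<le>k. real (n choose j) * (real j * x ^ (j - 1))) - real n * S k x)"
   using k by (cases n) (simp_all add: algebra_simps)
  also have "... = - ((1 + x) ^ (n - 1) * (K * x ^ k))" unfolding tele[OF k] by (simp add: K_def)
  also have "- (- ((1 + x) ^ (n - 1) * (K * x ^ k)) / ((1 + x) ^ n * (1 + x) ^ n)) / K = x ^ k / (1 + x) ^ (n + 1)"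
  proof -
   have gen: "- (- (P * (K * q)) / ((P * y) * (P * y))) / K = q / (P * (y * y))" if "P > 0" "y > 0" for P q y
    using that K by (simp add: field_simps)
   obtain n' where n: "n = Suc n'" using k by (cases n) auto
   show ?thesis using gen[of "(1 + x) ^ n'" "1 + x" "x ^ k"] x1 unfolding n by (simp add: mult_ac)
  qed
  finally show "(F has_real_derivative x ^ k / (1 + x) ^ (n + 1)) (at x)" .
 next
  have "((%x::real. x ^ j / (1 + x) ^ n) \<longlongrightarrow> 0) at_top" if "j < n" for j
  proof (rule tendsto_sandwich[of "%_. 0" _ _ "%x. 1 / (1 + x)"])
   show "((%x::real. 1 / (1 + x)) \<longlongrightarrow> 0) at_top" by real_asymp
   show "\<forall>\<^sub>F x::real in at_top. 0 <= x ^ j / (1 + x) ^ n"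
    using eventually_ge_at_top[of 0] by eventually_elim simp
   show "\<forall>\<^sub>F x::real in at_top. x ^ j / (1 + x) ^ n <= 1 / (1 + x)"
    using eventually_ge_at_top[of 0]
   proof eventually_elim
    fix x :: real assume x: "0 <= x"
    have "x ^ j * (1 + x) <= (1 + x) ^ j * (1 + x)" using x by (intro mult_right_mono power_mono) auto
    also have "... = (1 + x) ^ Suc j" by simp
    also have "... <= (1 + x) ^ n" using that x by (intro power_increasing) auto
    finally show "x ^ j / (1 + x) ^ n <= 1 / (1 + x)" using x by (simp add: field_simps)
   qed
  qed auto
  then have "((%x. - (\<Sum>j\<le>k. real (n choose j) * (x ^ j / (1 + x) ^ n)) / K) \<longlongrightarrow> - (\<Sum>j\<le>k. real (n choose j) * 0) / K) at_top"
   using k K by (intro tendsto_intros) auto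
  moreover have "F = (%x. - (\<Sum>j\<le>k. real (n choose j) * (x ^ j / (1 + x) ^ n)) / K)"
   by (simp add: F_def S_def fun_eq_iff sum_divide_distrib)
  ultimately show "(F \<longlongrightarrow> 0) at_top" by simp
 qed (use r in auto)
 have "(\<integral>\<^sup>+z. ennreal (indicator {z. r <= csq z} z * inverse ((1 + csq z) ^ (n + 1)) * (cmod z) ^ (2 * k)) \<partial>lborel) =
  (\<integral>\<^sup>+z. (%x. ennreal (x ^ k / (1 + x) ^ (n + 1)) * indicator {r..} x) (csq z) \<partial>lborel)"
 proof (intro nn_integral_cong)
  fix z :: complex
  have "cmod z ^ (2 * k) = (csq z) ^ k" by (rule power_mult)
  then show "ennreal (indicator {z. r <= csq z} z * inverse ((1 + csq z) ^ (n + 1)) * (cmod z) ^ (2 * k)) =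
   (%x. ennreal (x ^ k / (1 + x) ^ (n + 1)) * indicator {r..} x) (csq z)"
   by (cases "r <= csq z") (simp_all only: indicator_def mem_Collect_eq atLeast_iff if_True if_False divide_inverse mult.commute mult_1_left mult_1_right mult_zero_left mult_zero_right ennreal_0 of_bool_eq)
 qed
 also have "... = ennreal pi * (\<integral>\<^sup>+x. (ennreal (x ^ k / (1 + x) ^ (n + 1)) * indicator {r..} x) * indicator {0..} x \<partial>lborel)"
  by (rule nn_integral_radial) measurable
 also have "(\<integral>\<^sup>+x. (ennreal (x ^ k / (1 + x) ^ (n + 1)) * indicator {r..} x) * indicator {0..} x \<partial>lborel) =
  (\<integral>\<^sup>+x. ennreal (x ^ k / (1 + x) ^ (n + 1)) * indicator {r..} x \<partial>lborel)"
  using r by (intro nn_integral_cong) (auto simp: indicator_def)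
 also have "... = ennreal (S k r / (1 + r) ^ n / K)" unfolding FTC by (simp add: F_def)
 also have "ennreal pi * ennreal (S k r / (1 + r) ^ n / K) = ennreal (pi * (S k r / (1 + r) ^ n / K))"
 proof (rule ennreal_mult[symmetric])
  have "0 <= S k r" unfolding S_def using r by (intro sum_nonneg) auto
  then show "0 <= S k r / (1 + r) ^ n / K" using K r by simp
 qed simp
 also have "pi * (S k r / (1 + r) ^ n / K) = pi / K * (S k r / (1 + r) ^ n)" by simp
 finally show ?thesis unfolding K_def S_def .
qed

text \<open>The parameter is the squared radius; r = t / (1 - t) corresponds to a cap that covers
  the fraction t of the sphere.\<close>

definition dball :: "real => complex set" where
 "dball r = {z. csq z < r}"

text \<open>The probability that a binomial variable with n trials and success probability r / (1 +
  r) is at most k.\<close>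

definition Phi :: "nat => nat => real => real" where
 "Phi n k r = (\<Sum>j\<le>k. real (n choose j) * r ^ j) / (1 + r) ^ n"

lemma open_dball: "open (dball r)"
 unfolding dball_def by (intro open_Collect_less continuous_intros)

lemma Phi_pos: "0 <= r ==> 0 < Phi n k r"
proof -
 assume r: "0 <= r"
 have "0 < real (n choose 0) * r ^ 0" by simp
 also have "... <= (\<Sum>j\<le>k. real (n choose j) * r ^ j)"
  using r by (intro member_le_sum) auto
 finally show ?thesis unfolding Phi_def using r by (intro divide_pos_pos zero_less_power) auto
qed

lemma ent_dball:
 assumes k: "k < n" and r: "0 <= r"
 shows "ent (wg n (dball r)) k k = of_real (pi / (real (Suc k) * real (n choose Suc k)) * Phi n k r)"
proof -
 let ?h = "wg n (dball r)"
 have e: "?h z * cmod z ^ (2 * k) = indicator {z. r <= csq z} z * inverse ((1 + csq z) ^ (n + 1)) * (cmod z) ^ (2 * k)" for z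
  by (auto simp: wgt_def dball_def indicator_def)
 have p0: "0 <= pi / (real (Suc k) * real (n choose Suc k)) * Phi n k r"
  using Phi_pos[OF r, of n k] by (intro mult_nonneg_nonneg divide_nonneg_nonneg) auto
 have m: "(%z. ?h z * cmod z ^ (2 * k)) \<in> borel_measurable lborel"
  using measurable_wgt[OF open_dball, of r "[]" "n + 1"] by measurable
 have "(\<integral>z. ?h z * cmod z ^ (2 * k) \<partial>lborel) = enn2real (\<integral>\<^sup>+z. ennreal (?h z * cmod z ^ (2 * k)) \<partial>lborel)"
  by (rule integral_eq_nn_integral[OF m]) (simp add: wgt_nonneg)
 also have "... = pi / (real (Suc k) * real (n choose Suc k)) * Phi n k r"
  unfolding e radial_integral[OF k r] Phi_def[symmetric] by (rule enn2real_ennreal[OF p0])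
 finally have i: "(\<integral>z. ?h z * cmod z ^ (2 * k) \<partial>lborel) = pi / (real (Suc k) * real (n choose Suc k)) * Phi n k r" .
 have "ent ?h k k = (\<integral>z. complex_of_real (?h z * cmod z ^ (2 * k)) \<partial>lborel)"
  unfolding ent_def
 proof (intro Bochner_Integration.integral_cong refl)
  fix z
  have "complex_of_real (cmod z ^ (2 * k)) = of_real (csq z) ^ k" by (simp add: power_mult)
  also have "... = z ^ k * cnj z ^ k" by (simp only: complex_norm_square power_mult_distrib)
  finally show "complex_of_real (?h z) * (z ^ k * cnj z ^ k) = complex_of_real (?h z * cmod z ^ (2 * k))" by simp
 qed
 then show ?thesis unfolding integral_complex_of_real i .
qed

lemma gram_dball:
 assumes r: "0 <= r"
 shows "grm n (dball r) = mat n n (%(i, j). if i = j then of_real (pi / (real (Suc i) * real (n choose Suc i)) * Phi n i r) else 0)"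
proof (rule eq_matI)
 fix i j assume "i < dim_row (mat n n (%(i, j). if i = j then complex_of_real (pi / (real (Suc i) * real (n choose Suc i)) * Phi n i r) else 0))"
  "j < dim_col (mat n n (%(i, j). if i = j then complex_of_real (pi / (real (Suc i) * real (n choose Suc i)) * Phi n i r) else 0))"
 then have ij: "i < n" "j < n" by auto
 show "grm n (dball r) $$ (i, j) = mat n n (%(i, j). if i = j then of_real (pi / (real (Suc i) * real (n choose Suc i)) * Phi n i r) else 0) $$ (i, j)"
 proof (cases "i = j")
  case True
  then show ?thesis using ij ent_dball[OF ij(1) r] by (simp add: gram_def)
 next
  case False
  have "ent (wg n (dball r)) i j = 0"
   by (rule ent_radial_off_diag[OF measurable_wgt[OF open_dball], where H="%x. (if x\<^sup>2 < r then 0 else 1) * inverse ((1 + x^2) ^ (n + 1))"])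
    (use False in \<open>auto simp: wgt_def dball_def indicator_def\<close>)
  then show ?thesis using False ij by (simp add: gram_def)
 qed
qed (auto simp: gram_def)

lemma det_gram_dball:
 assumes r: "0 <= r"
 shows "det (grm n (dball r)) = of_real (\<Prod>i<n. pi / (real (Suc i) * real (n choose Suc i)) * Phi n i r)"
proof -
 let ?M = "mat n n (%(i, j). if i = j then complex_of_real (pi / (real (Suc i) * real (n choose Suc i)) * Phi n i r) else 0)"
 have "upper_triangular ?M" by (auto simp: upper_triangular_def)
 then have "det ?M = prod_list (diag_mat ?M)" by (rule det_upper_triangular[where n=n]) simp
 also have "... = (\<Prod>i\<in>{0..<n}. ?M $$ (i, i))" by (simp add: prod_list_diag_prod)
 also have "... = (\<Prod>i<n. of_real (pi / (real (Suc i) * real (n choose Suc i)) * Phi n i r))"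
  by (simp add: atLeast0LessThan)
 finally show ?thesis unfolding gram_dball[OF r] by simp
qed

lemma dball_0: "dball 0 = {}"
 by (auto simp: dball_def not_less)

lemma Phi_0 [simp]: "Phi n k 0 = 1"
proof -
 have "(\<Sum>j\<le>k. real (n choose j) * 0 ^ j) = (\<Sum>j\<le>k. if j = 0 then 1 else 0)"
  by (intro sum.cong) auto
 then show ?thesis by (simp add: Phi_def)
qed

theorem hp_dball:
 assumes r: "0 <= r"
 shows "hp n (dball r) = (\<Prod>i<n. Phi n i r)"
proof -
 define a where "a i = pi / (real (Suc i) * real (n choose Suc i))" for i
 have pos: "(\<Prod>i<n. a i) > 0" unfolding a_def by (intro prod_pos) auto
 have "hp n (dball r) = (\<Prod>i<n. pi / (real (Suc i) * real (n choose Suc i)) * Phi n i r) / (\<Prod>i<n. pi / (real (Suc i) * real (n choose Suc i)) * Phi n i 0)"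
  unfolding hp_def dball_0[symmetric] det_gram_dball[OF r] det_gram_dball[OF order_refl] Re_complex_of_real ..
 also have "... = ((\<Prod>i<n. a i) * (\<Prod>i<n. Phi n i r)) / (\<Prod>i<n. a i)"
  unfolding a_def[symmetric] prod.distrib Phi_0 by simp
 also have "... = (\<Prod>i<n. Phi n i r)" by (rule nonzero_mult_div_cancel_left) (use pos in linarith)
 finally show ?thesis .
qed

lemma adm_gram: "n >= 1 ==> open V ==> adm (n - 1) (wg n V)"
 using adm_wgt[of V "n - 1" "[]"] by (cases n) auto

lemma ent_cnj: "ent h j i = cnj (ent h i j)"
proof -
 have "cnj (ent h i j) = (\<integral>z. cnj (of_real (h z) * (z ^ i * cnj z ^ j)) \<partial>lborel)"
  unfolding ent_def by (rule Bochner_Integration.integral_cnj[symmetric])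
 also have "... = ent h j i" unfolding ent_def
  by (intro Bochner_Integration.integral_cong refl) (simp add: mult_ac)
 finally show ?thesis ..
qed

lemma quadratic_gram:
 assumes h: "adm N h" and n: "n <= Suc N"
 shows "(\<Sum>i<n. \<Sum>j<n. cnj (x i) * ent h i j * x j) = of_real (\<integral>z. h z * csq (\<Sum>j<n. x j * cnj z ^ j) \<partial>lborel)"
  "integrable lborel (%z. h z * csq (\<Sum>j<n. x j * cnj z ^ j))"
proof -
 define t where "t i j z = cnj (x i) * x j * (of_real (h z) * (z ^ i * cnj z ^ j))" for i j z
 have it: "integrable lborel (t i j)" if "i < n" "j < n" for i j
  unfolding t_def using that n by (intro integrable_mult_right integrable_ent[OF h]) auto
 have pt: "(\<Sum>i<n. \<Sum>j<n. t i j z) = complex_of_real (h z * csq (\<Sum>j<n. x j * cnj z ^ j))" for z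
 proof -
  have "complex_of_real (h z * csq (\<Sum>j<n. x j * cnj z ^ j)) =
   of_real (h z) * (cnj (\<Sum>i<n. x i * cnj z ^ i) * (\<Sum>j<n. x j * cnj z ^ j))"
   by (simp only: of_real_mult complex_norm_square mult.commute)
  also have "cnj (\<Sum>i<n. x i * cnj z ^ i) = (\<Sum>i<n. cnj (x i) * z ^ i)" by (simp add: cnj_sum)
  also have "of_real (h z) * ((\<Sum>i<n. cnj (x i) * z ^ i) * (\<Sum>j<n. x j * cnj z ^ j)) = (\<Sum>i<n. \<Sum>j<n. t i j z)"
   unfolding sum_product unfolding sum_distrib_left t_def by (intro sum.cong refl) (simp only: mult_ac)
  finally show ?thesis ..
 qed
 have "integrable lborel (%z. \<Sum>i<n. \<Sum>j<n. t i j z)"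
  by (intro Bochner_Integration.integrable_sum it) auto
 then have ic: "integrable lborel (%z. complex_of_real (h z * csq (\<Sum>j<n. x j * cnj z ^ j)))"
  unfolding pt .
 from integrable_Re[OF this]
 show "integrable lborel (%z. h z * csq (\<Sum>j<n. x j * cnj z ^ j))"
  unfolding Re_complex_of_real .
 have "(\<Sum>i<n. \<Sum>j<n. cnj (x i) * ent h i j * x j) = (\<Sum>i<n. \<Sum>j<n. (\<integral>z. t i j z \<partial>lborel))"
 proof (intro sum.cong refl)
  fix i j assume "i \<in> {..<n}" "j \<in> {..<n}"
  have "(\<integral>z. t i j z \<partial>lborel) = cnj (x i) * x j * ent h i j"
   unfolding t_def ent_def by (rule integral_mult_right_zero)
  then show "cnj (x i) * ent h i j * x j = (\<integral>z. t i j z \<partial>lborel)" by (simp only: mult_ac)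
 qed
 also have "... = (\<Sum>i<n. (\<integral>z. (\<Sum>j<n. t i j z) \<partial>lborel))"
  by (intro sum.cong refl Bochner_Integration.integral_sum[symmetric] it) auto
 also have "... = (\<integral>z. (\<Sum>i<n. \<Sum>j<n. t i j z) \<partial>lborel)"
  by (intro Bochner_Integration.integral_sum[symmetric] Bochner_Integration.integrable_sum it) auto
 also have "... = of_real (\<integral>z. h z * csq (\<Sum>j<n. x j * cnj z ^ j) \<partial>lborel)"
  unfolding pt by (rule integral_complex_of_real)
 finally show "(\<Sum>i<n. \<Sum>j<n. cnj (x i) * ent h i j * x j) = of_real (\<integral>z. h z * csq (\<Sum>j<n. x j * cnj z ^ j) \<partial>lborel)" .
qed

lemma finite_poly_cnj_zeros:
 assumes "\<exists>i<n. x i ~= (0 :: complex)"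
 shows "finite {z. (\<Sum>j<n. x j * cnj z ^ j) = 0}"
proof -
 obtain N where n: "n = Suc N" using assms by (cases n) auto
 have "finite {w. (\<Sum>j\<le>N. x j * w ^ j) = 0}"
  using assms unfolding Transcendental.polyfun_finite_roots n by (auto simp: less_Suc_eq_le)
 then have "finite (cnj -` {w. (\<Sum>j\<le>N. x j * w ^ j) = 0})"
  by (rule finite_vimageI) (simp add: inj_on_def)
 then show ?thesis unfolding n lessThan_Suc_atMost by (simp add: vimage_def)
qed

text \<open>The quadratic form is the weighted integral of the squared modulus of a polynomial in
  the conjugate of z. A nonzero polynomial has finitely many zeros, so the form can only vanish if V
  has full measure.\<close>

lemma pd_gram:
 assumes V: "open V" and n: "n >= 1" and pos: "~ (AE z in lborel. z \<in> V)"
 shows "pd n (grm n V)"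
 unfolding pd_def
proof (intro conjI allI impI)
 let ?h = "wg n V"
 have adm: "adm (n - 1) ?h" by (rule adm_gram[OF n V])
 show "gram n ?h \<in> carrier_mat n n" by (simp add: gram_def)
 show "gram n ?h $$ (i, j) = cnj (gram n ?h $$ (j, i))" if "i < n" "j < n" for i j
  using that ent_cnj[of ?h i j] by (simp add: gram_def)
 fix x :: "nat => complex" assume x: "\<exists>i<n. x i ~= 0"
 let ?f = "%z. ?h z * csq (\<Sum>j<n. x j * cnj z ^ j)"
 have le: "n <= Suc (n - 1)" by simp
 have nn: "0 <= ?f z" for z by (simp add: wgt_nonneg)
 have "(\<integral>z. ?f z \<partial>lborel) ~= 0"
 proof
  assume "(\<integral>z. ?f z \<partial>lborel) = 0"
  then have "AE z in lborel. ?f z = 0"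
   using integral_nonneg_eq_0_iff_AE[OF quadratic_gram(2)[OF adm le, of x]] nn by simp
  moreover have "AE z in lborel. z ~: {z. (\<Sum>j<n. x j * cnj z ^ j) = 0}"
   using finite_poly_cnj_zeros[OF x] by (intro AE_not_in finite_imp_null_set_lborel)
  ultimately have "AE z in lborel. z \<in> V"
  proof eventually_elim
   case (elim z)
   then have "?h z = 0" by simp
   moreover have "1 + csq z ~= 0" by (smt (verit) zero_le_power2)
   ultimately show ?case by (cases "z \<in> V") (auto simp: wgt_def)
  qed
  with pos show False ..
 qed
 moreover have "0 <= (\<integral>z. ?f z \<partial>lborel)" using nn by (intro Bochner_Integration.integral_nonneg) auto
 ultimately have p: "0 < (\<integral>z. ?f z \<partial>lborel)" by simp
 have "(\<Sum>i<n. \<Sum>j<n. cnj (x i) * gram n ?h $$ (i, j) * x j) = (\<Sum>i<n. \<Sum>j<n. cnj (x i) * ent ?h i j * x j)"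
  by (intro sum.cong refl) (simp add: gram_def)
 then show "0 < Re (\<Sum>i<n. \<Sum>j<n. cnj (x i) * gram n ?h $$ (i, j) * x j)"
  unfolding quadratic_gram(1)[OF adm le] using p by simp
qed

lemma Phi_le_1:
 assumes r: "0 <= r" and k: "k <= n"
 shows "Phi n k r <= 1"
proof -
 have "(\<Sum>j\<le>k. real (n choose j) * r ^ j) <= (\<Sum>j\<le>n. real (n choose j) * r ^ j)"
  using k r by (intro sum_mono2) auto
 also have "... = (1 + r) ^ n" using binomial_ring[of r 1 n] by (simp add: add.commute)
 finally show ?thesis unfolding Phi_def using r by (simp add: divide_le_eq)
qed

lemma hp_nonneg:
 assumes V: "open V" and n: "n >= 1"
 shows "0 <= hp n V"
proof -
 have "0 <= Re (det (grm n V))" "0 <= Re (det (grm n {}))"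
  using det_gram_real_nonneg[of n] adm_gram[OF n V] adm_gram[OF n, of "{}"] by auto
 then show ?thesis by (simp add: hp_def)
qed

text \<open>Negative correlation: in the monomial basis the Gram matrix of the complement of a centred
 disc is diagonal, so that removing the disc from a domain changes only the diagonal entries, and
 Fischer's inequality bounds the determinant.\<close>

theorem hp_disjoint:
 assumes V: "open V" and disj: "dball r \<inter> V = {}" and r: "0 <= r" and n: "n >= 1"
 shows "hp n (dball r \<union> V) <= hp n (dball r) * hp n V"
proof -
 let ?W = "dball r \<union> V"
 have W: "open ?W" using V open_dball by auto
 define h where "h i = pi / (real (Suc i) * real (n choose Suc i))" for i
 \<comment> \<open>The contribution of the disc to the i-th diagonal entry; h i is the entry for the
   whole plane.\<close>
 define e where "e i = h i - h i * Phi n i r" for i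
 have h0: "0 < h i" if "i < n" for i unfolding h_def using that by simp
 have ad: "adm (n - 1) (wg n U)" if "open U" for U by (rule adm_gram[OF n that])
 have d: "0 < Re (det (grm n {}))" by (rule J_hp(2)[OF V n])
 have gW: "grm n ?W = mat n n (%(i, j). grm n V $$ (i, j) - (if i = j then of_real (e i) else 0))"
 proof (rule eq_matI)
  fix i j assume "i < dim_row (mat n n (%(i, j). grm n V $$ (i, j) - (if i = j then complex_of_real (e i) else 0)))"
   "j < dim_col (mat n n (%(i, j). grm n V $$ (i, j) - (if i = j then complex_of_real (e i) else 0)))"
  then have ij: "i < n" "j < n" by auto
  then have ij': "i <= n - 1" "j <= n - 1" by auto
  let ?m = "%z::complex. z ^ i * cnj z ^ j"
  have "wg n ?W z = wg n V z - (wg n {} z - wg n (dball r) z)" for z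
   using disj by (auto simp: wgt_def indicator_def)
  then have "ent (wg n ?W) i j = (\<integral>z. of_real (wg n V z) * ?m z - (of_real (wg n {} z) * ?m z - of_real (wg n (dball r) z) * ?m z) \<partial>lborel)"
   unfolding ent_def by (intro Bochner_Integration.integral_cong refl) (simp add: left_diff_distrib)
  also have "... = ent (wg n V) i j - (ent (wg n {}) i j - ent (wg n (dball r)) i j)"
  proof -
   have I: "integrable lborel (%z. complex_of_real (wg n U z) * ?m z)" if "open U" for U
    by (rule integrable_ent[OF ad[OF that] ij'])
   note I3 = I[OF V] I[OF open_empty] I[OF open_dball, of r]
   show ?thesis
    unfolding ent_def
    using Bochner_Integration.integral_diff[OF I3(1) Bochner_Integration.integrable_diff[OF I3(2,3)]]
     Bochner_Integration.integral_diff[OF I3(2,3)] by simp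
  qed
  also have "ent (wg n {}) i j = grm n (dball 0) $$ (i, j)" using ij by (simp add: gram_def dball_0)
  also have "ent (wg n (dball r)) i j = grm n (dball r) $$ (i, j)" using ij by (simp add: gram_def)
  also have "grm n (dball 0) $$ (i, j) - grm n (dball r) $$ (i, j) = (if i = j then of_real (e i) else 0)"
   unfolding gram_dball[OF r] gram_dball[OF order_refl] using ij by (simp add: e_def h_def)
  finally show "grm n ?W $$ (i, j) = mat n n (%(i, j). grm n V $$ (i, j) - (if i = j then of_real (e i) else 0)) $$ (i, j)"
   using ij by (simp add: gram_def)
 qed (auto simp: gram_def)
 have main: "Re (det (grm n ?W)) <= (\<Prod>i<n. Phi n i r) * Re (det (grm n V))"
 \<comment> \<open>If the holes fill the plane up to a null set, the Gram matrix is zero rather than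
   positive definite, and the bound is trivial.\<close>
 proof (cases "AE z in lborel. z \<in> ?W")
  case True
  have "ent (wg n ?W) i j = (\<integral>z. 0 \<partial>(lborel :: complex measure))" for i j
   unfolding ent_def
  proof (rule integral_cong_AE)
   show "(%z. complex_of_real (wg n ?W z) * (z ^ i * cnj z ^ j)) \<in> borel_measurable lborel"
   proof -
    have [measurable]: "cnj \<in> borel_measurable borel" by (intro borel_measurable_continuous_onI continuous_intros)
    show ?thesis using measurable_wgt[OF W, of "[]" "n + 1"] by measurable
   qed
   show "AE z in lborel. complex_of_real (wg n ?W z) * (z ^ i * cnj z ^ j) = 0"
    using True by eventually_elim (auto simp: wgt_def)
  qed simp
  then have "grm n ?W = 0\<^sub>m n n" by (intro eq_matI) (auto simp: gram_def)
  then have "Re (det (grm n ?W)) = 0" using n by simp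
  moreover have "0 <= (\<Prod>i<n. Phi n i r)" using Phi_pos[OF r, of n] by (intro prod_nonneg) (auto intro: less_imp_le)
  moreover have "0 <= Re (det (grm n V))" using det_gram_real_nonneg[of n] ad[OF V] by simp
  ultimately show ?thesis by simp
 next
  case False
  have pdW: "pd n (grm n ?W)" by (rule pd_gram[OF W n False])
  have "Re (det (grm n ?W)) <= (\<Prod>i<n. (h i - e i) / h i) * Re (det (grm n V))"
   unfolding gW
  proof (rule pd_sub_diag_det)
   show "pd n (mat n n (%(i, j). grm n V $$ (i, j) - (if i = j then of_real (e i) else 0)))"
    using pdW unfolding gW .
   show "grm n V \<in> carrier_mat n n" by (simp add: gram_def)
  next
   fix i assume i: "i < n"
   have "Phi n i r <= 1" "0 < Phi n i r" using Phi_le_1[OF r, of i n] Phi_pos[OF r] i by auto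
   then have "h i * Phi n i r <= h i * 1" "0 <= h i * Phi n i r" using h0[OF i] by (intro mult_left_mono mult_nonneg_nonneg; simp)+
   then show "0 <= e i & e i <= h i & 0 < h i" using h0[OF i] unfolding e_def by simp
   have re: "Re (ent (wg n U) i i) = (\<integral>z. Re (of_real (wg n U z) * (z ^ i * cnj z ^ i)) \<partial>lborel)"
    "integrable lborel (%z. Re (of_real (wg n U z) * (z ^ i * cnj z ^ i)))" if "open U" for U
   proof -
    have "integrable lborel (%z. of_real (wg n U z) * (z ^ i * cnj z ^ i))"
     using i by (intro integrable_ent[OF ad[OF that]]) auto
    from integral_Re[OF this] integrable_Re[OF this]
    show "Re (ent (wg n U) i i) = (\<integral>z. Re (of_real (wg n U z) * (z ^ i * cnj z ^ i)) \<partial>lborel)"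
     "integrable lborel (%z. Re (of_real (wg n U z) * (z ^ i * cnj z ^ i)))"
     unfolding ent_def by simp_all
   qed
   have "Re (ent (wg n V) i i) <= Re (ent (wg n {}) i i)"
    unfolding re(1)[OF V] re(1)[OF open_empty]
   proof (rule integral_mono[OF re(2)[OF V] re(2)[OF open_empty]])
    fix z
    have "z ^ i * cnj z ^ i = of_real ((csq z) ^ i)"
    proof -
     have "complex_of_real ((csq z) ^ i) = (of_real (csq z)) ^ i" by (rule of_real_power)
     also have "... = (z * cnj z) ^ i" by (simp only: complex_norm_square)
     also have "... = z ^ i * cnj z ^ i" by (rule power_mult_distrib)
     finally show ?thesis ..
    qed
    then have rw: "Re (of_real (wg n U z) * (z ^ i * cnj z ^ i)) = wg n U z * (csq z) ^ i" for U
     by (simp only: Re_complex_of_real of_real_mult[symmetric])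
    have "wg n V z <= wg n {} z" by (auto simp: wgt_def indicator_def)
    then show "Re (of_real (wg n V z) * (z ^ i * cnj z ^ i)) <= Re (of_real (wg n {} z) * (z ^ i * cnj z ^ i))"
     unfolding rw by (intro mult_right_mono) auto
   qed
   also have "ent (wg n {}) i i = of_real (h i)"
    using ent_dball[OF i order_refl] unfolding dball_0 Phi_0 h_def by simp
   finally show "Re (grm n V $$ (i, i)) <= h i" using i by (simp add: gram_def)
  qed
  also have "(\<Prod>i<n. (h i - e i) / h i) = (\<Prod>i<n. Phi n i r)"
  proof (rule prod.cong[OF refl])
   fix i assume "i \<in> {..<n}"
   then have "0 < h i" using h0 by simp
   then show "(h i - e i) / h i = Phi n i r" by (simp add: e_def)
  qed
  finally show ?thesis .
 qed
 show ?thesis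
  unfolding hp_dball[OF r] unfolding hp_def times_divide_eq_right
  using main d by (intro divide_right_mono) auto
qed

section \<open>Rotations\<close>

text \<open>Points of the sphere are given by homogeneous coordinates in C^2, with (z, 1) for a
  point z of the plane, so that rotations stay defined at infinity. \<open>cval\<close> is the
  Hermitian inner product.\<close>

definition cval :: "complex \<times> complex => complex \<times> complex => complex" where
 "cval u x = fst x * cnj (fst u) + snd x * cnj (snd u)"

definition nsq :: "complex \<times> complex => real" where
 "nsq x = csq (fst x) + csq (snd x)"

text \<open>For a unit vector u and t between 0 and 1, the open cap around u that covers the
  fraction t of the sphere, as a cone in C^2; \<open>Ocap\<close> is its trace on the plane.\<close>

definition Ccap :: "complex \<times> complex => real => (complex \<times> complex) set" where
 "Ccap u t = {x. (1 - t) * nsq x < csq (cval u x)}"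

definition Ocap :: "complex \<times> complex => real => complex set" where
 "Ocap u t = {z. (z, 1) \<in> Ccap u t}"

definition rot :: "complex => complex => complex \<times> complex => complex \<times> complex" where
 "rot p q x = (fst x * cnj p - snd x * q, snd x * p + fst x * cnj q)"

definition hdet :: "nat => pencil => complex \<times> complex => complex" where
 "hdet n y x = det (mat n n (%(i, j). snd x * y (False, i, j) - fst x * y (True, i, j)))"

lemma open_Ocap: "open (Ocap u t)"
 unfolding Ocap_def Ccap_def mem_Collect_eq cval_def nsq_def fst_conv snd_conv
 by (intro open_Collect_less continuous_intros)

context
 fixes p q :: complex
 assumes pq: "csq p + csq q = 1"

begin

lemma pq1: "p * cnj p + q * cnj q = 1"
proof -
 have "complex_of_real (csq p + csq q) = 1" unfolding pq by simp
 then show ?thesis unfolding of_real_add complex_norm_square .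
qed

lemma unitary_norm: "csq (p * b + q * a) + csq (cnj p * a - cnj q * b) = csq a + csq b"
proof -
 have "complex_of_real (csq (p * b + q * a) + csq (cnj p * a - cnj q * b)) =
  (p * cnj p + q * cnj q) * (a * cnj a + b * cnj b)"
  unfolding of_real_add complex_norm_square by (simp add: algebra_simps)
 also have "... = complex_of_real (csq a + csq b)" unfolding pq1 of_real_add complex_norm_square by simp
 finally show ?thesis unfolding of_real_eq_iff .
qed

lemma cval_rot: "cval (rot p q u) (rot p q x) = cval u x"
proof -
 have "cval (rot p q u) (rot p q x) = (p * cnj p + q * cnj q) * cval u x"
  by (simp add: cval_def rot_def algebra_simps)
 then show ?thesis unfolding pq1 by simp
qed

lemma nsq_rot: "nsq (rot p q x) = nsq x"
proof -
 have "complex_of_real (nsq y) = cval y y" for y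
  unfolding nsq_def cval_def of_real_add complex_norm_square ..
 then have "complex_of_real (nsq (rot p q x)) = of_real (nsq x)" using cval_rot[of x x] by simp
 then show ?thesis by simp
qed

lemma Ccap_rot: "rot p q x \<in> Ccap (rot p q u) t \<longleftrightarrow> x \<in> Ccap u t"
 unfolding Ccap_def mem_Collect_eq cval_rot nsq_rot ..

lemma surj_rot: "\<exists>y. rot p q y = x"
proof -
 have "rot p q (fst x * p + snd x * q, snd x * cnj p - fst x * cnj q) =
  ((p * cnj p + q * cnj q) * fst x, (p * cnj p + q * cnj q) * snd x)"
  by (simp add: rot_def algebra_simps)
 then show ?thesis unfolding pq1 by auto
qed

lemma ball_Ccap_rot: "(\<forall>x\<in>Ccap u t. P (rot p q x)) \<longleftrightarrow> (\<forall>x\<in>Ccap (rot p q u) t. P x)"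
proof
 assume h: "\<forall>x\<in>Ccap u t. P (rot p q x)"
 show "\<forall>x\<in>Ccap (rot p q u) t. P x"
 proof
  fix x assume x: "x \<in> Ccap (rot p q u) t"
  obtain y where y: "rot p q y = x" using surj_rot by blast
  have "y \<in> Ccap u t" using x unfolding y[symmetric] Ccap_rot .
  then show "P x" using h y by blast
 qed
next
 assume h: "\<forall>x\<in>Ccap (rot p q u) t. P x"
 show "\<forall>x\<in>Ccap u t. P (rot p q x)"
 proof
  fix x assume "x \<in> Ccap u t"
  then have "rot p q x \<in> Ccap (rot p q u) t" unfolding Ccap_rot .
  then show "P (rot p q x)" using h by blast
 qed
qed

end

text \<open>A cap may contain the point at infinity, which the plane does not see. There the
  homogeneous determinant is det A up to a nonzero factor, and det A does not vanish by
  assumption.\<close>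

lemma hole_homogeneous:
 assumes t: "t <= 1" and a: "adet n y ~= 0"
 shows "hole n (\<Union>u\<in>F. Ocap u t) y \<longleftrightarrow> (\<forall>u\<in>F. \<forall>x\<in>Ccap u t. hdet n y x ~= 0)"
proof
 assume h: "hole n (\<Union>u\<in>F. Ocap u t) y"
 show "\<forall>u\<in>F. \<forall>x\<in>Ccap u t. hdet n y x ~= 0"
 proof (intro ballI)
  fix u x assume u: "u \<in> F" and x: "x \<in> Ccap u t"
  obtain z w where zw: "x = (z, w)" by (cases x)
  show "hdet n y x ~= 0"
  proof (cases "w = 0")
   case False
   have c: "cval u (z / w, 1) = cval u x / w" unfolding cval_def zw using False by (simp add: field_simps)
   have n: "nsq (z / w, 1) = nsq x / csq w" unfolding nsq_def zw using False by (simp add: norm_divide power_divide add_divide_distrib)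
   have "(z / w, 1) \<in> Ccap u t"
    using x False unfolding Ccap_def mem_Collect_eq c n norm_divide power_divide
    by (simp add: divide_strict_right_mono)
   then have "pdet n y (z / w) ~= 0" using h u unfolding hole_def Ocap_def by blast
   moreover have "mat n n (%(i, j). snd x * y (False, i, j) - fst x * y (True, i, j)) = w \<cdot>\<^sub>m mat n n (%(i, j). y (False, i, j) - z / w * y (True, i, j))"
    using False by (intro eq_matI) (auto simp: zw field_simps)
   ultimately show ?thesis using False unfolding hdet_def pdet_def by simp
  next
   case True
   have "z ~= 0" using x True by (auto simp: zw Ccap_def cval_def nsq_def)
   moreover have "mat n n (%(i, j). snd x * y (False, i, j) - fst x * y (True, i, j)) = (- z) \<cdot>\<^sub>m mat n n (%(i, j). y (True, i, j))"
    using True by (intro eq_matI) (auto simp: zw)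
   ultimately show ?thesis using a unfolding hdet_def adet_def by simp
  qed
 qed
next
 assume h: "\<forall>u\<in>F. \<forall>x\<in>Ccap u t. hdet n y x ~= 0"
 have "pdet n y z = hdet n y (z, 1)" for z by (simp add: pdet_def hdet_def)
 then show "hole n (\<Union>u\<in>F. Ocap u t) y" using h unfolding hole_def Ocap_def by auto
qed

text \<open>The lines are the pairs of corresponding entries of B (position 0) and A (position
  1).\<close>

lemma lines_pencil: "lines (ix n) (%(c::bool, i::nat, j::nat). if c then 1 else 0) (%(c, i, j) k. (k = 1, i, j)) 2 (n * n)"
proof
 fix k :: nat assume k: "k < 2"
 have "{i \<in> ix n. (case i of (c::bool, i, j) => if c then 1 else 0) = k} = {k = 1} \<times> {..<n} \<times> {..<n}"
 proof -
  have k2: "k = 0 \<or> k = 1" using k by linarith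
  show ?thesis
  proof (rule Set.set_eqI)
   fix x :: "bool \<times> nat \<times> nat"
   obtain c i j where x: "x = (c, i, j)" by (cases x)
   show "x \<in> {i \<in> ix n. (case i of (c::bool, i, j) => if c then 1 else 0) = k} \<longleftrightarrow> x \<in> {k = 1} \<times> {..<n} \<times> {..<n}"
    using k2 unfolding x by (cases c; elim disjE) simp_all
  qed
 qed
 then show "card {i \<in> ix n. (case i of (c::bool, i, j) => if c then 1 else 0) = k} = n * n"
  by (simp add: card_cartesian_product)
qed (auto simp: less_2_cases_iff split: if_splits)

text \<open>Mixing B and A by a unitary 2 by 2 matrix keeps the Gaussian weight and moves the
  eigenvalues by a rotation of the sphere.\<close>

theorem J_rot:
 assumes pq: "csq p + csq q = 1" and t: "t <= 1"
 shows "J n (\<Union>u\<in>F. Ocap u t) [] = J n (\<Union>u\<in>rot p q ` F. Ocap u t) []"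
proof -
 let ?r = "%(c::bool, i::nat, j::nat). if c then 1 else (0::nat)" and ?e = "%(c::bool, i::nat, j::nat) k::nat. (k = 1, i, j)"
 interpret L: lines "ix n" ?r ?e 2 "n * n" by (rule lines_pencil)
 define M where "M = mat 2 2 (%(i, j). if i = 0 then (if j = 0 then p else q) else if j = 0 then - cnj q else cnj p)"
 have MC: "M \<in> carrier_mat 2 2" by (simp add: M_def)
 have s2: "(\<Sum>i<2. f i) = f 0 + f (1::nat)" for f :: "nat => 'b :: comm_monoid_add" by (simp add: numeral_2_eq_2)
 have dM: "cmod (det M) = 1"
 proof (rule isometric_det[OF MC])
  fix x
  show "isom 2 M x"
   using unitary_norm[OF pq, of "x 0" "x 1"] unfolding s2 mv_def by (simp add: M_def algebra_simps)
 qed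
 then have dM0: "det M ~= 0" by auto
 define T where "T = L.lin M"
 have linF: "T y (False, i, j) = p * y (False, i, j) + q * y (True, i, j)" if "i < n" "j < n" for y i j
  using that unfolding T_def L.lin_def s2 by (simp add: M_def)
 have linT: "T y (True, i, j) = cnj p * y (True, i, j) - cnj q * y (False, i, j)" if "i < n" "j < n" for y i j
  using that unfolding T_def L.lin_def s2 by (simp add: M_def)
 have Inv: "Intg (ix n) G y = Intg (ix n) (%y. G (T y)) y" if "G \<in> benv" for G y
  using L.Intg_lin[OF MC dM0 that] dM unfolding T_def by simp
 have Tm: "T \<in> env \<rightarrow>\<^sub>M env" unfolding T_def by (rule L.measurable_lin)
 have sb2: "(\<Sum>c\<in>UNIV. f c) = f False + f True" for f :: "bool => real" by (simp add: UNIV_bool)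
 have sq: "sq (ix n) (T y) = sq (ix n) y" for y
 proof -
  have "sq (ix n) (T y) = (\<Sum>i<n. \<Sum>j<n. csq (T y (False, i, j)) + csq (T y (True, i, j)))"
   unfolding sq_ix[OF finite_lessThan finite_lessThan] sb2 by (simp add: sum.distrib)
  also have "... = (\<Sum>i<n. \<Sum>j<n. csq (y (True, i, j)) + csq (y (False, i, j)))"
   by (intro sum.cong refl) (simp only: linF linT lessThan_iff unitary_norm[OF pq])
  also have "... = sq (ix n) y"
   unfolding sq_ix[OF finite_lessThan finite_lessThan] sb2 by (simp add: sum.distrib)
  finally show ?thesis .
 qed
 have hd: "hdet n (T y) x = hdet n y (rot p q x)" for y x
  unfolding hdet_def
 proof (rule arg_cong[where f=det], rule cong_mat)
  fix i j assume ij: "i < n" "j < n"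
  show "(case (i, j) of (i, j) => snd x * T y (False, i, j) - fst x * T y (True, i, j)) =
   (case (i, j) of (i, j) => snd (rot p q x) * y (False, i, j) - fst (rot p q x) * y (True, i, j))"
   unfolding prod.case linF[OF ij] linT[OF ij] rot_def fst_conv snd_conv by (simp add: algebra_simps)
 qed simp_all
 let ?V = "\<Union>u\<in>F. Ocap u t" and ?V' = "\<Union>u\<in>rot p q ` F. Ocap u t"
 have V: "open ?V" "open ?V'" by (intro open_UN ballI open_Ocap)+
 have sb: "{y. bad n y} \<in> sets env" using pred_bad[of n] by (simp add: pred_def)
 have sb': "{y. bad n (T y)} \<in> sets env"
  using measurable_sets[OF Tm sb] by (simp add: vimage_def)
 have mF: "(%y. FJ n ?V [] (T y)) \<in> benv"
  using measurable_FJ[OF V(1)] Tm by (rule measurable_compose[rotated])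
 have "J n ?V [] = Intg (ix n) (%y. FJ n ?V [] (T y)) (%_. 0)"
  unfolding J_def by (rule Inv[OF measurable_FJ[OF V(1)]])
 also have "... = Intg (ix n) (FJ n ?V' []) (%_. 0)"
 proof (rule Intg_cong_null[OF mF measurable_FJ[OF V(2)]])
  \<comment> \<open>Both the pencil and its transform have to be regular, so that the homogeneous
    description of holes is available on either side.\<close>
  show "{y. bad n y} \<union> {y. bad n (T y)} \<in> sets env" using sb sb' by auto
  have "Intg (ix n) (indicator ({y. bad n y} \<union> {y. bad n (T y)})) (%_. 0) <=
   Intg (ix n) (%y. indicator {y. bad n y} y + indicator {y. bad n y} (T y)) (%_. 0)"
   by (intro Intg_mono) (auto simp: indicator_def)
  also have "... = Intg (ix n) (indicator {y. bad n y}) (%_. 0) + Intg (ix n) (%y. indicator {y. bad n y} (T y)) (%_. 0)"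
  proof (rule Intg_add)
   show "indicator {y. bad n y} \<in> benv" using sb by (rule borel_measurable_indicator)
   then show "(%y. indicator {y. bad n y} (T y)) \<in> benv"
    using Tm by (rule measurable_compose[rotated])
  qed
  also have "Intg (ix n) (%y. indicator {y. bad n y} (T y)) (%_. 0) = Intg (ix n) (indicator {y. bad n y}) (%_. 0)"
   by (rule Inv[symmetric, OF borel_measurable_indicator[OF sb]])
  finally show "Intg (ix n) (indicator ({y. bad n y} \<union> {y. bad n (T y)})) (%_. 0) = 0"
   by (simp add: Intg_bad)
 next
  fix y assume "y ~: {y. bad n y} \<union> {y. bad n (T y)}"
  then have a: "adet n y ~= 0" "adet n (T y) ~= 0" using bad_adet by auto
  have "hole n ?V (T y) \<longleftrightarrow> hole n ?V' y"
   unfolding hole_homogeneous[OF t a(1)] hole_homogeneous[OF t a(2)] hd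
   using ball_Ccap_rot[OF pq, of _ t "%x. hdet n y x ~= 0"] by auto
  then show "FJ n ?V [] (T y) = FJ n ?V' [] y"
   by (simp add: FJ_def sq indicator_def)
 qed
 finally show ?thesis unfolding J_def .
qed

lemma Ocap_pole: "t < 1 ==> Ocap (0, 1) t = dball (t / (1 - t))"
 unfolding Ocap_def Ccap_def cval_def nsq_def dball_def by (auto simp: field_simps)

section \<open>Binomial tails\<close>

definition Bin :: "nat => real => nat => real" where
 "Bin n t k = (\<Sum>j\<le>k. real (n choose j) * t ^ j * (1 - t) ^ (n - j))"

lemma Phi_Bin:
 assumes t: "0 <= t" "t < 1" and k: "k <= n"
 shows "Phi n k (t / (1 - t)) = Bin n t k"
proof -
 have "1 + t / (1 - t) = 1 / (1 - t)" using t by (simp add: field_simps)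
 then have "Phi n k (t / (1 - t)) = (\<Sum>j\<le>k. real (n choose j) * (t / (1 - t)) ^ j) * (1 - t) ^ n"
  using t by (simp add: Phi_def power_one_over)
 also have "... = (\<Sum>j\<le>k. real (n choose j) * t ^ j * (1 - t) ^ (n - j))"
  unfolding sum_distrib_right
 proof (rule sum.cong[OF refl])
  fix j assume "j \<in> {..k}"
  then have "(1 - t) ^ n = (1 - t) ^ j * (1 - t) ^ (n - j)" using k by (simp flip: power_add)
  then show "real (n choose j) * (t / (1 - t)) ^ j * (1 - t) ^ n = real (n choose j) * t ^ j * (1 - t) ^ (n - j)"
   using t by (simp add: power_divide)
 qed
 finally show ?thesis unfolding Bin_def .
qed

lemma Bin_total: "Bin n t n = 1"
 unfolding Bin_def using binomial_ring[of t "1 - t" n] by simp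

lemma Bin_pos: "0 <= t ==> t < 1 ==> 0 < Bin n t k"
proof -
 assume t: "0 <= t" "t < 1"
 have "0 < real (n choose 0) * t ^ 0 * (1 - t) ^ (n - 0)" using t by simp
 also have "... <= Bin n t k" unfolding Bin_def using t by (intro member_le_sum) auto
 finally show ?thesis .
qed

lemma Bin_mono: "0 <= t ==> t <= 1 ==> k <= l ==> Bin n t k <= Bin n t l"
 unfolding Bin_def by (intro sum_mono2) auto

lemma Bin_le_1: "0 <= t ==> t <= 1 ==> k <= n ==> Bin n t k <= 1"
 using Bin_mono[of t k n n] Bin_total[of n t] by simp

lemma gen_sum_le:
 assumes t: "0 <= t" "t <= 1" and x: "0 < x"
 shows "(\<Sum>j\<le>n. real (n choose j) * t ^ j * (1 - t) ^ (n - j) * x ^ j) <= exp (- (real n * t * (1 - x)))"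
proof -
 have "(\<Sum>j\<le>n. real (n choose j) * t ^ j * (1 - t) ^ (n - j) * x ^ j) = (t * x + (1 - t)) ^ n"
  unfolding binomial_ring by (intro sum.cong refl) (simp add: power_mult_distrib)
 also have "... <= exp (- (t * (1 - x))) ^ n"
 proof (rule power_mono)
  show "t * x + (1 - t) <= exp (- (t * (1 - x)))"
   using exp_ge_add_one_self[of "- (t * (1 - x))"] by (simp add: algebra_simps)
  show "0 <= t * x + (1 - t)" using t x by (intro add_nonneg_nonneg mult_nonneg_nonneg) auto
 qed
 also have "... = exp (- (real n * t * (1 - x)))" by (simp add: exp_of_nat_mult[symmetric] mult.assoc)
 finally show ?thesis .
qed

text \<open>Chernoff's bound for the lower tail: for x at most 1 and j at most k, x^j is at least
  x^k, and the generating function is at most an exponential.\<close>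

lemma Bin_upper:
 assumes t: "0 <= t" "t <= 1" and x: "0 < x" "x <= 1" and k: "k <= n"
 shows "Bin n t k <= exp (- (real n * t * (1 - x))) / x ^ k"
proof -
 have "Bin n t k * x ^ k <= (\<Sum>j\<le>k. real (n choose j) * t ^ j * (1 - t) ^ (n - j) * x ^ j)"
  unfolding Bin_def sum_distrib_right using t x
  by (intro sum_mono mult_left_mono power_decreasing) auto
 also have "... <= (\<Sum>j\<le>n. real (n choose j) * t ^ j * (1 - t) ^ (n - j) * x ^ j)"
  using k t x by (intro sum_mono2) auto
 also have "... <= exp (- (real n * t * (1 - x)))" by (rule gen_sum_le[OF t x(1)])
 finally show ?thesis using x by (simp add: pos_le_divide_eq)
qed

text \<open>Chernoff's bound for the upper tail at x = e, with e - 1 at most 2.\<close>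

lemma Bin_tail:
 assumes t: "0 <= t" "t <= 1" and k: "k <= n"
 shows "1 - Bin n t k <= exp (2 * (real n * t) - real k)"
proof -
 have "1 - Bin n t k = Bin n t n - Bin n t k" by (simp add: Bin_total)
 also have "... = (\<Sum>j\<in>{..n} - {..k}. real (n choose j) * t ^ j * (1 - t) ^ (n - j))"
  unfolding Bin_def using k by (subst sum_diff) auto
 also have "... <= (\<Sum>j\<in>{..n} - {..k}. real (n choose j) * t ^ j * (1 - t) ^ (n - j) * exp 1 ^ j * exp (- real k))"
 proof (rule sum_mono)
  fix j assume "j \<in> {..n} - {..k}"
  then have "1 <= exp (real j - real k)" by simp
  also have "... = exp 1 ^ j * exp (- real k)" by (simp add: exp_diff exp_minus exp_of_nat_mult[symmetric] divide_inverse)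
  finally have "real (n choose j) * t ^ j * (1 - t) ^ (n - j) * 1 <= real (n choose j) * t ^ j * (1 - t) ^ (n - j) * (exp 1 ^ j * exp (- real k))"
   using t by (intro mult_left_mono) auto
  then show "real (n choose j) * t ^ j * (1 - t) ^ (n - j) <= real (n choose j) * t ^ j * (1 - t) ^ (n - j) * exp 1 ^ j * exp (- real k)"
   by (simp add: mult.assoc)
 qed
 also have "... <= (\<Sum>j\<le>n. real (n choose j) * t ^ j * (1 - t) ^ (n - j) * exp 1 ^ j * exp (- real k))"
  using t by (intro sum_mono2) auto
 also have "... <= exp (- (real n * t * (1 - exp 1))) * exp (- real k)"
  unfolding sum_distrib_right[symmetric] by (intro mult_right_mono gen_sum_le[OF t]) auto
 also have "... = exp (real n * t * (exp 1 - 1) - real k)" by (simp add: exp_add[symmetric] algebra_simps)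
 also have "... <= exp (2 * (real n * t) - real k)"
  using mult_left_mono[of "exp 1 - 1" 2 "real n * t"] t exp_le by simp
 finally show ?thesis .
qed

lemma ln_fact_le: "ln (fact k) <= (real k + 1) * ln (real k + 1) - real k"
proof (induction k)
 case (Suc k)
 have "ln (fact (Suc k)) = ln (real (Suc k)) + ln (fact k)" by (simp add: ln_mult del: of_nat_Suc)
 moreover have "(real k + 2) * ln (real k + 2) - (real k + 2) * ln (real k + 1) >= 1"
 proof -
  have "ln (real k + 1) - ln (real k + 2) = ln ((real k + 1) / (real k + 2))" by (simp add: ln_div)
  also have "... <= (real k + 1) / (real k + 2) - 1" by (rule ln_le_minus_one) simp
  also have "... = - 1 / (real k + 2)" by (simp add: field_simps)
  finally have "(real k + 2) * (ln (real k + 1) - ln (real k + 2)) <= (real k + 2) * (- 1 / (real k + 2))"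
   by (intro mult_left_mono) auto
  then show ?thesis by (simp add: algebra_simps)
 qed
 ultimately show ?case using Suc by (simp add: algebra_simps)
qed simp

lemma ln_1_minus: "0 <= x ==> x <= 1 / 2 ==> - x - 2 * x^2 <= ln (1 - x)" for x :: real
 using ln_one_minus_pos_lower_bound[of x] by simp

text \<open>The single term j = k suffices. The condition that m^2 is at most n keeps the
  corrections bounded: replacing the falling factorial of n costs at most 3 in the exponent,
  replacing (1 - t)^n by exp(- m) at most 2.\<close>

lemma Bin_lower:
 assumes m: "2 <= m" "m^2 <= n" and k: "k <= m"
 shows "exp (real k * ln (real m) - ln (fact k) - real m - 5) <= Bin n (real m / real n) k"
proof -
 have n0: "0 < real n" using m by (cases n) auto
 have mm: "real m * real m <= real n" using m(2) by (metis of_nat_le_iff of_nat_mult power2_eq_square)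
 have m2: "2 * real m <= real m * real m" using m(1) by simp
 define t where "t = real m / real n"
 have mn2: "2 * real m <= real n" using mm m2 by linarith
 have t: "0 < t" "t <= 1 / 2" using m(1) mn2 n0 unfolding t_def pos_divide_le_eq[OF n0] by (auto intro!: divide_pos_pos)
 define x where "x = real k / real n"
 have x: "0 <= x" "x <= t" using k n0 by (auto simp: x_def t_def divide_right_mono)
 have kn: "k <= n" using k mm m2 by linarith
 have tn: "real n * t = real m" using n0 by (simp add: t_def)
 have "real k * x <= real m * t" using k x t by (intro mult_mono) auto
 moreover have mt: "real m * t <= 1" using mm n0 by (simp add: t_def field_simps)
 moreover have "real k * x^2 <= real m * t"
 proof -
  have "x^2 <= t * 1" unfolding power2_eq_square using x t by (intro mult_mono) auto
  then show ?thesis using k x by (intro mult_mono) auto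
 qed
 moreover have "real k * (- x - 2 * x^2) <= real k * ln (1 - x)" using ln_1_minus[of x] x t by (intro mult_left_mono) auto
 ultimately have lk: "- 3 <= real k * ln (1 - x)" by (simp add: algebra_simps)
 have "real n * (- t - 2 * t^2) <= real n * ln (1 - t)" using ln_1_minus[of t] t by (intro mult_left_mono) auto
 moreover have "real n * t^2 = real m * t" unfolding power2_eq_square mult.assoc[symmetric] tn ..
 moreover have "real n * (- t - 2 * t^2) = - (real n * t) - 2 * (real n * t^2)" by (simp add: algebra_simps)
 ultimately have ln: "- real m - 2 <= real n * ln (1 - t)" using mt unfolding tn by linarith
 have ch: "(real n - real k) ^ k / fact k <= real (n choose k)"
 proof -
  have "(real n - real k) ^ k = (\<Prod>i<k. real n - real k)" by simp
  also have "... <= (\<Prod>i<k. real n - real i)" using kn by (intro prod_mono) auto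
  also have "... = fact k * real (n choose k)"
   by (simp add: binomial_gbinomial gbinomial_prod_rev atLeast0LessThan)
  finally show ?thesis by (simp add: divide_le_eq mult.commute)
 qed
 have "exp (real k * ln (real m) - ln (fact k) - real m - 5) <= exp (real k * ln (real m) - ln (fact k) + real k * ln (1 - x) + real n * ln (1 - t))"
  using lk ln by simp
 also have "... = real m ^ k / fact k * (1 - x) ^ k * (1 - t) ^ n"
  using m x t by (simp add: exp_add exp_diff exp_of_nat_mult)
 also have "... <= real m ^ k / fact k * (1 - x) ^ k * (1 - t) ^ (n - k)"
  using x t by (intro mult_left_mono power_decreasing mult_nonneg_nonneg divide_nonneg_nonneg) auto
 also have "real m ^ k / fact k * (1 - x) ^ k = (real n - real k) ^ k / fact k * t ^ k"
 proof -
  have "real m * (1 - x) = (real n - real k) * t" using n0 by (simp add: x_def t_def field_simps)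
  then have "real m ^ k * (1 - x) ^ k = (real n - real k) ^ k * t ^ k" by (metis power_mult_distrib)
  then show ?thesis by simp
 qed
 also have "(real n - real k) ^ k / fact k * t ^ k * (1 - t) ^ (n - k) <= real (n choose k) * t ^ k * (1 - t) ^ (n - k)"
  using ch t by (intro mult_right_mono) auto
 also have "... <= Bin n t k" unfolding Bin_def using t by (intro member_le_sum) auto
 finally show ?thesis unfolding t_def .
qed

section \<open>Asymptotics of the product of binomial tails\<close>

definition KL :: "nat => real" where "KL m = (\<Sum>k<m. real k * ln (real k))"

text \<open>An antiderivative of x ln x. Its value at 1 is -1/4, which is the origin of the 1/4 in
  the comparison with the sums \<open>KL\<close>.\<close>

definition FF :: "real => real" where "FF x = x^2 / 2 * ln x - x\<^sup>2 / 4"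

lemma FF_deriv: "0 < x ==> (FF has_real_derivative x * ln x) (at x)"
 unfolding FF_def[abs_def] by (auto intro!: derivative_eq_intros simp: power2_eq_square add_divide_distrib)

lemma FF_step:
 assumes "1 <= x"
 shows "x * ln x <= FF (x + 1) - FF x" "FF (x + 1) - FF x <= (x + 1) * ln (x + 1)"
proof -
 have "\<exists>z. x < z & z < x + 1 & FF (x + 1) - FF x = (x + 1 - x) * (z * ln z)"
  by (rule MVT2) (use assms in \<open>auto intro!: FF_deriv\<close>)
 then obtain z where z: "x < z" "z < x + 1" "FF (x + 1) - FF x = z * ln z" by auto
 show "x * ln x <= FF (x + 1) - FF x" "FF (x + 1) - FF x <= (x + 1) * ln (x + 1)"
  unfolding z(3) using z assms by (intro mult_mono; simp)+
qed

lemma KL_bounds: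
 assumes "1 <= m"
 shows "KL m <= FF (real m) + 1 / 4" "FF (real m) + 1 / 4 <= KL (Suc m)"
proof -
 have "KL m <= FF (real m) + 1 / 4 & FF (real m) + 1 / 4 <= KL (Suc m)"
  using assms
 proof (induction m rule: nat_induct_at_least)
  case base
  then show ?case by (simp add: KL_def FF_def)
 next
  case (Suc m)
  have "KL (Suc m) = KL m + real m * ln (real m)" "KL (Suc (Suc m)) = KL (Suc m) + (real m + 1) * ln (real m + 1)"
   by (simp_all add: KL_def add.commute)
  then show ?case using Suc FF_step[of "real m"] by (simp add: add.commute)
 qed
 then show "KL m <= FF (real m) + 1 / 4" "FF (real m) + 1 / 4 <= KL (Suc m)" by auto
qed

lemma sum_lessThan_real: "(\<Sum>k<m. real k) = real m * (real m - 1) / 2"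
 by (induction m) (auto simp: field_simps)

text \<open>The sum over k < m of k ln m - k ln k + k - m, with the sum of k ln k replaced by its
  integral bound. The terms in m^2 ln m cancel and - m^2 / 4 remains.\<close>

definition EU :: "real => real" where
 "EU x = x * (x - 1) / 2 * (ln x + 1) - x\<^sup>2 - (FF (x - 1) + 1 / 4)"

lemma EU_limit: "((%x. EU x / x^2) \<longlongrightarrow> - 1 / 4) at_top"
 unfolding EU_def FF_def by real_asymp

text \<open>The factors with k at least m are bounded by 1. For k < m the Chernoff parameter x = k /
  m is the best one, as it minimises exp(- m (1 - x)) / x^k.\<close>

theorem hole_upper:
 assumes m: "2 <= m" "m < n"
 shows "(\<Prod>k<n. Bin n (real m / real n) k) <= exp (EU (real m))"
proof -
 define t where "t = real m / real n"
 have t: "0 < t" "t < 1" using m by (auto simp: t_def)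
 have tn: "real n * t = real m" using m by (simp add: t_def)
 have b: "Bin n t k <= exp (real k * ln (real m) - real k * ln (real k) + real k - real m)" if k: "k < m" for k
 proof (cases "k = 0")
  case True
  have "Bin n t 0 = (1 - t) ^ n" by (simp add: Bin_def)
  also have "... <= exp (- t) ^ n" using t exp_ge_add_one_self[of "- t"] by (intro power_mono) auto
  also have "... = exp (- real m)" by (simp add: exp_of_nat_mult[symmetric] tn)
  finally show ?thesis using True by simp
 next
  case False
  have x: "0 < real k / real m" "real k / real m <= 1" using False k by auto
  have "Bin n t k <= exp (- (real n * t * (1 - real k / real m))) / (real k / real m) ^ k"
   by (rule Bin_upper) (use t x k m in auto)
  also have "real n * t * (1 - real k / real m) = real m - real k" unfolding tn using k by (simp add: field_simps)
  also have "(real k / real m) ^ k = exp (real k * ln (real k / real m))" using x by (simp only: exp_of_nat_mult exp_ln)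
  also have "ln (real k / real m) = ln (real k) - ln (real m)" using False k by (simp add: ln_div)
  also have "exp (- (real m - real k)) / exp (real k * (ln (real k) - ln (real m))) = exp (real k * ln (real m) - real k * ln (real k) + real k - real m)"
   unfolding exp_diff[symmetric] by (simp add: algebra_simps)
  finally show ?thesis .
 qed
 have "(\<Prod>k<n. Bin n t k) <= (\<Prod>k<m. Bin n t k)"
 proof -
  have "(\<Prod>k<n. Bin n t k) = (\<Prod>k<m. Bin n t k) * (\<Prod>k\<in>{..<n} - {..<m}. Bin n t k)"
   using m by (subst prod.subset_diff[of "{..<m}" "{..<n}"]) (auto simp: mult.commute)
  also have "... <= (\<Prod>k<m. Bin n t k) * 1"
   using t Bin_pos[of t n] Bin_le_1[of t _ n] by (intro mult_left_mono prod_le_1 prod_nonneg) (auto intro: less_imp_le)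
  finally show ?thesis by simp
 qed
 also have "... <= (\<Prod>k<m. exp (real k * ln (real m) - real k * ln (real k) + real k - real m))"
  using b t Bin_pos[of t n] by (intro prod_mono) (auto intro: less_imp_le)
 also have "... = exp (\<Sum>k<m. real k * ln (real m) - real k * ln (real k) + real k - real m)" by (simp add: exp_sum)
 also have "(\<Sum>k<m. real k * ln (real m) - real k * ln (real k) + real k - real m) = real m * (real m - 1) / 2 * (ln (real m) + 1) - (real m)\<^sup>2 - KL m"
  unfolding sum.distrib sum_subtractf sum_distrib_right[symmetric] sum_lessThan_real KL_def by (simp add: field_simps power2_eq_square)
 also have "exp (real m * (real m - 1) / 2 * (ln (real m) + 1) - (real m)\<^sup>2 - KL m) <= exp (EU (real m))"
 proof -
  have "1 <= m - 1" and S: "Suc (m - 1) = m" using m by auto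
  then have "FF (real m - 1) + 1 / 4 <= KL m" using KL_bounds(2)[of "m - 1"] m by (simp add: of_nat_diff)
  then show ?thesis unfolding EU_def by simp
 qed
 finally show ?thesis unfolding t_def .
qed

lemma prod_1_minus:
 assumes "finite A" "!!i. i \<in> A ==> 0 <= a i & a i <= (1::real)"
 shows "1 - (\<Sum>i\<in>A. a i) <= (\<Prod>i\<in>A. 1 - a i) & (\<Prod>i\<in>A. 1 - a i) <= 1 & 0 <= (\<Prod>i\<in>A. 1 - a i)"
 using assms
proof (induction A rule: finite_induct)
 case (insert x A)
 have i: "1 - sum a A <= (\<Prod>i\<in>A. 1 - a i)" "(\<Prod>i\<in>A. 1 - a i) <= 1" "0 <= (\<Prod>i\<in>A. 1 - a i)" using insert by auto
 have x: "0 <= a x" "a x <= 1" using insert by auto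
 have "(1 - a x) * (\<Prod>i\<in>A. 1 - a i) = (\<Prod>i\<in>A. 1 - a i) - a x * (\<Prod>i\<in>A. 1 - a i)" by (simp add: algebra_simps)
 moreover have "a x * (\<Prod>i\<in>A. 1 - a i) <= a x * 1" using i x by (intro mult_left_mono) auto
 moreover have "(1 - a x) * (\<Prod>i\<in>A. 1 - a i) <= 1 * 1" using i x by (intro mult_mono) auto
 moreover have "0 <= (1 - a x) * (\<Prod>i\<in>A. 1 - a i)" using i x by (intro mult_nonneg_nonneg) auto
 ultimately show ?case using insert(1,2) i by simp
qed simp

definition EL :: "real => real" where
 "EL x = x * (x - 1) / 2 * (ln x + 1) - x\<^sup>2 - (FF (x + 1) + 1 / 4) - 5 * x - 3 * x * (ln (x + 1) + 6) - ln 2"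

lemma EL_limit: "((%x. EL x / x^2) \<longlongrightarrow> - 1 / 4) at_top"
 unfolding EL_def FF_def by real_asymp

text \<open>Three ranges. Below m, \<open>Bin_lower\<close> gives the leading term. Between m and 4
  m every factor is at least the one at m, which is of order 1 / (m + 1), so these 3 m factors cost
  only O(m ln m). From 4 m on the upper tails are summable and the product is at least 1/2, whence
  the ln 2 in \<open>EL\<close>.\<close>

theorem hole_lower:
 assumes m: "2 <= m" "m^2 <= n"
 shows "exp (EL (real m)) <= (\<Prod>k<n. Bin n (real m / real n) k)"
proof -
 define t where "t = real m / real n"
 have n0: "0 < real n" using m by (cases n) auto
 have mm: "real m * real m <= real n" using m(2) by (metis of_nat_le_iff of_nat_mult power2_eq_square)
 have m2: "2 * real m <= real m * real m" using m(1) by simp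
 have mn2: "2 * real m <= real n" using mm m2 by linarith
 have t: "0 < t" "t < 1" using m(1) mn2 n0 unfolding t_def pos_divide_less_eq[OF n0] by (auto intro!: divide_pos_pos)
 have mn: "m <= n" using mm m2 by linarith
 have tn: "real n * t = real m" using n0 by (simp add: t_def)
 let ?A = "{..<m}" and ?B = "{m..<min n (4 * m)}" and ?C = "{4 * m..<n}"
 have split: "{..<n} = ?A \<union> (?B \<union> ?C)" using mn by auto
 have hP: "(\<Prod>k<n. Bin n t k) = (\<Prod>k\<in>?A. Bin n t k) * ((\<Prod>k\<in>?B. Bin n t k) * (\<Prod>k\<in>?C. Bin n t k))"
  unfolding split by (subst prod.union_disjoint; (subst prod.union_disjoint)?; auto)
 have hA: "exp (real m * (real m - 1) / 2 * (ln (real m) + 1) - (real m)\<^sup>2 - (FF (real m + 1) + 1 / 4) - 5 * real m) <= (\<Prod>k\<in>?A. Bin n t k)"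
 proof -
  have "real m * (real m - 1) / 2 * (ln (real m) + 1) - (real m)\<^sup>2 - KL (Suc m) - 5 * real m <=
   (\<Sum>k<m. real k * ln (real m) - ln (fact k) - real m - 5)"
  proof -
   define A where "A = real m * (real m - 1) / 2"
   have "(\<Sum>k<m. ln (fact k)) <= (\<Sum>k<m. (real k + 1) * ln (real k + 1) - real k)"
    by (intro sum_mono ln_fact_le)
   also have "... = KL (Suc m) - A"
    unfolding sum_subtractf sum_lessThan_real KL_def sum.lessThan_Suc_shift A_def by (simp add: add.commute)
   finally have f: "(\<Sum>k<m. ln (fact k)) <= KL (Suc m) - A" .
   have "(\<Sum>k<m. real k * ln (real m) - ln (fact k) - real m - 5) = A * ln (real m) - (\<Sum>k<m. ln (fact k)) - real m * real m - 5 * real m"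
    unfolding sum_subtractf sum_distrib_right[symmetric] sum_lessThan_real A_def[symmetric] by simp
   moreover have "A * (ln (real m) + 1) = A * ln (real m) + A" by (simp add: distrib_left)
   ultimately show ?thesis using f unfolding A_def[symmetric] power2_eq_square by linarith
  qed
  then have "exp (real m * (real m - 1) / 2 * (ln (real m) + 1) - (real m)\<^sup>2 - (FF (real m + 1) + 1 / 4) - 5 * real m) <=
   exp (\<Sum>k<m. real k * ln (real m) - ln (fact k) - real m - 5)"
   using KL_bounds(1)[of "Suc m"] by (simp add: add.commute)
  also have "... = (\<Prod>k<m. exp (real k * ln (real m) - ln (fact k) - real m - 5))" by (simp add: exp_sum)
  also have "... <= (\<Prod>k<m. Bin n t k)" unfolding t_def using Bin_lower[OF m] by (intro prod_mono) auto
  finally show ?thesis .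
 qed
 have hB: "exp (- (3 * real m * (ln (real m + 1) + 6))) <= (\<Prod>k\<in>?B. Bin n t k)"
 proof -
  let ?b = "exp (- (ln (real m + 1) + 6))"
  have b1: "?b <= Bin n t m"
  proof -
   have "real m * ln (real m + 1) - real m * ln (real m) <= 1"
   proof -
    have "ln (real m + 1) - ln (real m) = ln ((real m + 1) / real m)" using m by (simp add: ln_div)
    also have "... <= (real m + 1) / real m - 1" using m by (intro ln_le_minus_one) auto
    also have "... = 1 / real m" using m by (simp add: field_simps)
    finally have "real m * (ln (real m + 1) - ln (real m)) <= real m * (1 / real m)" by (intro mult_left_mono) auto
    then show ?thesis using m by (simp add: algebra_simps)
   qed
   then have "- (ln (real m + 1) + 6) <= real m * ln (real m) - ln (fact m) - real m - 5"
    using ln_fact_le[of m] by (simp add: algebra_simps)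
   then have "?b <= exp (real m * ln (real m) - ln (fact m) - real m - 5)" by simp
   also have "... <= Bin n t m" unfolding t_def by (rule Bin_lower[OF m order_refl])
   finally show ?thesis .
  qed
  have c: "card ?B <= 3 * m" by simp
  have "exp (- (3 * real m * (ln (real m + 1) + 6))) = ?b ^ (3 * m)"
   by (simp add: exp_of_nat_mult[symmetric] algebra_simps)
  also have "... <= ?b ^ card ?B"
  proof (rule power_decreasing[OF c])
   have "0 <= ln (real m + 1)" by simp
   then have "- (ln (real m + 1) + 6) <= 0" by linarith
   then show "?b <= 1" by simp
  qed simp
  also have "... = (\<Prod>k\<in>?B. ?b)" by simp
  also have "... <= (\<Prod>k\<in>?B. Bin n t k)"
  proof (rule prod_mono)
   fix k assume "k \<in> ?B"
   then show "0 <= ?b & ?b <= Bin n t k" using b1 Bin_mono[of t m k n] t by auto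
  qed
  finally show ?thesis .
 qed
 have hC: "exp (- ln 2) <= (\<Prod>k\<in>?C. Bin n t k)"
 proof -
  have geo: "(\<Sum>k\<in>{a..<b}. (2/3::real) ^ k) <= 3 * (2/3) ^ a" for a b :: nat
  proof (cases "a <= b")
   case True
   then have "(\<Sum>k\<in>{a..<b}. (2/3::real) ^ k) = 3 * (2/3) ^ a - 3 * (2/3) ^ b"
    by (induction b rule: dec_induct) auto
   then show ?thesis by simp
  qed simp
  have e: "exp (- (1/2)) <= (2/3 :: real)"
  proof -
   have "3 / 2 <= exp (1/2 :: real)" using exp_ge_add_one_self[of "1/2"] by simp
   then have "inverse (exp (1/2 :: real)) <= inverse (3/2)" by (intro le_imp_inverse_le) auto
   then show ?thesis by (simp add: exp_minus)
  qed
  \<comment> \<open>For k at least 4 m the exponent 2 m - k of \<open>Bin_tail\<close> is at most -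
    k / 2, and exp(- 1/2) is at most 2/3.\<close>
  have a: "0 <= 1 - Bin n t k & 1 - Bin n t k <= 1 & 1 - Bin n t k <= (2/3) ^ k" if "k \<in> ?C" for k
  proof -
   have "1 - Bin n t k <= exp (2 * (real n * t) - real k)" using that t by (intro Bin_tail) auto
   also have "... <= exp (real k * (- (1/2)))" using that by (simp add: tn)
   also have "... = exp (- (1/2)) ^ k" by (rule exp_of_nat_mult)
   also have "... <= (2/3) ^ k" using e by (intro power_mono) auto
   finally show ?thesis using Bin_pos[of t n k] Bin_le_1[of t k n] t that by auto
  qed
  have "(\<Sum>k\<in>?C. 1 - Bin n t k) <= (\<Sum>k\<in>?C. (2/3) ^ k)" using a by (intro sum_mono) auto
  also have "... <= 3 * (2/3) ^ (4 * m)" by (rule geo)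
  also have "... <= 3 * (2/3) ^ 8" using m by (intro mult_left_mono power_decreasing) auto
  also have "... <= (1/2 :: real)" by (simp add: power_divide)
  finally have "1 / 2 <= 1 - (\<Sum>k\<in>?C. 1 - Bin n t k)" by simp
  also have "... <= (\<Prod>k\<in>?C. 1 - (1 - Bin n t k))" using prod_1_minus[of ?C "%k. 1 - Bin n t k"] a by auto
  finally show ?thesis by (simp add: exp_minus)
 qed
 have "exp (real m * (real m - 1) / 2 * (ln (real m) + 1) - (real m)\<^sup>2 - (FF (real m + 1) + 1 / 4) - 5 * real m) *
  (exp (- (3 * real m * (ln (real m + 1) + 6))) * exp (- ln 2)) <= (\<Prod>k<n. Bin n t k)"
 proof -
  note nA = order_trans[OF exp_ge_zero hA] and nB = order_trans[OF exp_ge_zero hB]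
  show ?thesis unfolding hP by (intro mult_mono hA hB hC nA nB mult_nonneg_nonneg exp_ge_zero)
 qed
 then show ?thesis unfolding EL_def t_def exp_add[symmetric] by (simp add: algebra_simps)
qed

section \<open>Caps of the sphere\<close>

abbreviation S2 :: "(real^3) set" where "S2 == sphere 0 1"

text \<open>R^3 as plane times height, so that horizontal slices can be integrated with the radial
  formula.\<close>

definition vec3 :: "complex \<times> real => real^3" where
 "vec3 x = vector [Re (fst x), Im (fst x), snd x]"

lemma vec3_nth [simp]: "vec3 x $ 1 = Re (fst x)" "vec3 x $ 2 = Im (fst x)" "vec3 x $ 3 = snd x"
 by (simp_all add: vec3_def)

lemma measurable_vec3: "vec3 \<in> borel_measurable borel"
proof (rule borel_measurable_continuous_onI, unfold continuous_on_def, intro ballI)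
 fix x :: "complex \<times> real"
 have "(%x. vec3 x $ i) \<midarrow>x\<rightarrow> vec3 x $ i" for i
 proof -
  have "\<forall>i. (%x. vec3 x $ i) \<midarrow>x\<rightarrow> vec3 x $ i"
   unfolding forall_3 by (auto intro!: tendsto_intros)
  then show ?thesis ..
 qed
 then show "vec3 \<midarrow>x\<rightarrow> vec3 x" by (rule vec_tendstoI)
qed

lemma prod_Basis_vec:
 fixes v :: "real^'n"
 shows "(\<Prod>b\<in>Basis. v \<bullet> b) = (\<Prod>i\<in>UNIV. v $ i)"
proof -
 have B: "(Basis :: (real^'n) set) = (%i. axis i 1) ` UNIV" by (auto simp: Basis_vec_def)
 have "(\<Prod>b\<in>Basis. v \<bullet> b) = (\<Prod>i\<in>UNIV. v \<bullet> axis i 1)"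
  unfolding B by (subst prod.reindex) (auto simp: inj_on_def axis_eq_axis)
 then show ?thesis by (simp add: inner_axis)
qed

lemma distr_vec3: "distr lborel borel vec3 = lborel"
proof (rule lborel_eqI[symmetric])
 fix l u :: "real^3" assume lu0: "!!b. b \<in> Basis ==> l \<bullet> b <= u \<bullet> b"
 have lu: "l $ i <= u $ i" for i
 proof -
  have "axis i (1::real) \<in> Basis" by (simp add: axis_in_Basis_iff)
  from lu0[OF this] show ?thesis by (simp add: inner_axis)
 qed
 have pre: "vec3 -` box l u = box (Complex (l $ 1) (l $ 2)) (Complex (u $ 1) (u $ 2)) \<times> box (l $ 3) (u $ 3)"
  by (auto simp: mem_box_cart forall_3 in_box_complex_iff)
 have "emeasure (distr lborel borel vec3) (box l u) = emeasure (lborel \<Otimes>\<^sub>M lborel) (vec3 -` box l u)"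
  by (subst emeasure_distr) (simp_all add: measurable_vec3 lborel_prod)
 also have "... = emeasure lborel (box (Complex (l $ 1) (l $ 2)) (Complex (u $ 1) (u $ 2))) * emeasure lborel (box (l $ 3) (u $ 3))"
  unfolding pre by (rule lborel.emeasure_pair_measure_Times) auto
 also have "emeasure lborel (box (Complex (l $ 1) (l $ 2)) (Complex (u $ 1) (u $ 2))) = ennreal ((u $ 1 - l $ 1) * (u $ 2 - l $ 2))"
  using lu[of 1] lu[of 2] by (subst emeasure_lborel_box) (auto simp: Basis_complex_def inner_complex_def complex_eq_iff)
 also have "emeasure lborel (box (l $ 3) (u $ 3)) = ennreal (u $ 3 - l $ 3)"
  using lu[of 3] by simp
 finally have d: "emeasure (distr lborel borel vec3) (box l u) = ennreal ((u $ 1 - l $ 1) * (u $ 2 - l $ 2)) * ennreal (u $ 3 - l $ 3)" .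
 then show "emeasure (distr lborel borel vec3) (box l u) = ennreal (\<Prod>b\<in>Basis. (u - l) \<bullet> b)"
 proof -
  have "(\<Prod>i\<in>UNIV. (u - l) $ i) = ((u $ 1 - l $ 1) * (u $ 2 - l $ 2)) * (u $ 3 - l $ 3)"
   unfolding UNIV_3 by (simp add: mult.assoc)
  moreover have "ennreal (((u $ 1 - l $ 1) * (u $ 2 - l $ 2)) * (u $ 3 - l $ 3)) = ennreal ((u $ 1 - l $ 1) * (u $ 2 - l $ 2)) * ennreal (u $ 3 - l $ 3)"
   using lu[of 1] lu[of 2] lu[of 3] by (intro ennreal_mult) auto
  ultimately show ?thesis
   using d unfolding prod_Basis_vec by simp
 qed
qed simp

text \<open>For unit u and positive c, the solid sector of the unit ball over an open cap; up to the
  factor 3 its volume is the area of the cap in the given normalisation.\<close>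

definition scone :: "real^3 => real => (real^3) set" where
 "scone u c = {x. norm x <= 1 & c * norm x < u \<bullet> x}"

lemma sets_scone [measurable]: "scone u c \<in> sets borel"
 unfolding scone_def by measurable

lemma norm_vec3: "norm (vec3 x) = sqrt (csq (fst x) + (snd x)^2)"
 by (simp add: norm_vec_def L2_set_def sum_3 cmod_power2)

text \<open>The slice at height h is a disc of squared radius L h. For h up to c the cone bounds it,
  above c the ball does.\<close>

lemma emeasure_scone_axis:
 assumes c: "0 < c" "c < 1"
 shows "emeasure lborel (scone (axis 3 1) c) = ennreal (2 * pi / 3 * (1 - c))"
proof -
 define L where "L h = (if 0 < h & h <= c then h\<^sup>2 * ((1 - c\<^sup>2) / c^2) else if c < h & h <= 1 then 1 - h\<^sup>2 else 0)" for h :: real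
 have c2: "0 < c^2" "c^2 < 1" using c by (auto simp: power_less_one_iff abs_square_less_1)
 have sec: "(\<integral>\<^sup>+s. indicator {s. s + h^2 <= 1 & c * sqrt (s + h^2) < h} s * indicator {0..} s \<partial>lborel) = ennreal (L h)" for h :: real
 proof -
  have iff: "c * sqrt (s + h^2) < h \<longleftrightarrow> 0 < h & s < h^2 * ((1 - c\<^sup>2) / c^2)" if "0 <= s" for s
  proof (cases "0 < h")
   case True
   have "c * sqrt (s + h^2) < h \<longleftrightarrow> (c * sqrt (s + h^2))\<^sup>2 < h^2"
    using True c that abs_le_square_iff[of h "c * sqrt (s + h^2)"] by (simp add: not_le[symmetric] abs_mult)
   also have "... \<longleftrightarrow> c\<^sup>2 * (s + h^2) < h^2" using that by (simp add: power_mult_distrib)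
   also have "... \<longleftrightarrow> s < h^2 * ((1 - c\<^sup>2) / c^2)" using c2 by (simp add: field_simps)
   finally show ?thesis using True by simp
  next
   case False
   have "0 <= c * sqrt (s + h^2)" using c that by simp
   then show ?thesis using False by auto
  qed
  define a where "a = h^2 * ((1 - c\<^sup>2) / c^2)"
  consider "h <= 0 \<or> 1 < h" | "0 < h" "h <= c" | "c < h" "h <= 1" by linarith
  then have "(\<integral>\<^sup>+s. indicator ({s. s + h^2 <= 1 & c * sqrt (s + h^2) < h} \<inter> {0..}) s \<partial>lborel) = ennreal (L h)"
  proof cases
   case 1
   then have "{s. s + h^2 <= 1 & c * sqrt (s + h^2) < h} \<inter> {0..} = {}"
   proof
    assume "1 < h"
    then have "1 < h^2" by (simp add: one_less_power)
    then show ?thesis by auto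
   qed (use iff in auto)
   then show ?thesis using 1 c by (auto simp: L_def)
  next
   case 2
   have "a <= 1 - h\<^sup>2"
   proof -
    have "h^2 <= c^2" using 2 by (intro power_mono) auto
    then have "h^2 / c^2 <= 1" using c2 by simp
    moreover have "a = h^2 / c^2 - h\<^sup>2" unfolding a_def using c2 by (simp add: field_simps)
    ultimately show ?thesis by simp
   qed
   then have "{s. s + h^2 <= 1 & c * sqrt (s + h^2) < h} \<inter> {0..} = {0..<a}"
    using iff 2 unfolding a_def by auto
   moreover have "0 <= a" unfolding a_def using c2 by simp
   ultimately show ?thesis using 2 by (simp add: L_def a_def)
  next
   case 3
   have "1 - h\<^sup>2 < a"
   proof -
    have "c^2 < h^2" using 3 c by (intro power_strict_mono) auto
    then have "1 < h^2 / c^2" using c2 by simp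
    moreover have "a = h^2 / c^2 - h\<^sup>2" unfolding a_def using c2 by (simp add: field_simps)
    ultimately show ?thesis by simp
   qed
   then have "{s. s + h^2 <= 1 & c * sqrt (s + h^2) < h} \<inter> {0..} = {0..1 - h\<^sup>2}"
    using iff 3 c unfolding a_def by auto
   moreover have "0 <= 1 - h\<^sup>2" using 3 c by (simp add: power_le_one)
   ultimately show ?thesis using 3 by (simp add: L_def)
  qed
  then show ?thesis by (simp add: indicator_inter_arith)
 qed
 have W: "vec3 -` scone (axis 3 1) c = {x. csq (fst x) + (snd x)^2 <= 1 & c * sqrt (csq (fst x) + (snd x)^2) < snd x}"
  by (auto simp: scone_def norm_vec3 inner_axis' inner_vec_def sum_3 axis_def)
 have Wm: "vec3 -` scone (axis 3 1) c \<in> sets (lborel \<Otimes>\<^sub>M lborel)"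
  using measurable_sets[OF measurable_vec3 sets_scone, of "axis 3 1" c] unfolding lborel_prod by simp
 have "emeasure lborel (scone (axis 3 1) c) = emeasure (distr lborel borel vec3) (scone (axis 3 1) c)"
  by (simp add: distr_vec3)
 also have "... = emeasure (lborel \<Otimes>\<^sub>M lborel) (vec3 -` scone (axis 3 1) c)"
  by (subst emeasure_distr) (simp_all add: measurable_vec3 lborel_prod)
 also have "... = (\<integral>\<^sup>+h. emeasure lborel ((%z. (z, h)) -` (vec3 -` scone (axis 3 1) c)) \<partial>lborel)"
  by (rule lborel_pair.emeasure_pair_measure_alt2[OF Wm])
 also have "... = (\<integral>\<^sup>+h. ennreal pi * ennreal (L h) \<partial>lborel)"
 proof (rule nn_integral_cong)
  fix h :: real
  let ?T = "{s. s + h^2 <= 1 & c * sqrt (s + h^2) < h}"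
  have Z: "(%z. (z, h)) -` (vec3 -` scone (axis 3 1) c) = {z. csq z \<in> ?T}" unfolding W by auto
  have "(%z. (z, h)) -` (vec3 -` scone (axis 3 1) c) \<in> sets lborel" using sets_Pair2[OF Wm] .
  then have "emeasure lborel ((%z. (z, h)) -` (vec3 -` scone (axis 3 1) c)) = (\<integral>\<^sup>+z. indicator ((%z. (z, h)) -` (vec3 -` scone (axis 3 1) c)) z \<partial>lborel)"
   by simp
  also have "... = (\<integral>\<^sup>+z. indicator ?T (csq z) \<partial>lborel)" unfolding Z by (intro nn_integral_cong) (auto simp: indicator_def)
  also have "... = ennreal pi * (\<integral>\<^sup>+s. indicator ?T s * indicator {0..} s \<partial>lborel)"
   by (rule nn_integral_radial) measurable
  finally show "emeasure lborel ((%z. (z, h)) -` (vec3 -` scone (axis 3 1) c)) = ennreal pi * ennreal (L h)" unfolding sec .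
 qed
 also have "... = ennreal pi * (\<integral>\<^sup>+h. ennreal (L h) \<partial>lborel)"
  by (rule nn_integral_cmult) (simp add: L_def)
 also have "(\<integral>\<^sup>+h. ennreal (L h) \<partial>lborel) = (\<integral>\<^sup>+h. ennreal (h^2 * ((1 - c\<^sup>2) / c^2)) * indicator {0..c} h + ennreal (1 - h\<^sup>2) * indicator {c..1} h \<partial>lborel)"
 proof (rule nn_integral_cong_AE)
  show "AE h in lborel. ennreal (L h) = ennreal (h^2 * ((1 - c\<^sup>2) / c^2)) * indicator {0..c} h + ennreal (1 - h\<^sup>2) * indicator {c..1} h"
   using AE_lborel_singleton[of c] AE_lborel_singleton[of 0]
   by eventually_elim (use c in \<open>auto simp: L_def indicator_def\<close>)
 qed
 also have "... = (\<integral>\<^sup>+h. ennreal (h^2 * ((1 - c\<^sup>2) / c^2)) * indicator {0..c} h \<partial>lborel) + (\<integral>\<^sup>+h. ennreal (1 - h\<^sup>2) * indicator {c..1} h \<partial>lborel)"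
  by (rule nn_integral_add) measurable
 also have "(\<integral>\<^sup>+h. ennreal (h^2 * ((1 - c\<^sup>2) / c^2)) * indicator {0..c} h \<partial>lborel) = ennreal ((c ^ 3 / 3 * ((1 - c\<^sup>2) / c^2)) - (0 ^ 3 / 3 * ((1 - c\<^sup>2) / c^2)))"
   proof -
  have "(\<integral>\<^sup>+h. ennreal (h^2 * \<kappa>) * indicator {0..c} h \<partial>lborel) = ennreal ((c ^ 3 / 3 * \<kappa>) - (0 ^ 3 / 3 * \<kappa>))" if "0 <= \<kappa>" for \<kappa> :: real
   by (rule nn_integral_FTC_Icc) (use c that in \<open>auto intro!: derivative_eq_intros\<close>)
  note k = this
  show ?thesis by (rule k) (use c2 in simp)
 qed
 also have "(\<integral>\<^sup>+h. ennreal (1 - h\<^sup>2) * indicator {c..1} h \<partial>lborel) = ennreal ((1 - 1 ^ 3 / 3) - (c - c ^ 3 / 3))"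
  by (rule nn_integral_FTC_Icc) (use c in \<open>auto intro!: derivative_eq_intros simp: power_le_one\<close>)
 also have "c ^ 3 / 3 * ((1 - c\<^sup>2) / c^2) = (c - c ^ 3) / 3" using c by (simp add: field_simps power2_eq_square power3_eq_cube)
 also have "ennreal ((c - c ^ 3) / 3 - 0 ^ 3 / 3 * ((1 - c\<^sup>2) / c^2)) + ennreal ((1 - 1 ^ 3 / 3) - (c - c ^ 3 / 3)) = ennreal (2 / 3 * (1 - c))"
 proof -
  have "c ^ 3 <= c" using c power_decreasing[of 1 3 c] by simp
  moreover have "0 <= (1 - 1 ^ 3 / 3) - (c - c ^ 3 / 3)"
  proof -
   have "(1 - 1 ^ 3 / 3) - (c - c ^ 3 / 3) = (1 - c)^2 * (c + 2) / 3" by (simp add: field_simps power2_eq_square power3_eq_cube)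
   moreover have "0 <= (1 - c)\<^sup>2 * (c + 2) / 3" using c by (intro divide_nonneg_pos mult_nonneg_nonneg) auto
   ultimately show ?thesis by simp
  qed
  ultimately show ?thesis by (subst ennreal_plus[symmetric]) (auto simp: field_simps)
 qed
 finally show ?thesis using c by (simp add: mult_ac flip: ennreal_mult)
qed

lemma emeasure_scone:
 assumes u: "norm u = 1" and c: "0 < c" "c < 1"
 shows "emeasure lborel (scone u c) = ennreal (2 * pi / 3 * (1 - c))"
proof -
 obtain f :: "real^3 => real^3" where f: "orthogonal_transformation f" "f (axis 3 1) = u"
  using orthogonal_transformation_exists_1[of "axis 3 1 :: real^3" u] u by (auto simp: norm_axis_1)
 have bij: "bij f" using f(1) by (rule orthogonal_transformation_bij)
 have im: "f ` scone (axis 3 1) c = scone u c"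
 proof -
  have "f x \<in> scone u c \<longleftrightarrow> x \<in> scone (axis 3 1) c" for x
   using f(1) unfolding scone_def f(2)[symmetric] by (simp add: orthogonal_transformation_def orthogonal_transformation_norm)
  then show ?thesis using bij by (metis (no_types, lifting) bij_is_surj image_subset_iff subsetI subset_antisym surjD image_eqI)
 qed
 have lm: "scone v c \<in> lmeasurable" for v
 proof (rule bounded_set_imp_lmeasurable)
  show "bounded (scone v c)" unfolding bounded_iff scone_def by auto
  show "scone v c \<in> sets lebesgue" by simp
 qed
 have ms: "emeasure lborel (scone v c) = ennreal (measure lebesgue (scone v c))" for v
  using fmeasurableD2[OF lm] by (simp add: emeasure_eq_ennreal_measure)
 have "measure lebesgue (scone u c) = measure lebesgue (scone (axis 3 1) c)"
  using measure_orthogonal_image[OF f(1) lm[of "axis 3 1"]] unfolding im .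
 then show ?thesis using emeasure_scone_axis[OF c] unfolding ms by simp
qed

lemma sgn_borel: "(sgn :: real^3 => real^3) \<in> borel_measurable borel"
 unfolding sgn_div_norm[abs_def] by measurable

lemma emeasure_sphere_area:
 assumes E: "E \<in> sets borel" "E <= S2"
 shows "emeasure sphere_area E = 3 * emeasure lborel {x. x ~= 0 & norm x <= 1 & sgn x \<in> E}"
proof -
 let ?R = "restrict_space lborel (cball 0 1 - {0}) :: (real^3) measure"
 have sp: "space ?R = cball 0 1 - {0}" by (simp add: space_restrict_space)
 have m: "sgn \<in> measurable ?R (restrict_space borel S2)"
  by (intro measurable_restrict_space2 measurable_restrict_space1) (auto simp: sp norm_sgn sgn_borel)
 have "emeasure sphere_area E = 3 * emeasure ?R (sgn -` E \<inter> space ?R)"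
  unfolding sphere_area_def using E
  by (simp add: emeasure_distr[OF m] sets_restrict_space_iff)
 also have "sgn -` E \<inter> space ?R = {x. x ~= 0 & norm x <= 1 & sgn x \<in> E}" unfolding sp by auto
 also have "emeasure ?R {x. x ~= 0 & norm x <= 1 & sgn x \<in> E} = emeasure lborel {x. x ~= 0 & norm x <= 1 & sgn x \<in> E}"
  by (rule emeasure_restrict_space) auto
 finally show ?thesis .
qed

lemma sets_sphere_area: "E \<in> sets borel ==> E <= S2 ==> E \<in> sets sphere_area"
 by (simp add: sphere_area_def sets_restrict_space_iff)

lemma space_sphere_area: "space sphere_area = S2"
 by (simp add: sphere_area_def space_scale_measure space_restrict_space)

lemma emeasure_S2: "emeasure sphere_area S2 = ennreal (4 * pi)"
proof -
 have "{x :: real^3. x ~= 0 & norm x <= 1 & sgn x \<in> S2} = cball 0 1 - {0}" by (auto simp: norm_sgn)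
 then have "emeasure sphere_area S2 = 3 * emeasure lborel (cball 0 1 - {0 :: real^3})"
  by (simp add: emeasure_sphere_area)
 also have "emeasure lborel (cball 0 1 - {0 :: real^3}) = emeasure lborel (cball (0 :: real^3) 1)"
  by (rule emeasure_Diff_null_set) auto
 also have "... = ennreal (4 * pi / 3)"
  by (subst emeasure_cball) (simp_all add: eval_unit_ball_vol)
 also have "3 * ennreal (4 * pi / 3) = ennreal (3 * (4 * pi / 3))" by (subst ennreal_mult) auto
 finally show ?thesis by simp
qed

interpretation SA: finite_measure sphere_area
 by standard (simp add: space_sphere_area emeasure_S2)

lemma measure_S2: "measure sphere_area S2 = 4 * pi"
 by (simp add: measure_def emeasure_S2)

definition capo :: "real^3 => real => (real^3) set" where
 "capo u c = {p \<in> S2. c < u \<bullet> p}"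

definition capc :: "real^3 => real => (real^3) set" where
 "capc u c = {p \<in> S2. c <= u \<bullet> p}"

lemma sets_caps: "capo u c \<in> sets sphere_area" "capc u c \<in> sets sphere_area"
proof -
 have [measurable]: "S2 \<in> sets borel" by simp
 have "{p \<in> space borel. p \<in> S2 & c < u \<bullet> p} \<in> sets borel" "{p \<in> space borel. p \<in> S2 & c <= u \<bullet> p} \<in> sets borel"
  by measurable
 then show "capo u c \<in> sets sphere_area" "capc u c \<in> sets sphere_area"
  unfolding capo_def capc_def by (auto intro!: sets_sphere_area)
qed

lemma measure_capo_aux:
 assumes u: "norm u = 1" and c: "0 < c" "c < 1"
 shows "measure sphere_area (capo u c) = 2 * pi * (1 - c)"
proof -
 have b: "capo u c \<in> sets borel"
 proof -
  have [measurable]: "S2 \<in> sets borel" by simp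
  have "{p \<in> space borel. p \<in> S2 & c < u \<bullet> p} \<in> sets borel" by measurable
  then show ?thesis by (simp add: capo_def)
 qed
 have "x ~= 0 & norm x <= 1 & sgn x \<in> capo u c \<longleftrightarrow> x \<in> scone u c" for x
 proof (cases "x = 0")
  case False
  then have "c < u \<bullet> sgn x \<longleftrightarrow> c * norm x < u \<bullet> x"
   by (simp add: sgn_div_norm field_simps)
  then show ?thesis using False by (simp add: capo_def scone_def norm_sgn)
 qed (simp add: scone_def)
 then have "{x. x ~= 0 & norm x <= 1 & sgn x \<in> capo u c} = scone u c" by blast
 moreover have sub: "capo u c <= S2" by (auto simp: capo_def)
 ultimately have "emeasure sphere_area (capo u c) = 3 * ennreal (2 * pi / 3 * (1 - c))"
  using emeasure_sphere_area[OF b] emeasure_scone[OF u c] sub by simp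
 also have "... = ennreal (3 * (2 * pi / 3 * (1 - c)))" using c by (subst ennreal_mult) auto
 finally show ?thesis using c by (simp add: measure_def)
qed

lemma measure_capc_compl: "measure sphere_area (capc u c) = 4 * pi - measure sphere_area (capo (- u) (- c))"
proof -
 have "capc u c = space sphere_area - capo (- u) (- c)" by (auto simp: capc_def capo_def space_sphere_area)
 then show ?thesis using SA.finite_measure_compl[OF sets_caps(1), of "- u" "- c"]
  by (simp add: space_sphere_area measure_S2)
qed

text \<open>Archimedes: the area is proportional to the height. The sector computation covers open
  caps with 0 < c < 1; closed caps and the boundary values are squeezed between neighbouring open
  ones, and negative c follows by complements.\<close>

theorem measure_cap:
 assumes u: "norm u = 1" and c: "-1 <= c" "c <= 1"
 shows "measure sphere_area (capo u c) = 2 * pi * (1 - c)" "measure sphere_area (capc u c) = 2 * pi * (1 - c)"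
proof -
 have mono: "measure sphere_area (capc u c') <= measure sphere_area (capo u c)" if "c < c'" for u c c'
  by (rule SA.finite_measure_mono[OF _ sets_caps(1)]) (use that in \<open>auto simp: capc_def capo_def\<close>)
 have mono': "measure sphere_area (capo u c) <= measure sphere_area (capc u c)" for u c
  by (rule SA.finite_measure_mono[OF _ sets_caps(2)]) (auto simp: capc_def capo_def)
 have up: "measure sphere_area (capc u c) <= 2 * pi * (1 - c)" if u: "norm u = 1" and c: "0 < c" "c <= 1" for u c
 proof (rule ccontr)
  define d where "d = 1 - measure sphere_area (capc u c) / (2 * pi)"
  have Bd: "measure sphere_area (capc u c) = 2 * pi * (1 - d)" by (simp add: d_def)
  assume "~ ?thesis"
  then have "d < c" unfolding Bd by simp
  then obtain c' where c': "max d 0 < c'" "c' < c" using dense[of "max d 0" c] c by auto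
  have "2 * pi * (1 - d) <= 2 * pi * (1 - c')"
   using mono[OF c'(2), of u] measure_capo_aux[OF u, of c'] c' c unfolding Bd by simp
  then show False using c' by simp
 qed
 have lo: "2 * pi * (1 - c) <= measure sphere_area (capo u c)" if u: "norm u = 1" and c: "0 <= c" "c <= 1" for u c
 proof (rule ccontr)
  define d where "d = 1 - measure sphere_area (capo u c) / (2 * pi)"
  have Bd: "measure sphere_area (capo u c) = 2 * pi * (1 - d)" by (simp add: d_def)
  have d1: "d <= 1" by (simp add: d_def)
  assume "~ ?thesis"
  then have "c < d" unfolding Bd by simp
  then obtain c' where c': "c < c'" "c' < d" using dense by blast
  have "2 * pi * (1 - c') <= 2 * pi * (1 - d)"
   using mono[OF c'(1), of u] mono'[of u c'] measure_capo_aux[OF u, of c'] c' c d1 unfolding Bd by linarith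
  then show False using c' by simp
 qed
 have up': "measure sphere_area (capc u c) <= 2 * pi * (1 - c)" if u: "norm u = 1" and c: "-1 <= c" "c <= 1" for u c
 proof (cases "0 < c")
  case False
  then show ?thesis unfolding measure_capc_compl using lo[of "- u" "- c"] u c by (simp add: algebra_simps)
 qed (use up u c in blast)
 have lo': "2 * pi * (1 - c) <= measure sphere_area (capo u c)"
  using up'[of "- u" "- c"] u c measure_capc_compl[of "- u" "- c"] by (simp add: algebra_simps)
 show "measure sphere_area (capo u c) = 2 * pi * (1 - c)" "measure sphere_area (capc u c) = 2 * pi * (1 - c)"
  using lo' mono'[of u c] up'[OF u c] by linarith+
qed

section \<open>Empty caps and nets\<close>

text \<open>On the sphere: the open cap with centre q and area 4 pi t misses X. Its chordal radius
  is 2 sqrt t.\<close>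

definition emp :: "(real^3) set => real^3 => real => bool" where
 "emp X q t \<longleftrightarrow> (\<forall>p\<in>X. p \<bullet> q <= 1 - 2 * t)"

lemma inner_S2: "p \<in> S2 ==> q \<in> S2 ==> \<bar>p \<bullet> q\<bar> <= 1"
 using Cauchy_Schwarz_ineq2[of p q] by simp

lemma dist_S2: "p \<in> S2 ==> q \<in> S2 ==> (dist p q)\<^sup>2 = 2 - 2 * (p \<bullet> q)"
 by (simp add: dist_norm power2_norm_eq_inner inner_diff_left inner_diff_right inner_commute norm_eq_1)

lemma largest_empty_cap_area_bounds:
 "0 <= largest_empty_cap_area X" "largest_empty_cap_area X <= 4 * pi"
 "bdd_above {measure sphere_area C |C. spherical_cap C & top_of_set S2 interior_of C \<inter> set_mset X = {}}"
 "0 \<in> {measure sphere_area C |C. spherical_cap C & top_of_set S2 interior_of C \<inter> set_mset X = {}}"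
proof -
 let ?A = "{measure sphere_area C |C. spherical_cap C & top_of_set S2 interior_of C \<inter> set_mset X = {}}"
 have le: "a <= 4 * pi" if "a \<in> ?A" for a
  using that SA.bounded_measure by (auto simp: space_sphere_area measure_S2)
 show b: "bdd_above ?A" using le by (rule bdd_aboveI)
 have "spherical_cap {}"
  unfolding spherical_cap_def
 proof (intro exI[of _ "axis 1 1"] exI[of _ 2] conjI)
  show "axis 1 1 ~= (0 :: real^3)" by (simp add: axis_eq_0_iff)
  show "{} = S2 \<inter> {p. 2 <= axis 1 1 \<bullet> p}"
   using inner_S2[of "axis 1 1"] by (fastforce simp: norm_axis_1)
 qed
 then show z: "0 \<in> ?A" by (auto intro!: exI[of _ "{}"])
 show "0 <= largest_empty_cap_area X" unfolding largest_empty_cap_area_def by (rule cSup_upper[OF z b])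
 show "largest_empty_cap_area X <= 4 * pi" unfolding largest_empty_cap_area_def
  using z le by (intro cSup_least) auto
qed

text \<open>The strict inequality leaves room between t and t', so that closed caps, their relative
  interiors and open caps need not be told apart: one direction uses the open cap inside the
  interior, the other a slightly smaller closed cap.\<close>

theorem largest_empty_cap_area_gt:
 assumes X: "set_mset X <= S2" and t: "0 <= t"
 shows "4 * pi * t < largest_empty_cap_area X \<longleftrightarrow> (\<exists>t'. t < t' & t' <= 1 & (\<exists>q\<in>S2. emp (set_mset X) q t'))"
proof -
 let ?A = "{measure sphere_area C |C. spherical_cap C & top_of_set S2 interior_of C \<inter> set_mset X = {}}"
 have "4 * pi * t < largest_empty_cap_area X \<longleftrightarrow> (\<exists>a\<in>?A. 4 * pi * t < a)"
  unfolding largest_empty_cap_area_def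
  using largest_empty_cap_area_bounds(3,4)[of X] by (intro less_cSup_iff) auto
 also have "... \<longleftrightarrow> (\<exists>t'. t < t' & t' <= 1 & (\<exists>q\<in>S2. emp (set_mset X) q t'))"
 proof
  assume "\<exists>a\<in>?A. 4 * pi * t < a"
  then obtain u c where u: "u ~= 0" and a: "4 * pi * t < measure sphere_area (S2 \<inter> {p. u \<bullet> p >= c})"
   and int: "top_of_set S2 interior_of (S2 \<inter> {p. u \<bullet> p >= c}) \<inter> set_mset X = {}"
   unfolding spherical_cap_def by auto
  define v where "v = u /\<^sub>R norm u"
  define d where "d = c / norm u"
  have v: "norm v = 1" using u by (simp add: v_def)
  then have vS: "v \<in> S2" by simp
  have uv: "u \<bullet> p = norm u * (v \<bullet> p)" for p using u by (simp add: v_def)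
  have iff: "c <= u \<bullet> p \<longleftrightarrow> d <= v \<bullet> p" for p unfolding uv using u by (simp add: d_def field_simps)
  have C: "S2 \<inter> {p. u \<bullet> p >= c} = capc v d" by (auto simp: capc_def iff)
  \<comment> \<open>A threshold below -1 cuts nothing off; replacing it by -1 brings it into the
    range of \<open>measure_cap\<close>.\<close>
  have C': "capc v d = capc v (max d (-1))" using inner_S2[OF vS] by (fastforce simp: capc_def)
  have d1: "d <= 1"
  proof (rule ccontr)
   assume "~ d <= 1"
   then have "capc v d = {}" using inner_S2[OF vS] by (fastforce simp: capc_def)
   then have "4 * pi * t < 0" using a C by simp
   moreover have "0 <= 4 * pi * t" using t by simp
   ultimately show False by linarith
  qed
  define t' where "t' = (1 - max d (-1)) / 2"
  have "4 * pi * t < 2 * pi * (1 - max d (-1))"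
   using a d1 measure_cap(2)[OF v, of "max d (-1)"] unfolding C C' by simp
  also have "... = 4 * pi * t'" by (simp add: t'_def)
  finally have "t < t'" by simp
  moreover have "t' <= 1" by (simp add: t'_def)
  moreover have "emp (set_mset X) v t'"
   unfolding emp_def
  proof
   fix p assume p: "p \<in># X"
   have "openin (top_of_set S2) (S2 \<inter> {p. d < v \<bullet> p})"
    using open_halfspace_gt[of d v] by (intro openin_open_Int) auto
   then have sub: "S2 \<inter> {p. d < v \<bullet> p} <= top_of_set S2 interior_of (capc v d)"
    by (intro interior_of_maximal) (auto simp: capc_def)
   show "p \<bullet> v <= 1 - 2 * t'"
   proof (rule ccontr)
    assume "~ ?thesis"
    moreover have "1 - 2 * t' = max d (-1)" by (simp add: t'_def field_simps)
    ultimately have "d < v \<bullet> p" by (simp add: inner_commute)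
    then show False using sub p X int unfolding C by blast
   qed
  qed
  ultimately show "\<exists>t'. t < t' & t' <= 1 & (\<exists>q\<in>S2. emp (set_mset X) q t')" using vS by blast
 next
  assume "\<exists>t'. t < t' & t' <= 1 & (\<exists>q\<in>S2. emp (set_mset X) q t')"
  then obtain t' q where t': "t < t'" "t' <= 1" and q: "q \<in> S2" "emp (set_mset X) q t'" by blast
  obtain s where s: "t < s" "s < t'" using dense t'(1) by blast
  let ?C = "capc q (1 - 2 * s)"
  have "spherical_cap ?C"
   unfolding spherical_cap_def using q(1)
   by (intro exI[of _ q] exI[of _ "1 - 2 * s"]) (auto simp: capc_def)
  moreover have "top_of_set S2 interior_of ?C \<inter> set_mset X = {}"
  proof -
   have "?C \<inter> set_mset X = {}" using q(2) s unfolding emp_def capc_def by (force simp: inner_commute)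
   then show ?thesis using interior_of_subset[of "top_of_set S2" ?C] by blast
  qed
  moreover have "measure sphere_area ?C = 4 * pi * s" using measure_cap(2)[of q "1 - 2 * s"] q(1) s t' t by simp
  ultimately have "4 * pi * s \<in> ?A" by (metis (mono_tags, lifting) mem_Collect_eq)
  then show "\<exists>a\<in>?A. 4 * pi * t < a" using s by (intro bexI[of _ "4 * pi * s"]) auto
 qed
 finally show ?thesis .
qed

text \<open>Reduces existence of a large empty cap to countably many caps, for measurability.
  Shrinking the cap to a rational r < t' leaves room to move its centre into D.\<close>

lemma emp_dense:
 "\<exists>D. countable D & D <= S2 & (\<forall>X t. X <= S2 -->
  (\<exists>t'. t < t' & t' <= 1 & (\<exists>q\<in>S2. emp X q t')) = (\<exists>t'\<in>\<rat>. t < t' & t' <= 1 & (\<exists>q\<in>D. emp X q t')))"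
proof -
 obtain D where D: "countable D" "D <= S2" "S2 <= closure D" using separable[of S2] by blast
 show ?thesis
 proof (intro exI[of _ D] conjI allI impI D(1,2))
  fix X t assume X: "X <= S2"
  show "(\<exists>t'. t < t' & t' <= 1 & (\<exists>q\<in>S2. emp X q t')) \<longleftrightarrow> (\<exists>t'\<in>\<rat>. t < t' & t' <= 1 & (\<exists>q\<in>D. emp X q t'))"
  proof
   assume "\<exists>t'. t < t' & t' <= 1 & (\<exists>q\<in>S2. emp X q t')"
   then obtain t' q where t': "t < t'" "t' <= 1" and q: "q \<in> S2" "emp X q t'" by blast
   obtain r where r: "r \<in> \<rat>" "t < r" "r < t'" using Rats_dense_in_real[OF t'(1)] by blast
   have "q \<in> closure D" using q D by auto
   then obtain q' where q': "q' \<in> D" "dist q' q < 2 * (t' - r)"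
    using r unfolding closure_approachable by (metis diff_gt_0_iff_gt mult_pos_pos zero_less_numeral)
   have "emp X q' r"
    unfolding emp_def
   proof
    fix p assume p: "p \<in> X"
    have "p \<bullet> (q' - q) <= norm p * norm (q' - q)" by (rule norm_cauchy_schwarz)
    also have "... < 2 * (t' - r)" using p X q' by (auto simp: dist_norm)
    finally show "p \<bullet> q' <= 1 - 2 * r" using q(2) p unfolding emp_def by (force simp: inner_diff_right)
   qed
   then show "\<exists>t'\<in>\<rat>. t < t' & t' <= 1 & (\<exists>q\<in>D. emp X q t')" using r t' q' by (intro bexI[of _ r]) auto
  qed (use D in blast)
 qed
qed

text \<open>Moving the centre by the fraction \<epsilon> of the chordal radius leaves an empty cap
  of radius 1 - \<epsilon> times the old one; the area scales with the square.\<close>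

lemma emp_approx:
 assumes X: "X <= S2" and q: "q \<in> S2" "q' \<in> S2" and e: "emp X q t" and d: "dist q q' <= 2 * \<epsilon> * sqrt t"
  and eps: "0 < \<epsilon>" "\<epsilon> < 1" and t: "0 <= t"
 shows "emp X q' ((1 - \<epsilon>)^2 * t)"
 unfolding emp_def
proof
 fix p assume p: "p \<in> X"
 then have pS: "p \<in> S2" using X by auto
 have "4 * t <= (dist p q)\<^sup>2" using e p unfolding dist_S2[OF pS q(1)] emp_def by force
 then have "sqrt (4 * t) <= dist p q" using real_sqrt_le_mono by fastforce
 then have "2 * (1 - \<epsilon>) * sqrt t <= dist p q'"
  using dist_triangle[of p q q'] d by (simp add: real_sqrt_mult algebra_simps dist_commute)
 then have "(2 * (1 - \<epsilon>) * sqrt t)^2 <= (dist p q')\<^sup>2"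
  using eps t by (intro power_mono) auto
 then show "p \<bullet> q' <= 1 - 2 * ((1 - \<epsilon>)^2 * t)"
  unfolding dist_S2[OF pS q(2)] power_mult_distrib real_sqrt_pow2[OF t] by simp
qed

lemma emp_mono: "emp X q t ==> s <= t ==> emp X q s"
 unfolding emp_def by force

text \<open>A separated set of maximal size. Caps of area fraction t / 4, of chordal radius sqrt t,
  around its points are disjoint, which bounds the size by 4 / t and makes a maximum exist. By
  maximality caps of fraction t cover the sphere, so there are at least 1 / t points.\<close>

theorem separated_net:
 assumes t: "0 < t" "t <= 1"
 shows "\<exists>N. finite N & N <= S2 & 1 / t <= real (card N) & real (card N) <= 4 / t &
  (\<forall>p\<in>N. \<forall>q\<in>N. p ~= q --> 2 * sqrt t <= dist p q) & (\<forall>q\<in>S2. \<exists>p\<in>N. dist q p < 2 * sqrt t)"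
proof -
 define sep where "sep N \<longleftrightarrow> finite N & N <= S2 & (\<forall>p\<in>N. \<forall>q\<in>N. p ~= q --> 2 * sqrt t <= dist p q)" for N
 have cap_dist: "p \<in> capo q (1 - 2 * s) \<longleftrightarrow> p \<in> S2 & dist q p < 2 * sqrt s" if "q \<in> S2" "0 <= s" for p q s
 proof (cases "p \<in> S2")
  case True
  have "dist q p < 2 * sqrt s \<longleftrightarrow> (dist q p)\<^sup>2 < (2 * sqrt s)^2"
   using that abs_le_square_iff[of "2 * sqrt s" "dist q p"] by (simp add: not_le[symmetric] abs_mult)
  also have "... \<longleftrightarrow> 1 - 2 * s < q \<bullet> p" unfolding dist_S2[OF that(1) True] using that by (auto simp: power_mult_distrib)
  finally show ?thesis using True by (simp add: capo_def)
 qed (simp add: capo_def)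
 have pack: "real (card N) <= 4 / t" if N: "sep N" for N
 proof -
  have fin: "finite N" and S: "N <= S2" using N by (auto simp: sep_def)
  have "disjoint_family_on (%q. capo q (1 - 2 * (t / 4))) N"
   unfolding disjoint_family_on_def
  proof (intro ballI impI)
   fix p q assume pq: "p \<in> N" "q \<in> N" "p ~= q"
   show "capo p (1 - 2 * (t / 4)) \<inter> capo q (1 - 2 * (t / 4)) = {}"
   proof (rule ccontr)
    assume "~ ?thesis"
    then obtain x where x: "x \<in> capo p (1 - 2 * (t / 4))" "x \<in> capo q (1 - 2 * (t / 4))" by blast
    have "dist p x < 2 * sqrt (t / 4)" "dist q x < 2 * sqrt (t / 4)"
     using x pq S t cap_dist[of p "t / 4" x] cap_dist[of q "t / 4" x] by auto
    then have "dist p q < 2 * sqrt t"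
     using dist_triangle[of p q x] by (simp add: real_sqrt_divide dist_commute)
    then show False using N pq unfolding sep_def by force
   qed
  qed
  then have "measure sphere_area (\<Union>q\<in>N. capo q (1 - 2 * (t / 4))) = (\<Sum>q\<in>N. measure sphere_area (capo q (1 - 2 * (t / 4))))"
   using fin sets_caps by (intro SA.finite_measure_finite_Union) auto
  also have "... = (\<Sum>q\<in>N. pi * t)"
  proof (rule sum.cong[OF refl])
   fix q assume "q \<in> N"
   then have "norm q = 1" using S by auto
   then show "measure sphere_area (capo q (1 - 2 * (t / 4))) = pi * t" using measure_cap(1)[of q "1 - 2 * (t / 4)"] t by simp
  qed
  finally have "real (card N) * (pi * t) <= 4 * pi"
   using SA.bounded_measure[of "\<Union>q\<in>N. capo q (1 - 2 * (t / 4))"] by (simp add: space_sphere_area measure_S2)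
  then have "real (card N) * t * pi <= 4 * pi" by (simp add: mult_ac)
  then have "real (card N) * t <= 4" by (simp only: mult_le_cancel_right_pos pi_gt_zero)
  then show ?thesis using t by (simp add: field_simps)
 qed
 have "\<forall>k. (\<exists>N. sep N & card N = k) --> k <= nat \<lceil>4 / t\<rceil>"
  using pack by (auto simp: le_nat_iff) (meson le_of_int_ceiling of_nat_le_iff order_trans real_nat_ceiling_ge pack)
 moreover have "\<exists>N. sep N & card N = 0" by (intro exI[of _ "{}"]) (simp add: sep_def)
 ultimately obtain k where k: "\<exists>N. sep N & card N = k" "!!l. (\<exists>N. sep N & card N = l) ==> l <= k"
  using Nat.ex_has_greatest_nat[of "%k. \<exists>N. sep N & card N = k" 0 "nat \<lceil>4 / t\<rceil>"] by blast
 then obtain N where N: "sep N" and max: "!!N'. sep N' ==> card N' <= card N" by blast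
 have fin: "finite N" and S: "N <= S2" using N by (auto simp: sep_def)
 have cov: "\<exists>p\<in>N. dist q p < 2 * sqrt t" if q: "q \<in> S2" for q
 proof (rule ccontr)
  assume n: "~ ?thesis"
  then have "q ~: N" using t by force
  moreover have "sep (insert q N)" using N n q unfolding sep_def by (auto simp: dist_commute not_less)
  ultimately show False using max[of "insert q N"] fin by simp
 qed
 have "S2 <= (\<Union>q\<in>N. capo q (1 - 2 * t))"
 proof
  fix x assume x: "x \<in> S2"
  obtain p where p: "p \<in> N" "dist x p < 2 * sqrt t" using cov[OF x] by blast
  then have "x \<in> capo p (1 - 2 * t)" using cap_dist[of p t x] S t x by (auto simp: dist_commute)
  then show "x \<in> (\<Union>q\<in>N. capo q (1 - 2 * t))" using p by blast
 qed
 then have "4 * pi <= measure sphere_area (\<Union>q\<in>N. capo q (1 - 2 * t))"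
  unfolding measure_S2[symmetric] using fin sets_caps by (intro SA.finite_measure_mono) auto
 also have "... <= (\<Sum>q\<in>N. measure sphere_area (capo q (1 - 2 * t)))"
  using fin sets_caps by (intro SA.finite_measure_subadditive_finite) auto
 also have "... = (\<Sum>q\<in>N. 4 * pi * t)"
 proof (rule sum.cong[OF refl])
  fix q assume "q \<in> N"
  then have "norm q = 1" using S by auto
  then show "measure sphere_area (capo q (1 - 2 * t)) = 4 * pi * t" using measure_cap(1)[of q "1 - 2 * t"] t by simp
 qed
 finally have "1 * (4 * pi) <= real (card N) * t * (4 * pi)" by (simp add: mult_ac)
 then have "1 <= real (card N) * t" by (rule mult_right_le_imp_le) simp
 then have "1 / t <= real (card N)" using t by (simp add: field_simps)
 moreover have "\<forall>p\<in>N. \<forall>q\<in>N. p ~= q --> 2 * sqrt t <= dist p q" using N by (simp add: sep_def)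
 ultimately show ?thesis using fin S pack[OF N] cov by (intro exI[of _ N] conjI ballI) auto
qed

section \<open>The law of the spherical ensemble\<close>

lemma PiM_std_gaussian:
 fixes K :: "'i set"
 assumes K: "finite K"
 shows "Pi\<^sub>M K (%_. std_complex_gaussian) = density (LPi K) (%x. \<Prod>k\<in>K. ennreal (exp (- csq (x k)) / pi))"
proof -
 let ?f = "%z. ennreal (exp (- csq z) / pi)"
 have m[measurable]: "?f \<in> borel_measurable borel" by measurable
 have comp: "(%x. ?f (x k)) \<in> borel_measurable (LPi K)" if "k \<in> K" for k
  using measurable_compose[OF measurable_component_singleton[OF that, of "%_. lborel"], of ?f borel] m by simp
 then have pm: "(%x. \<Prod>k\<in>K. ?f (x k)) \<in> borel_measurable (LPi K)"
  by (rule borel_measurable_prod_ennreal)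
 have "(\<integral>\<^sup>+z. ?f z \<partial>lborel) = (\<integral>\<^sup>+z. ennreal (1 / pi) * ennreal (exp (- csq z)) \<partial>lborel)"
  by (intro nn_integral_cong) (simp flip: ennreal_mult)
 also have "... = ennreal (1 / pi) * ennreal pi"
  by (subst nn_integral_cmult) (simp_all add: nn_integral_gauss_complex)
 finally have "emeasure std_complex_gaussian (space std_complex_gaussian) = ennreal (1 / pi) * ennreal pi"
  by (simp add: std_complex_gaussian_def emeasure_density)
 then have "finite_measure std_complex_gaussian" by (intro finite_measureI) (simp add: ennreal_mult_eq_top_iff)
 then have "sigma_finite_measure std_complex_gaussian" by (rule finite_measure.axioms(1))
 then have psf: "product_sigma_finite (%_::'i. std_complex_gaussian)" by (simp add: product_sigma_finite_def)
 interpret S: product_sigma_finite "%_::'i. std_complex_gaussian" by (rule psf)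
 show ?thesis
 proof (rule sym, rule S.PiM_eqI[OF K])
 show "sets (density (LPi K) (%x. \<Prod>k\<in>K. ?f (x k))) = sets (Pi\<^sub>M K (%_. std_complex_gaussian))"
  unfolding sets_density by (intro sets_PiM_cong) (auto simp: std_complex_gaussian_def)
 fix A :: "'i => complex set" assume "!!i. i \<in> K ==> A i \<in> sets std_complex_gaussian"
 then have A: "A i \<in> sets borel" if "i \<in> K" for i using that by (simp add: std_complex_gaussian_def)
 have "emeasure (density (LPi K) (%x. \<Prod>k\<in>K. ?f (x k))) (Pi\<^sub>E K A) =
  (\<integral>\<^sup>+x. (\<Prod>k\<in>K. ?f (x k)) * indicator (Pi\<^sub>E K A) x \<partial>LPi K)"
  using pm A K by (intro emeasure_density sets_PiM_I_finite) auto
 also have "... = (\<integral>\<^sup>+x. (\<Prod>k\<in>K. ?f (x k) * indicator (A k) (x k)) \<partial>LPi K)"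
 proof (rule nn_integral_cong)
  fix x :: "'i => complex" assume "x \<in> space (LPi K)"
  then have "x \<in> extensional K" by (simp add: space_PiM PiE_def)
  then have "indicator (Pi\<^sub>E K A) x = (\<Prod>k\<in>K. indicator (A k) (x k) :: ennreal)"
   using K by (cases "\<forall>k\<in>K. x k \<in> A k") (auto simp: PiE_def Pi_def indicator_def intro!: prod.neutral)
  then show "(\<Prod>k\<in>K. ?f (x k)) * indicator (Pi\<^sub>E K A) x = (\<Prod>k\<in>K. ?f (x k) * indicator (A k) (x k))"
   by (simp add: prod.distrib)
 qed
 also have "... = (\<Prod>k\<in>K. \<integral>\<^sup>+z. ?f z * indicator (A k) z \<partial>lborel)"
  using A by (intro lborel_prod.product_nn_integral_prod[OF K]) auto
 also have "... = (\<Prod>k\<in>K. emeasure std_complex_gaussian (A k))"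
  using A by (intro prod.cong refl) (simp add: std_complex_gaussian_def emeasure_density)
 finally show "emeasure (density (LPi K) (%x. \<Prod>k\<in>K. ?f (x k))) (Pi\<^sub>E K A) = (\<Prod>k\<in>K. emeasure std_complex_gaussian (A k))" .
 qed
qed

text \<open>Coordinates outside the matrices are 0, matching the base point at which J is
  evaluated.\<close>

definition entries :: "complex mat => complex mat => nat => pencil" where
 "entries A B n = override_on (%_. 0) (%(c, i, j). (if c then A else B) $$ (i, j)) (ix n)"

text \<open>The power of pi is the normalising constant of the Gaussian density of the 2 n^2
  entries; moving it to the left leaves the unnormalised integral on the right.\<close>

lemma entries_law:
 fixes A B :: "'a => complex mat"
 assumes g: "independent_gaussian_matrices M n A B" and n: "n >= 1" and S: "S \<in> sets env"
 shows "{om \<in> space M. entries (A om) (B om) n \<in> S} \<in> sets M"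
  and "emeasure M {om \<in> space M. entries (A om) (B om) n \<in> S} * ennreal pi ^ (2 * n * n) =
   Intg (ix n) (%y. ennreal (exp (- sq (ix n) y)) * indicator S y) (%_. 0)"
proof -
 interpret prob_space M using g by (simp add: independent_gaussian_matrices_def)
 let ?Y = "%k om. (case k of (c, i, j) => (if c then A om else B om) $$ (i, j))"
 let ?K = "ix n"
 have K: "finite ?K" "?K ~= {}" using n by (auto simp: lessThan_empty_iff)
 have ind: "indep_vars (%_. borel) ?Y ?K"
  using g unfolding independent_gaussian_matrices_def by (simp add: split_def)
 then have rv: "?Y k \<in> borel_measurable M" if "k \<in> ?K" for k
  using that unfolding indep_vars_def by blast
 have dk: "distr M borel (?Y k) = std_complex_gaussian" if "k \<in> ?K" for k
 proof -
  obtain c i j where kk: "k = (c, i, j)" "i < n" "j < n" using \<open>k \<in> ?K\<close> by (cases k) auto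
  have d: "!!i j. i < n ==> j < n ==> distr M borel (%om. A om $$ (i, j)) = std_complex_gaussian"
   "!!i j. i < n ==> j < n ==> distr M borel (%om. B om $$ (i, j)) = std_complex_gaussian"
   using g unfolding independent_gaussian_matrices_def by blast+
  show ?thesis unfolding kk(1) prod.case using d[OF kk(2,3)] by (cases c) simp_all
 qed
 define X where "X om = (\<lambda>k\<in>?K. ?Y k om)" for om
 have Xe: "X = (%om. \<lambda>k\<in>?K. ?Y k om)" by (rule ext) (simp only: X_def)
 have iff: "indep_vars (%_. borel) ?Y ?K \<longleftrightarrow> distr M (\<Pi>\<^sub>M i\<in>?K. borel) (%x. \<lambda>i\<in>?K. ?Y i x) = (\<Pi>\<^sub>M i\<in>?K. distr M borel (?Y i))"
  by (rule indep_vars_iff_distr_eq_PiM'[OF K(2)]) (rule rv)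
 have "distr M (\<Pi>\<^sub>M i\<in>?K. borel) X = (\<Pi>\<^sub>M i\<in>?K. distr M borel (?Y i))"
  unfolding Xe by (rule iffD1[OF iff ind])
 also have "... = Pi\<^sub>M ?K (%_. std_complex_gaussian)" by (rule PiM_cong[OF refl dk])
 finally have dX: "distr M (\<Pi>\<^sub>M i\<in>?K. borel) X = density (LPi ?K) (%x. \<Prod>k\<in>?K. ennreal (exp (- csq (x k)) / pi))"
  unfolding PiM_std_gaussian[OF K(1)] .
 have Xm: "X \<in> M \<rightarrow>\<^sub>M (\<Pi>\<^sub>M i\<in>?K. borel)" unfolding X_def[abs_def] by (intro measurable_restrict rv)
 have sPi: "sets (\<Pi>\<^sub>M i\<in>?K. (borel :: complex measure)) = sets (LPi ?K)" by (intro sets_PiM_cong) auto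
 have ov: "(%x. override_on (%_. 0) x ?K) \<in> (\<Pi>\<^sub>M i\<in>?K. borel) \<rightarrow>\<^sub>M env"
  using measurable_override_right[of "%_. 0" ?K] measurable_cong_sets[OF sPi refl] by blast
 have e: "entries (A om) (B om) n = override_on (%_. 0) (X om) ?K" for om
  unfolding entries_def X_def by (auto simp: override_on_def)
 have em: "(%om. entries (A om) (B om) n) \<in> M \<rightarrow>\<^sub>M env" unfolding e using Xm ov by (rule measurable_compose)
 have pre: "{om \<in> space M. entries (A om) (B om) n \<in> S} = (%om. entries (A om) (B om) n) -` S \<inter> space M" by auto
 show "{om \<in> space M. entries (A om) (B om) n \<in> S} \<in> sets M" unfolding pre by (rule measurable_sets[OF em S])
 define S' where "S' = (%x. override_on (%_. 0) x ?K) -` S \<inter> space (\<Pi>\<^sub>M i\<in>?K. (borel :: complex measure))"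
 have S': "S' \<in> sets (\<Pi>\<^sub>M i\<in>?K. borel)" unfolding S'_def by (rule measurable_sets[OF ov S])
 have "{om \<in> space M. entries (A om) (B om) n \<in> S} = X -` S' \<inter> space M"
  unfolding e S'_def using measurable_space[OF Xm] by auto
 then have "emeasure M {om \<in> space M. entries (A om) (B om) n \<in> S} = emeasure (distr M (\<Pi>\<^sub>M i\<in>?K. borel) X) S'"
  by (simp add: emeasure_distr[OF Xm S'])
 also have "... = (\<integral>\<^sup>+x. (\<Prod>k\<in>?K. ennreal (exp (- csq (x k)) / pi)) * indicator S' x \<partial>LPi ?K)"
  unfolding dX
 proof (rule emeasure_density)
  have "(%x. ennreal (exp (- csq (x k)) / pi)) \<in> borel_measurable (LPi ?K)" if "k \<in> ?K" for k
   using measurable_compose[OF measurable_component_singleton[OF that, of "%_. lborel"], of "%z. ennreal (exp (- csq z) / pi)" borel]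
   by simp
  then show "(%x. \<Prod>k\<in>?K. ennreal (exp (- csq (x k)) / pi)) \<in> borel_measurable (LPi ?K)"
   by (rule borel_measurable_prod_ennreal)
  show "S' \<in> sets (LPi ?K)" using S' unfolding sPi .
 qed
 finally have E: "emeasure M {om \<in> space M. entries (A om) (B om) n \<in> S} =
  (\<integral>\<^sup>+x. (\<Prod>k\<in>?K. ennreal (exp (- csq (x k)) / pi)) * indicator S' x \<partial>LPi ?K)" .
 have cK: "card ?K = 2 * n * n" by (simp add: card_cartesian_product mult.assoc)
 have pt: "(\<Prod>k\<in>?K. ennreal (exp (- csq (x k)) / pi)) * indicator S' x * ennreal pi ^ (2 * n * n) =
  ennreal (exp (- sq ?K (override_on (%_. 0) x ?K))) * indicator S (override_on (%_. 0) x ?K)"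
  if x: "x \<in> space (Pi\<^sub>M ?K (%_. lborel :: complex measure))" for x
 proof -
  have "(\<Prod>k\<in>?K. ennreal (exp (- csq (x k)) / pi)) * ennreal pi ^ (2 * n * n) = (\<Prod>k\<in>?K. ennreal (exp (- csq (x k)) / pi) * ennreal pi)"
   unfolding prod.distrib prod_constant cK ..
  also have "... = (\<Prod>k\<in>?K. ennreal (exp (- csq (x k))))"
   by (intro prod.cong refl) (simp flip: ennreal_mult)
  also have "... = ennreal (exp (- sq ?K x))"
   unfolding sq_def sum_negf[symmetric] exp_sum[OF K(1)] by (rule prod_ennreal) simp
  also have "sq ?K x = sq ?K (override_on (%_. 0) x ?K)" unfolding sq_def by (intro sum.cong refl) simp
  finally have a: "(\<Prod>k\<in>?K. ennreal (exp (- csq (x k)) / pi)) * ennreal pi ^ (2 * n * n) = ennreal (exp (- sq ?K (override_on (%_. 0) x ?K)))" .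
  have b: "indicator S' x = (indicator S (override_on (%_. 0) x ?K) :: ennreal)"
   using x by (auto simp: S'_def indicator_def space_PiM)
  show ?thesis unfolding a[symmetric] b by (simp only: mult_ac)
 qed
 have "emeasure M {om \<in> space M. entries (A om) (B om) n \<in> S} * ennreal pi ^ (2 * n * n) =
  (\<integral>\<^sup>+x. (\<Prod>k\<in>?K. ennreal (exp (- csq (x k)) / pi)) * indicator S' x * ennreal pi ^ (2 * n * n) \<partial>LPi ?K)"
  unfolding E
 proof (rule nn_integral_multc[symmetric])
  have "(%x. ennreal (exp (- csq (x k)) / pi)) \<in> borel_measurable (LPi ?K)" if "k \<in> ?K" for k
   using measurable_compose[OF measurable_component_singleton[OF that, of "%_. lborel"], of "%z. ennreal (exp (- csq z) / pi)" borel]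
   by simp
  then have "(%x. \<Prod>k\<in>?K. ennreal (exp (- csq (x k)) / pi)) \<in> borel_measurable (LPi ?K)"
   by (rule borel_measurable_prod_ennreal)
  moreover have "S' \<in> sets (LPi ?K)" using S' unfolding sPi .
  ultimately show "(%x. (\<Prod>k\<in>?K. ennreal (exp (- csq (x k)) / pi)) * indicator S' x) \<in> borel_measurable (LPi ?K)"
   by (intro borel_measurable_times_ennreal borel_measurable_indicator)
 qed
 also have "... = Intg ?K (%y. ennreal (exp (- sq ?K y)) * indicator S y) (%_. 0)"
  unfolding Intg_def by (intro nn_integral_cong pt)
 finally show "emeasure M {om \<in> space M. entries (A om) (B om) n \<in> S} * ennreal pi ^ (2 * n * n) =
   Intg (ix n) (%y. ennreal (exp (- sq (ix n) y)) * indicator S y) (%_. 0)" .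
qed

lemma prob_bad:
 assumes g: "independent_gaussian_matrices M n A B" and n: "n >= 1"
 shows "{om \<in> space M. bad n (entries (A om) (B om) n)} \<in> null_sets M"
proof -
 have S: "{y. bad n y} \<in> sets env" using pred_bad[of n] by (simp add: pred_def)
 let ?E = "{om \<in> space M. bad n (entries (A om) (B om) n)}"
 have "emeasure M ?E * ennreal pi ^ (2 * n * n) = Intg (ix n) (%y. ennreal (exp (- sq (ix n) y)) * indicator {y. bad n y} y) (%_. 0)"
  using entries_law(2)[OF g n S] by simp
 also have "... <= Intg (ix n) (indicator {y. bad n y}) (%_. 0)"
 proof (rule Intg_mono)
  fix y :: "pencil"
  have "0 <= sq (ix n) y" unfolding sq_def by (intro sum_nonneg) auto
  then show "ennreal (exp (- sq (ix n) y)) * indicator {y. bad n y} y <= indicator {y. bad n y} y"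
   by (auto simp: indicator_def)
 qed
 also have "... = 0" by (rule Intg_bad)
 finally have "emeasure M ?E = 0" using pi_power_ennreal(1)[of "2 * n * n"] by simp
 then show ?thesis using entries_law(1)[OF g n S] by (simp add: null_sets_def)
qed

lemma prob_hole:
 assumes g: "independent_gaussian_matrices M n A B" and n: "n >= 1" and V: "open V"
 shows "{om \<in> space M. hole n V (entries (A om) (B om) n)} \<in> sets M"
  and "measure M {om \<in> space M. hole n V (entries (A om) (B om) n)} = hp n V"
proof -
 let ?E = "{om \<in> space M. hole n V (entries (A om) (B om) n)}"
 show "?E \<in> sets M" using entries_law(1)[OF g n sets_hole[OF V, of n]] by simp
 have "emeasure M ?E * ennreal pi ^ (2 * n * n) = J n V []"
  using entries_law(2)[OF g n sets_hole[OF V, of n]] unfolding J_def by (simp add: FJ_def[abs_def])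
 also have "... = ennreal (hp n V) * ennreal pi ^ (2 * n * n)" by (rule J_hp(1)[OF V n])
 finally have "ennreal pi ^ (2 * n * n) * emeasure M ?E = ennreal pi ^ (2 * n * n) * ennreal (hp n V)"
  by (simp only: mult.commute)
 then have "emeasure M ?E = ennreal (hp n V)"
  using pi_power_ennreal[of "2 * n * n"] unfolding ennreal_mult_cancel_left by auto
 moreover have "0 <= hp n V"
 proof -
  have "adm (n - 1) (wg n U)" if "open U" for U
   using adm_wgt[OF that, of "n - 1" "[]"] n by (cases n) auto
  then have "0 <= Re (det (grm n V))" "0 <= Re (det (grm n {}))"
   using det_gram_real_nonneg[of n] V by auto
  then show ?thesis by (simp add: hp_def)
 qed
 ultimately show "measure M ?E = hp n V" by (simp add: measure_def)
qed

text \<open>For invertible A, det (B - z A) is det A times the determinant of the inverse of A times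
  B minus z, so the eigenvalues are the zeros of \<open>pdet\<close>. For singular A the
  configuration is empty by definition.\<close>

lemma set_spherical_ensemble:
 assumes A: "A \<in> carrier_mat n n" and B: "B \<in> carrier_mat n n"
 shows "set_mset (spherical_ensemble A B) =
  (if adet n (entries A B n) = 0 then {} else inv_stereographic ` {z. pdet n (entries A B n) z = 0})"
proof -
 have ent: "entries A B n (c, i, j) = (if c then A else B) $$ (i, j)" if "i < n" "j < n" for c i j
  using that by (simp add: entries_def)
 have a: "adet n (entries A B n) = det A"
 proof -
  have "mat n n (%(i, j). entries A B n (True, i, j)) = A" using A by (intro eq_matI) (auto simp: ent)
  then show ?thesis by (simp add: adet_def)
 qed
 show ?thesis
 proof (cases "mat_inverse A")
  case None
  have "det A = 0"
  proof (rule ccontr)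
   assume "det A ~= 0"
   from det_non_zero_imp_unit[OF A this, of "()"] mat_inverse(1)[OF A None, of "()"] show False by simp
  qed
  then show ?thesis using None unfolding a by (simp add: spherical_ensemble_def)
 next
  case (Some A')
  have A': "A * A' = 1\<^sub>m n" "A' * A = 1\<^sub>m n" "A' \<in> carrier_mat n n" using mat_inverse(2)[OF A Some] by auto
  have "det A * det A' = 1" using det_mult[OF A A'(3)] A' by simp
  then have dA: "det A ~= 0" by auto
  let ?C = "A' * B"
  have C: "?C \<in> carrier_mat n n" using A' B by simp
  have root: "poly (char_poly ?C) z = 0 \<longleftrightarrow> pdet n (entries A B n) z = 0" for z
  proof -
   have "A * char_matrix ?C z = mat n n (%(i, j). entries A B n (False, i, j) - z * entries A B n (True, i, j))"
   proof -
    have "A * char_matrix ?C z = A * ?C + A * ((- z) \<cdot>\<^sub>m 1\<^sub>m n)"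
     unfolding char_matrix_def using A C A' by (subst mult_add_distrib_mat[OF A C]) auto
    also have "A * ?C = B" using A A' B by (subst assoc_mult_mat[symmetric, OF A A'(3) B]) simp
    also have "A * ((- z) \<cdot>\<^sub>m 1\<^sub>m n) = (- z) \<cdot>\<^sub>m A" using A by (subst mult_smult_distrib[OF A]) auto
    also have "B + (- z) \<cdot>\<^sub>m A = mat n n (%(i, j). entries A B n (False, i, j) - z * entries A B n (True, i, j))"
     using A B by (intro eq_matI) (auto simp: ent)
    finally show ?thesis .
   qed
   then have "pdet n (entries A B n) z = det A * det (char_matrix ?C z)"
    using det_mult[OF A, of "char_matrix ?C z"] C by (simp add: pdet_def)
   then show ?thesis using dA eigenvalue_root_char_poly[OF C] eigenvalue_det[OF C] by simp
  qed
  have "char_poly ?C ~= 0" using degree_monic_char_poly[OF C] by auto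
  then have "set_mset (eigenvalues_mset ?C) = {z. pdet n (entries A B n) z = 0}"
   unfolding eigenvalues_mset_def by (simp add: root)
  then show ?thesis using Some dA unfolding a by (simp add: spherical_ensemble_def)
 qed
qed

section \<open>From homogeneous coordinates to the sphere\<close>

text \<open>The Hopf map from nonzero vectors of C^2 to the sphere. At (z, 1) it is the inverse of
  the stereographic projection, and it turns Hermitian inner products into Euclidean ones.\<close>

definition hopf :: "complex \<times> complex => real^3" where
 "hopf x = vec3 (of_real (2 / nsq x) * (fst x * cnj (snd x)), (csq (fst x) - csq (snd x)) / nsq x)"

lemma inner_vec3: "vec3 x \<bullet> vec3 y = Re (fst x) * Re (fst y) + Im (fst x) * Im (fst y) + snd x * snd y"
 by (simp add: inner_vec_def sum_3)

lemma vec3_eqI: "Re (fst x) = p $ 1 ==> Im (fst x) = p $ 2 ==> snd x = p $ 3 ==> vec3 x = p"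
 by (simp add: Finite_Cartesian_Product.vec_eq_iff forall_3)

lemma hopf_S2:
 assumes "0 < nsq x"
 shows "hopf x \<in> S2"
proof -
 define a where "a = cmod (fst x)"
 define b where "b = cmod (snd x)"
 have N: "nsq x = a^2 + b^2" by (simp add: nsq_def a_def b_def)
 have pos: "0 < a^2 + b^2" using assms N by simp
 have "csq (of_real (2 / nsq x) * (fst x * cnj (snd x))) = (2 * (a * b) / (a^2 + b^2))^2"
  using assms unfolding norm_mult norm_of_real complex_mod_cnj a_def[symmetric] b_def[symmetric] N by simp
 then have "csq (of_real (2 / nsq x) * (fst x * cnj (snd x))) + ((a^2 - b\<^sup>2) / nsq x)^2 = ((2 * (a * b))^2 + (a^2 - b\<^sup>2)^2) / (a^2 + b^2)^2"
  unfolding N power_divide add_divide_distrib by simp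
 also have "(2 * (a * b))^2 + (a^2 - b\<^sup>2)^2 = (a^2 + b^2)^2" by (simp add: power2_eq_square algebra_simps)
 also have "(a^2 + b^2)^2 / (a^2 + b^2)^2 = 1"
  by (rule divide_self) (use zero_less_power[OF pos, of 2] in linarith)
 finally have "csq (of_real (2 / nsq x) * (fst x * cnj (snd x))) + ((a^2 - b\<^sup>2) / nsq x)^2 = 1" .
 then show ?thesis unfolding hopf_def a_def b_def by (simp add: norm_vec3)
qed

lemma cval_identity:
 "2 * csq (cval u x) = nsq x * nsq u
  + 4 * (Re (fst x * cnj (snd x)) * Re (fst u * cnj (snd u)) + Im (fst x * cnj (snd x)) * Im (fst u * cnj (snd u)))
  + (csq (fst x) - csq (snd x)) * (csq (fst u) - csq (snd u))"
 unfolding nsq_def cval_def cmod_power2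
 by (simp add: algebra_simps power2_eq_square)

lemma hopf_inner:
 assumes x: "0 < nsq x" and u: "nsq u = 1"
 shows "hopf x \<bullet> hopf u = 2 * csq (cval u x) / nsq x - 1"
proof -
 let ?r = "Re (fst x * cnj (snd x)) * Re (fst u * cnj (snd u)) + Im (fst x * cnj (snd x)) * Im (fst u * cnj (snd u))"
 let ?d = "(csq (fst x) - csq (snd x)) * (csq (fst u) - csq (snd u))"
 have re: "Re (of_real c * w) = c * Re w" "Im (of_real c * w) = c * Im w" for c w by simp_all
 have "hopf x \<bullet> hopf u = (2 / nsq x) * Re (fst x * cnj (snd x)) * (2 * Re (fst u * cnj (snd u)))
  + (2 / nsq x) * Im (fst x * cnj (snd x)) * (2 * Im (fst u * cnj (snd u))) + ?d / nsq x"
  unfolding hopf_def inner_vec3 fst_conv snd_conv re u by simp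
 also have "... = (4 * ?r + ?d) / nsq x"
 proof -
  have "(2 / N) * a * (2 * a') + (2 / N) * b * (2 * b') + d / N = (4 * (a * a' + b * b') + d) / N" if "0 < N" for N a a' b b' d :: real
   using that by (simp add: field_simps)
  from this[OF x] show ?thesis .
 qed
 also have "4 * ?r + ?d = 2 * csq (cval u x) - nsq x" unfolding cval_identity u by simp
 finally show ?thesis using x by (simp add: diff_divide_distrib)
qed

lemma Ccap_hopf:
 assumes x: "0 < nsq x" and u: "nsq u = 1"
 shows "x \<in> Ccap u t \<longleftrightarrow> 1 - 2 * t < hopf x \<bullet> hopf u"
proof -
 define c where "c = csq (cval u x)"
 have "1 - 2 * t < 2 * c / nsq x - 1 \<longleftrightarrow> 2 * (1 - t) < 2 * c / nsq x" by (auto simp: algebra_simps)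
 also have "... \<longleftrightarrow> 2 * ((1 - t) * nsq x) < 2 * c" unfolding pos_less_divide_eq[OF x] by (simp only: mult.assoc)
 also have "... \<longleftrightarrow> (1 - t) * nsq x < c" by simp
 finally show ?thesis unfolding hopf_inner[OF x u] Ccap_def c_def by simp
qed

lemma S2_coords: "q \<in> S2 \<longleftrightarrow> (q $ 1)\<^sup>2 + (q $ 2)^2 + (q $ 3)^2 = 1"
 by (simp add: norm_vec_def L2_set_def sum_3)

lemma hopf_surj:
 assumes q: "q \<in> S2"
 obtains u where "nsq u = 1" "hopf u = q"
proof (cases "q $ 3 = -1")
 case True
 then have "(q $ 1)^2 + (q $ 2)^2 = 0" using q unfolding S2_coords by simp
 then have "q $ 1 = 0" "q $ 2 = 0" by (simp_all add: sum_power2_eq_zero_iff)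
 then have "hopf (0, 1) = q" using True unfolding hopf_def by (intro vec3_eqI) (simp_all add: nsq_def)
 then show thesis using that[of "(0, 1)"] by (simp add: nsq_def)
next
 case False
 have sq: "(q $ 1)^2 + (q $ 2)^2 = (1 - q $ 3) * (1 + q $ 3)"
  using q unfolding S2_coords by (simp add: algebra_simps power2_eq_square)
 have "(q $ 3)^2 <= 1" using q zero_le_power2[of "q $ 1"] zero_le_power2[of "q $ 2"] unfolding S2_coords by linarith
 then have "\<bar>q $ 3\<bar> <= 1" by (simp add: abs_square_le_1)
 then have p: "0 < 1 + q $ 3" using False by linarith
 define a where "a = sqrt ((1 + q $ 3) / 2)"
 have a: "0 < a" "a^2 = (1 + q $ 3) / 2" using p by (simp_all add: a_def)
 define u where "u = (complex_of_real a, Complex (q $ 1 / (2 * a)) (- (q $ 2) / (2 * a)))"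
 have f: "csq (fst u) = (1 + q $ 3) / 2" using a by (simp add: u_def)
 have "csq (snd u) = ((q $ 1)^2 + (q $ 2)^2) / (4 * a^2)"
  by (simp add: u_def cmod_power2 power_divide power_mult_distrib add_divide_distrib)
 also have "... = (1 - q $ 3) / 2" unfolding sq a(2) using p by (simp add: field_simps)
 finally have s: "csq (snd u) = (1 - q $ 3) / 2" .
 have n: "nsq u = 1" unfolding nsq_def f s by (simp add: field_simps)
 have "hopf u = q"
  unfolding hopf_def n f s
  by (rule vec3_eqI) (use a in \<open>simp_all add: u_def field_simps\<close>)
 with n show thesis using that by blast
qed

lemma hopf_affine:
 "hopf (z, 1) $ 1 = 2 * Re z / (1 + csq z)" "hopf (z, 1) $ 2 = 2 * Im z / (1 + csq z)"
 "hopf (z, 1) $ 3 = (csq z - 1) / (1 + csq z)"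
 by (simp_all add: hopf_def nsq_def add.commute)

lemma nsq_affine: "0 < nsq (z, 1)"
 unfolding nsq_def fst_conv snd_conv by (rule add_nonneg_pos) auto

lemma stereographic_hopf:
 assumes p: "p \<in> S2 - {north_pole}"
 shows "hopf (stereographic p, 1) = p"
proof -
 have s: "(p $ 1)^2 + (p $ 2)^2 = (1 - p $ 3) * (1 + p $ 3)"
  using p unfolding Diff_iff S2_coords by (simp add: algebra_simps power2_eq_square)
 have d: "1 - p $ 3 ~= 0"
 proof
  assume z: "1 - p $ 3 = 0"
  then have "(p $ 1)^2 + (p $ 2)^2 = 0" using s by simp
  then have "p $ 1 = 0" "p $ 2 = 0" by (simp_all add: sum_power2_eq_zero_iff)
  then have "p = north_pole" using z by (simp add: Finite_Cartesian_Product.vec_eq_iff forall_3 north_pole_def)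
  with p show False by simp
 qed
 let ?z = "stereographic p"
 have "csq ?z = ((p $ 1)^2 + (p $ 2)^2) / (1 - p $ 3)^2"
  by (simp add: stereographic_def cmod_power2 power_divide add_divide_distrib)
 also have "... = (1 + p $ 3) / (1 - p $ 3)" unfolding s using d by (simp add: power2_eq_square)
 finally have c: "csq ?z = (1 + p $ 3) / (1 - p $ 3)" .
 have c1: "1 + csq ?z = 2 / (1 - p $ 3)" unfolding c using d by (simp add: field_simps)
 have c2: "csq ?z - 1 = 2 * p $ 3 / (1 - p $ 3)" unfolding c using d by (simp add: field_simps)
 show ?thesis
  unfolding Finite_Cartesian_Product.vec_eq_iff forall_3 hopf_affine c1 c2 using d by (simp add: stereographic_def)
qed

lemma inv_stereographic_hopf: "inv_stereographic z = hopf (z, 1)"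
 unfolding inv_stereographic_def
proof (rule inv_into_f_eq)
 show "inj_on stereographic (S2 - {north_pole})"
  by (rule inj_on_inverseI[of _ "%z. hopf (z, 1)"]) (rule stereographic_hopf)
 have N: "1 + csq z ~= 0" using nsq_affine[of z] by (simp add: nsq_def)
 have h3: "1 - hopf (z, 1) $ 3 = 2 / (1 + csq z)" unfolding hopf_affine using N by (simp add: field_simps)
 have "hopf (z, 1) ~= north_pole"
 proof
  assume "hopf (z, 1) = north_pole"
  then have "hopf (z, 1) $ 3 = 1" by (simp add: north_pole_def)
  then show False using h3 N by simp
 qed
 then show "hopf (z, 1) \<in> S2 - {north_pole}" using hopf_S2[OF nsq_affine] by simp
 show "stereographic (hopf (z, 1)) = z"
  unfolding stereographic_def h3 hopf_affine(1,2) using N by (simp add: complex_eq_iff)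
qed

lemma emp_hole:
 assumes u: "nsq u = 1"
 shows "emp (inv_stereographic ` {z. pdet n y z = 0}) (hopf u) t \<longleftrightarrow> hole n (Ocap u t) y"
 unfolding emp_def hole_def Ocap_def mem_Collect_eq Ccap_hopf[OF nsq_affine u] inv_stereographic_hopf
 by (auto simp: not_less)

lemma hp_eqI:
 assumes V: "open V" "open V'" and n: "n >= 1" and J: "J n V [] = J n V' []"
 shows "hp n V = hp n V'"
proof -
 have "ennreal pi ^ (2 * n * n) * ennreal (hp n V) = ennreal pi ^ (2 * n * n) * ennreal (hp n V')"
  using J unfolding J_hp(1)[OF V(1) n] J_hp(1)[OF V(2) n] by (simp only: mult.commute)
 then have "ennreal (hp n V) = ennreal (hp n V')"
  using pi_power_ennreal[of "2 * n * n"] unfolding ennreal_mult_cancel_left by auto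
 then show ?thesis using hp_nonneg[OF V(1) n] hp_nonneg[OF V(2) n] by simp
qed

section \<open>Probabilities of empty caps\<close>

text \<open>The probability that a fixed cap of area fraction t is empty.\<close>

definition HH :: "nat => real => real" where "HH n t = (\<Prod>k<n. Bin n t k)"

lemma rot_to_pole:
 assumes u: "nsq u = 1"
 shows "csq (cnj (snd u)) + csq (fst u) = 1" "rot (cnj (snd u)) (fst u) u = (0, 1)"
proof -
 show pq: "csq (cnj (snd u)) + csq (fst u) = 1" using u by (simp add: nsq_def add.commute)
 have "snd u * cnj (snd u) + fst u * cnj (fst u) = complex_of_real (csq (snd u) + csq (fst u))"
  unfolding of_real_add complex_norm_square ..
 also have "... = 1" using pq by simp
 finally show "rot (cnj (snd u)) (fst u) u = (0, 1)" by (simp add: rot_def mult.commute)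
qed

lemma hp_Ocap:
 assumes u: "nsq u = 1" and n: "n >= 1" and t: "0 <= t" "t < 1"
 shows "hp n (Ocap u t) = HH n t"
proof -
 have "J n (Ocap u t) [] = J n (Ocap (0, 1) t) []"
  using J_rot[OF rot_to_pole(1)[OF u], of t n "{u}"] t rot_to_pole(2)[OF u] by simp
 then have "hp n (Ocap u t) = hp n (Ocap (0, 1) t)" by (rule hp_eqI[OF open_Ocap open_Ocap n])
 also have "... = (\<Prod>k<n. Phi n k (t / (1 - t)))" unfolding Ocap_pole[OF t(2)] using t by (intro hp_dball) simp
 also have "... = HH n t" unfolding HH_def by (intro prod.cong refl Phi_Bin t) simp
 finally show ?thesis .
qed

text \<open>A rotation carries the first cap to a disc around 0, where \<open>hp_disjoint\<close>
  applies; the second cap is then evaluated by a rotation of its own.\<close>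

lemma hp_Ocap_pair:
 assumes u: "nsq u = 1" "nsq v = 1" and n: "n >= 1" and t: "0 <= t" "t < 1"
  and disj: "Ccap u t \<inter> Ccap v t = {}"
 shows "hp n (Ocap u t \<union> Ocap v t) <= (HH n t)\<^sup>2"
proof -
 let ?R = "rot (cnj (snd u)) (fst u)"
 note pq = rot_to_pole(1)[OF u(1)]
 have r: "?R u = (0, 1)" by (rule rot_to_pole(2)[OF u(1)])
 have nv: "nsq (?R v) = 1" unfolding nsq_rot[OF pq] by (rule u(2))
 have o: "open (Ocap u t \<union> Ocap v t)" "open (Ocap (0, 1) t \<union> Ocap (?R v) t)" using open_Ocap by blast+
 have "J n (Ocap u t \<union> Ocap v t) [] = J n (Ocap (0, 1) t \<union> Ocap (?R v) t) []"
  using J_rot[OF pq, of t n "{u, v}"] t r by simp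
 then have "hp n (Ocap u t \<union> Ocap v t) = hp n (Ocap (0, 1) t \<union> Ocap (?R v) t)" by (rule hp_eqI[OF o n])
 also have "... = hp n (dball (t / (1 - t)) \<union> Ocap (?R v) t)" unfolding Ocap_pole[OF t(2)] ..
 also have "... <= hp n (dball (t / (1 - t))) * hp n (Ocap (?R v) t)"
 proof (rule hp_disjoint[OF open_Ocap _ _ n])
  show "dball (t / (1 - t)) \<inter> Ocap (?R v) t = {}"
  proof (rule ccontr)
   assume "~ ?thesis"
   then obtain z where z: "(z, 1) \<in> Ccap (?R u) t" "(z, 1) \<in> Ccap (?R v) t"
    unfolding Ocap_pole[OF t(2), symmetric] r Ocap_def by blast
   obtain y where y: "?R y = (z, 1)" using surj_rot[OF pq] by blast
   have "y \<in> Ccap u t" "y \<in> Ccap v t" using z unfolding y[symmetric] Ccap_rot[OF pq] by auto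
   with disj show False by blast
  qed
 qed (use t in simp)
 also have "hp n (dball (t / (1 - t))) = HH n t"
  using hp_Ocap[of "(0, 1)" n t] n t unfolding Ocap_pole[OF t(2)] by (simp add: nsq_def)
 also have "hp n (Ocap (?R v) t) = HH n t" by (rule hp_Ocap[OF nv n t])
 finally show ?thesis by (simp add: power2_eq_square)
qed

lemma Ccap_disjoint:
 assumes u: "nsq u = 1" "nsq v = 1" and t: "0 <= t" "t <= 1" and d: "4 * sqrt t <= dist (hopf u) (hopf v)"
 shows "Ccap u t \<inter> Ccap v t = {}"
proof (rule ccontr)
 assume "~ ?thesis"
 then obtain x where x: "x \<in> Ccap u t" "x \<in> Ccap v t" by blast
 have "0 <= nsq x" by (simp add: nsq_def)
 moreover have "nsq x ~= 0"
 proof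
  assume "nsq x = 0"
  then have "fst x = 0" "snd x = 0" by (simp_all add: nsq_def sum_power2_eq_zero_iff)
  then show False using x(1) by (simp add: Ccap_def cval_def nsq_def)
 qed
 ultimately have nx: "0 < nsq x" by simp
 have uS: "hopf u \<in> S2" "hopf v \<in> S2" "hopf x \<in> S2" using hopf_S2[of u] hopf_S2[of v] hopf_S2[OF nx] u by auto
 have close: "dist (hopf x) (hopf w) < 2 * sqrt t" if w: "nsq w = 1" "x \<in> Ccap w t" for w
 proof -
  have wS: "hopf w \<in> S2" using hopf_S2[of w] w by simp
  have "(dist (hopf x) (hopf w))^2 < 4 * t"
   using w(2) unfolding Ccap_hopf[OF nx w(1)] dist_S2[OF uS(3) wS] by simp
  also have "... = (2 * sqrt t)^2" using t by (simp add: power_mult_distrib)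
  finally show ?thesis by (rule power2_less_imp_less) (use t in simp)
 qed
 show False using close[OF u(1) x(1)] close[OF u(2) x(2)] d dist_triangle[of "hopf u" "hopf v" "hopf x"]
  by (simp add: dist_commute)
qed

text \<open>Chebyshev's inequality: pairwise negative correlation bounds the variance of the number
  of events that occur by its mean c. If no event occurs, the number deviates from c by c.\<close>

lemma (in prob_space) second_moment:
 assumes fin: "finite N" "N ~= {}" and E: "!!i. i \<in> N ==> E i \<in> events" and p: "0 < p"
  and pi: "!!i. i \<in> N ==> prob (E i) = p"
  and pij: "!!i j. i \<in> N ==> j \<in> N ==> i ~= j ==> prob (E i \<inter> E j) <= p^2"
 shows "prob (space M - (\<Union>i\<in>N. E i)) <= 1 / (real (card N) * p)"
proof -
 define c where "c = real (card N) * p"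
 have c0: "0 < c" using fin p by (simp add: c_def card_gt_0_iff)
 let ?Z = "%om. \<Sum>i\<in>N. indicator (E i) om :: real"
 let ?W = "space M - (\<Union>i\<in>N. E i)"
 have W: "?W \<in> events" using E fin by auto
 have ind: "integrable M (%om. indicator A om :: real)" if "A \<in> events" for A
  using that by (intro integrable_real_indicator) (simp_all add: emeasure_eq_measure)
 have e: "(?Z om - c)^2 = (\<Sum>i\<in>N. \<Sum>j\<in>N. indicator (E i \<inter> E j) om) - 2 * c * ?Z om + c^2" for om
  unfolding power2_diff by (simp add: power2_eq_square sum_product indicator_inter_arith mult_ac)
 have EE: "E i \<inter> E j \<in> events" if "i \<in> N" "j \<in> N" for i j using E that by blast
 have "c^2 * prob ?W = (\<integral>om. c\<^sup>2 * indicator ?W om \<partial>M)" using W by simp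
 also have "... <= (\<integral>om. (\<Sum>i\<in>N. \<Sum>j\<in>N. indicator (E i \<inter> E j) om) - 2 * c * ?Z om + c^2 \<partial>M)"
 proof (rule integral_mono)
  show "integrable M (%om. c\<^sup>2 * indicator ?W om)" using ind[OF W] by (rule integrable_mult_right)
  show "integrable M (%om. (\<Sum>i\<in>N. \<Sum>j\<in>N. indicator (E i \<inter> E j) om) - 2 * c * ?Z om + c^2)"
   by (intro Bochner_Integration.integrable_add Bochner_Integration.integrable_diff integrable_mult_right
     Bochner_Integration.integrable_sum ind EE E integrable_const) auto
  show "c^2 * indicator ?W om <= (\<Sum>i\<in>N. \<Sum>j\<in>N. indicator (E i \<inter> E j) om) - 2 * c * ?Z om + c^2" for om
  proof (cases "om \<in> ?W")
   case True
   then have "?Z om = 0" by (intro sum.neutral) auto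
   then show ?thesis unfolding e[symmetric] using True by simp
  next
   case False
   then show ?thesis unfolding e[symmetric] by simp
  qed
 qed
 also have "... = (\<Sum>i\<in>N. \<Sum>j\<in>N. prob (E i \<inter> E j)) - 2 * c * (\<Sum>i\<in>N. prob (E i)) + c^2"
 proof -
  have a: "integrable M (%om. \<Sum>i\<in>N. \<Sum>j\<in>N. indicator (E i \<inter> E j) om :: real)"
   by (intro Bochner_Integration.integrable_sum ind EE)
  have iI: "(\<integral>om. indicator F om \<partial>M) = prob F" if "F \<in> events" for F using that by simp
  have b: "integrable M ?Z" by (intro Bochner_Integration.integrable_sum ind E)
  have "(\<integral>om. (\<Sum>i\<in>N. \<Sum>j\<in>N. indicator (E i \<inter> E j) om :: real) \<partial>M) = (\<Sum>i\<in>N. \<Sum>j\<in>N. prob (E i \<inter> E j))"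
  proof -
   have "(\<integral>om. (\<Sum>i\<in>N. \<Sum>j\<in>N. indicator (E i \<inter> E j) om :: real) \<partial>M) = (\<Sum>i\<in>N. \<integral>om. (\<Sum>j\<in>N. indicator (E i \<inter> E j) om) \<partial>M)"
    by (intro Bochner_Integration.integral_sum Bochner_Integration.integrable_sum ind EE)
   also have "... = (\<Sum>i\<in>N. \<Sum>j\<in>N. \<integral>om. indicator (E i \<inter> E j) om \<partial>M)"
    by (intro sum.cong refl Bochner_Integration.integral_sum ind EE)
   also have "... = (\<Sum>i\<in>N. \<Sum>j\<in>N. prob (E i \<inter> E j))"
    by (intro sum.cong refl iI EE)
   finally show ?thesis .
  qed
  moreover have "(\<integral>om. ?Z om \<partial>M) = (\<Sum>i\<in>N. prob (E i))"
  proof -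
   have "(\<integral>om. ?Z om \<partial>M) = (\<Sum>i\<in>N. \<integral>om. indicator (E i) om \<partial>M)"
    by (intro Bochner_Integration.integral_sum ind E)
   also have "... = (\<Sum>i\<in>N. prob (E i))" by (intro sum.cong refl iI E)
   finally show ?thesis .
  qed
  ultimately show ?thesis
   using a b by (simp add: prob_space)
 qed
 also have "(\<Sum>i\<in>N. prob (E i)) = c" by (simp add: pi c_def)
 also have "(\<Sum>i\<in>N. \<Sum>j\<in>N. prob (E i \<inter> E j)) <= (\<Sum>i\<in>N. \<Sum>j\<in>N. p\<^sup>2 + (if j = i then p else 0))"
  using pi pij p by (intro sum_mono) (auto simp: power2_eq_square)
 also have "... = c^2 + c" using fin by (simp add: sum.distrib c_def power2_eq_square algebra_simps)
 finally have "c^2 * prob ?W <= c" by (simp add: power2_eq_square)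
 then have "c * prob ?W <= 1" using c0 by (simp add: power2_eq_square mult.assoc)
 then show ?thesis unfolding c_def[symmetric] using c0 by (simp add: field_simps)
qed

context
 fixes M :: "'a measure" and n :: nat and A B :: "'a => complex mat"
 assumes g: "independent_gaussian_matrices M n A B" and n: "n >= 1"

begin

interpretation prob_space M using g by (simp add: independent_gaussian_matrices_def)

abbreviation (input) ent_mat :: "'a => pencil" where
 "ent_mat om == entries (A om) (B om) n"

abbreviation (input) pts :: "'a => (real^3) multiset" where
 "pts om == spherical_ensemble (A om) (B om)"

abbreviation (input) Ev :: "real^3 => real => 'a set" where
 "Ev q t == {om \<in> space M. emp (set_mset (pts om)) q t}"

lemma set_pts: "om \<in> space M ==> set_mset (pts om) =
  (if adet n (ent_mat om) = 0 then {} else inv_stereographic ` {z. pdet n (ent_mat om) z = 0})"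
 using g by (intro set_spherical_ensemble) (auto simp: independent_gaussian_matrices_def)

lemma pts_S2: "om \<in> space M ==> set_mset (pts om) <= S2"
 using hopf_S2[OF nsq_affine] by (auto simp: set_pts inv_stereographic_hopf)

text \<open>When A is singular there are no points and every cap counts as empty; this is a null
  event that has to be carried along.\<close>

lemma Ev_hole:
 assumes u: "nsq u = 1"
 shows "Ev (hopf u) t = {om \<in> space M. adet n (ent_mat om) = 0} \<union> {om \<in> space M. hole n (Ocap u t) (ent_mat om)}"
proof -
 have "emp (set_mset (pts om)) (hopf u) t \<longleftrightarrow> adet n (ent_mat om) = 0 \<or> hole n (Ocap u t) (ent_mat om)" if "om \<in> space M" for om
  unfolding set_pts[OF that] using emp_hole[OF u, of n "ent_mat om" t] by (simp add: emp_def)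
 then show ?thesis by blast
qed

lemma null_singular: "{om \<in> space M. adet n (ent_mat om) = 0} \<in> null_sets M"
proof (rule null_sets_subset[OF prob_bad[OF g n]])
 show "{om \<in> space M. adet n (ent_mat om) = 0} \<in> events"
  using entries_law(1)[OF g n sets_adet, of n] by simp
 show "{om \<in> space M. adet n (ent_mat om) = 0} <= {om \<in> space M. bad n (ent_mat om)}"
  using bad_adet by blast
qed

lemma prob_Un_singular: "F \<in> events ==> prob ({om \<in> space M. adet n (ent_mat om) = 0} \<union> F) = prob F"
 unfolding Un_commute[of _ F] by (rule measure_Un_null_set[OF _ null_singular])

lemma Ev_events: "q \<in> S2 ==> Ev q t \<in> events"
proof -
 assume "q \<in> S2"
 then obtain u where u: "nsq u = 1" "hopf u = q" by (rule hopf_surj)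
 show ?thesis
  unfolding u(2)[symmetric] Ev_hole[OF u(1)]
  using prob_hole(1)[OF g n open_Ocap] null_singular by (intro sets.Un) auto
qed

lemma prob_Ev:
 assumes q: "q \<in> S2" and t: "0 <= t" "t < 1"
 shows "prob (Ev q t) = HH n t"
proof -
 obtain u where u: "nsq u = 1" "hopf u = q" using q by (rule hopf_surj)
 show ?thesis
  unfolding u(2)[symmetric] Ev_hole[OF u(1)] prob_Un_singular[OF prob_hole(1)[OF g n open_Ocap]]
   prob_hole(2)[OF g n open_Ocap] by (rule hp_Ocap[OF u(1) n t])
qed

lemma prob_Ev_pair:
 assumes q: "q \<in> S2" "r \<in> S2" and t: "0 <= t" "t < 1" and d: "4 * sqrt t <= dist q r"
 shows "prob (Ev q t \<inter> Ev r t) <= (HH n t)\<^sup>2"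
proof -
 obtain u where u: "nsq u = 1" "hopf u = q" using q(1) by (rule hopf_surj)
 obtain v where v: "nsq v = 1" "hopf v = r" using q(2) by (rule hopf_surj)
 have o: "open (Ocap u t \<union> Ocap v t)" by (intro open_Un open_Ocap)
 have disj: "Ccap u t \<inter> Ccap v t = {}" using Ccap_disjoint[OF u(1) v(1)] t d u v by simp
 have "Ev q t \<inter> Ev r t = {om \<in> space M. adet n (ent_mat om) = 0} \<union> {om \<in> space M. hole n (Ocap u t \<union> Ocap v t) (ent_mat om)}"
  unfolding u(2)[symmetric] v(2)[symmetric] Ev_hole[OF u(1)] Ev_hole[OF v(1)] by (auto simp: hole_def)
 then show ?thesis
  using prob_Un_singular[OF prob_hole(1)[OF g n o]] prob_hole(2)[OF g n o] hp_Ocap_pair[OF u(1) v(1) n t disj] by simp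
qed

abbreviation (input) cov :: "'a => real" where
 "cov om == largest_empty_cap_area (pts om)"

lemma cov_gt: "om \<in> space M ==> 0 <= t ==>
  4 * pi * t < cov om \<longleftrightarrow> (\<exists>t'. t < t' & t' <= 1 & (\<exists>q\<in>S2. emp (set_mset (pts om)) q t'))"
 by (rule largest_empty_cap_area_gt[OF pts_S2])

lemma measurable_cov: "(%om. largest_empty_cap_area (spherical_ensemble (A om) (B om))) \<in> borel_measurable M"
 unfolding borel_measurable_iff_greater
proof
 fix a :: real
 show "{om \<in> space M. a < cov om} \<in> events"
 proof (cases "a < 0")
  case True
  then have "{om \<in> space M. a < cov om} = space M" using largest_empty_cap_area_bounds(1) by (fastforce intro: less_le_trans)
  then show ?thesis by simp
 next
  case False
  obtain D where D: "countable D" "D <= S2" "\<forall>X t. X <= S2 -->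
    (\<exists>t'. t < t' & t' <= 1 & (\<exists>q\<in>S2. emp X q t')) = (\<exists>t'\<in>\<rat>. t < t' & t' <= 1 & (\<exists>q\<in>D. emp X q t'))"
   using emp_dense by (elim exE conjE) (rule that)
  define t where "t = a / (4 * pi)"
  have t: "0 <= t" "a = 4 * pi * t" using False by (simp_all add: t_def)
  have "{om \<in> space M. a < cov om} = (\<Union>t'\<in>{t'\<in>\<rat>. t < t' & t' <= 1}. \<Union>q\<in>D. Ev q t')"
  proof (rule Set.set_eqI)
   fix om
   show "om \<in> {om \<in> space M. a < cov om} \<longleftrightarrow> om \<in> (\<Union>t'\<in>{t'\<in>\<rat>. t < t' & t' <= 1}. \<Union>q\<in>D. Ev q t')"
   proof (cases "om \<in> space M")
    case True
    have "om \<in> {om \<in> space M. a < cov om} \<longleftrightarrow> (\<exists>t'\<in>\<rat>. t < t' & t' <= 1 & (\<exists>q\<in>D. emp (set_mset (pts om)) q t'))"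
     unfolding mem_Collect_eq t(2) cov_gt[OF True t(1)] D(3)[rule_format, OF pts_S2[OF True]] using True by simp
    also have "... \<longleftrightarrow> om \<in> (\<Union>t'\<in>{t'\<in>\<rat>. t < t' & t' <= 1}. \<Union>q\<in>D. Ev q t')"
     unfolding UN_iff mem_Collect_eq using True by auto
    finally show ?thesis .
   qed simp
  qed
  also have "... \<in> events"
  proof (intro sets.countable_UN'' )
   show "countable {t' \<in> \<rat>. t < t' & t' <= (1::real)}" by (rule countable_subset[OF _ countable_rat]) auto
   show "countable D" by (rule D(1))
   show "Ev q t' \<in> events" if "q \<in> D" for q t' using that D(2) by (intro Ev_events) auto
  qed
  finally show ?thesis .
 qed
qed

text \<open>The net has mesh \<eta> times the chordal radius. An empty cap of fraction above t then
  forces an empty cap of fraction (1 - \<eta>)^2 t around a net point, and there are at most 4 /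
  (\<eta>^2 t) of these.\<close>

theorem prob_cov_upper:
 assumes eta: "0 < \<eta>" "\<eta> < 1" and t: "0 < t" "t <= 1" and s: "0 <= s" "s < 1" "s <= (1 - \<eta>)\<^sup>2 * t"
 shows "measure M {om \<in> space M. 4 * pi * t < largest_empty_cap_area (spherical_ensemble (A om) (B om))} <= 4 / (\<eta>\<^sup>2 * t) * HH n s"
proof -
 have "\<eta>\<^sup>2 * t <= 1 * 1" using eta t by (intro mult_mono) (auto simp: power_le_one)
 then have e: "0 < \<eta>\<^sup>2 * t" "\<eta>\<^sup>2 * t <= 1" using eta t by auto
 obtain N where N: "finite N" "N <= S2" "real (card N) <= 4 / (\<eta>\<^sup>2 * t)" "\<forall>q\<in>S2. \<exists>p\<in>N. dist q p < 2 * sqrt (\<eta>\<^sup>2 * t)"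
  using separated_net[OF e] by (elim exE conjE) (rule that)
 have sub: "{om \<in> space M. 4 * pi * t < cov om} <= (\<Union>q\<in>N. Ev q s)"
 proof
  fix om assume w: "om \<in> {om \<in> space M. 4 * pi * t < cov om}"
  then have ws: "om \<in> space M" by simp
  obtain t' q where t': "t < t'" "t' <= 1" and q: "q \<in> S2" "emp (set_mset (pts om)) q t'"
   using w cov_gt[OF ws, of t] t by auto
  obtain p where p: "p \<in> N" "dist q p < 2 * sqrt (\<eta>\<^sup>2 * t)" using N(4) q(1) by blast
  have "sqrt (\<eta>\<^sup>2 * t) = \<eta> * sqrt t" using eta by (simp add: real_sqrt_mult)
  also have "... <= \<eta> * sqrt t'" using eta t' by (intro mult_left_mono) auto
  finally have "dist q p <= 2 * \<eta> * sqrt t'" using p by simp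
  then have "emp (set_mset (pts om)) p ((1 - \<eta>)^2 * t')"
   using N(2) p t t' eta q by (intro emp_approx[OF pts_S2[OF ws] q(1) _ q(2)]) auto
  moreover have "s <= (1 - \<eta>)\<^sup>2 * t'" using s(3) t' mult_left_mono[of t t' "(1 - \<eta>)^2"] by simp
  ultimately have "emp (set_mset (pts om)) p s" by (rule emp_mono)
  then show "om \<in> (\<Union>q\<in>N. Ev q s)" using p ws by blast
 qed
 have ev: "!!q. q \<in> N ==> Ev q s \<in> events" using N(2) by (intro Ev_events) auto
 have "prob {om \<in> space M. 4 * pi * t < cov om} <= prob (\<Union>q\<in>N. Ev q s)"
  using sub N(1) ev by (intro finite_measure_mono sets.finite_UN) auto
 also have "... <= (\<Sum>q\<in>N. prob (Ev q s))"
  using N(1) ev by (intro finite_measure_subadditive_finite) auto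
 also have "... = (\<Sum>q\<in>N. HH n s)" using N(2) s by (intro sum.cong refl prob_Ev) auto
 also have "... <= 4 / (\<eta>\<^sup>2 * t) * HH n s"
  using N(3) Bin_pos[of s n] s unfolding sum_constant HH_def by (intro mult_right_mono prod_nonneg) (auto intro: less_imp_le)
 finally show ?thesis .
qed

text \<open>The centres are 2 sqrt (4 t) = 4 sqrt t apart, twice the chordal radius of a cap of
  fraction t, so the caps are disjoint. There are at least 1 / (4 t) of them, and the second moment
  method applies.\<close>

theorem prob_cov_lower:
 assumes t: "0 < t" "4 * t <= 1"
 shows "measure M {om \<in> space M. largest_empty_cap_area (spherical_ensemble (A om) (B om)) < 4 * pi * t} <= 4 * t / HH n t"
proof -
 have H: "0 < HH n t" unfolding HH_def using Bin_pos[of t n] t by (intro prod_pos) auto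
 have t4: "0 < 4 * t" using t by simp
 obtain N where N: "finite N" "N <= S2" "1 / (4 * t) <= real (card N)" "\<forall>p\<in>N. \<forall>q\<in>N. p ~= q --> 2 * sqrt (4 * t) <= dist p q"
  using separated_net[OF t4 t(2)] by (elim exE conjE) (rule that)
 have "0 < 1 / (4 * t)" using t by simp
 then have N0: "0 < real (card N)" using N(3) by linarith
 have sq: "2 * sqrt (4 * t) = 4 * sqrt t" by (simp add: real_sqrt_mult)
 have ev: "!!q. q \<in> N ==> Ev q t \<in> events" using N(2) by (intro Ev_events) auto
 have "prob {om \<in> space M. cov om < 4 * pi * t} <= prob (space M - (\<Union>q\<in>N. Ev q t))"
 proof (rule finite_measure_mono)
  show "{om \<in> space M. cov om < 4 * pi * t} <= space M - (\<Union>q\<in>N. Ev q t)"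
  proof
   fix om assume w: "om \<in> {om \<in> space M. cov om < 4 * pi * t}"
   then have ws: "om \<in> space M" by simp
   have False if q: "q \<in> N" "om \<in> Ev q t" for q
   proof -
    define s where "s = cov om / (4 * pi)"
    have s0: "0 <= s" unfolding s_def using largest_empty_cap_area_bounds(1) by simp
    have cs: "4 * pi * s = cov om" by (simp add: s_def)
    have "cov om < 4 * pi * t" using w by simp
    then have st: "s < t" unfolding cs[symmetric] by simp
    have "t <= 1" using t by simp
    then have "4 * pi * s < cov om" unfolding cov_gt[OF ws s0] using q N(2) st by blast
    then show False unfolding cs by simp
   qed
   then show "om \<in> space M - (\<Union>q\<in>N. Ev q t)" using ws by blast
  qed
  show "space M - (\<Union>q\<in>N. Ev q t) \<in> events" using ev N(1) by (intro sets.compl_sets sets.finite_UN) auto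
 qed
 also have "... <= 1 / (real (card N) * HH n t)"
 proof (rule second_moment[OF N(1) _ ev H])
  show "N ~= {}" using N0 by auto
  show "prob (Ev q t) = HH n t" if "q \<in> N" for q using that N(2) t by (intro prob_Ev) auto
  show "prob (Ev p t \<inter> Ev q t) <= (HH n t)\<^sup>2" if "p \<in> N" "q \<in> N" "p ~= q" for p q
   using that N(2) t N(4) unfolding sq by (intro prob_Ev_pair) auto
 qed
 also have "... <= 1 / (1 / (4 * t) * HH n t)"
  using N(3) H t N0 by (intro divide_left_mono mult_right_mono mult_pos_pos) auto
 also have "... = 4 * t / HH n t" by simp
 finally show ?thesis .
qed

end

section \<open>The largest empty cap\<close>

lemma sqrt_ln_at_top: "filterlim (%n. sqrt (ln (real n))) at_top sequentially"
 by real_asymp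

context
 fixes c :: real and m :: "nat => nat"
 assumes c: "0 < c" and m: "!!n. \<bar>real (m n) - c * sqrt (ln (real n))\<bar> <= 1"

begin

lemma ratio_limit: "(%n. real (m n) / sqrt (ln (real n))) \<longlonglongrightarrow> c"
proof (rule tendsto_sandwich)
 let ?r = "%n. sqrt (ln (real n))"
 have i: "(%n. inverse (?r n)) \<longlonglongrightarrow> 0" by (rule tendsto_inverse_0_at_top[OF sqrt_ln_at_top])
 show "(%n. c - inverse (?r n)) \<longlonglongrightarrow> c" using tendsto_diff[OF tendsto_const i, of c] by simp
 show "(%n. c + inverse (?r n)) \<longlonglongrightarrow> c" using tendsto_add[OF tendsto_const i, of c] by simp
 have ev: "\<forall>\<^sub>F n in sequentially. 0 < ?r n" using sqrt_ln_at_top unfolding filterlim_at_top_dense by (rule spec)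
 show "\<forall>\<^sub>F n in sequentially. c - inverse (?r n) <= real (m n) / ?r n"
  using ev
 proof eventually_elim
  case (elim n)
  have "c * ?r n - 1 <= real (m n)" using m[of n] by linarith
  then have "(c * ?r n - 1) / ?r n <= real (m n) / ?r n" using elim by (intro divide_right_mono) auto
  moreover have "(c * ?r n - 1) / ?r n = c - inverse (?r n)" using elim by (simp add: diff_divide_distrib inverse_eq_divide)
  ultimately show ?case by simp
 qed
 show "\<forall>\<^sub>F n in sequentially. real (m n) / ?r n <= c + inverse (?r n)"
  using ev
 proof eventually_elim
  case (elim n)
  have "real (m n) <= c * ?r n + 1" using m[of n] by linarith
  then have "real (m n) / ?r n <= (c * ?r n + 1) / ?r n" using elim by (intro divide_right_mono) auto
  moreover have "(c * ?r n + 1) / ?r n = c + inverse (?r n)" using elim by (simp add: add_divide_distrib inverse_eq_divide)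
  ultimately show ?case by simp
 qed
qed

lemma m_at_top: "filterlim (%n. real (m n)) at_top sequentially"
proof (rule filterlim_at_top_mono)
 show "filterlim (%n. - 1 + c * sqrt (ln (real n))) at_top sequentially"
  by (intro filterlim_tendsto_add_at_top[OF tendsto_const] filterlim_tendsto_pos_mult_at_top[OF tendsto_const c] sqrt_ln_at_top)
 show "\<forall>\<^sub>F n in sequentially. - 1 + c * sqrt (ln (real n)) <= real (m n)"
 proof (intro always_eventually allI)
  show "- 1 + c * sqrt (ln (real n)) <= real (m n)" for n using m[of n] by linarith
 qed
qed

text \<open>With f(m) close to - m^2 / 4 and m close to c sqrt(ln n), the exponential of f(m) is n
  to a power tending to - (c / 2)^2.\<close>

lemma exponent_limit:
 assumes f: "((%x. f x / x^2) \<longlongrightarrow> - 1 / 4) at_top"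
 shows "(%n. f (real (m n)) / ln (real n)) \<longlonglongrightarrow> - (c / 2)\<^sup>2"
proof -
 have "(%n. f (real (m n)) / (real (m n))^2 * (real (m n) / sqrt (ln (real n)))^2) \<longlonglongrightarrow> - 1 / 4 * c^2"
  by (intro tendsto_mult tendsto_power ratio_limit filterlim_compose[OF f m_at_top])
 then have l: "(%n. f (real (m n)) / (real (m n))^2 * (real (m n) / sqrt (ln (real n)))^2) \<longlonglongrightarrow> - (c / 2)\<^sup>2"
  by (simp add: power_divide)
 have "\<forall>\<^sub>F n in sequentially. 0 < real (m n)" using m_at_top unfolding filterlim_at_top_dense by (rule spec)
 then have ev: "\<forall>\<^sub>F n in sequentially. f (real (m n)) / (real (m n))^2 * (real (m n) / sqrt (ln (real n)))^2 = f (real (m n)) / ln (real n)"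
  using eventually_ge_at_top[of 1]
 proof eventually_elim
  case (elim n)
  have "(sqrt (ln (real n)))^2 = ln (real n)" using elim by simp
  then have "(real (m n) / sqrt (ln (real n)))^2 = (real (m n))^2 / ln (real n)" by (simp only: power_divide)
  then show ?case using elim by simp
 qed
 show ?thesis by (rule Lim_transform_eventually[OF l ev])
qed

end

context
 fixes M :: "nat => 'a measure" and A B :: "nat => 'a => complex mat"
 assumes g: "!!n. n >= 1 ==> independent_gaussian_matrices (M n) n (A n) (B n)"

begin

abbreviation (input) cova :: "nat => 'a => real" where
 "cova n om == largest_empty_cap_area (spherical_ensemble (A n om) (B n om))"

abbreviation (input) rescaled :: "nat => 'a => real" where
 "rescaled n om == real n / (8 * pi * sqrt (ln (real n))) * cova n om"

lemma rescaled_less_iff: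
 assumes "2 <= n"
 shows "a < rescaled n om \<longleftrightarrow> 4 * pi * (2 * a * sqrt (ln (real n)) / real n) < cova n om"
  and "rescaled n om < a \<longleftrightarrow> cova n om < 4 * pi * (2 * a * sqrt (ln (real n)) / real n)"
proof -
 define r where "r = sqrt (ln (real n))"
 have r: "0 < r" "0 < real n" using assms by (auto simp: r_def)
 show "a < rescaled n om \<longleftrightarrow> 4 * pi * (2 * a * sqrt (ln (real n)) / real n) < cova n om"
  "rescaled n om < a \<longleftrightarrow> cova n om < 4 * pi * (2 * a * sqrt (ln (real n)) / real n)"
  unfolding r_def[symmetric] using r by (simp_all add: field_simps)
qed

text \<open>The net has O(n / sqrt(ln n)) points, and each carries an empty cap with probability
  about n^(- b'^2). The intermediate b' leaves room on both sides: from a down to b' for the mesh of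
  the net, from b' down to b for the error in the exponent.\<close>

lemma upper_tail:
 assumes ab: "0 < b" "b < a"
 shows "\<forall>\<^sub>F n in sequentially. measure (M n) {om \<in> space (M n). a < rescaled n om} <= real n powr (1 - b\<^sup>2)"
proof -
 define b' where "b' = (a + b) / 2"
 have b': "b < b'" "b' < a" "0 < b'" using ab by (auto simp: b'_def)
 \<comment> \<open>Chosen so that shrinking by (1 - \<eta>)^2 lowers the level exactly from a to
   b'.\<close>
 define \<eta> where "\<eta> = 1 - sqrt (b' / a)"
 have "0 < sqrt (b' / a)" "sqrt (b' / a) < 1" using b' by simp_all
 then have eta: "0 < \<eta>" "\<eta> < 1" by (auto simp: \<eta>_def)
 have eta2: "(1 - \<eta>)^2 = b' / a" using b' by (simp add: \<eta>_def)
 let ?r = "%n. sqrt (ln (real n))"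
 \<comment> \<open>The bounds on \<open>HH\<close> hold at t = m / n with integral m; rounding down
   keeps the cap within the one provided by the net.\<close>
 define m where "m n = nat \<lfloor>2 * b' * ?r n\<rfloor>" for n
 have m0: "real (m n) <= 2 * b' * ?r n" "2 * b' * ?r n - 1 <= real (m n)" for n
 proof -
  have "0 <= 2 * b' * ?r n" using b' by (cases n) auto
  then have "real (m n) = of_int \<lfloor>2 * b' * ?r n\<rfloor>" by (simp add: m_def)
  then show "real (m n) <= 2 * b' * ?r n" "2 * b' * ?r n - 1 <= real (m n)" by linarith+
 qed
 have ma: "\<bar>real (m n) - 2 * b' * ?r n\<bar> <= 1" for n using m0[of n] by linarith
 have c2: "0 < 2 * b'" using b' by simp
 have "(%n. EU (real (m n)) / ln (real n)) \<longlonglongrightarrow> - (2 * b' / 2)\<^sup>2"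
  by (rule exponent_limit[OF c2 ma EU_limit])
 moreover have "- (2 * b' / 2)\<^sup>2 < - b\<^sup>2" using b' ab by (simp add: power_strict_mono)
 ultimately have e1: "\<forall>\<^sub>F n in sequentially. EU (real (m n)) / ln (real n) < - b\<^sup>2" by (rule order_tendstoD(2))
 have e2: "\<forall>\<^sub>F n in sequentially. 2 <= real (m n)"
  using m_at_top[OF c2 ma] unfolding filterlim_at_top by (rule spec)
 have e3: "\<forall>\<^sub>F n in sequentially. 4 / (\<eta>\<^sup>2 * (2 * a)) <= ?r n"
  using sqrt_ln_at_top unfolding filterlim_at_top by (rule spec)
 have "(%n. ?r n / real n) \<longlonglongrightarrow> 0" by real_asymp
 then have "(%n. 2 * a * (?r n / real n)) \<longlonglongrightarrow> 2 * a * 0" by (intro tendsto_mult tendsto_const)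
 then have e4: "\<forall>\<^sub>F n in sequentially. 2 * a * (?r n / real n) < 1" by (intro order_tendstoD(2)) auto
 show ?thesis
  using e1 e2 e3 e4 eventually_ge_at_top[of 2]
 proof eventually_elim
  case (elim n)
  have n0: "0 < real n" "n >= 1" using elim(5) by auto
  have L: "0 < ln (real n)" using elim(5) by simp
  then have r: "0 < ?r n" by simp
  define t where "t = 2 * a * ?r n / real n"
  have t: "0 < t" "t <= 1" using elim(4) ab r n0 by (auto simp: t_def)
  define s where "s = real (m n) / real n"
  have s: "0 <= s" by (simp add: s_def)
  have "s <= 2 * b' * ?r n / real n" unfolding s_def using m0(1) n0 by (intro divide_right_mono) auto
  also have "... = (1 - \<eta>)^2 * t" unfolding eta2 t_def using ab by simp
  finally have st: "s <= (1 - \<eta>)\<^sup>2 * t" .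
  also have "... < 1 * 1" unfolding eta2 using b' t by (intro mult_less_le_imp_less) auto
  finally have s1: "s < 1" by simp
  then have mn: "m n < n" using n0 by (simp add: s_def)
  have "measure (M n) {om \<in> space (M n). a < rescaled n om} = measure (M n) {om \<in> space (M n). 4 * pi * t < cova n om}"
   unfolding rescaled_less_iff(1)[OF elim(5)] t_def ..
  also have "... <= 4 / (\<eta>\<^sup>2 * t) * HH n s"
   by (rule prob_cov_upper[OF g[OF n0(2)] n0(2) eta t s s1 st])
  also have "... <= real n * exp (- b\<^sup>2 * ln (real n))"
  proof (rule mult_mono)
   have "4 / (\<eta>\<^sup>2 * t) = (4 / (\<eta>\<^sup>2 * (2 * a))) / ?r n * real n" unfolding t_def using r n0 ab eta by simp
   also have "... <= 1 * real n"
   proof (rule mult_right_mono)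
    show "4 / (\<eta>\<^sup>2 * (2 * a)) / ?r n <= 1" unfolding pos_divide_le_eq[OF r] using elim(3) by (simp only: mult_1_left)
   qed simp
   finally show "4 / (\<eta>\<^sup>2 * t) <= real n" by simp
   have "HH n s <= exp (EU (real (m n)))"
    unfolding HH_def s_def using elim(2) mn by (intro hole_upper) auto
   also have "... <= exp (- b\<^sup>2 * ln (real n))" using elim(1) L by (simp add: divide_less_eq)
   finally show "HH n s <= exp (- b\<^sup>2 * ln (real n))" .
   show "0 <= HH n s" unfolding HH_def using Bin_pos[OF s s1, of n] by (intro prod_nonneg) (auto intro: less_imp_le)
  qed simp
  also have "... = real n powr (1 - b\<^sup>2)"
   using n0 by (simp add: powr_def exp_diff exp_minus algebra_simps divide_inverse)
  finally show ?case .
 qed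
qed

text \<open>The emptiness probability is at least n^(- c') for some c' < 1, while the number of
  disjoint caps is of order n / sqrt(ln n), so the expected number of empty ones tends to
  infinity.\<close>

lemma lower_tail:
 assumes c: "0 < c" "c < 1"
 shows "(%n. measure (M n) {om \<in> space (M n). rescaled n om < c}) \<longlonglongrightarrow> 0"
proof -
 let ?r = "%n. sqrt (ln (real n))"
 \<comment> \<open>Halfway between c^2, the limiting exponent, and 1, the exponent at which the
   expected number stops growing as a power of n.\<close>
 define c' where "c' = (1 + c^2) / 2"
 have "c^2 < 1" using c by (simp add: power_less_one_iff abs_square_less_1)
 then have c': "c^2 < c'" "c' < 1" by (auto simp: c'_def)
 \<comment> \<open>Rounded up, so that an area below the level c is also below 4 pi m / n.\<close>
 define m where "m n = nat \<lceil>2 * c * ?r n\<rceil>" for n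
 have m0: "2 * c * ?r n <= real (m n)" "real (m n) <= 2 * c * ?r n + 1" for n
 proof -
  have "0 <= 2 * c * ?r n" using c by (cases n) auto
  then have "real (m n) = of_int \<lceil>2 * c * ?r n\<rceil>" by (simp add: m_def)
  then show "2 * c * ?r n <= real (m n)" "real (m n) <= 2 * c * ?r n + 1" by linarith+
 qed
 have ma: "\<bar>real (m n) - 2 * c * ?r n\<bar> <= 1" for n using m0[of n] by linarith
 have c2: "0 < 2 * c" using c by simp
 have "(%n. EL (real (m n)) / ln (real n)) \<longlonglongrightarrow> - (2 * c / 2)\<^sup>2"
  by (rule exponent_limit[OF c2 ma EL_limit])
 moreover have "- c' < - (2 * c / 2)\<^sup>2" using c' by simp
 ultimately have e1: "\<forall>\<^sub>F n in sequentially. - c' < EL (real (m n)) / ln (real n)" by (rule order_tendstoD(1))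
 have e2: "\<forall>\<^sub>F n in sequentially. 2 <= real (m n)"
  using m_at_top[OF c2 ma] unfolding filterlim_at_top by (rule spec)
 have e3: "\<forall>\<^sub>F n in sequentially. 1 <= ?r n"
  using sqrt_ln_at_top unfolding filterlim_at_top by (rule spec)
 have "(%n. 9 * ln (real n) / real n) \<longlonglongrightarrow> 0" "(%n. 12 * ?r n / real n) \<longlonglongrightarrow> 0" by real_asymp+
 then have e4: "\<forall>\<^sub>F n in sequentially. 9 * ln (real n) / real n < 1" "\<forall>\<^sub>F n in sequentially. 12 * ?r n / real n < 1"
  by (auto intro: order_tendstoD(2))
 have ev: "\<forall>\<^sub>F n in sequentially. measure (M n) {om \<in> space (M n). rescaled n om < c} <= 12 * (?r n * real n powr (- (1 - c')))"
  using e1 e2 e3 e4 eventually_ge_at_top[of 2]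
 proof eventually_elim
  case (elim n)
  have n0: "0 < real n" "n >= 1" using elim(6) by auto
  have L: "0 < ln (real n)" using elim(6) by simp
  have rr: "(?r n)^2 = ln (real n)" using L by simp
  have "c * ?r n <= 1 * ?r n" using c elim(3) by (intro mult_right_mono) auto
  then have m3: "real (m n) <= 3 * ?r n" using m0(2)[of n] elim(3) by linarith
  have "(real (m n))^2 <= (3 * ?r n)\<^sup>2" using m3 by (intro power_mono) auto
  also have "... = 9 * ln (real n)" unfolding power_mult_distrib rr by simp
  also have "... <= real n" using elim(4) n0 by (simp add: divide_less_eq)
  finally have mm: "(m n)^2 <= n" by (metis of_nat_le_iff of_nat_power)
  have "12 * ?r n <= real n" using elim(5) n0 by (simp add: divide_less_eq)
  then have m4: "4 * real (m n) <= real n" using m3 by linarith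
  define t where "t = real (m n) / real n"
  have t: "0 < t" "4 * t <= 1" using elim(2) m4 n0 by (auto simp: t_def divide_le_eq)
  have pr: "prob_space (M n)" using g[OF n0(2)] by (simp add: independent_gaussian_matrices_def)
  have meas: "cova n \<in> borel_measurable (M n)" by (rule measurable_cov[OF g[OF n0(2)] n0(2)])
  have "measure (M n) {om \<in> space (M n). rescaled n om < c} = measure (M n) {om \<in> space (M n). cova n om < 4 * pi * (2 * c * ?r n / real n)}"
   unfolding rescaled_less_iff(2)[OF elim(6)] ..
  also have "... <= measure (M n) {om \<in> space (M n). cova n om < 4 * pi * t}"
  proof (rule finite_measure.finite_measure_mono[OF prob_space.finite_measure[OF pr]])
   have "2 * c * ?r n / real n <= t" unfolding t_def using m0(1) n0 by (intro divide_right_mono) auto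
   then have "4 * pi * (2 * c * ?r n / real n) <= 4 * pi * t" by (intro mult_left_mono) auto
   then show "{om \<in> space (M n). cova n om < 4 * pi * (2 * c * ?r n / real n)} <= {om \<in> space (M n). cova n om < 4 * pi * t}"
    by (auto intro: less_le_trans)
   show "{om \<in> space (M n). cova n om < 4 * pi * t} \<in> sets (M n)" using meas by measurable
  qed
  also have "... <= 4 * t / HH n t" by (rule prob_cov_lower[OF g[OF n0(2)] n0(2) t])
  also have "... <= 4 * t / exp (- c' * ln (real n))"
  proof (rule divide_left_mono)
   have "- c' * ln (real n) <= EL (real (m n))" using elim(1) L by (simp add: less_divide_eq)
   then have "exp (- c' * ln (real n)) <= exp (EL (real (m n)))" by simp
   also have "... <= HH n t" unfolding HH_def t_def using elim(2) mm by (intro hole_lower) auto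
   finally show le: "exp (- c' * ln (real n)) <= HH n t" .
   then have "0 < HH n t" using exp_gt_zero less_le_trans by blast
   then show "0 < HH n t * exp (- c' * ln (real n))" by simp
  qed (use t in simp)
  also have "... <= 4 * (3 * ?r n / real n) / exp (- c' * ln (real n))"
   unfolding t_def using m3 n0 by (intro divide_right_mono mult_left_mono) auto
  also have "... = 12 * (?r n * real n powr (- (1 - c')))"
  proof -
   have "real n powr (- (1 - c')) = exp (c' * ln (real n)) * exp (- ln (real n))"
    using n0 by (simp add: powr_def algebra_simps flip: exp_add)
   also have "exp (- ln (real n)) = inverse (real n)" using n0 by (simp add: exp_minus)
   finally show ?thesis by (simp add: exp_minus divide_inverse)
  qed
  finally show ?case .
 qed
 define d where "d = 1 - c'"
 have d: "0 < d" using c' by (simp add: d_def)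
 have lim: "(%n. ?r n * real n powr (- d)) \<longlonglongrightarrow> 0" using d by real_asymp
 then have "(%n. 12 * (?r n * real n powr (- d))) \<longlonglongrightarrow> 12 * 0" by (intro tendsto_mult tendsto_const)
 then have "(%n. 12 * (?r n * real n powr (- (1 - c')))) \<longlonglongrightarrow> 0" by (simp add: d_def)
 then show ?thesis
  by (intro tendsto_sandwich[OF always_eventually ev tendsto_const]) auto
qed

text \<open>The area is at most 4 pi, so the deviation is bounded for each n. At n = 1 the logarithm
  vanishes and division by zero makes the factor 0, which the same bound covers.\<close>

lemma deviation_integrable:
 assumes n: "n >= 1" and s: "0 < s"
 shows "integrable (M n) (%om. \<bar>rescaled n om - 1\<bar> powr s)"
proof -
 interpret prob_space "M n" using g[OF n] by (simp add: independent_gaussian_matrices_def)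
 have [measurable]: "cova n \<in> borel_measurable (M n)" by (rule measurable_cov[OF g[OF n] n])
 define k where "k = real n / (8 * pi * sqrt (ln (real n)))"
 show ?thesis
  unfolding k_def[symmetric]
 proof (rule integrable_const_bound)
  show "AE om in M n. norm (\<bar>k * cova n om - 1\<bar> powr s) <= (\<bar>k\<bar> * (4 * pi) + 1) powr s"
  proof (intro AE_I2)
   fix om
   have "\<bar>k * cova n om - 1\<bar> <= \<bar>k * cova n om\<bar> + 1" by linarith
   also have "\<bar>k * cova n om\<bar> <= \<bar>k\<bar> * (4 * pi)"
    unfolding abs_mult using largest_empty_cap_area_bounds[of "spherical_ensemble (A n om) (B n om)"]
    by (intro mult_left_mono) auto
   finally show "norm (\<bar>k * cova n om - 1\<bar> powr s) <= (\<bar>k\<bar> * (4 * pi) + 1) powr s"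
    using s by (simp add: powr_mono2)
  qed
  show "(%om. \<bar>k * cova n om - 1\<bar> powr s) \<in> borel_measurable (M n)" by measurable
 qed
qed

text \<open>Four ranges of the rescaled area: below 1 - \<epsilon>, near 1, up to K, and beyond. In
  the last one only the deterministic bound n is at hand, so the tail beyond K has to beat
  n^s.\<close>

lemma deviation_bound:
 assumes s: "0 < s" and eps: "0 < \<epsilon>" "\<epsilon> < 1" and K: "1 + \<epsilon> <= K" and n: "2 <= n" "1 <= sqrt (ln (real n))"
 shows "prob_space.expectation (M n) (%om. \<bar>rescaled n om - 1\<bar> powr s) <=
  \<epsilon> powr s + measure (M n) {om \<in> space (M n). rescaled n om < 1 - \<epsilon>}
  + K powr s * measure (M n) {om \<in> space (M n). 1 + \<epsilon> < rescaled n om}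
  + real n powr s * measure (M n) {om \<in> space (M n). K < rescaled n om}"
proof -
 have n1: "n >= 1" using n by simp
 interpret prob_space "M n" using g[OF n1] by (simp add: independent_gaussian_matrices_def)
 have [measurable]: "cova n \<in> borel_measurable (M n)" by (rule measurable_cov[OF g[OF n1] n1])
 define X where "X om = rescaled n om" for om
 have Xm[measurable]: "X \<in> borel_measurable (M n)" unfolding X_def[abs_def] by measurable
 have X0: "0 <= X om" for om unfolding X_def using largest_empty_cap_area_bounds(1) n by simp
 have Xn: "X om <= real n" for om
 proof -
  have "X om <= real n / (8 * pi * sqrt (ln (real n))) * (4 * pi)"
   unfolding X_def using largest_empty_cap_area_bounds(2) n by (intro mult_left_mono) auto
  also have "... = real n / (2 * sqrt (ln (real n)))" by simp
  also have "... <= real n / 1"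
  proof (rule divide_left_mono)
   show g1: "1 <= 2 * sqrt (ln (real n))" using n(2) by linarith
   show "0 < 2 * sqrt (ln (real n)) * 1" using g1 by linarith
  qed simp
  finally show ?thesis by simp
 qed
 let ?P = "%om. X om < 1 - \<epsilon>" and ?Q = "%om. 1 + \<epsilon> < X om" and ?R = "%om. K < X om"
 let ?F = "%om. \<epsilon> powr s + indicator {om \<in> space (M n). ?P om} om + K powr s * indicator {om \<in> space (M n). ?Q om} om
  + real n powr s * indicator {om \<in> space (M n). ?R om} om"
 have ev: "{om \<in> space (M n). ?P om} \<in> events" "{om \<in> space (M n). ?Q om} \<in> events" "{om \<in> space (M n). ?R om} \<in> events"
  by measurable
 have ind: "integrable (M n) (%om. indicator F om :: real)" "(\<integral>om. indicator F om \<partial>M n) = prob F" if "F \<in> events" for F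
  using that by (auto intro!: integrable_real_indicator simp: emeasure_eq_measure)
 have int: "integrable (M n) (%om. \<bar>X om - 1\<bar> powr s)" unfolding X_def by (rule deviation_integrable[OF n1 s])
 have "expectation (%om. \<bar>X om - 1\<bar> powr s) <= expectation ?F"
 proof (rule integral_mono[OF int])
  show "integrable (M n) ?F"
   by (intro Bochner_Integration.integrable_add integrable_const integrable_mult_right ind ev)
  fix om assume w: "om \<in> space (M n)"
  have nn: "0 <= \<epsilon> powr s" "0 <= K powr s" "0 <= real n powr s" by auto
  have pm: "\<bar>X om - 1\<bar> <= y ==> \<bar>X om - 1\<bar> powr s <= y powr s" for y
   using s by (intro powr_mono2) auto
  consider "X om < 1 - \<epsilon>" | "\<bar>X om - 1\<bar> <= \<epsilon>" | "1 + \<epsilon> < X om" "X om <= K" | "1 + \<epsilon> < X om" "K < X om" by linarith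
  then show "\<bar>X om - 1\<bar> powr s <= ?F om"
  proof cases
   case 1
   have "\<bar>X om - 1\<bar> powr s <= 1 powr s" using 1 X0[of om] eps by (intro pm) linarith
   then show ?thesis using 1 w nn eps K by (simp add: indicator_def add_increasing)
  next
   case 2
   have "\<bar>X om - 1\<bar> powr s <= \<epsilon> powr s" using 2 by (rule pm)
   then show ?thesis using nn by (simp add: indicator_def add_increasing2)
  next
   case 3
   have "\<bar>X om - 1\<bar> powr s <= K powr s" using 3 eps by (intro pm) linarith
   then show ?thesis using 3 w nn eps by (simp add: indicator_def add_increasing)
  next
   case 4
   have "\<bar>X om - 1\<bar> powr s <= real n powr s" using 4 eps Xn[of om] by (intro pm) linarith
   then show ?thesis using 4 w nn eps by (simp add: indicator_def add_increasing)
  qed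
 qed
 also have "... = \<epsilon> powr s + prob {om \<in> space (M n). ?P om} + K powr s * prob {om \<in> space (M n). ?Q om} + real n powr s * prob {om \<in> space (M n). ?R om}"
 proof -
  note i = ind(1)[OF ev(1)] integrable_mult_right[OF ind(1)[OF ev(2)], of "K powr s"] integrable_mult_right[OF ind(1)[OF ev(3)], of "real n powr s"]
  have c: "integrable (M n) (%_. \<epsilon> powr s)" by (rule integrable_const)
  show ?thesis
   using Bochner_Integration.integral_add[OF Bochner_Integration.integrable_add[OF Bochner_Integration.integrable_add[OF c i(1)] i(2)] i(3)]
    Bochner_Integration.integral_add[OF Bochner_Integration.integrable_add[OF c i(1)] i(2)]
    Bochner_Integration.integral_add[OF c i(1)] ind(2)[OF ev(1)] ind(2)[OF ev(2)] ind(2)[OF ev(3)]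
   by (simp add: prob_space)
 qed
 finally show ?thesis unfolding X_def .
qed

theorem deviation_limit:
 assumes s: "0 < s"
 shows "(%n. prob_space.expectation (M n) (%om. \<bar>rescaled n om - 1\<bar> powr s)) \<longlonglongrightarrow> 0"
proof (rule tendstoI)
 fix e :: real assume e: "0 < e"
 \<comment> \<open>Small enough that the values near 1 contribute at most e / 2.\<close>
 define \<epsilon> where "\<epsilon> = min (1/2) ((e / 2) powr (1 / s))"
 have eps: "0 < \<epsilon>" "\<epsilon> < 1" using e by (auto simp: \<epsilon>_def)
 have "\<epsilon> powr s <= ((e / 2) powr (1 / s)) powr s" using s eps by (intro powr_mono2) (auto simp: \<epsilon>_def)
 also have "... = e / 2" using s e by (simp add: powr_powr)
 finally have es: "\<epsilon> powr s <= e / 2" .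
 \<comment> \<open>With b^2 = s + 2 the far tail n^(1 - b^2) times n^s is 1 / n.\<close>
 define b where "b = sqrt (s + 2)"
 have b: "1 < b" "b^2 = s + 2" using s by (auto simp: b_def)
 define K where "K = b + 1"
 have K: "1 + \<epsilon> <= K" "0 < b" "b < K" using b eps by (auto simp: K_def)
 \<comment> \<open>Strictly between 1 and 1 + \<epsilon>, so that the upper tail bound applies at 1
   + \<epsilon> with a negative power of n.\<close>
 define b1 where "b1 = 1 + \<epsilon> / 2"
 have b1: "0 < b1" "b1 < 1 + \<epsilon>" using eps by (auto simp: b1_def)
 have "1 * 1 < b1 * b1" using eps by (intro mult_strict_mono) (auto simp: b1_def)
 then have b1s: "0 < b1^2 - 1" by (simp add: power2_eq_square)
 have neg: "(%n. real n powr (- d)) \<longlonglongrightarrow> 0" if "0 < d" for d :: real using that by real_asymp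
 have l: "(%n. measure (M n) {om \<in> space (M n). rescaled n om < 1 - \<epsilon>} + K powr s * real n powr (- (b1^2 - 1)) + real n powr (- 1)) \<longlonglongrightarrow> 0 + K powr s * 0 + 0"
  using lower_tail[of "1 - \<epsilon>"] eps neg[OF b1s] neg[of 1] by (intro tendsto_add tendsto_mult tendsto_const) auto
 have f: "\<forall>\<^sub>F n in sequentially. measure (M n) {om \<in> space (M n). rescaled n om < 1 - \<epsilon>} + K powr s * real n powr (- (b1^2 - 1)) + real n powr (- 1) < e / 2"
  using e by (intro order_tendstoD(2)[OF l]) simp
 have r1: "\<forall>\<^sub>F n in sequentially. 1 <= sqrt (ln (real n))"
  using sqrt_ln_at_top unfolding filterlim_at_top by (rule spec)
 show "\<forall>\<^sub>F n in sequentially. dist (prob_space.expectation (M n) (%om. \<bar>rescaled n om - 1\<bar> powr s)) 0 < e"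
  using f r1 eventually_ge_at_top[of 2] upper_tail[OF b1] upper_tail[OF K(2,3)]
 proof eventually_elim
  case (elim n)
  let ?E = "prob_space.expectation (M n) (%om. \<bar>rescaled n om - 1\<bar> powr s)"
  have "real n powr s * measure (M n) {om \<in> space (M n). K < rescaled n om} <= real n powr s * real n powr (1 - b\<^sup>2)"
   using elim(5) by (intro mult_left_mono) auto
  also have "... = real n powr (- 1)" unfolding b by (simp add: powr_add[symmetric])
  finally have t3: "real n powr s * measure (M n) {om \<in> space (M n). K < rescaled n om} <= real n powr (- 1)" .
  have t2: "K powr s * measure (M n) {om \<in> space (M n). 1 + \<epsilon> < rescaled n om} <= K powr s * real n powr (- (b1^2 - 1))"
   using elim(4) by (intro mult_left_mono) auto
  have "?E < e"
   using deviation_bound[OF s eps K(1) elim(3,2)] es elim(1) t2 t3 by linarith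
  moreover have "0 <= ?E" by (intro Bochner_Integration.integral_nonneg) simp
  ultimately show "dist ?E 0 < e" by simp
 qed
qed

end

theorem theorem1p2:
  fixes M :: "nat \<Rightarrow> 'a measure"
    and A B :: "nat \<Rightarrow> 'a \<Rightarrow> complex mat"
    and s :: real
  defines "M\<^sub>n \<equiv> \<lambda>n \<omega>. largest_empty_cap_area (spherical_ensemble (A n \<omega>) (B n \<omega>))"
  defines "D \<equiv> \<lambda>n \<omega>. \<bar>real n / (8 * pi * sqrt (ln (real n))) * M\<^sub>n n \<omega> - 1\<bar> powr s"
  assumes "\<And>n. n \<ge> 1 \<Longrightarrow> independent_gaussian_matrices (M n) n (A n) (B n)"
    and "s > 0"
  shows "(\<forall>n\<ge>1. integrable (M n) (D n)) \<and>
         (\<lambda>n. prob_space.expectation (M n) (D n)) \<longlonglongrightarrow> 0"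
 unfolding D_def M\<^sub>n_def
proof (intro conjI allI impI)
 fix n :: nat assume "1 <= n"
 then show "integrable (M n) (%om. \<bar>real n / (8 * pi * sqrt (ln (real n))) * largest_empty_cap_area (spherical_ensemble (A n om) (B n om)) - 1\<bar> powr s)"
  using assms(3,4) by (intro deviation_integrable) auto
next
 show "(%n. prob_space.expectation (M n) (%om. \<bar>real n / (8 * pi * sqrt (ln (real n))) * largest_empty_cap_area (spherical_ensemble (A n om) (B n om)) - 1\<bar> powr s)) \<longlonglongrightarrow> 0"
  by (rule deviation_limit[OF assms(3,4)])
qed

end
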